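(* Let $n=3$ and $\gamma>1$. There exists $\lambda_0=\lambda_0(\gamma)>1$ such that for every $\lambda\in(1,\lambda_0)$, with $\kappa=\bar\kappa:=-\frac{2(\lambda-1)}{\gamma-1}$, the 3-dimensional compressible Euler system $$\rho_t+\mathrm{div}_{\mathbf x}(\rho\mathbf u)=0,\qquad (\rho\mathbf u)_t+\mathrm{div}_{\mathbf x}[\rho\,\mathbf u\otimes\mathbf u]+\mathrm{grad}_{\mathbf x}\,p=0,\qquad (\rho E)_t+\mathrm{div}_{\mathbf x}[(\rho E+p)\mathbf u]=0,$$ with $E=e+\frac12|\mathbf u|^2$ and $p=(\gamma-1)\rho e$, admits radially symmetric solutions ($\rho=\rho(t,r)$, $\mathbf u(t,\mathbf x)=u(t,r)\frac{\mathbf x}{r}$, $c=c(t,r)$, $r=|\mathbf x|$) of the self-similar form $$x=\frac{t}{r^\lambda},\quad \rho(t,r)=r^\kappa R(x),\quad u(t,r)=-\frac{r^{1-\lambda}}{\lambda}\frac{V(x)}{x},\quad c(t,r)=-\frac{r^{1-\lambda}}{\lambda}\frac{C(x)}{x}$$ with the following properties: (i) they are defined on all of $\mathbb R_t\times\mathbb R^3_{\mathbf x}$ and are continuous except at the single point $(t,\mathbf x)=(0,0)$; (ii) at time $t=0$ the density $\rho$, velocity ($|u|$), pressure $p$, sound speed $c$, and temperature $\theta$ all tend to infinity as the origin $\mathbf x=0$ is approached; (iii) the solutions contain locally finite amounts of mass, momentum, and energy at all times, and describe globally isentropic (the specific entropy is constant in space-time), shock-free flows; (iv) there are solutions with properties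 (i)-(iii) for which, in addition, the fluid is everywhere flowing toward the center of motion at time $t=0$ (i.e. $u(0,r)<0$ for all $r>0$); similarly, there are other solutions satisfying (i)-(iii) for which the fluid is everywhere flowing away from the center at time $t=0$ (i.e. $u(0,r)>0$ for all $r>0$).
   Context: The fluid is an ideal polytropic gas with adiabatic index $\gamma>1$; $\rho$ is density, $\mathbf u$ velocity, $e$ specific internal energy, $p$ pressure, $\theta$ absolute temperature ($e$ is proportional to $\theta$), and $c\ge 0$ is the sound speed, $c=\sqrt{\gamma p/\rho}=\sqrt{\gamma(\gamma-1)e}$. The specific entropy $S$ is determined by Gibbs' relation $de=\theta\,dS-p\,d(1/\rho)$, so it is a function of $\rho^{1-\gamma}\theta\propto\rho^{1-\gamma}c^2$. For radial flows and $r>0$ the system reads $$\rho_t+u\rho_r+\rho\Big(u_r+\tfrac{(n-1)u}{r}\Big)=0,\quad u_t+uu_r+\tfrac{1}{\gamma\rho}(\rho c^2)_r=0,\quad c_t+uc_r+\tfrac{\gamma-1}{2}c\Big(u_r+\tfrac{(n-1)u}{r}\Big)=0 .$$ The self-similar formulas at $t=0$, $r>0$ (i.e. $x=0$) are understood via the finite limits of $V(x)/x$ and $C(x)/x$ as $x\to0$; values at $r=0$, $t\ne0$ are understood as limits as $r\downarrow0$. Solutions are understood as continuous (away from the point $(0,0)$) functions that satisfy the system, in the weak (distributional) sense where they are not differentiable. "Locally finite amounts of mass, momentum, and energy" means that for every time $t$ and every finite $\bar r>0$ the integrals $\int_0^{\bar r}\rho r^{2}dr$, $\int_0^{\bar r}\rho|u|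 r^{2}dr$, $\int_0^{\bar r}\rho(e+\frac12u^2) r^{2}dr$ are finite. *)

theory Defs
  imports "HOL-Analysis.Analysis"
begin

type_synonym spacetime = "real \<times> (real ^ 3)"

section \<open>Distributional solutions of conservation laws\<close>

fun Ck :: "nat \<Rightarrow> (spacetime \<Rightarrow> real) \<Rightarrow> bool" where
  "Ck 0 f \<longleftrightarrow> continuous_on UNIV f"
| "Ck (Suc k) f \<longleftrightarrow>
     (\<forall>z. f differentiable (at z)) \<and> (\<forall>h. Ck k (\<lambda>z. frechet_derivative f (at z) h))"

definition test_function :: "(spacetime \<Rightarrow> real) \<Rightarrow> bool" where
  "test_function \<phi> \<longleftrightarrow> (\<forall>k. Ck k \<phi>) \<and> compact (closure {z. \<phi> z \<noteq> 0})"

definition dt :: "(spacetime \<Rightarrow> real) \<Rightarrow> spacetime \<Rightarrow> real" where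
  "dt \<phi> z = frechet_derivative \<phi> (at z) (1, 0)"

definition grad_x :: "(spacetime \<Rightarrow> real) \<Rightarrow> spacetime \<Rightarrow> real ^ 3" where
  "grad_x \<phi> z = (\<chi> i. frechet_derivative \<phi> (at z) (0, axis i 1))"

definition locally_integrable :: "(spacetime \<Rightarrow> 'b::euclidean_space) \<Rightarrow> bool" where
  "locally_integrable f \<longleftrightarrow> (\<forall>K. compact K \<longrightarrow> set_integrable lborel K f)"

text \<open>
  \<open>w\<^sub>t + div\<^sub>x F = 0\<close> in the sense of distributions on the whole of space-time (the test
  functions need not vanish near the origin).  Where \<open>w\<close> and \<open>F\<close> are continuous, this contains the
  classical equation at every point at which both are differentiable.
\<close>

definition weak_conservation_law ::
    "(spacetime \<Rightarrow> real) \<Rightarrow> (spacetime \<Rightarrow> real ^ 3) \<Rightarrow> bool" where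
  "weak_conservation_law w F \<longleftrightarrow>
     locally_integrable w \<and> locally_integrable F \<and>
     (\<forall>\<phi>. test_function \<phi> \<longrightarrow>
        (\<integral>z. w z * dt \<phi> z + F z \<bullet> grad_x \<phi> z \<partial>lborel) = 0)"


section \<open>Ideal polytropic gas\<close>

text \<open>The sound speed \<open>c \<ge> 0\<close> determines \<open>e\<close> through \<open>c = sqrt (\<gamma> (\<gamma> - 1) e)\<close>.\<close>

definition internal_energy :: "real \<Rightarrow> real \<Rightarrow> real" where
  "internal_energy \<gamma> c = c\<^sup>2 / (\<gamma> * (\<gamma> - 1))"

definition pressure :: "real \<Rightarrow> real \<Rightarrow> real \<Rightarrow> real" where
  "pressure \<gamma> \<rho> e = (\<gamma> - 1) * \<rho> * e"

text \<open>The constant of proportionality in \<open>e = c\<^sub>v \<theta>\<close> is the specific heat \<open>cv > 0\<close>.\<close>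

definition temperature :: "real \<Rightarrow> real \<Rightarrow> real" where
  "temperature cv e = e / cv"

text \<open>
  Gibbs' relation \<open>de = \<theta> dS - p d(1/\<rho>)\<close> for \<open>S\<close> as a function of \<open>(\<rho>, \<theta>)\<close>, with \<open>e = cv \<theta>\<close>.
  It determines \<open>S\<close> on the quadrant \<open>\<rho>, \<theta> > 0\<close> up to an additive constant, namely
  \<open>S = cv ln (\<rho> powr (1 - \<gamma>) * \<theta>) + const\<close>.
\<close>

definition specific_entropy :: "real \<Rightarrow> real \<Rightarrow> (real \<times> real \<Rightarrow> real) \<Rightarrow> bool" where
  "specific_entropy \<gamma> cv S \<longleftrightarrow>
     (\<forall>\<rho> \<theta>. \<rho> > 0 \<longrightarrow> \<theta> > 0 \<longrightarrow>
        (\<exists>dS. (S has_derivative dS) (at (\<rho>, \<theta>)) \<and>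
           (\<forall>d\<rho> d\<theta>. cv * d\<theta> =
              \<theta> * dS (d\<rho>, d\<theta>) - pressure \<gamma> \<rho> (cv * \<theta>) * (- d\<rho> / \<rho>\<^sup>2))))"


section \<open>The compressible Euler system in three space dimensions\<close>

definition weak_euler_solution ::
    "real \<Rightarrow> (spacetime \<Rightarrow> real) \<Rightarrow> (spacetime \<Rightarrow> real ^ 3) \<Rightarrow> (spacetime \<Rightarrow> real) \<Rightarrow> bool" where
  "weak_euler_solution \<gamma> \<rho> U e \<longleftrightarrow>
     (let p = (\<lambda>z. pressure \<gamma> (\<rho> z) (e z));
          E = (\<lambda>z. e z + (norm (U z))\<^sup>2 / 2)
      in weak_conservation_law \<rho> (\<lambda>z. \<rho> z *\<^sub>R U z) \<and>
         (\<forall>i. weak_conservation_law (\<lambda>z. \<rho> z * U z $ i)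
                (\<lambda>z. (\<rho> z * U z $ i) *\<^sub>R U z + p z *\<^sub>R axis i 1)) \<and>
         weak_conservation_law (\<lambda>z. \<rho> z * E z) (\<lambda>z. (\<rho> z * E z + p z) *\<^sub>R U z))"


section \<open>Radial self-similar flows\<close>

text \<open>
  Radial profiles are functions of \<open>(t, r)\<close> with \<open>r \<ge> 0\<close>.  At \<open>x = 0\<close> the vector field below is \<open>0\<close>
  because of \<open>a / 0 = 0\<close>; continuity of the field there then forces \<open>u(t,r) \<rightarrow> 0\<close> as \<open>r \<rightarrow> 0\<close>.
\<close>

definition radial_scalar :: "(real \<Rightarrow> real \<Rightarrow> real) \<Rightarrow> spacetime \<Rightarrow> real" where
  "radial_scalar f z = f (fst z) (norm (snd z))"

definition radial_vector :: "(real \<Rightarrow> real \<Rightarrow> real) \<Rightarrow> spacetime \<Rightarrow> real ^ 3" where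
  "radial_vector u z = (u (fst z) (norm (snd z)) / norm (snd z)) *\<^sub>R snd z"

text \<open>
  At \<open>t = 0\<close> the quotients \<open>V(x)/x\<close> and \<open>C(x)/x\<close> are replaced by their finite limits as \<open>x \<rightarrow> 0\<close>, and
  the values at \<open>r = 0\<close>, \<open>t \<noteq> 0\<close> are limits as \<open>r\<close> decreases to \<open>0\<close>.  The values at \<open>(0,0)\<close> are
  left arbitrary and never used.
\<close>

definition self_similar ::
    "real \<Rightarrow> real \<Rightarrow> (real \<Rightarrow> real) \<Rightarrow> (real \<Rightarrow> real) \<Rightarrow> (real \<Rightarrow> real) \<Rightarrow>
     (real \<Rightarrow> real \<Rightarrow> real) \<Rightarrow> (real \<Rightarrow> real \<Rightarrow> real) \<Rightarrow> (real \<Rightarrow> real \<Rightarrow> real) \<Rightarrow> bool" where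
  "self_similar lam \<kappa> R V C \<rho> u c \<longleftrightarrow>
     (\<forall>t r. r > 0 \<longrightarrow> \<rho> t r = r powr \<kappa> * R (t / r powr lam)) \<and>
     (\<forall>t r. r > 0 \<longrightarrow> t \<noteq> 0 \<longrightarrow>
        (let x = t / r powr lam
         in u t r = - (r powr (1 - lam) / lam) * (V x / x) \<and>
            c t r = - (r powr (1 - lam) / lam) * (C x / x))) \<and>
     (\<exists>v0 c0. ((\<lambda>x. V x / x) \<longlongrightarrow> v0) (at 0) \<and> ((\<lambda>x. C x / x) \<longlongrightarrow> c0) (at 0) \<and>
        (\<forall>r>0. u 0 r = - (r powr (1 - lam) / lam) * v0 \<and>
               c 0 r = - (r powr (1 - lam) / lam) * c0)) \<and>
     (\<forall>t. t \<noteq> 0 \<longrightarrow>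
        (\<rho> t \<longlongrightarrow> \<rho> t 0) (at_right 0) \<and> (u t \<longlongrightarrow> u t 0) (at_right 0) \<and>
        (c t \<longlongrightarrow> c t 0) (at_right 0))"

definition continuous_off_origin :: "(spacetime \<Rightarrow> 'b::topological_space) \<Rightarrow> bool" where
  "continuous_off_origin f \<longleftrightarrow> continuous_on (- {(0, 0)}) f"

definition blows_up_at_time_zero :: "(spacetime \<Rightarrow> real) \<Rightarrow> bool" where
  "blows_up_at_time_zero f \<longleftrightarrow> filterlim (\<lambda>x. f (0, x)) at_top (at 0)"

definition locally_finite :: "(real \<Rightarrow> real \<Rightarrow> real) \<Rightarrow> bool" where
  "locally_finite f \<longleftrightarrow>
     (\<forall>t. \<forall>rbar>0. set_integrable lborel {0..rbar} (\<lambda>r. f t r * r\<^sup>2))"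

text \<open>
  The flow is required to stay in \<open>\<rho>, c > 0\<close>, the domain of the specific entropy.  Absence of
  shocks, i.e. of jump discontinuities, is expressed by continuity off the space-time origin.
\<close>

definition continuous_blowup_flow ::
    "real \<Rightarrow> real \<Rightarrow> (real \<Rightarrow> real \<Rightarrow> real) \<Rightarrow> (real \<Rightarrow> real \<Rightarrow> real) \<Rightarrow> (real \<Rightarrow> real \<Rightarrow> real) \<Rightarrow> bool"
  where
  "continuous_blowup_flow \<gamma> cv \<rho> u c \<longleftrightarrow>
     (let e = (\<lambda>t r. internal_energy \<gamma> (c t r));
          p = (\<lambda>t r. pressure \<gamma> (\<rho> t r) (e t r));
          \<theta> = (\<lambda>t r. temperature cv (e t r))
      in
       (\<forall>t r. r \<ge> 0 \<longrightarrow> (t, r) \<noteq> (0, 0) \<longrightarrow> \<rho> t r > 0 \<and> c t r > 0) \<and>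
       weak_euler_solution \<gamma> (radial_scalar \<rho>) (radial_vector u) (radial_scalar e) \<and>
       continuous_off_origin (radial_scalar \<rho>) \<and>
       continuous_off_origin (radial_vector u) \<and>
       continuous_off_origin (radial_scalar c) \<and>
       blows_up_at_time_zero (radial_scalar \<rho>) \<and>
       blows_up_at_time_zero (\<lambda>z. norm (radial_vector u z)) \<and>
       blows_up_at_time_zero (radial_scalar p) \<and>
       blows_up_at_time_zero (radial_scalar c) \<and>
       blows_up_at_time_zero (radial_scalar \<theta>) \<and>
       locally_finite \<rho> \<and>
       locally_finite (\<lambda>t r. \<rho> t r * \<bar>u t r\<bar>) \<and>
       locally_finite (\<lambda>t r. \<rho> t r * (e t r + (u t r)\<^sup>2 / 2)) \<and>
       (\<exists>S s0. specific_entropy \<gamma> cv S \<and>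
          (\<forall>t r. r \<ge> 0 \<longrightarrow> (t, r) \<noteq> (0, 0) \<longrightarrow> S (\<rho> t r, \<theta> t r) = s0)))"

end

theory Submission
  imports Defs
begin

text \<open>
  Write \<open>k = (\<gamma> - 1) / 2\<close> and look for isentropic flows \<open>\<rho> = c powr (1 / k)\<close>, so that the system reduces to
  the autonomous similarity equations for \<open>V\<close> and \<open>C\<close>.  In the coordinates \<open>w = 1 + V\<close>, \<open>C = z w\<close> the
  trajectory leaves the origin at \<open>z = 0\<close>, crosses the sonic line \<open>z = 1\<close> at a critical point
  \<open>w = 1 - \<delta>\<^sup>2\<close> and ends at \<open>z = \<infinity>\<close>, the centre of motion; \<open>\<lambda>\<close> is a function of \<open>\<delta>\<close> that
  tends to \<open>1\<close> as \<open>\<delta> \<rightarrow> 0\<close>.  Dividing \<open>w - (1 - \<delta>\<^sup>2)\<close> by \<open>1 - z\<^sup>2\<close> removes the singularity at the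
  sonic point: on each side of it the rescaled unknown satisfies an equation that is regular up to the
  factor \<open>1 - z\<^sup>2\<close>, and for small \<open>\<delta>\<close> explicit barriers trap a solution.  On \<open>0 < z < 1\<close> the initial
  slope, hence the sign and size of \<open>lim V / x\<close>, remains free in an interval around \<open>0\<close>, so the branches for
  \<open>t < 0\<close> and \<open>t > 0\<close> can be matched with either sign of the velocity at \<open>t = 0\<close>.

  The resulting flow is continuous off the origin, satisfies the Euler equations classically off a null set
  which lines in coordinate directions meet in finitely many points, and its singularity at the origin is
  too weak to contribute to the integrals defining the weak formulation.
\<close>

section \<open>Ordinary differential equations\<close>

text \<open>Since \<open>z\<close> increases along each half of the trajectory, it can replace the
  similarity variable; the origin, the sonic point and the centre then sit at the fixed values 0, 1
  and \<infinity>. A change of time sends 1 and \<infinity> to infinite time, so global solutions of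
  bounded Lipschitz fields, caught between barriers, replace a local analysis of degenerate critical
  points. The price is that the two sides of the sonic point are joined by continuity of
  \<open>w\<close> alone: the flow may have a kink along a sonic surface, which is why an
  exceptional set appears in the proof of the conservation laws. The parameter is \<delta> and not
  \<lambda> because the coefficients are then rational, and the barrier inequalities can be reduced
  to strict ones at \<delta> = 0; compactness carries these to small \<delta>, and the intermediate
  value theorem returns to an interval of \<lambda>. Reflecting \<open>x\<close> changes the sign of
  the slope \<open>V x / x\<close>, so the branches before and after \<open>t = 0\<close> come from
  trajectories with opposite initial slopes.\<close>

lemma nonneg_of_deriv_nonneg_where_neg:
  fixes d d' :: "real \<Rightarrow> real"
  assumes der: "\<And>t. t \<ge> a \<Longrightarrow> (d has_real_derivative d' t) (at t within {a..})"
    and init: "d a \<ge> 0" and up: "\<And>t. t \<ge> a \<Longrightarrow> d t < 0 \<Longrightarrow> d' t \<ge> 0" and "t \<ge> a"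
  shows "d t \<ge> 0"
proof (rule ccontr)
  assume neg: "\<not> d t \<ge> 0"
  have cont: "continuous_on {a..t} d"
    by (rule continuous_on_subset[OF DERIV_continuous_on[of "{a..}" d d']]) (auto intro: der)
  \<comment> \<open>After the last time \<open>s\<close> in \<open>A\<close> the function stays
    negative, so it does not decrease there, which contradicts
    \<open>d s \<ge> 0 > d t\<close>.\<close>
  define A where "A = {a..t} \<inter> d -` {0..}"
  have "closed A"
    unfolding A_def by (rule continuous_closed_preimage[OF cont]) auto
  hence "compact A"
    using compact_Int_closed[OF compact_Icc[of a t] \<open>closed A\<close>] by (simp add: A_def)
  moreover have "a \<in> A" using init \<open>t \<ge> a\<close> by (auto simp: A_def)
  ultimately obtain s where s: "s \<in> A" "\<And>x. x \<in> A \<Longrightarrow> x \<le> s"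
    using compact_attains_sup[of A] by blast
  have st: "a \<le> s" "s < t" "d s \<ge> 0" using s(1) neg by (auto simp: A_def less_le)
  have dneg: "d x < 0" if "s < x" "x \<le> t" for x
  proof (rule ccontr)
    assume "\<not> d x < 0"
    hence "x \<in> A" using that st by (simp add: A_def)
    from s(2)[OF this] that show False by simp
  qed
  have "\<exists>z\<in>{s<..<t}. d t - d s = (\<lambda>x. x * d' z) (t - s)"
  proof (rule mvt_simple[OF st(2)])
    fix x assume x: "s \<le> x" "x \<le> t"
    have "(d has_derivative (*) (d' x)) (at x within {a..})"
      using der[of x] x st by (simp add: has_field_derivative_def)
    thus "(d has_derivative (\<lambda>y. y * d' x)) (at x within {s..t})"
      by (rule has_derivative_subset[THEN has_derivative_eq_rhs]) (use st in \<open>auto simp: fun_eq_iff\<close>)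
  qed
  then obtain z where "s < z" "z < t" "d t - d s = (t - s) * d' z" by auto
  moreover have "d' z \<ge> 0" using up[of z] dneg[of z] \<open>s < z\<close> \<open>z < t\<close> st by auto
  ultimately have "d t \<ge> d s" using st mult_nonneg_nonneg[of "t - s" "d' z"] by linarith
  thus False using st neg by auto
qed

lemma continuous_on_atLeast_exhaust:
  fixes g :: "real \<Rightarrow> 'a::topological_space"
  assumes "\<And>b. continuous_on {a..b} g"
  shows "continuous_on {a..} g"
  unfolding continuous_on_eq_continuous_within
proof
  fix t assume "t \<in> {a..}"
  hence "continuous (at t within {a..t+1}) g"
    using assms[of "t+1"] by (auto simp: continuous_on_eq_continuous_within)
  moreover have "at t within {a..t+1} = at t within {a..}"
    by (rule at_within_nhd[of _ "{..<t+1}"]) auto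
  ultimately show "continuous (at t within {a..}) g" by simp
qed

text \<open>The Lipschitz constant is uniform in time, so the integral operator is a contraction on
  all of \<open>{a..}\<close> at once in a norm with an exponential weight; no continuation of local
  solutions is needed.\<close>

lemma picard_global:
  fixes f :: "real \<Rightarrow> real \<Rightarrow> real"
  assumes cont: "continuous_on UNIV (\<lambda>p. f (fst p) (snd p))"
    and lip: "\<And>t y y'. \<bar>f t y - f t y'\<bar> \<le> L * \<bar>y - y'\<bar>"
    and bdd: "\<And>t y. \<bar>f t y\<bar> \<le> B"
  shows "\<exists>y. y a = y0 \<and> (\<forall>t\<ge>a. (y has_real_derivative f t (y t)) (at t within {a..}))"
proof -
  define M where "M = max L 1"
  have M: "M > 0" "L \<le> M" by (auto simp: M_def)
  have B0: "B \<ge> 0" using bdd[of 0 0] by linarith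
  \<comment> \<open>Freezing the time at \<open>a\<close> to the left of \<open>a\<close> puts the
    unknown into the Banach space of bounded continuous functions on the whole line.\<close>
  define c where "c t = max a t" for t
  have cc: "continuous_on UNIV c" unfolding c_def by (intro continuous_intros)
  \<comment> \<open>The unknown is \<open>G t = exp (- (2*M*(t-a))) * (y t - y0)\<close>.
    Integrating \<open>M * exp (2*M*(s-a))\<close> and removing the weight again leaves the
    contraction constant 1/2.\<close>
  define I where "I G t = integral {a..c t} (\<lambda>s. f s (y0 + exp (2*M*(s-a)) * G s))" for G t
  define T where "T G t = exp (- (2*M*(c t-a))) * I G t" for G t
  have contf: "continuous_on S (\<lambda>s. f s (y0 + exp (2*M*(s-a)) * G s))" if "continuous_on UNIV G" for G S
  proof -
    have "continuous_on S (\<lambda>s. (s, y0 + exp (2*M*(s-a)) * G s))"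
      by (intro continuous_intros continuous_on_subset[OF that]) simp
    from continuous_on_compose2[OF cont this] show ?thesis by simp
  qed
  have contI: "continuous_on UNIV (I G)" if "continuous_on UNIV G" for G
  proof -
    have "continuous_on {a..b} (\<lambda>x. integral {a..x} (\<lambda>s. f s (y0 + exp (2*M*(s-a)) * G s)))" for b
      by (intro indefinite_integral_continuous_1 integrable_continuous_real contf that)
    hence *: "continuous_on {a..} (\<lambda>x. integral {a..x} (\<lambda>s. f s (y0 + exp (2*M*(s-a)) * G s)))"
      by (rule continuous_on_atLeast_exhaust)
    show ?thesis unfolding I_def
      by (rule continuous_on_compose2[OF * cc]) (auto simp: c_def)
  qed
  \<comment> \<open>The integral of the bounded field grows at most linearly, so the weight keeps
    \<open>T G\<close> bounded.\<close>
  have decay: "exp (- (2*M*x)) * (B * x) \<le> B / M" if "x \<ge> 0" for x :: real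
  proof -
    have "x * M \<ge> 0" using M that by simp
    hence "x * M \<le> exp (2*M*x)" using exp_ge_add_one_self[of "2 * (x*M)"]
      by (simp only: mult.commute[of x M] mult.assoc)
    hence "x * M * exp (- (2*M*x)) \<le> exp (2*M*x) * exp (- (2*M*x))" by (rule mult_right_mono) simp
    hence "exp (- (2*M*x)) * x \<le> 1 / M" using M by (simp add: pos_le_divide_eq mult_exp_exp ac_simps)
    from mult_left_mono[OF this B0] show ?thesis by (simp add: ac_simps)
  qed
  have bddT: "\<bar>T G t\<bar> \<le> B / M" if "continuous_on UNIV G" for G t
  proof -
    have "norm (I G t) \<le> B * (c t - a)"
      unfolding I_def using integral_bound[of a "c t", OF _ contf[OF that], of B] bdd
      by (auto simp: c_def)
    hence "\<bar>T G t\<bar> \<le> exp (- (2*M*(c t-a))) * (B * (c t - a))"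
      by (simp add: T_def abs_mult)
    also have "\<dots> \<le> B / M" using decay[of "c t - a"] by (auto simp: c_def)
    finally show ?thesis .
  qed
  have TB: "T (apply_bcontfun G) \<in> bcontfun" for G
    unfolding bcontfun_def using bddT[of "apply_bcontfun G"]
    by (auto intro!: boundedI[of _ "B/M"] continuous_intros contI cc simp: T_def[abs_def] )
  define TT where "TT G = Bcontfun (T (apply_bcontfun G))" for G
  have TT: "apply_bcontfun (TT G) = T (apply_bcontfun G)" for G
    unfolding TT_def by (rule Bcontfun_inverse[OF TB])
  have "\<exists>!G. TT G = G"
  proof (rule banach_fix_type[of "1/2"])
    show "\<forall>x y. dist (TT x) (TT y) \<le> 1/2 * dist x y"
    proof (intro allI, rule dist_bound)
      fix G H :: "real \<Rightarrow>\<^sub>C real" and t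
      let ?D = "dist G H"
      have int: "(\<lambda>s. f s (y0 + exp (2*M*(s-a)) * apply_bcontfun G s)) integrable_on {a..c t}" for G
        by (intro integrable_continuous_real contf) auto
      have le: "\<bar>f s (y0 + exp (2*M*(s-a)) * apply_bcontfun G s) - f s (y0 + exp (2*M*(s-a)) * apply_bcontfun H s)\<bar>
          \<le> M * ?D * exp (2*M*(s-a))" for s
      proof -
        have "L * \<bar>exp (2*M*(s-a)) * (apply_bcontfun G s - apply_bcontfun H s)\<bar>
           \<le> M * (exp (2*M*(s-a)) * ?D)"
          using M dist_bounded[of G s H] by (intro mult_mono) (auto simp: abs_mult dist_real_def)
        thus ?thesis using lip[of s "y0 + exp (2*M*(s-a)) * apply_bcontfun G s" "y0 + exp (2*M*(s-a)) * apply_bcontfun H s"]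
          by (simp add: algebra_simps)
      qed
      have i2: "((\<lambda>s. M * ?D * exp (2*M*(s-a))) has_integral
           (?D/2 * exp (2*M*(c t-a)) - ?D/2 * exp (2*M*(a-a)))) {a..c t}"
        using M by (intro fundamental_theorem_of_calculus)
           (auto intro!: derivative_eq_intros simp: c_def has_real_derivative_iff_has_vector_derivative[symmetric])
      have "\<bar>I G t - I H t\<bar> \<le> ?D/2 * exp (2*M*(c t-a)) - ?D/2 * exp (2*M*(a-a))"
        unfolding I_def integral_diff[OF int int, symmetric] integral_unique[OF i2, symmetric]
        unfolding real_norm_def[symmetric]
        by (intro integral_norm_bound_integral integrable_diff int has_integral_integrable[OF i2])
           (simp add: le)
      also have "\<dots> \<le> ?D/2 * exp (2*M*(c t-a))" by simp
      finally have "exp (- (2*M*(c t-a))) * \<bar>I G t - I H t\<bar>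
          \<le> exp (- (2*M*(c t-a))) * (?D/2 * exp (2*M*(c t-a)))"
        by (rule mult_left_mono) simp
      also have "\<dots> = ?D/2" by (simp add: mult_exp_exp mult.left_commute)
      finally have "exp (- (2*M*(c t-a))) * \<bar>I G t - I H t\<bar> \<le> ?D/2" .
      thus "dist (apply_bcontfun (TT G) t) (apply_bcontfun (TT H) t) \<le> 1/2 * ?D"
        unfolding TT T_def dist_real_def right_diff_distrib[symmetric] abs_mult by simp
    qed
  qed auto
  then obtain G where "TT G = G" by blast
  hence G: "T (apply_bcontfun G) = apply_bcontfun G" using TT[of G] by simp
  define y where "y t = y0 + exp (2*M*(t-a)) * apply_bcontfun G t" for t
  have contG: "continuous_on UNIV (apply_bcontfun G)" by simp
  have y: "y t = y0 + integral {a..t} (\<lambda>s. f s (y s))" if "t \<ge> a" for t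
  proof -
    have "c t = t" using that by (simp add: c_def)
    hence "apply_bcontfun G t = exp (- (2*M*(t-a))) * integral {a..t} (\<lambda>s. f s (y s))"
      using fun_cong[OF G, of t] unfolding y_def T_def I_def by simp
    thus ?thesis by (simp add: y_def mult.assoc[symmetric] mult_exp_exp)
  qed
  have der: "(y has_real_derivative f t (y t)) (at t within {a..})" if "t \<ge> a" for t
  proof -
    have "((\<lambda>u. integral {a..u} (\<lambda>s. f s (y s))) has_real_derivative f t (y t)) (at t within {a..t+1})"
      unfolding y_def by (rule integral_has_real_derivative[OF contf[OF contG]]) (use that in simp)
    hence "((\<lambda>u. y0 + integral {a..u} (\<lambda>s. f s (y s))) has_real_derivative f t (y t)) (at t within {a..t+1})"
      by (auto intro!: derivative_eq_intros)
    hence "(y has_real_derivative f t (y t)) (at t within {a..t+1})"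
      by (rule has_field_derivative_transform_within[OF _ zero_less_one]) (use y that in auto)
    moreover have "at t within {a..t+1} = at t within {a..}"
      by (rule at_within_nhd[of _ "{..<t+1}"]) auto
    ultimately show ?thesis by simp
  qed
  moreover have "y a = y0" using y[of a] by simp
  ultimately show ?thesis by blast
qed

text \<open>The solutions that start on the lower barrier at time \<open>- n\<close> increase with \<open>n\<close> and converge.\<close>

lemma entire_trapped_solution:
  fixes f :: "real \<Rightarrow> real \<Rightarrow> real"
  assumes cont: "continuous_on UNIV (\<lambda>p. f (fst p) (snd p))"
    and lip: "\<And>t y y'. \<bar>f t y - f t y'\<bar> \<le> M * \<bar>y - y'\<bar>"
    and bdd: "\<And>t y. \<bar>f t y\<bar> \<le> B"
    and LU: "l \<le> u"
    and low: "\<And>t y. y \<le> l \<Longrightarrow> f t y \<ge> 0" and upp: "\<And>t y. y \<ge> u \<Longrightarrow> f t y \<le> 0"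
  shows "\<exists>y. \<forall>t. l \<le> y t \<and> y t \<le> u \<and> (y has_real_derivative f t (y t)) (at t)"
proof -
  have "\<exists>y. y (- real n) = l \<and>
      (\<forall>t\<ge>- real n. (y has_real_derivative f t (y t)) (at t within {- real n..}))" for n
    by (rule picard_global[OF cont lip bdd])
  then obtain Y where Y0: "\<And>n. Y n (- real n) = l"
    and Yd: "\<And>n t. t \<ge> - real n \<Longrightarrow>
        (Y n has_real_derivative f t (Y n t)) (at t within {- real n..})" by metis
  have lo: "l \<le> Y n t" if "t \<ge> - real n" for n t
  proof -
    have "Y n t - l \<ge> 0"
    proof (rule nonneg_of_deriv_nonneg_where_neg[of "- real n" "\<lambda>t. Y n t - l" "\<lambda>t. f t (Y n t)"])
      show "((\<lambda>t. Y n t - l) has_real_derivative f t (Y n t)) (at t within {- real n..})"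
        if "t \<ge> - real n" for t
        using DERIV_diff[OF Yd[OF that] DERIV_const[of l]] by simp
    qed (use that low Y0[of n] in auto)
    thus ?thesis by simp
  qed
  have up: "Y n t \<le> u" if "t \<ge> - real n" for n t
  proof -
    have "u - Y n t \<ge> 0"
    proof (rule nonneg_of_deriv_nonneg_where_neg[of "- real n" "\<lambda>t. u - Y n t" "\<lambda>t. - f t (Y n t)"])
      show "((\<lambda>t. u - Y n t) has_real_derivative - f t (Y n t)) (at t within {- real n..})"
        if "t \<ge> - real n" for t
        using DERIV_diff[OF DERIV_const[of u] Yd[OF that]] by simp
    qed (use that upp Y0[of n] LU in auto)
    thus ?thesis by simp
  qed
  have mono: "Y n t \<le> Y m t" if "n \<le> m" "t \<ge> - real n" for n m t
  proof -
    have sub: "{- real n..} \<subseteq> {- real m..}" using that by auto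
    \<comment> \<open>At time \<open>- n\<close> the solution \<open>Y m\<close> already lies above
      the barrier \<open>l\<close>, where \<open>Y n\<close> starts. The factor
      \<open>exp (- M * t)\<close> absorbs the Lipschitz constant: wherever \<open>Y m\<close> is
      below \<open>Y n\<close>, the weighted difference has nonnegative derivative.\<close>
    define d where "d t = (Y m t - Y n t) * exp (- M * t)" for t
    define d' where "d' t = exp (- M * t) * (f t (Y m t) - f t (Y n t) - M * (Y m t - Y n t))" for t
    have "d t \<ge> 0"
    proof (rule nonneg_of_deriv_nonneg_where_neg[of "- real n" d d'])
      fix s assume s: "s \<ge> - real n"
      have "(Y m has_real_derivative f s (Y m s)) (at s within {- real n..})"
        by (rule DERIV_subset[OF Yd sub]) (use s that in auto)
      thus "(d has_real_derivative d' s) (at s within {- real n..})"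
        unfolding d_def d'_def using Yd[OF s]
        by (auto intro!: derivative_eq_intros simp: algebra_simps)
      assume "d s < 0"
      hence "Y m s < Y n s" by (simp add: d_def mult_less_0_iff)
      thus "d' s \<ge> 0" using lip[of s "Y m s" "Y n s"] unfolding d'_def
        by (intro mult_nonneg_nonneg) (auto simp: abs_if algebra_simps split: if_splits)
    next
      show "d (- real n) \<ge> 0" using lo[of m "- real n"] Y0[of n] that by (simp add: d_def)
    qed (use that in auto)
    thus ?thesis by (simp add: d_def zero_le_mult_iff)
  qed
  have "\<exists>y. (\<lambda>n. Y n t) \<longlonglongrightarrow> y" for t
  proof -
    obtain N :: nat where N: "- t \<le> real N" using real_arch_simple by blast
    have "incseq (\<lambda>n. Y (n + N) t)"
      unfolding incseq_def using N by (auto intro!: mono)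
    moreover have "\<And>n. Y (n + N) t \<le> u" using N by (intro up) auto
    ultimately obtain y where "(\<lambda>n. Y (n + N) t) \<longlonglongrightarrow> y" using incseq_convergent by blast
    hence "(\<lambda>n. Y n t) \<longlonglongrightarrow> y" by (rule LIMSEQ_offset)
    thus ?thesis ..
  qed
  then obtain y where y: "\<And>t. (\<lambda>n. Y n t) \<longlonglongrightarrow> y t" by metis
  have ev: "eventually (\<lambda>n. t \<ge> - real n) sequentially" for t
  proof -
    obtain N :: nat where N: "- t \<le> real N" using real_arch_simple by blast
    show ?thesis using eventually_ge_at_top[of N] by eventually_elim (use N in linarith)
  qed
  \<comment> \<open>The convergence is only pointwise, so the equation passes to the limit in
    integral form, by dominated convergence with the constant bound \<open>B\<close>.\<close>
  have int: "y b - y a = integral {a..b} (\<lambda>s. f s (y s))" if "a \<le> b" for a b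
  proof -
    obtain N :: nat where N: "- a \<le> real N" using real_arch_simple by blast
    have hi: "((\<lambda>s. f s (Y (n+N) s)) has_integral (Y (n+N) b - Y (n+N) a)) {a..b}" for n
    proof (rule fundamental_theorem_of_calculus[OF that])
      fix s assume "s \<in> {a..b}"
      hence s: "s \<ge> - real (n+N)" and sub: "{a..b} \<subseteq> {- real (n+N)..}" using N by auto
      show "(Y (n+N) has_vector_derivative f s (Y (n+N) s)) (at s within {a..b})"
        using DERIV_subset[OF Yd[OF s] sub]
        by (simp add: has_real_derivative_iff_has_vector_derivative)
    qed
    have lim: "(\<lambda>n. f s (Y (n+N) s)) \<longlonglongrightarrow> f s (y s)" for s
    proof -
      have "continuous_on UNIV (f s)"
      proof -
        have "continuous_on UNIV (\<lambda>v. (s, v))" by (intro continuous_intros)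
        from continuous_on_compose2[OF cont this] show ?thesis by simp
      qed
      hence "isCont (f s) (y s)" by (simp add: continuous_on_eq_continuous_at)
      thus ?thesis using LIMSEQ_ignore_initial_segment[OF y[of s], of N] by (rule isCont_tendsto_compose)
    qed
    have dc: "(\<lambda>n. integral {a..b} (\<lambda>s. f s (Y (n+N) s))) \<longlonglongrightarrow> integral {a..b} (\<lambda>s. f s (y s))"
    proof (rule dominated_convergence(2)[where h="\<lambda>_. B"])
      show "(\<lambda>s. f s (Y (n+N) s)) integrable_on {a..b}" for n
        using hi by (rule has_integral_integrable)
    qed (use lim bdd in auto)
    have "(\<lambda>n. Y (n+N) b - Y (n+N) a) \<longlonglongrightarrow> y b - y a"
      by (intro tendsto_diff LIMSEQ_ignore_initial_segment y)
    with dc show ?thesis unfolding integral_unique[OF hi] using LIMSEQ_unique by blast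
  qed
  \<comment> \<open>Continuity of the limit comes from the common Lipschitz constant
    \<open>B\<close>; it is needed before the integral form can be differentiated.\<close>
  have ylip: "\<bar>y b - y a\<bar> \<le> B * \<bar>b - a\<bar>" if "a \<le> b" for a b
  proof (rule LIMSEQ_le_const2)
    show "(\<lambda>n. \<bar>Y n b - Y n a\<bar>) \<longlonglongrightarrow> \<bar>y b - y a\<bar>" by (intro tendsto_intros y)
    have "\<bar>Y n b - Y n a\<bar> \<le> B * \<bar>b - a\<bar>" if n: "a \<ge> - real n" for n
    proof -
      have "norm (Y n b - Y n a) \<le> B * norm (b - a)"
      proof (rule field_differentiable_bound[of "{- real n..}" _ "\<lambda>t. f t (Y n t)"])
        show "(Y n has_real_derivative f z (Y n z)) (at z within {- real n..})"
          if "z \<in> {- real n..}" for z using Yd[of n z] that by simp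
      qed (use n \<open>a \<le> b\<close> bdd in auto)
      thus ?thesis by simp
    qed
    thus "\<exists>N. \<forall>n\<ge>N. \<bar>Y n b - Y n a\<bar> \<le> B * \<bar>b - a\<bar>"
      using ev[of a] unfolding eventually_sequentially by blast
  qed
  have B0: "B \<ge> 0" using bdd[of 0 0] by linarith
  have "B-lipschitz_on UNIV y"
  proof (rule lipschitz_onI)
    fix a b :: real
    show "dist (y a) (y b) \<le> B * dist a b"
      using ylip[of a b] ylip[of b a] by (cases "a \<le> b") (simp_all add: dist_real_def abs_minus_commute)
  qed (rule B0)
  hence ycont: "continuous_on UNIV y" by (rule lipschitz_on_continuous_on)
  have fcont: "continuous_on S (\<lambda>s. f s (y s))" for S
  proof -
    have "continuous_on S (\<lambda>s. (s, y s))"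
      by (intro continuous_intros continuous_on_subset[OF ycont]) simp
    from continuous_on_compose2[OF cont this] show ?thesis by simp
  qed
  have der: "(y has_real_derivative f t (y t)) (at t)" for t
  proof -
    have "((\<lambda>v. integral {t-1..v} (\<lambda>s. f s (y s))) has_real_derivative f t (y t)) (at t within {t-1..t+1})"
      by (rule integral_has_real_derivative[OF fcont]) simp
    hence "((\<lambda>v. y (t-1) + integral {t-1..v} (\<lambda>s. f s (y s))) has_real_derivative f t (y t)) (at t within {t-1..t+1})"
      by (auto intro!: derivative_eq_intros)
    moreover have "y (t-1) + integral {t-1..v} (\<lambda>s. f s (y s)) = y v" if "v \<in> {t-1..t+1}" for v
      using int[of "t-1" v] that by simp
    ultimately have "(y has_real_derivative f t (y t)) (at t within {t-1..t+1})"
      using has_field_derivative_transform_within[OF _ zero_less_one, of _ _ t "{t-1..t+1}" y] by simp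
    thus ?thesis by (simp add: at_within_Icc_at)
  qed
  have "l \<le> y t \<and> y t \<le> u" for t
  proof
    show "l \<le> y t"
      by (rule tendsto_lowerbound[OF y eventually_mono[OF ev[of t]]]) (use lo in auto)
    show "y t \<le> u"
      by (rule tendsto_upperbound[OF y eventually_mono[OF ev[of t]]]) (use up in auto)
  qed
  with der show ?thesis by blast
qed

text \<open>The pairs at which \<open>f\<close> fails to be positive form a compact set, so their
  parameters form a closed set, which misses 0. Inequalities for small parameters are thereby
  reduced to strict inequalities at parameter 0.\<close>

lemma eventually_pos_on_compact:
  fixes f :: "real \<Rightarrow> 'a::metric_space \<Rightarrow> real"
  assumes K: "compact K" and cont: "continuous_on ({0..1} \<times> K) (\<lambda>p. f (fst p) (snd p))"
    and pos: "\<And>p. p \<in> K \<Longrightarrow> f 0 p > 0"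
  shows "eventually (\<lambda>d. \<forall>p\<in>K. f d p > 0) (at_right 0)"
proof -
  define A where "A = ({0..1} \<times> K) \<inter> (\<lambda>p. f (fst p) (snd p)) -` {..0}"
  have c: "compact ({0..1::real} \<times> K)" by (intro compact_Times K) auto
  have "closedin (top_of_set ({0..1} \<times> K)) A"
    unfolding A_def by (rule continuous_closedin_preimage[OF cont]) auto
  hence "compact A" using c closedin_compact by blast
  hence "compact (fst ` A)" by (intro compact_continuous_image continuous_intros)
  hence "closed (fst ` A)" by (rule compact_imp_closed)
  moreover have "0 \<notin> fst ` A" using pos by (force simp: A_def)
  ultimately have "eventually (\<lambda>d. d \<in> - fst ` A) (nhds 0)"
    by (intro eventually_nhds_in_open) auto
  hence "eventually (\<lambda>d. d \<notin> fst ` A) (at_right 0)"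
    by (simp add: eventually_at_filter eventually_mono)
  moreover have "eventually (\<lambda>d::real. d \<in> {0<..<1}) (at_right 0)"
    by (rule eventually_at_right_real) simp
  ultimately show ?thesis
    by eventually_elim (force simp: A_def not_le)
qed

section \<open>Families with a common bound and Lipschitz constant\<close>

text \<open>Boundedness is included so that products stay in the class. With denominators bounded
  away from 0, the class is then closed under the rational operations that make up the barrier
  equations.\<close>

definition lip_family :: "real set \<Rightarrow> real set \<Rightarrow> (real \<Rightarrow> real \<Rightarrow> real) \<Rightarrow> bool" where
  "lip_family S J f \<longleftrightarrow> (\<exists>M. \<forall>s\<in>S. \<forall>y\<in>J. \<bar>f s y\<bar> \<le> M \<and> (\<forall>y'\<in>J. \<bar>f s y - f s y'\<bar> \<le> M * \<bar>y - y'\<bar>))"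

lemma lip_familyI:
  assumes "\<And>s y. s \<in> S \<Longrightarrow> y \<in> J \<Longrightarrow> \<bar>f s y\<bar> \<le> M"
    "\<And>s y y'. s \<in> S \<Longrightarrow> y \<in> J \<Longrightarrow> y' \<in> J \<Longrightarrow> \<bar>f s y - f s y'\<bar> \<le> M' * \<bar>y - y'\<bar>"
  shows "lip_family S J f"
  unfolding lip_family_def
proof (intro exI[of _ "max M M'"] ballI conjI)
  fix s y y' assume a: "s \<in> S" "y \<in> J"
  show "\<bar>f s y\<bar> \<le> max M M'" using assms(1)[OF a] by simp
  assume "y' \<in> J"
  hence "\<bar>f s y - f s y'\<bar> \<le> M' * \<bar>y - y'\<bar>" using assms(2) a by blast
  also have "\<dots> \<le> max M M' * \<bar>y - y'\<bar>" by (intro mult_right_mono) auto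
  finally show "\<bar>f s y - f s y'\<bar> \<le> max M M' * \<bar>y - y'\<bar>" .
qed

lemma lip_familyE:
  assumes "lip_family S J f"
  obtains M where "M \<ge> 0" "\<And>s y. s \<in> S \<Longrightarrow> y \<in> J \<Longrightarrow> \<bar>f s y\<bar> \<le> M"
    "\<And>s y y'. s \<in> S \<Longrightarrow> y \<in> J \<Longrightarrow> y' \<in> J \<Longrightarrow> \<bar>f s y - f s y'\<bar> \<le> M * \<bar>y - y'\<bar>"
proof -
  obtain M where M: "\<And>s y. s \<in> S \<Longrightarrow> y \<in> J \<Longrightarrow> \<bar>f s y\<bar> \<le> M"
    "\<And>s y y'. s \<in> S \<Longrightarrow> y \<in> J \<Longrightarrow> y' \<in> J \<Longrightarrow> \<bar>f s y - f s y'\<bar> \<le> M * \<bar>y - y'\<bar>"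
    using assms unfolding lip_family_def by blast
  show ?thesis
  proof (rule that[of "max M 0"])
    fix s y y' assume a: "s \<in> S" "y \<in> J"
    show "\<bar>f s y\<bar> \<le> max M 0" using M(1)[OF a] by simp
    assume "y' \<in> J"
    from M(2)[OF a this] show "\<bar>f s y - f s y'\<bar> \<le> max M 0 * \<bar>y - y'\<bar>"
      by (rule order_trans) (intro mult_right_mono, auto)
  qed simp
qed

lemma lip_family_const:
  assumes "bounded (g ` S)"
  shows "lip_family S J (\<lambda>s y. g s)"
proof -
  obtain M where "\<And>s. s \<in> S \<Longrightarrow> \<bar>g s\<bar> \<le> M" using assms unfolding bounded_iff by auto
  thus ?thesis by (intro lip_familyI[where M=M and M'=0]) auto
qed

lemma lip_family_var:
  assumes "bounded J"
  shows "lip_family S J (\<lambda>s y. y)"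
proof -
  obtain M where "\<And>y. y \<in> J \<Longrightarrow> \<bar>y\<bar> \<le> M" using assms unfolding bounded_iff by auto
  thus ?thesis by (intro lip_familyI[where M=M and M'=1]) auto
qed

lemma lip_family_add:
  assumes "lip_family S J f" "lip_family S J g"
  shows "lip_family S J (\<lambda>s y. f s y + g s y)"
proof -
  from assms(1) obtain M where M: "\<And>s y. s \<in> S \<Longrightarrow> y \<in> J \<Longrightarrow> \<bar>f s y\<bar> \<le> M"
    "\<And>s y y'. s \<in> S \<Longrightarrow> y \<in> J \<Longrightarrow> y' \<in> J \<Longrightarrow> \<bar>f s y - f s y'\<bar> \<le> M * \<bar>y - y'\<bar>"
    by (elim lip_familyE) blast
  from assms(2) obtain N where N: "\<And>s y. s \<in> S \<Longrightarrow> y \<in> J \<Longrightarrow> \<bar>g s y\<bar> \<le> N"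
    "\<And>s y y'. s \<in> S \<Longrightarrow> y \<in> J \<Longrightarrow> y' \<in> J \<Longrightarrow> \<bar>g s y - g s y'\<bar> \<le> N * \<bar>y - y'\<bar>"
    by (elim lip_familyE) blast
  show ?thesis
  proof (rule lip_familyI[where M="M+N" and M'="M+N"])
    fix s y y' assume a: "s \<in> S" "y \<in> J"
    show "\<bar>f s y + g s y\<bar> \<le> M + N" using M(1)[OF a] N(1)[OF a] by linarith
    assume "y' \<in> J"
    with M(2)[OF a this] N(2)[OF a this]
    show "\<bar>f s y + g s y - (f s y' + g s y')\<bar> \<le> (M + N) * \<bar>y - y'\<bar>"
      by (simp add: distrib_right)
  qed
qed

lemma lip_family_mult:
  assumes "lip_family S J f" "lip_family S J g"
  shows "lip_family S J (\<lambda>s y. f s y * g s y)"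
proof -
  from assms(1) obtain M where M: "M \<ge> 0" "\<And>s y. s \<in> S \<Longrightarrow> y \<in> J \<Longrightarrow> \<bar>f s y\<bar> \<le> M"
    "\<And>s y y'. s \<in> S \<Longrightarrow> y \<in> J \<Longrightarrow> y' \<in> J \<Longrightarrow> \<bar>f s y - f s y'\<bar> \<le> M * \<bar>y - y'\<bar>"
    by (elim lip_familyE) blast
  from assms(2) obtain N where N: "N \<ge> 0" "\<And>s y. s \<in> S \<Longrightarrow> y \<in> J \<Longrightarrow> \<bar>g s y\<bar> \<le> N"
    "\<And>s y y'. s \<in> S \<Longrightarrow> y \<in> J \<Longrightarrow> y' \<in> J \<Longrightarrow> \<bar>g s y - g s y'\<bar> \<le> N * \<bar>y - y'\<bar>"
    by (elim lip_familyE) blast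
  show ?thesis
  proof (rule lip_familyI[where M="M*N" and M'="2*M*N"])
    fix s y y' assume a: "s \<in> S" "y \<in> J"
    show "\<bar>f s y * g s y\<bar> \<le> M * N" unfolding abs_mult using M N a by (intro mult_mono) auto
    assume b: "y' \<in> J"
    have "\<bar>f s y * g s y - f s y' * g s y'\<bar> = \<bar>f s y * (g s y - g s y') + (f s y - f s y') * g s y'\<bar>"
      by (simp add: algebra_simps)
    also have "\<dots> \<le> \<bar>f s y\<bar> * \<bar>g s y - g s y'\<bar> + \<bar>f s y - f s y'\<bar> * \<bar>g s y'\<bar>"
      by (rule order_trans[OF abs_triangle_ineq]) (simp add: abs_mult)
    also have "\<dots> \<le> M * (N * \<bar>y - y'\<bar>) + (M * \<bar>y - y'\<bar>) * N"
      using M N a b by (intro add_mono mult_mono) auto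
    finally show "\<bar>f s y * g s y - f s y' * g s y'\<bar> \<le> 2 * M * N * \<bar>y - y'\<bar>" by (simp add: algebra_simps)
  qed
qed

lemma lip_family_inverse:
  assumes "lip_family S J f" and c: "c > 0" "\<And>s y. s \<in> S \<Longrightarrow> y \<in> J \<Longrightarrow> f s y \<ge> c"
  shows "lip_family S J (\<lambda>s y. inverse (f s y))"
proof -
  from assms(1) obtain M where M: "M \<ge> 0" "\<And>s y. s \<in> S \<Longrightarrow> y \<in> J \<Longrightarrow> \<bar>f s y\<bar> \<le> M"
    "\<And>s y y'. s \<in> S \<Longrightarrow> y \<in> J \<Longrightarrow> y' \<in> J \<Longrightarrow> \<bar>f s y - f s y'\<bar> \<le> M * \<bar>y - y'\<bar>"
    by (elim lip_familyE) blast
  have i: "0 < inverse (f s y) \<and> inverse (f s y) \<le> inverse c" if "s \<in> S" "y \<in> J" for s y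
    using c(1) c(2)[OF that] by (auto intro: le_imp_inverse_le)
  show ?thesis
  proof (rule lip_familyI[where M="inverse c" and M'="inverse c * M * inverse c"])
    fix s y y' assume a: "s \<in> S" "y \<in> J"
    show "\<bar>inverse (f s y)\<bar> \<le> inverse c" using i[OF a] by auto
    assume b: "y' \<in> J"
    have "f s y \<noteq> 0" "f s y' \<noteq> 0" using c a b by force+
    hence "\<bar>inverse (f s y) - inverse (f s y')\<bar> = \<bar>inverse (f s y)\<bar> * \<bar>f s y - f s y'\<bar> * \<bar>inverse (f s y')\<bar>"
      by (simp add: inverse_diff_inverse abs_mult)
    also have "\<dots> \<le> inverse c * (M * \<bar>y - y'\<bar>) * inverse c"
      using i[OF a] i[OF a(1) b] M a b c by (intro mult_mono) auto
    finally show "\<bar>inverse (f s y) - inverse (f s y')\<bar> \<le> inverse c * M * inverse c * \<bar>y - y'\<bar>"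
      by (simp add: ac_simps)
  qed
qed

lemma lip_family_minus: "lip_family S J f \<Longrightarrow> lip_family S J (\<lambda>s y. - f s y)"
  unfolding lip_family_def by (simp add: abs_minus_commute add.commute)

lemma lip_family_diff:
  "lip_family S J f \<Longrightarrow> lip_family S J g \<Longrightarrow> lip_family S J (\<lambda>s y. f s y - g s y)"
  using lip_family_add[OF _ lip_family_minus, of S J f g] by simp

lemma lip_family_power:
  assumes "lip_family S J f"
  shows "lip_family S J (\<lambda>s y. f s y ^ n)"
proof (induction n)
  case 0
  show ?case using lip_family_const[of "\<lambda>_. 1" S J] by (simp add: image_constant_conv)
qed (auto intro: lip_family_mult assms)

lemma lip_family_divide:
  assumes "lip_family S J f" "lip_family S J g" "c > 0" "\<And>s y. s \<in> S \<Longrightarrow> y \<in> J \<Longrightarrow> g s y \<ge> c"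
  shows "lip_family S J (\<lambda>s y. f s y / g s y)"
  unfolding divide_inverse by (intro lip_family_mult lip_family_inverse[where c=c] assms)

section \<open>Weak conservation laws with a point singularity\<close>

text \<open>The fundamental theorem for the Henstock-Kurzweil integral tolerates finitely many
  points without derivative, hence so does the mean value inequality. The points of \<open>S\<close>
  are the kinks of the flow along a line.\<close>

lemma abs_diff_le_of_bounded_deriv_off_finite:
  fixes f f' :: "real \<Rightarrow> real"
  assumes "finite S" and le: "a \<le> b" and cont: "continuous_on {a..b} f"
    and der: "\<And>x. x \<in> {a<..<b} - S \<Longrightarrow> (f has_real_derivative f' x) (at x)"
    and bd: "\<And>x. x \<in> {a<..<b} - S \<Longrightarrow> \<bar>f' x\<bar> \<le> K" and K: "K \<ge> 0"
  shows "\<bar>f b - f a\<bar> \<le> K * (b - a)"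
proof -
  define g where "g x = (if x \<in> {a<..<b} - S then f' x else 0)" for x
  have "(g has_integral (f b - f a)) {a..b}"
    using der by (intro fundamental_theorem_of_calculus_interior_strong[OF \<open>finite S\<close> le _ cont])
      (auto simp: g_def has_real_derivative_iff_has_vector_derivative)
  hence "norm (f b - f a) \<le> K * Henstock_Kurzweil_Integration.content {a..b}"
    using bd K by (intro has_integral_bound_real[OF K]) (auto simp: g_def)
  thus ?thesis using le by simp
qed

lemma lborel_integral_shift:
  fixes h :: "'a::euclidean_space \<Rightarrow> real"
  assumes "h \<in> borel_measurable borel"
  shows "(\<integral>z. h (z + c) \<partial>lborel) = (\<integral>z. h z \<partial>lborel)"
proof -
  have "(\<integral>z. h z \<partial>distr lborel borel ((+) c)) = (\<integral>z. h (c + z) \<partial>lborel)"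
    using assms by (intro integral_distr) auto
  thus ?thesis by (simp add: lborel_distr_plus add.commute)
qed

text \<open>Difference quotients of a compactly supported function integrate to 0 by translation
  invariance, and dominated convergence passes to the derivatives. The dominating constant is the
  mean value inequality on lines of direction \<open>e i\<close>, hence the hypothesis that almost
  every such line meets \<open>S\<close> in a finite set. The limit is taken for the whole sum, so
  measurability is asked of \<open>G\<close> only.\<close>

lemma integral_sum_directional_derivatives_eq_0:
  fixes h :: "'i \<Rightarrow> 'a::euclidean_space \<Rightarrow> real"
  assumes "finite I" and K: "K \<ge> 0"
    and cont: "\<And>i. i \<in> I \<Longrightarrow> continuous_on UNIV (h i)"
    and supp: "\<And>i z. i \<in> I \<Longrightarrow> z \<notin> cball 0 r \<Longrightarrow> h i z = 0"
    and null: "AE z in lborel. z \<notin> S"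
    and lines: "\<And>i. i \<in> I \<Longrightarrow> AE z in lborel. finite {s. z + s *\<^sub>R e i \<in> S}"
    and der: "\<And>i z. i \<in> I \<Longrightarrow> z \<notin> S \<Longrightarrow> (h i has_derivative h' i z) (at z)"
    and bd: "\<And>i z. i \<in> I \<Longrightarrow> z \<notin> S \<Longrightarrow> \<bar>h' i z (e i)\<bar> \<le> K"
    and G: "G \<in> borel_measurable borel" "\<And>z. z \<notin> S \<Longrightarrow> (\<Sum>i\<in>I. h' i z (e i)) = G z"
  shows "(\<integral>z. G z \<partial>lborel) = 0"
proof -
  define s where "s n = inverse (real (Suc n))" for n
  have s: "s n > 0" "s n \<le> 1" for n by (auto simp: s_def field_simps)
  have s0: "s \<longlonglongrightarrow> 0" unfolding s_def by (rule LIMSEQ_inverse_real_of_nat)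
  \<comment> \<open>Steps are at most 1, so this ball contains the supports of all translates that
    occur in the quotients.\<close>
  define B where "B = cball (0::'a) (\<bar>r\<bar> + (\<Sum>i\<in>I. norm (e i)))"
  define Q where "Q i n z = (h i (z + s n *\<^sub>R e i) - h i z) / s n" for i n z
  have one: "Q i n \<in> borel_measurable lborel" "integrable lborel (Q i n)" "(\<integral>z. Q i n z \<partial>lborel) = 0"
    "AE z in lborel. \<bar>Q i n z\<bar> \<le> K * indicator B z"
    "AE z in lborel. (\<lambda>n. Q i n z) \<longlonglongrightarrow> h' i z (e i)" if i: "i \<in> I" for i n
  proof -
  have hm[measurable]: "h i \<in> borel_measurable borel"
    using cont[OF i] by (rule borel_measurable_continuous_onI)
  have hint: "integrable lborel (h i)"
  proof -
    have "integrable lborel (\<lambda>z. indicator (cball 0 r) z *\<^sub>R h i z)"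
      by (rule borel_integrable_compact) (auto intro: continuous_on_subset[OF cont[OF i]])
    moreover have "(\<lambda>z. indicator (cball 0 r) z *\<^sub>R h i z) = h i"
      using supp[OF i] by (force simp: indicator_def fun_eq_iff)
    ultimately show ?thesis by simp
  qed
  have hint': "integrable lborel (\<lambda>z. h i (z + c))" for c
  proof -
    have "integrable (distr lborel borel ((+) c)) (h i)" using hint by (simp add: lborel_distr_plus)
    hence "integrable lborel (\<lambda>z. h i (c + z))" by (subst (asm) integrable_distr_eq) auto
    thus ?thesis by (simp add: add.commute)
  qed
  have Q0: "(\<integral>z. Q i n z \<partial>lborel) = 0" for n
    unfolding Q_def using hint hint' lborel_integral_shift[OF hm] by simp
  have bound: "AE z in lborel. \<bar>Q i n z\<bar> \<le> K * indicator B z" for n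
    using lines[OF i]
  proof eventually_elim
    case (elim z)
    show ?case
    proof (cases "z \<in> B")
      case True
      define F where "F \<sigma> = h i (z + \<sigma> *\<^sub>R e i)" for \<sigma>
      have "\<bar>F (s n) - F 0\<bar> \<le> K * (s n - 0)"
      proof (rule abs_diff_le_of_bounded_deriv_off_finite[OF elim])
        show "continuous_on {0..s n} F" unfolding F_def
          by (rule continuous_on_compose2[OF cont[OF i]]) (auto intro!: continuous_intros)
        fix \<sigma> assume "\<sigma> \<in> {0<..<s n} - {s. z + s *\<^sub>R e i \<in> S}"
        hence ns: "z + \<sigma> *\<^sub>R e i \<notin> S" by simp
        have d1: "((\<lambda>\<sigma>. z + \<sigma> *\<^sub>R e i) has_derivative (\<lambda>\<tau>. \<tau> *\<^sub>R e i)) (at \<sigma>)"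
          by (auto intro!: derivative_eq_intros)
        have "(F has_derivative (\<lambda>\<tau>. h' i (z + \<sigma> *\<^sub>R e i) (\<tau> *\<^sub>R e i))) (at \<sigma>)"
          unfolding F_def by (rule has_derivative_compose[OF d1 der[OF i ns]])
        moreover have "h' i (z + \<sigma> *\<^sub>R e i) (\<tau> *\<^sub>R e i) = h' i (z + \<sigma> *\<^sub>R e i) (e i) * \<tau>" for \<tau>
          using linear_cmul[OF has_derivative_linear[OF der[OF i ns]]] by simp
        ultimately show "(F has_real_derivative h' i (z + \<sigma> *\<^sub>R e i) (e i)) (at \<sigma>)"
          by (simp add: has_field_derivative_def)
        show "\<bar>h' i (z + \<sigma> *\<^sub>R e i) (e i)\<bar> \<le> K" by (rule bd[OF i ns])
      qed (use s[of n] K in auto)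
      thus ?thesis using True s[of n] by (simp add: Q_def F_def pos_divide_le_eq)
    next
      case False
      hence nz: "norm z > \<bar>r\<bar> + norm (e i)"
        using member_le_sum[of i I "\<lambda>i. norm (e i)"] i \<open>finite I\<close> by (auto simp: B_def)
      have "norm (s n *\<^sub>R e i) \<le> norm (e i)" using s[of n] by (simp add: mult_left_le_one_le)
      hence "norm (z + s n *\<^sub>R e i) > \<bar>r\<bar>" using nz norm_triangle_ineq4[of "z + s n *\<^sub>R e i" "s n *\<^sub>R e i"] by simp
      moreover have "norm z > \<bar>r\<bar>" using nz norm_ge_zero[of "e i"] by linarith
      ultimately have "h i (z + s n *\<^sub>R e i) = 0" "h i z = 0" by (auto intro!: supp[OF i])
      thus ?thesis using K by (simp add: Q_def)
    qed
  qed
  have lim: "AE z in lborel. (\<lambda>n. Q i n z) \<longlonglongrightarrow> h' i z (e i)"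
    using null
  proof eventually_elim
    case (elim z)
    have d1: "((\<lambda>\<sigma>. z + \<sigma> *\<^sub>R e i) has_derivative (\<lambda>\<tau>. \<tau> *\<^sub>R e i)) (at 0)"
      by (auto intro!: derivative_eq_intros)
    have "((\<lambda>\<sigma>. h i (z + \<sigma> *\<^sub>R e i)) has_derivative (\<lambda>\<tau>. h' i z (\<tau> *\<^sub>R e i))) (at 0)"
      by (rule has_derivative_compose[OF d1]) (use der[OF i elim] in simp)
    moreover have "h' i z (\<tau> *\<^sub>R e i) = h' i z (e i) * \<tau>" for \<tau>
      using linear_cmul[OF has_derivative_linear[OF der[OF i elim]]] by simp
    ultimately have "((\<lambda>\<sigma>. h i (z + \<sigma> *\<^sub>R e i)) has_real_derivative h' i z (e i)) (at 0)"
      by (simp add: has_field_derivative_def)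
    hence "(\<lambda>\<sigma>. (h i (z + \<sigma> *\<^sub>R e i) - h i z) / \<sigma>) \<midarrow>0\<rightarrow> h' i z (e i)"
      by (simp add: has_field_derivative_iff)
    moreover have "filterlim s (at 0) sequentially"
      using s0 s by (auto simp: filterlim_at less_imp_neq[symmetric])
    ultimately show ?case unfolding Q_def by (rule filterlim_compose)
  qed
    show "Q i n \<in> borel_measurable lborel" unfolding Q_def by measurable
    show "integrable lborel (Q i n)" unfolding Q_def using hint hint' by simp
    show "(\<integral>z. Q i n z \<partial>lborel) = 0" by (rule Q0)
    show "AE z in lborel. \<bar>Q i n z\<bar> \<le> K * indicator B z" by (rule bound)
    show "AE z in lborel. (\<lambda>n. Q i n z) \<longlonglongrightarrow> h' i z (e i)" by (rule lim)
  qed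
  have fin: "emeasure lborel B < \<infinity>" unfolding B_def by (intro emeasure_compact_finite compact_cball)
  hence dom: "integrable lborel (\<lambda>z. (\<Sum>i\<in>I. K * indicator B z) :: real)"
    by (intro Bochner_Integration.integrable_sum integrable_mult_right integrable_real_indicator)
       (auto simp: B_def)
  have bound: "AE z in lborel. norm (\<Sum>i\<in>I. Q i n z) \<le> (\<Sum>i\<in>I. K * indicator B z)" for n
  proof -
    have "AE z in lborel. \<forall>i\<in>I. \<bar>Q i n z\<bar> \<le> K * indicator B z"
      using one(4) \<open>finite I\<close> by (subst AE_finite_all) auto
    thus ?thesis
      by eventually_elim (simp only: real_norm_def, rule order_trans[OF sum_abs], rule sum_mono, simp)
  qed
  have lim: "AE z in lborel. (\<lambda>n. \<Sum>i\<in>I. Q i n z) \<longlonglongrightarrow> G z"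
  proof -
    have "AE z in lborel. \<forall>i\<in>I. (\<lambda>n. Q i n z) \<longlonglongrightarrow> h' i z (e i)"
      using one(5) \<open>finite I\<close> by (subst AE_finite_all) auto
    with null show ?thesis by eventually_elim (auto simp: G(2)[symmetric] intro!: tendsto_sum)
  qed
  have Gm: "G \<in> borel_measurable lborel" using G(1) by simp
  have Qm: "\<And>n. (\<lambda>z. \<Sum>i\<in>I. Q i n z) \<in> borel_measurable lborel"
    using one(1) by (intro borel_measurable_sum) auto
  have "(\<lambda>n. \<integral>z. (\<Sum>i\<in>I. Q i n z) \<partial>lborel) \<longlonglongrightarrow> (\<integral>z. G z \<partial>lborel)"
    by (rule integral_dominated_convergence[OF Gm Qm dom lim bound])
  moreover have "(\<integral>z. (\<Sum>i\<in>I. Q i n z) \<partial>lborel) = 0" for n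
    using one(2,3) by (subst Bochner_Integration.integral_sum) auto
  ultimately show ?thesis by (simp add: LIMSEQ_const_iff)
qed

section \<open>Measure, integrability and cutoffs in space-time\<close>

lemma borel_measurable_fst_snd_spacetime [measurable]:
  "(fst :: spacetime \<Rightarrow> real) \<in> borel_measurable borel"
  "(snd :: spacetime \<Rightarrow> real^3) \<in> borel_measurable borel"
  by (intro borel_measurable_continuous_onI continuous_intros)+

lemma AE_spacetimeI:
  assumes [measurable]: "Measurable.pred borel P"
    and "AE t in lborel. AE x in lborel. P (t, x)"
  shows "AE z in (lborel :: spacetime measure). P z"
proof -
  have "AE z in (lborel \<Otimes>\<^sub>M lborel). P z"
  proof (rule lborel_pair.AE_pair_measure)
    show "{z \<in> space (lborel \<Otimes>\<^sub>M lborel). P z} \<in> sets (lborel \<Otimes>\<^sub>M lborel)"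
      unfolding lborel_prod by simp
  qed (use assms in simp)
  thus ?thesis unfolding lborel_prod .
qed

lemma AE_snd_neq_0: "AE z::spacetime in lborel. snd z \<noteq> 0"
proof (rule AE_spacetimeI)
  show "AE t in lborel. AE x in lborel. snd (t::real, x :: real^3) \<noteq> 0"
    using AE_lborel_singleton[of "0::real^3"] by simp
qed measurable

text \<open>Dyadic shells around the axis: where \<open>norm (snd z)\<close> lies between
  \<open>r j / 2\<close> and \<open>r j\<close>, the weight is at most \<open>w j\<close>, and the
  shell sits in a cylinder of volume proportional to \<open>r j ^ 3\<close>. The resulting series is
  geometric with ratio \<open>2 powr (a - 3) < 1\<close>.\<close>

lemma integrable_norm_snd_powr:
  fixes a \<rho> :: real
  assumes a: "0 \<le> a" "a < 3" and \<rho>: "\<rho> > 0"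
  shows "integrable lborel (\<lambda>z::spacetime. indicator (cball 0 \<rho>) z * norm (snd z) powr (- a))"
proof (rule integrableI_bounded)
  define r where "r j = \<rho> * (1/2) ^ j" for j :: nat
  define A where "A j = {-\<rho>..\<rho>} \<times> cball (0::real^3) (r j)" for j
  define w where "w j = (r j / 2) powr (- a)" for j
  have rp: "r j > 0" for j using \<rho> by (simp add: r_def)
  have "AE z::spacetime in lborel. ennreal (norm (indicator (cball 0 \<rho>) z * norm (snd z) powr (- a)))
      \<le> (\<Sum>j. ennreal (w j) * indicator (A j) z)"
    using AE_snd_neq_0
  proof eventually_elim
    case (elim z)
    show ?case
    proof (cases "z \<in> cball 0 \<rho>")
      case True
      have n: "norm (snd z) \<le> \<rho>" "\<bar>fst z\<bar> \<le> \<rho>"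
        using True norm_snd_le[of "snd z" "fst z"] norm_fst_le[of "fst z" "snd z"] by auto
      have "\<exists>j. r j < norm (snd z)"
        using real_arch_pow_inv[of "norm (snd z) / \<rho>" "1/2"] elim \<rho>
        by (auto simp: r_def field_simps)
      define j where "j = (LEAST j. r j < norm (snd z))"
      have j: "r j < norm (snd z)" using \<open>\<exists>j. r j < norm (snd z)\<close> unfolding j_def by (rule LeastI_ex)
      have j0: "j \<noteq> 0" using j n by (intro notI) (simp add: r_def)
      then obtain i where i: "j = Suc i" by (cases j) auto
      have "\<not> r i < norm (snd z)" using not_less_Least[of i "\<lambda>j. r j < norm (snd z)"] i by (simp add: j_def)
      hence zA: "z \<in> A i" using n by (cases z) (auto simp: A_def)
      have "r i / 2 \<le> norm (snd z)" using j by (simp add: i r_def)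
      hence "norm (snd z) powr (- a) \<le> w i" unfolding w_def using rp[of i] a
        by (intro powr_mono2') auto
      hence "ennreal (norm (indicator (cball 0 \<rho>) z * norm (snd z) powr (- a))) \<le> ennreal (w i) * indicator (A i) z"
        using zA True by (simp add: ennreal_leI)
      also have "\<dots> \<le> (\<Sum>j. ennreal (w j) * indicator (A j) z)"
      proof -
        have "sum (\<lambda>j. ennreal (w j) * indicator (A j) z) {i} \<le> (\<Sum>j. ennreal (w j) * indicator (A j) z)"
          by (rule sum_le_suminf) (auto intro: summableI)
        moreover have "sum (\<lambda>j. ennreal (w j) * indicator (A j) z) {i} = ennreal (w i) * indicator (A i) z"
          by (rule trans[OF sum.insert]) auto
        ultimately show ?thesis by (simp only:)
      qed
      finally show ?thesis .
    qed simp
  qed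
  hence "(\<integral>\<^sup>+z. ennreal (norm (indicator (cball 0 \<rho>) z * norm (snd (z::spacetime)) powr (- a))) \<partial>lborel)
      \<le> (\<integral>\<^sup>+z. (\<Sum>j. ennreal (w j) * indicator (A j) z) \<partial>lborel)"
    by (rule nn_integral_mono_AE)
  also have "\<dots> = (\<Sum>j. \<integral>\<^sup>+z. ennreal (w j) * indicator (A j) z \<partial>lborel)"
    by (rule nn_integral_suminf) (auto simp: A_def borel_prod[symmetric])
  also have "\<dots> = (\<Sum>j. ennreal (w j * (2 * \<rho> * (unit_ball_vol 3 * r j ^ 3))))"
  proof (rule suminf_cong)
    fix j
    have "emeasure (lborel :: spacetime measure) (A j) = ennreal (2*\<rho>) * ennreal (unit_ball_vol 3 * r j ^ 3)"
      unfolding lborel_prod[symmetric] A_def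
      by (subst lborel.emeasure_pair_measure_Times) (use \<rho> rp[of j] in \<open>auto simp: emeasure_cball less_imp_le\<close>)
    also have "\<dots> = ennreal (2 * \<rho> * (unit_ball_vol 3 * r j ^ 3))"
      using \<rho> rp[of j] by (subst ennreal_mult) (auto simp: less_imp_le)
    finally show "(\<integral>\<^sup>+z. ennreal (w j) * indicator (A j) z \<partial>lborel) = ennreal (w j * (2 * \<rho> * (unit_ball_vol 3 * r j ^ 3)))"
      using \<rho> rp[of j]
      by (subst nn_integral_cmult_indicator)
         (auto simp: A_def borel_prod[symmetric] ennreal_mult[symmetric] w_def less_imp_le)
  qed
  also have "\<dots> < \<infinity>"
  proof -
    define q where "q = (2::real) powr (a - 3)"
    have q: "0 \<le> q" "q < 1" unfolding q_def using a powr_less_mono[of "a - 3" 0 2] by auto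
    have half: "(1/2::real) ^ j = 2 powr (- real j)" for j
      by (simp add: powr_minus powr_realpow power_one_over inverse_eq_divide)
    have "w j * (2 * \<rho> * (unit_ball_vol 3 * r j ^ 3)) = ((\<rho>/2) powr (-a) * 2 * \<rho>^4 * unit_ball_vol 3) * q ^ j" for j
    proof -
      have "w j = (\<rho>/2) powr (-a) * ((1/2)^j) powr (-a)"
        unfolding w_def r_def using \<rho> by (subst powr_mult[symmetric]) (auto simp: field_simps)
      moreover have "((1/2::real)^j) powr (-a) * ((1/2)^j)^3 = q ^ j"
      proof -
        have "((1/2::real)^j) powr (-a) * ((1/2)^j)^3 = 2 powr (a * real j) * 2 powr (- 3 * real j)"
          unfolding half by (simp add: powr_powr powr_power mult.commute)
        also have "\<dots> = q ^ j"
          unfolding q_def by (simp add: powr_add[symmetric] powr_power algebra_simps)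
        finally show ?thesis .
      qed
      ultimately show ?thesis
        by (simp add: r_def power_mult_distrib power4_eq_xxxx power3_eq_cube algebra_simps)
    qed
    hence eq: "(\<lambda>j. w j * (2 * \<rho> * (unit_ball_vol 3 * r j ^ 3))) =
        (\<lambda>j. ((\<rho>/2) powr (-a) * 2 * \<rho>^4 * unit_ball_vol 3) * q ^ j)" by (intro ext)
    have "summable (\<lambda>j. w j * (2 * \<rho> * (unit_ball_vol 3 * r j ^ 3)))"
      unfolding eq using q by (intro summable_mult summable_geometric) simp
    hence "(\<Sum>j. ennreal (w j * (2 * \<rho> * (unit_ball_vol 3 * r j ^ 3)))) \<noteq> top"
      using \<rho> rp by (intro ennreal_suminf_neq_top) (auto simp: w_def less_imp_le)
    thus ?thesis by (simp add: less_top[symmetric])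
  qed
  finally show "(\<integral>\<^sup>+z. ennreal (norm (indicator (cball 0 \<rho>) z * norm (snd (z::spacetime)) powr (- a))) \<partial>lborel) < \<infinity>" .
next
  have [measurable]: "(snd :: spacetime \<Rightarrow> real^3) \<in> borel_measurable lborel" by simp
  show "(\<lambda>z::spacetime. indicator (cball 0 \<rho>) z * norm (snd z) powr (- a)) \<in> borel_measurable lborel"
    by (intro borel_measurable_times borel_measurable_indicator) (simp, measurable)
qed

text \<open>Scaling only the time coordinate is an affine map that is diagonal in
  \<open>Basis\<close>. It serves to blow up the layer around \<open>t = 0\<close> and, with factor
  -1, to reflect it.\<close>

lemma lborel_integral_scale_time:
  fixes f :: "spacetime \<Rightarrow> real"
  assumes [measurable]: "f \<in> borel_measurable borel" and c: "c \<noteq> 0"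
  shows "(\<integral>z. f z \<partial>lborel) = \<bar>c\<bar> * (\<integral>z. f (c * fst z, snd z) \<partial>lborel)"
proof -
  define e :: spacetime where "e = (1, 0)"
  have eB: "e \<in> Basis" by (simp add: e_def Basis_prod_def)
  define d where "d j = (if j = e then c else 1)" for j
  have T: "(\<Sum>j\<in>Basis. (d j * (z \<bullet> j)) *\<^sub>R j) = (c * fst z, snd z)" for z :: spacetime
  proof -
    have "(\<Sum>j\<in>Basis. (d j * (z \<bullet> j)) *\<^sub>R j)
       = (\<Sum>j\<in>Basis. (z \<bullet> j) *\<^sub>R j + (if j = e then ((c - 1) * (z \<bullet> j)) *\<^sub>R j else 0))"
      by (intro sum.cong refl) (auto simp: d_def algebra_simps)
    also have "\<dots> = z + ((c - 1) * (z \<bullet> e)) *\<^sub>R e"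
      using eB by (simp add: sum.distrib euclidean_representation)
    finally show ?thesis by (cases z) (simp add: e_def algebra_simps)
  qed
  have P: "(\<Prod>j\<in>Basis. \<bar>d j\<bar>) = \<bar>c\<bar>"
    using eB by (simp add: d_def if_distrib[of abs] prod.delta cong: if_cong)
  have Tm[measurable]: "(\<lambda>z::spacetime. (c * fst z, snd z)) \<in> borel_measurable borel"
    by (intro borel_measurable_continuous_onI continuous_intros)
  have "lborel = density (distr lborel borel (\<lambda>z. 0 + (\<Sum>j\<in>Basis. (d j * (z \<bullet> j)) *\<^sub>R j)))
      (\<lambda>_. (\<Prod>j\<in>(Basis::spacetime set). \<bar>d j\<bar>))"
    by (rule lborel_affine_euclidean) (use c in \<open>auto simp: d_def\<close>)
  hence eq: "lborel = density (distr lborel borel (\<lambda>z::spacetime. (c * fst z, snd z))) (\<lambda>_. ennreal \<bar>c\<bar>)"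
    unfolding T P by simp
  have "(\<integral>z. f z \<partial>lborel) = (\<integral>z. \<bar>c\<bar> *\<^sub>R f z \<partial>distr lborel borel (\<lambda>z::spacetime. (c * fst z, snd z)))"
    by (subst eq, subst integral_density) auto
  also have "\<dots> = \<bar>c\<bar> * (\<integral>z. f (c * fst z, snd z) \<partial>lborel)"
    by (subst integral_distr) auto
  finally show ?thesis .
qed

lemma has_derivative_pos_part_square:
  "((\<lambda>y::real. (max 0 y)\<^sup>2) has_real_derivative 2 * max 0 y) (at y)"
proof -
  consider "y < 0" | "y = 0" | "y > 0" by linarith
  thus ?thesis
  proof cases
    case 1
    have "((\<lambda>y::real. 0) has_real_derivative 0) (at y)" by simp
    hence "((\<lambda>y::real. (max 0 y)\<^sup>2) has_real_derivative 0) (at y)"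
      by (rule has_field_derivative_transform_within_open[where S="{..<0}"]) (use 1 in auto)
    thus ?thesis using 1 by simp
  next
    case 2
    have "((\<lambda>h::real. (max 0 h)\<^sup>2 / h) \<longlongrightarrow> 0) (at 0)"
    proof (rule Lim_null_comparison)
      show "\<forall>\<^sub>F h in at 0. norm ((max 0 h)\<^sup>2 / h) \<le> \<bar>h\<bar>"
        by (intro always_eventually) (auto simp: max_def power2_eq_square)
      show "((\<lambda>h::real. \<bar>h\<bar>) \<longlongrightarrow> 0) (at 0)" by (auto intro!: tendsto_eq_intros)
    qed
    thus ?thesis using 2 by (simp add: has_field_derivative_iff)
  next
    case 3
    have "((\<lambda>y::real. y\<^sup>2) has_real_derivative 2 * y) (at y)" by (auto intro!: derivative_eq_intros)
    hence "((\<lambda>y::real. (max 0 y)\<^sup>2) has_real_derivative 2 * y) (at y)"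
      by (rule has_field_derivative_transform_within_open[where S="{0<..}"]) (use 3 in auto)
    thus ?thesis using 3 by simp
  qed
qed

text \<open>The cutoff is differentiated only once, so a quadratic spline composed with the even
  function \<open>s\<^sup>2 - 1\<close> is smooth enough; evenness makes the derivative odd.\<close>

lemma ex_cutoff:
  "\<exists>\<psi> \<psi>' :: real \<Rightarrow> real. (\<forall>s. (\<psi> has_real_derivative \<psi>' s) (at s)) \<and> continuous_on UNIV \<psi>' \<and>
     (\<forall>s. \<bar>s\<bar> \<le> 1 \<longrightarrow> \<psi> s = 0) \<and> (\<forall>s. \<bar>s\<bar> \<le> 1 \<longrightarrow> \<psi>' s = 0) \<and>
     (\<forall>s. \<bar>s\<bar> \<ge> 2 \<longrightarrow> \<psi> s = 1) \<and> (\<forall>s. \<bar>s\<bar> \<ge> 2 \<longrightarrow> \<psi>' s = 0) \<and> (\<forall>s. \<psi>' (- s) = - \<psi>' s) \<and>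
     (\<exists>B. \<forall>s. \<bar>\<psi> s\<bar> \<le> B \<and> \<bar>\<psi>' s\<bar> \<le> B)"
proof -
  \<comment> \<open>A quadratic spline that is 0 for \<open>y \<le> 0\<close> and 1 for
    \<open>y \<ge> 1\<close>: in the latter range the three squares add up to a constant.\<close>
  define g :: "real \<Rightarrow> real" where "g y = 2 * (max 0 y)\<^sup>2 - 4 * (max 0 (y - 1/2))\<^sup>2 + 2 * (max 0 (y - 1))\<^sup>2" for y
  define g' :: "real \<Rightarrow> real" where "g' y = 4 * max 0 y - 8 * max 0 (y - 1/2) + 4 * max 0 (y - 1)" for y
  have sh: "((\<lambda>y::real. (max 0 (y - c))\<^sup>2) has_real_derivative 2 * max 0 (y - c)) (at y)" for c y
    using DERIV_chain2[where f="\<lambda>y. (max 0 y)\<^sup>2" and g="\<lambda>y. y - c", OF has_derivative_pos_part_square, of 1 y]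
    by (simp add: DERIV_cdivide DERIV_diff[OF DERIV_ident DERIV_const, simplified])
  have dg: "(g has_real_derivative g' y) (at y)" for y
    unfolding g_def g'_def
    by (rule derivative_eq_intros has_derivative_pos_part_square sh refl | simp)+
  define \<psi> where "\<psi> s = g (s\<^sup>2 - 1)" for s
  define \<psi>' where "\<psi>' s = g' (s\<^sup>2 - 1) * (2 * s)" for s
  have d: "(\<psi> has_real_derivative \<psi>' s) (at s)" for s
    unfolding \<psi>_def \<psi>'_def by (rule DERIV_chain2[OF dg]) (auto intro!: derivative_eq_intros)
  have c': "continuous_on UNIV \<psi>'" unfolding \<psi>'_def g'_def by (intro continuous_intros)
  have c: "continuous_on UNIV \<psi>" using d by (intro DERIV_continuous_on) (auto intro: has_field_derivative_at_within)
  have sq: "s\<^sup>2 \<le> 1" if "\<bar>s\<bar> \<le> 1" for s :: real using that by (simp add: abs_square_le_1)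
  have sq2: "s\<^sup>2 \<ge> 4" if "\<bar>s\<bar> \<ge> 2" for s :: real using that power_mono[of 2 "\<bar>s\<bar>" 2] by simp
  have z: "\<psi> s = 0" "\<psi>' s = 0" if "\<bar>s\<bar> \<le> 1" for s
    using sq[OF that] by (auto simp: \<psi>_def \<psi>'_def g_def g'_def max_def)
  have o: "\<psi> s = 1" "\<psi>' s = 0" if "\<bar>s\<bar> \<ge> 2" for s
    using sq2[OF that] by (auto simp: \<psi>_def \<psi>'_def g_def g'_def max_def power2_eq_square algebra_simps)
  have "compact (\<psi> ` {-2..2})" "compact (\<psi>' ` {-2..2})"
    by (auto intro!: compact_continuous_image continuous_on_subset[OF c] continuous_on_subset[OF c'])
  hence "bounded (\<psi> ` {-2..2})" "bounded (\<psi>' ` {-2..2})" by (auto intro: compact_imp_bounded)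
  then obtain B1 B2 where B: "\<And>s. s \<in> {-2..2} \<Longrightarrow> \<bar>\<psi> s\<bar> \<le> B1" "\<And>s. s \<in> {-2..2} \<Longrightarrow> \<bar>\<psi>' s\<bar> \<le> B2"
    unfolding bounded_iff by (auto simp del: atLeastAtMost_iff)
  have "\<bar>\<psi> s\<bar> \<le> max 1 (max B1 B2) \<and> \<bar>\<psi>' s\<bar> \<le> max 1 (max B1 B2)" for s
  proof (cases "\<bar>s\<bar> \<ge> 2")
    case True thus ?thesis using o[of s] by auto
  next
    case False
    hence "s \<in> {-2..2}" by auto
    from B[OF this] show ?thesis by linarith
  qed
  moreover have "\<psi>' (- s) = - \<psi>' s" for s by (simp add: \<psi>'_def)
  ultimately show ?thesis using d c' z o by blast
qed

section \<open>Conservation laws with an exceptional set\<close>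

text \<open>The bound on the derivative is uniform on the part of a compact set outside
  \<open>S\<close>, hence right up to the axis and the sonic surfaces; the mean value inequality
  along lines needs this. Compact sets stay away from \<open>t = 0\<close> because the cutoff in
  time does.\<close>

definition tame :: "spacetime set \<Rightarrow> (spacetime \<Rightarrow> real) \<Rightarrow> bool" where
  "tame S f \<longleftrightarrow> continuous_on {z. fst z \<noteq> 0} f \<and>
     (\<forall>T. compact T \<longrightarrow> T \<subseteq> {z. fst z \<noteq> 0} \<longrightarrow>
        (\<exists>M. \<forall>z\<in>T - S. \<exists>f'. (f has_derivative f') (at z) \<and> (\<forall>v. \<bar>f' v\<bar> \<le> M * norm v)))"

lemma test_function_facts:
  assumes "test_function \<phi>"
  shows "continuous_on UNIV \<phi>" "(\<phi> has_derivative frechet_derivative \<phi> (at z)) (at z)"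
    "continuous_on UNIV (\<lambda>z. frechet_derivative \<phi> (at z) e)"
    "\<exists>r>0. \<forall>z. z \<notin> cball 0 r \<longrightarrow> \<phi> z = 0 \<and> frechet_derivative \<phi> (at z) = (\<lambda>_. 0)"
    "\<exists>B. \<forall>z. \<bar>\<phi> z\<bar> \<le> B" "\<exists>B. \<forall>z. \<bar>frechet_derivative \<phi> (at z) e\<bar> \<le> B"
proof -
  have ck: "Ck 0 \<phi>" "Ck (Suc 0) \<phi>" using assms unfolding test_function_def by blast+
  show c: "continuous_on UNIV \<phi>" using ck(1) by simp
  show d: "(\<phi> has_derivative frechet_derivative \<phi> (at z)) (at z)" for z
  proof -
    have "\<phi> differentiable (at z)" using ck(2) unfolding Ck.simps by blast
    thus ?thesis by (simp add: frechet_derivative_works)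
  qed
  show dc: "continuous_on UNIV (\<lambda>z. frechet_derivative \<phi> (at z) e)" for e
    using ck(2) unfolding Ck.simps by blast
  have "bounded (closure {z. \<phi> z \<noteq> 0})"
    using assms by (auto simp: test_function_def intro: compact_imp_bounded)
  then obtain r where r: "r > 0" "closure {z. \<phi> z \<noteq> 0} \<subseteq> cball 0 r"
    using bounded_subset_ballD[of "closure {z. \<phi> z \<noteq> 0}" 0] ball_subset_cball[of 0] by blast
  have z: "\<phi> z = 0 \<and> frechet_derivative \<phi> (at z) = (\<lambda>_. 0)" if "z \<notin> cball 0 r" for z
  proof
    have nz: "\<phi> y = 0" if "y \<notin> cball 0 r" for y
      using r(2) closure_subset[of "{z. \<phi> z \<noteq> 0}"] that by auto
    show "\<phi> z = 0" using nz that by blast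
    have "((\<lambda>_. 0) has_derivative (\<lambda>_. 0)) (at z)" by simp
    hence "(\<phi> has_derivative (\<lambda>_. 0)) (at z)"
      by (rule has_derivative_transform_within_open[of _ _ _ _ "- cball 0 r"]) (use that nz in auto)
    thus "frechet_derivative \<phi> (at z) = (\<lambda>_. 0)" using frechet_derivative_at by metis
  qed
  show "\<exists>r>0. \<forall>z. z \<notin> cball 0 r \<longrightarrow> \<phi> z = 0 \<and> frechet_derivative \<phi> (at z) = (\<lambda>_. 0)"
    using r z by blast
  have bdd: "\<exists>B. \<forall>z. \<bar>g z\<bar> \<le> B" if "continuous_on UNIV g" "\<And>z. z \<notin> cball 0 r \<Longrightarrow> g z = 0" for g :: "spacetime \<Rightarrow> real"
  proof -
    have "bounded (g ` cball 0 r)"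
      by (intro compact_imp_bounded compact_continuous_image continuous_on_subset[OF that(1)]) auto
    then obtain B where B: "\<forall>y\<in>g ` cball 0 r. norm y \<le> B" unfolding bounded_iff by blast
    have "\<bar>g z\<bar> \<le> max B 0" for z
    proof (cases "z \<in> cball 0 r")
      case True
      hence "norm (g z) \<le> B" using B by blast
      thus ?thesis by simp
    next
      case False
      thus ?thesis using that(2) by simp
    qed
    thus ?thesis by blast
  qed
  show "\<exists>B. \<forall>z. \<bar>\<phi> z\<bar> \<le> B" by (rule bdd[OF c]) (use z in blast)
  show "\<exists>B. \<forall>z. \<bar>frechet_derivative \<phi> (at z) e\<bar> \<le> B" by (rule bdd[OF dc]) (use z in simp)
qed

lemma borel_measurable_off_origin:
  fixes f :: "spacetime \<Rightarrow> 'b::euclidean_space"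
  assumes "continuous_off_origin f"
  shows "f \<in> borel_measurable borel"
proof -
  have "(\<lambda>z. indicator (- {(0,0)}) z *\<^sub>R f z) \<in> borel_measurable borel"
    using assms unfolding continuous_off_origin_def
    by (intro borel_measurable_continuous_on_indicator) auto
  moreover have "(\<lambda>z::spacetime. indicator {(0,0)} z *\<^sub>R f (0,0)) \<in> borel_measurable borel"
    by (intro borel_measurable_scaleR borel_measurable_indicator borel_measurable_const borel_closed closed_singleton)
  ultimately have "(\<lambda>z. indicator (- {(0,0)}) z *\<^sub>R f z + indicator {(0,0)} z *\<^sub>R f (0,0)) \<in> borel_measurable borel"
    by (rule borel_measurable_add)
  also have "(\<lambda>z. indicator (- {(0,0)}) z *\<^sub>R f z + indicator {(0,0)} z *\<^sub>R f (0,0)) = f"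
    by (auto simp: fun_eq_iff indicator_def)
  finally show ?thesis .
qed

lemma integrable_singular_bound:
  fixes f :: "spacetime \<Rightarrow> 'b::euclidean_space"
  assumes "f \<in> borel_measurable borel" "0 \<le> a" "a < 3" "\<rho> > 0"
    and "\<And>z. z \<in> cball 0 \<rho> \<Longrightarrow> snd z \<noteq> 0 \<Longrightarrow> norm (f z) \<le> K * norm (snd z) powr (- a)"
    and "\<And>z. z \<notin> cball 0 \<rho> \<Longrightarrow> f z = 0"
  shows "integrable lborel f"
proof (rule Bochner_Integration.integrable_bound)
  show "integrable lborel (\<lambda>z::spacetime. K * (indicator (cball 0 \<rho>) z * norm (snd z) powr (- a)))"
    by (intro integrable_mult_right integrable_norm_snd_powr assms)
  show "AE z in lborel. norm (f z) \<le> norm (K * (indicator (cball 0 \<rho>) z * norm (snd z) powr (- a)))"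
    using AE_snd_neq_0
  proof eventually_elim
    case (elim z)
    show ?case
    proof (cases "z \<in> cball 0 \<rho>")
      case True
      thus ?thesis using assms(5)[OF True elim] by simp
    next
      case False
      thus ?thesis using assms(6) by simp
    qed
  qed
qed (use assms(1) in simp)

lemma locally_integrable_singular:
  fixes f :: "spacetime \<Rightarrow> 'b::euclidean_space"
  assumes "continuous_off_origin f" and a: "0 \<le> a" "a < 3"
    and bd: "\<And>\<rho>. \<exists>K. \<forall>z\<in>cball 0 \<rho>. snd z \<noteq> 0 \<longrightarrow> norm (f z) \<le> K * norm (snd z) powr (- a)"
  shows "locally_integrable f"
  unfolding locally_integrable_def set_integrable_def
proof (intro allI impI)
  fix T :: "spacetime set" assume T: "compact T"
  obtain \<rho> where \<rho>: "\<rho> > 0" "T \<subseteq> cball 0 \<rho>"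
    using bounded_subset_ballD[OF compact_imp_bounded[OF T], of 0] ball_subset_cball[of 0] by blast
  obtain K where K: "\<And>z. z \<in> cball 0 \<rho> \<Longrightarrow> snd z \<noteq> 0 \<Longrightarrow> norm (f z) \<le> K * norm (snd z) powr (- a)"
    using bd[of \<rho>] by blast
  show "integrable lborel (\<lambda>z. indicat_real T z *\<^sub>R f z)"
  proof (rule integrable_singular_bound[OF _ a \<rho>(1)])
    show "(\<lambda>z. indicat_real T z *\<^sub>R f z) \<in> borel_measurable borel"
      using T by (intro borel_measurable_scaleR borel_measurable_indicator borel_measurable_off_origin assms(1))
        (auto intro: borel_closed compact_imp_closed)
    fix z :: spacetime
    assume z: "z \<in> cball 0 \<rho>" "snd z \<noteq> 0"
    have "norm (indicat_real T z *\<^sub>R f z) \<le> norm (f z)" by (simp add: indicator_def)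
    thus "norm (indicat_real T z *\<^sub>R f z) \<le> K * norm (snd z) powr (- a)" using K[OF z] by linarith
  qed (use \<rho> in \<open>auto simp: indicator_def\<close>)
qed

text \<open>The cutoff \<open>\<chi> (t / \<delta>)\<close> removes the time slice through the singularity; its derivative is odd in
  \<open>t\<close>, so the error term vanishes in the limit because \<open>w \<phi>\<close> is continuous across \<open>t = 0\<close> off the origin.\<close>

lemma weak_conservation_lawI:
  fixes w :: "spacetime \<Rightarrow> real" and F :: "spacetime \<Rightarrow> real^3"
  assumes w: "tame S w" "continuous_off_origin w"
    and F: "\<And>i. tame S (\<lambda>z. F z $ i)" "continuous_off_origin F"
    and S0: "\<And>z. fst z = 0 \<Longrightarrow> z \<in> S"
    and null: "AE z in lborel. z \<notin> S"
    and lines: "AE z in lborel. finite {s. z + s *\<^sub>R (1, 0) \<in> S}"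
      "\<And>i. AE z in lborel. finite {s. z + s *\<^sub>R (0, axis i 1) \<in> S}"
    and div: "\<And>z w' F'. z \<notin> S \<Longrightarrow> (w has_derivative w') (at z) \<Longrightarrow>
        (\<And>i. ((\<lambda>z. F z $ i) has_derivative F' i) (at z)) \<Longrightarrow>
        w' (1, 0) + (\<Sum>i\<in>UNIV. F' i (0, axis i 1)) = 0"
    and a: "0 \<le> a" "a < 3"
    and bd: "\<And>\<rho>. \<exists>K. \<forall>z\<in>cball 0 \<rho>. snd z \<noteq> 0 \<longrightarrow> norm (w z) \<le> K * norm (snd z) powr (- a)"
      "\<And>\<rho>. \<exists>K. \<forall>z\<in>cball 0 \<rho>. snd z \<noteq> 0 \<longrightarrow> norm (F z) \<le> K * norm (snd z) powr (- a)"
  shows "weak_conservation_law w F"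
  unfolding weak_conservation_law_def
proof (intro conjI allI impI)
  show "locally_integrable w" by (rule locally_integrable_singular[OF w(2) a bd(1)])
  show "locally_integrable F" by (rule locally_integrable_singular[OF F(2) a bd(2)])
  fix \<phi> assume \<phi>: "test_function \<phi>"
  note tf = test_function_facts[OF \<phi>]
  define D where "D z = frechet_derivative \<phi> (at z)" for z
  obtain r where r: "r > 0" and \<phi>0: "\<And>z. z \<notin> cball 0 r \<Longrightarrow> \<phi> z = 0"
    and D0: "\<And>z. z \<notin> cball 0 r \<Longrightarrow> D z = (\<lambda>_. 0)" using tf(4) unfolding D_def by blast
  obtain \<psi> \<psi>' :: "real \<Rightarrow> real" and B\<psi> where \<psi>d: "\<And>s. (\<psi> has_real_derivative \<psi>' s) (at s)"
    and \<psi>'c: "continuous_on UNIV \<psi>'" and \<psi>z: "\<And>s. \<bar>s\<bar> \<le> 1 \<Longrightarrow> \<psi> s = 0" "\<And>s. \<bar>s\<bar> \<le> 1 \<Longrightarrow> \<psi>' s = 0"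
    and \<psi>o: "\<And>s. \<bar>s\<bar> \<ge> 2 \<Longrightarrow> \<psi> s = 1" "\<And>s. \<bar>s\<bar> \<ge> 2 \<Longrightarrow> \<psi>' s = 0"
    and odd: "\<And>s. \<psi>' (- s) = - \<psi>' s" and \<psi>B: "\<And>s. \<bar>\<psi> s\<bar> \<le> B\<psi>" "\<And>s. \<bar>\<psi>' s\<bar> \<le> B\<psi>"
    using ex_cutoff by blast
  have B\<psi>0: "B\<psi> \<ge> 0" using \<psi>B(1)[of 0] by linarith
  have \<psi>c: "continuous_on UNIV \<psi>" using \<psi>d by (meson DERIV_isCont continuous_at_imp_continuous_on)
  have wm[measurable]: "w \<in> borel_measurable borel" by (rule borel_measurable_off_origin[OF w(2)])
  have Fm[measurable]: "F \<in> borel_measurable borel" by (rule borel_measurable_off_origin[OF F(2)])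
  have \<phi>m[measurable]: "\<phi> \<in> borel_measurable borel" using tf(1) by (rule borel_measurable_continuous_onI)
  have Dm[measurable]: "(\<lambda>z. D z e) \<in> borel_measurable borel" for e
    using tf(3) unfolding D_def by (rule borel_measurable_continuous_onI)
  have \<psi>m[measurable]: "\<psi> \<in> borel_measurable borel" "\<psi>' \<in> borel_measurable borel"
    using \<psi>c \<psi>'c by (auto intro: borel_measurable_continuous_onI)
  define g where "g z = w z * \<phi> z" for z
  define main where "main z = w z * dt \<phi> z + F z \<bullet> grad_x \<phi> z" for z
  have main: "main z = w z * D z (1, 0) + (\<Sum>i\<in>UNIV. F z $ i * D z (0, axis i 1))" for z
    by (simp add: main_def dt_def grad_x_def inner_vec_def D_def)
  have Fim[measurable]: "(\<lambda>z. F z $ i) \<in> borel_measurable borel" for i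
    by (rule borel_measurable_continuous_on[OF _ Fm]) (intro continuous_intros)
  have gm[measurable]: "g \<in> borel_measurable borel" unfolding g_def by measurable
  have mm[measurable]: "main \<in> borel_measurable borel" unfolding main[abs_def] by measurable
  \<comment> \<open>After rescaling, the layer is \<open>\<bar>fst z\<bar> \<le> 2\<close>,
    \<open>norm (snd z) \<le> r\<close>, which lies in the ball of radius
    \<open>r + 2\<close>.\<close>
  define \<rho> where "\<rho> = r + 2"
  have \<rho>: "\<rho> > 0" "r \<le> \<rho>" using r by (auto simp: \<rho>_def)
  obtain Kw where Kw: "\<And>z. z \<in> cball 0 \<rho> \<Longrightarrow> snd z \<noteq> 0 \<Longrightarrow> \<bar>w z\<bar> \<le> Kw * norm (snd z) powr (- a)"
    using bd(1)[of \<rho>] unfolding real_norm_def by blast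
  obtain KF where KF: "\<And>z. z \<in> cball 0 \<rho> \<Longrightarrow> snd z \<noteq> 0 \<Longrightarrow> norm (F z) \<le> KF * norm (snd z) powr (- a)"
    using bd(2)[of \<rho>] by blast
  obtain B\<phi> where B\<phi>: "\<And>z. \<bar>\<phi> z\<bar> \<le> B\<phi>" using tf(5) by blast
  have "\<forall>e. \<exists>B. \<forall>z. \<bar>D z e\<bar> \<le> B" using tf(6) unfolding D_def by blast
  then obtain BD where BD: "\<And>e z. \<bar>D z e\<bar> \<le> BD e" by metis
  have B\<phi>0: "B\<phi> \<ge> 0" using B\<phi>[of 0] by linarith
  have mul_le: "\<bar>x * y\<bar> \<le> p * q * m" if "\<bar>x\<bar> \<le> p * m" "\<bar>y\<bar> \<le> q" for x y p q m :: real
    using mult_mono[OF that(1) that(2)] that by (simp add: abs_mult ac_simps)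
  have gint_bd: "norm (g z) \<le> Kw * B\<phi> * norm (snd z) powr (- a)" if "z \<in> cball 0 \<rho>" "snd z \<noteq> 0" for z
    unfolding g_def real_norm_def by (rule mul_le[OF Kw[OF that] B\<phi>])
  have main_bd: "norm (main z) \<le> (Kw * BD (1,0) + (\<Sum>i\<in>UNIV. KF * BD (0, axis i 1))) * norm (snd z) powr (- a)"
    if z: "z \<in> cball 0 \<rho>" "snd z \<noteq> 0" for z
  proof -
    have "\<bar>F z $ i * D z (0, axis i 1)\<bar> \<le> KF * BD (0, axis i 1) * norm (snd z) powr (- a)" for i
      by (rule mul_le[OF order_trans[OF component_le_norm_cart KF[OF z]] BD])
    hence "\<bar>\<Sum>i\<in>UNIV. F z $ i * D z (0, axis i 1)\<bar> \<le> (\<Sum>i\<in>UNIV. KF * BD (0, axis i 1) * norm (snd z) powr (- a))"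
      by (intro order_trans[OF sum_abs] sum_mono)
    moreover have "\<bar>w z * D z (1,0)\<bar> \<le> Kw * BD (1,0) * norm (snd z) powr (- a)"
      by (rule mul_le[OF Kw[OF z] BD])
    ultimately show ?thesis
      unfolding main real_norm_def by (simp only: distrib_right sum_distrib_right)
  qed
  have out: "\<phi> z = 0" "D z = (\<lambda>_. 0)" if "z \<notin> cball 0 \<rho>" for z
    using that \<rho> \<phi>0[of z] D0[of z] by auto
  have main_int: "integrable lborel main"
    by (rule integrable_singular_bound[OF mm a \<rho>(1) main_bd]) (use out in \<open>auto simp: main\<close>)
  define \<delta> where "\<delta> n = inverse (real (Suc n))" for n
  have \<delta>: "\<delta> n > 0" "\<delta> n \<le> 1" for n by (auto simp: \<delta>_def field_simps)
  have \<delta>0: "\<delta> \<longlonglongrightarrow> 0" unfolding \<delta>_def by (rule LIMSEQ_inverse_real_of_nat)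
  \<comment> \<open>On the compact set \<open>T\<close> the fields, and off \<open>S\<close> their
    derivatives, are bounded. Outside \<open>T\<close> either the test function or the cutoff
    vanishes together with its derivative, so the products satisfy the hypotheses of the integral
    lemma.\<close>
  have id: "(\<integral>z. \<psi> (fst z / \<delta> n) * main z + g z * (\<psi>' (fst z / \<delta> n) / \<delta> n) \<partial>lborel) = 0" for n
  proof -
    define T where "T = cball 0 r \<inter> {z::spacetime. \<bar>fst z\<bar> \<ge> \<delta> n}"
    have Tc: "compact T" unfolding T_def
      by (intro compact_Int_closed closed_Collect_le continuous_intros) auto
    have Tn: "T \<subseteq> {z. fst z \<noteq> 0}" using \<delta>[of n] by (auto simp: T_def)
    have kill: "\<phi> z = 0 \<and> D z = (\<lambda>_. 0) \<or> \<psi> (fst z / \<delta> n) = 0 \<and> \<psi>' (fst z / \<delta> n) = 0" if "z \<notin> T" for z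
    proof (cases "z \<in> cball 0 r")
      case True
      hence "\<bar>fst z\<bar> < \<delta> n" using that by (auto simp: T_def)
      hence "\<bar>fst z / \<delta> n\<bar> \<le> 1" using \<delta>[of n] by simp
      thus ?thesis using \<psi>z by blast
    next
      case False
      thus ?thesis using \<phi>0 D0 by blast
    qed
    \<comment> \<open>The density and the three flux components are treated as one family,
      \<open>None\<close> standing for time and \<open>Some i\<close> for the space
      directions.\<close>
    define f where "f j z = (case j of None \<Rightarrow> w z | Some i \<Rightarrow> F z $ i)" for j :: "3 option" and z
    define e :: "3 option \<Rightarrow> spacetime" where "e j = (case j of None \<Rightarrow> (1, 0) | Some i \<Rightarrow> (0, axis i 1))" for j
    have f_simps: "f None = w" "\<And>i. f (Some i) = (\<lambda>z. F z $ i)" by (auto simp: f_def)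
    have ft: "tame S (f j)" for j using w(1) F(1) by (cases j) (simp_all add: f_simps)
    define h where "h j z = f j z * (\<phi> z * \<psi> (fst z / \<delta> n))" for j z
    have "\<forall>j. \<exists>M. \<forall>z\<in>T - S. \<exists>f'. (f j has_derivative f') (at z) \<and> (\<forall>v. \<bar>f' v\<bar> \<le> M * norm v)"
      using ft Tc Tn unfolding tame_def by blast
    then obtain M where M: "\<And>j z. z \<in> T - S \<Longrightarrow> \<exists>f'. (f j has_derivative f') (at z) \<and> (\<forall>v. \<bar>f' v\<bar> \<le> M j * norm v)"
      by metis
    have dif: "\<exists>f'. (f j has_derivative f') (at z)" if "z \<notin> S" for j z
    proof -
      have "fst z \<noteq> 0" using S0 that by blast
      hence "compact {z}" "{z} \<subseteq> {z. fst z \<noteq> 0}" by auto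
      thus ?thesis using ft[of j] that unfolding tame_def by blast
    qed
    define f' where "f' j z = frechet_derivative (f j) (at z)" for j z
    have fd: "(f j has_derivative f' j z) (at z)" if "z \<notin> S" for j z
      using dif[OF that] unfolding f'_def by (metis frechet_derivative_at)
    have fb: "\<bar>f' j z v\<bar> \<le> M j * norm v" if "z \<in> T - S" for j z v
      using M[OF that, of j] fd[of z j] that has_derivative_unique by blast
    have fcT: "continuous_on T (f j)" for j
      using ft[of j] Tn unfolding tame_def by (auto intro: continuous_on_subset)
    have "\<forall>j. \<exists>N. \<forall>z\<in>T. \<bar>f j z\<bar> \<le> N"
    proof
      fix j
      have "bounded (f j ` T)" by (intro compact_imp_bounded compact_continuous_image fcT Tc)
      thus "\<exists>N. \<forall>z\<in>T. \<bar>f j z\<bar> \<le> N" unfolding bounded_iff by auto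
    qed
    then obtain N where N: "\<And>j z. z \<in> T \<Longrightarrow> \<bar>f j z\<bar> \<le> N j" by metis
    define h' where "h' j z v = f' j z v * (\<phi> z * \<psi> (fst z / \<delta> n))
        + f j z * (D z v * \<psi> (fst z / \<delta> n) + \<phi> z * (\<psi>' (fst z / \<delta> n) * (fst v / \<delta> n)))" for j z v
    define Kj where "Kj j = M j * norm (e j) * (B\<phi> * B\<psi>) + N j * (BD (e j) * B\<psi> + B\<phi> * (B\<psi> * (norm (e j) / \<delta> n)))" for j
    have \<psi>der: "((\<lambda>z::spacetime. \<psi> (fst z / \<delta> n)) has_derivative (\<lambda>v. \<psi>' (fst z / \<delta> n) * (fst v / \<delta> n))) (at z)" for z
    proof -
      have "((\<lambda>z::spacetime. fst z / \<delta> n) has_derivative (\<lambda>v. fst v / \<delta> n)) (at z)"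
        using \<delta>[of n] by (auto intro!: derivative_eq_intros)
      from has_derivative_compose[OF this \<psi>d[THEN has_field_derivative_imp_has_derivative]] show ?thesis .
    qed
    have \<phi>der: "(\<phi> has_derivative D z) (at z)" for z using tf(2) unfolding D_def .
    have hder: "(h j has_derivative h' j z) (at z)" if "z \<notin> S" for j z
      unfolding h_def h'_def
      by (rule has_derivative_eq_rhs[OF has_derivative_mult[OF fd[OF that] has_derivative_mult[OF \<phi>der \<psi>der]]])
         (auto simp: fun_eq_iff algebra_simps)
    have hbd: "\<bar>h' j z (e j)\<bar> \<le> \<bar>Kj j\<bar>" if "z \<notin> S" for j z
    proof (cases "z \<in> T")
      case True
      have ab: "\<bar>x * y\<bar> \<le> p * q" if "\<bar>x\<bar> \<le> p" "\<bar>y\<bar> \<le> q" for x y p q :: real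
        using mult_mono[OF that] that by (simp add: abs_mult)
      have ad: "\<bar>x + y\<bar> \<le> p + q" if "\<bar>x\<bar> \<le> p" "\<bar>y\<bar> \<le> q" for x y p q :: real
        using that by linarith
      have fe: "\<bar>fst (e j) / \<delta> n\<bar> \<le> norm (e j) / \<delta> n"
        using \<delta>[of n] norm_fst_le[of "fst (e j)" "snd (e j)"] by (simp add: divide_right_mono)
      have zT: "z \<in> T - S" using True that by blast
      have "\<bar>h' j z (e j)\<bar> \<le> Kj j"
        unfolding h'_def Kj_def by (intro ad ab fb[OF zT] N[OF True] BD B\<phi> \<psi>B fe)
      thus ?thesis by linarith
    next
      case False
      from kill[OF this] have "h' j z (e j) = 0" by (auto simp: h'_def)
      thus ?thesis by simp
    qed
    define G where "G z = \<psi> (fst z / \<delta> n) * main z + g z * (\<psi>' (fst z / \<delta> n) / \<delta> n)" for z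
    show ?thesis unfolding G_def[symmetric]
    proof (rule integral_sum_directional_derivatives_eq_0[where I=UNIV and h=h and h'=h' and e=e and S=S and r=r and K="\<Sum>j\<in>UNIV. \<bar>Kj j\<bar>"])
      show "\<bar>h' j z (e j)\<bar> \<le> (\<Sum>j\<in>UNIV. \<bar>Kj j\<bar>)" if "z \<notin> S" for j z
        using hbd[OF that, of j] member_le_sum[of j UNIV "\<lambda>j. \<bar>Kj j\<bar>"] by simp
      show "continuous_on UNIV (h j)" for j
      proof -
        have "continuous_on {z. fst z \<noteq> 0} (h j)"
          unfolding h_def using ft[of j]
          by (intro continuous_intros continuous_on_subset[OF tf(1)] continuous_on_compose2[OF \<psi>c])
             (use \<delta>[of n] in \<open>auto simp: tame_def\<close>)
        moreover have "continuous_on {z. \<bar>fst z\<bar> < \<delta> n} (h j)"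
        proof -
          have "h j z = 0" if "\<bar>fst z\<bar> < \<delta> n" for z
            using that \<delta>[of n] \<psi>z(1)[of "fst z / \<delta> n"] by (simp add: h_def)
          thus ?thesis by (intro continuous_on_eq[OF continuous_on_const[of _ 0]]) auto
        qed
        moreover have "open {z::spacetime. fst z \<noteq> 0}" "open {z::spacetime. \<bar>fst z\<bar> < \<delta> n}"
          by (intro open_Collect_neq open_Collect_less continuous_intros)+
        ultimately have "continuous_on ({z. fst z \<noteq> 0} \<union> {z. \<bar>fst z\<bar> < \<delta> n}) (h j)"
          by (intro continuous_on_open_Un)
        moreover have "{z. fst z \<noteq> 0} \<union> {z. \<bar>fst z\<bar> < \<delta> n} = (UNIV :: spacetime set)"
          using \<delta>[of n] by auto
        ultimately show ?thesis by simp
      qed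
      show "h j z = 0" if "z \<notin> cball 0 r" for j z using \<phi>0[OF that] by (simp add: h_def)
      show "AE z in lborel. finite {s. z + s *\<^sub>R e j \<in> S}" for j
        using lines by (cases j) (simp_all add: e_def)
      show "G \<in> borel_measurable borel"
        unfolding G_def by measurable
      show "(\<Sum>j\<in>UNIV. h' j z (e j)) = G z" if z: "z \<notin> S" for z
      proof -
        have d0: "f' None z (1,0) + (\<Sum>i\<in>UNIV. f' (Some i) z (0, axis i 1)) = 0"
          using fd[OF z, of None] fd[OF z, of "Some i" for i] by (intro div[OF z]) (simp_all add: f_simps)
        have "(\<Sum>j\<in>UNIV. h' j z (e j)) = h' None z (1,0) + (\<Sum>i\<in>UNIV. h' (Some i) z (0, axis i 1))"
          by (simp add: UNIV_option_conv sum.reindex e_def)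
        also have "\<dots> = (f' None z (1,0) + (\<Sum>i\<in>UNIV. f' (Some i) z (0, axis i 1))) * (\<phi> z * \<psi> (fst z / \<delta> n)) + G z"
          unfolding h'_def G_def main g_def
          by (simp add: f_def sum.distrib sum_distrib_left sum_distrib_right algebra_simps)
        finally show ?thesis using d0 by simp
      qed
    qed (use null hder in \<open>auto intro: sum_nonneg\<close>)
  qed
  have AE0: "AE z::spacetime in lborel. fst z \<noteq> 0" using null by eventually_elim (use S0 in blast)
  have i1: "integrable lborel (\<lambda>z. \<psi> (fst z / \<delta> n) * main z)" for n
    by (rule Bochner_Integration.integrable_bound[OF integrable_mult_right[OF integrable_norm[OF main_int], of B\<psi>]])
       (use \<psi>B B\<psi>0 in \<open>auto simp: abs_mult intro!: mult_right_mono\<close>)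
  have i2: "integrable lborel (\<lambda>z. g z * (\<psi>' (fst z / \<delta> n) / \<delta> n))" for n
  proof (rule integrable_singular_bound[OF _ a \<rho>(1)])
    show "norm (g z * (\<psi>' (fst z / \<delta> n) / \<delta> n)) \<le> Kw * B\<phi> * (B\<psi> / \<delta> n) * norm (snd z) powr (- a)"
      if "z \<in> cball 0 \<rho>" "snd z \<noteq> 0" for z
      unfolding real_norm_def
      by (rule mul_le) (use gint_bd[OF that] \<psi>B(2)[of "fst z / \<delta> n"] \<delta>[of n] in \<open>auto intro: divide_right_mono\<close>)
    show "g z * (\<psi>' (fst z / \<delta> n) / \<delta> n) = 0" if "z \<notin> cball 0 \<rho>" for z
      using out[OF that] by (simp add: g_def)
  qed measurable
  have l1: "(\<lambda>n. \<integral>z. \<psi> (fst z / \<delta> n) * main z \<partial>lborel) \<longlonglongrightarrow> (\<integral>z. main z \<partial>lborel)"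
  proof (rule integral_dominated_convergence[where w="\<lambda>z. B\<psi> * norm (main z)"])
    show "AE z in lborel. (\<lambda>n. \<psi> (fst z / \<delta> n) * main z) \<longlonglongrightarrow> main z"
      using AE0
    proof eventually_elim
      case (elim z)
      have "eventually (\<lambda>n. \<delta> n < \<bar>fst z\<bar> / 2) sequentially"
        using order_tendstoD(2)[OF \<delta>0, of "\<bar>fst z\<bar> / 2"] elim by simp
      hence "eventually (\<lambda>n. \<psi> (fst z / \<delta> n) * main z = main z) sequentially"
      proof eventually_elim
        case (elim n)
        hence "\<bar>fst z / \<delta> n\<bar> \<ge> 2" using \<delta>[of n] by (simp add: pos_le_divide_eq)
        thus ?case using \<psi>o(1) by simp
      qed
      thus ?case by (rule tendsto_eventually)
    qed
    show "AE z in lborel. norm (\<psi> (fst z / \<delta> n) * main z) \<le> B\<psi> * norm (main z)" for n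
      using \<psi>B(1) by (auto simp: abs_mult intro!: mult_right_mono)
  qed (use main_int in auto)
  have l2: "(\<lambda>n. \<integral>z. g z * (\<psi>' (fst z / \<delta> n) / \<delta> n) \<partial>lborel) \<longlonglongrightarrow> 0"
  proof -
    \<comment> \<open>Rescaling time turns the shrinking layer into a fixed one and cancels the
      factor \<open>1 / \<delta> n\<close>. The singular bound depends on \<open>snd z\<close> alone
      and is therefore unchanged, so it dominates uniformly in \<open>n\<close>.\<close>
    define Q where "Q n z = g (\<delta> n * fst z, snd z) * \<psi>' (fst z)" for n and z :: spacetime
    define Q0 where "Q0 z = g (0, snd z) * \<psi>' (fst z)" for z :: spacetime
    have cm[measurable]: "(\<lambda>z::spacetime. (c * fst z, snd z)) \<in> borel_measurable borel" for c
      by (intro borel_measurable_continuous_onI continuous_intros)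
    have c0[measurable]: "(\<lambda>z::spacetime. (0::real, snd z)) \<in> borel_measurable borel"
      by (intro borel_measurable_continuous_onI continuous_intros)
    have [measurable]: "Q n \<in> borel_measurable borel" "Q0 \<in> borel_measurable borel" for n
      unfolding Q_def[abs_def] Q0_def[abs_def] by measurable
    have sc: "(\<integral>z. g z * (\<psi>' (fst z / \<delta> n) / \<delta> n) \<partial>lborel) = (\<integral>z. Q n z \<partial>lborel)" for n
    proof -
      have "(\<integral>z. g z * (\<psi>' (fst z / \<delta> n) / \<delta> n) \<partial>lborel)
         = \<bar>\<delta> n\<bar> * (\<integral>z. g (\<delta> n * fst z, snd z) * (\<psi>' (\<delta> n * fst z / \<delta> n) / \<delta> n) \<partial>lborel)"
        using \<delta>[of n] by (subst lborel_integral_scale_time[of _ "\<delta> n"]) auto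
      also have "\<dots> = (\<integral>z. \<bar>\<delta> n\<bar> * (g (\<delta> n * fst z, snd z) * (\<psi>' (\<delta> n * fst z / \<delta> n) / \<delta> n)) \<partial>lborel)"
        by simp
      also have "\<dots> = (\<integral>z. Q n z \<partial>lborel)"
        using \<delta>[of n] by (intro Bochner_Integration.integral_cong) (auto simp: Q_def)
      finally show ?thesis .
    qed
    have Q00: "(\<integral>z. Q0 z \<partial>lborel) = 0"
    proof -
      have "(\<integral>z. Q0 z \<partial>lborel) = (\<integral>z. Q0 (-1 * fst z, snd z) \<partial>lborel)"
        by (subst lborel_integral_scale_time[of _ "-1"]) auto
      also have "\<dots> = - (\<integral>z. Q0 z \<partial>lborel)"
        by (simp add: Q0_def odd)
      finally show ?thesis by simp
    qed
    have "(\<lambda>n. \<integral>z. Q n z \<partial>lborel) \<longlonglongrightarrow> (\<integral>z. Q0 z \<partial>lborel)"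
    proof (rule integral_dominated_convergence[where w="\<lambda>z. Kw * B\<phi> * B\<psi> * (indicator (cball 0 \<rho>) z * norm (snd z) powr (- a))"])
      show "integrable lborel (\<lambda>z::spacetime. Kw * B\<phi> * B\<psi> * (indicator (cball 0 \<rho>) z * norm (snd z) powr (- a)))"
        by (intro integrable_mult_right integrable_norm_snd_powr a \<rho>)
      show "AE z in lborel. (\<lambda>n. Q n z) \<longlonglongrightarrow> Q0 z"
        using AE_snd_neq_0
      proof eventually_elim
        case (elim z)
        have "continuous_on (- {(0,0)}) g"
          unfolding g_def using w(2) by (intro continuous_intros continuous_on_subset[OF tf(1)]) (auto simp: continuous_off_origin_def)
        hence "isCont g (0, snd z)"
          by (rule continuous_on_interior) (use elim in \<open>auto simp: interior_open open_Compl\<close>)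
        moreover have "(\<lambda>n. (\<delta> n * fst z, snd z)) \<longlonglongrightarrow> (0, snd z)"
          using tendsto_mult[OF \<delta>0 tendsto_const[of "fst z"]] by (intro tendsto_Pair) auto
        ultimately have "(\<lambda>n. g (\<delta> n * fst z, snd z)) \<longlonglongrightarrow> g (0, snd z)"
          by (rule isCont_tendsto_compose)
        thus ?case unfolding Q_def Q0_def by (intro tendsto_mult tendsto_const)
      qed
      show "AE z in lborel. norm (Q n z) \<le> Kw * B\<phi> * B\<psi> * (indicator (cball 0 \<rho>) z * norm (snd z) powr (- a))" for n
        using AE_snd_neq_0
      proof eventually_elim
        case (elim z)
        show ?case
        proof (cases "\<bar>fst z\<bar> \<le> 2 \<and> norm (snd z) \<le> r")
          case True
          have nle: "norm p \<le> \<bar>fst p\<bar> + norm (snd p)" for p :: spacetime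
            using norm_Pair_le[of "fst p" "snd p"] by simp
          have zin: "z \<in> cball 0 \<rho>" using True nle[of z] by (simp add: \<rho>_def)
          have "\<bar>\<delta> n * fst z\<bar> \<le> 1 * 2" unfolding abs_mult using True \<delta>[of n] by (intro mult_mono) auto
          hence "(\<delta> n * fst z, snd z) \<in> cball 0 \<rho>" using True nle[of "(\<delta> n * fst z, snd z)"] by (simp add: \<rho>_def)
          from gint_bd[OF this] elim have "\<bar>g (\<delta> n * fst z, snd z)\<bar> \<le> Kw * B\<phi> * norm (snd z) powr (- a)" by simp
          from mul_le[OF this \<psi>B(2)] zin show ?thesis by (simp add: Q_def)
        next
          case False
          have "Q n z = 0"
          proof (cases "\<bar>fst z\<bar> \<ge> 2")
            case True thus ?thesis using \<psi>o(2) by (simp add: Q_def)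
          next
            case 2: False
            hence "norm (snd z) > r" using False by auto
            hence "(\<delta> n * fst z, snd z) \<notin> cball 0 r"
              using norm_snd_le[of "snd z" "\<delta> n * fst z"] by auto
            thus ?thesis using \<phi>0 by (simp add: Q_def g_def)
          qed
          moreover have "Kw * B\<phi> * B\<psi> * (indicator (cball 0 \<rho>) z * norm (snd z) powr (- a)) \<ge> 0"
          proof (cases "z \<in> cball 0 \<rho>")
            case True
            from gint_bd[OF True elim] have "Kw * B\<phi> * norm (snd z) powr (- a) \<ge> 0"
              using norm_ge_zero order_trans by blast
            hence "Kw * B\<phi> * norm (snd z) powr (- a) * B\<psi> \<ge> 0" using B\<psi>0 by (rule mult_nonneg_nonneg)
            thus ?thesis using True by (simp add: ac_simps)
          qed simp
          ultimately show ?thesis by simp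
        qed
      qed
    qed auto
    thus ?thesis unfolding sc Q00 .
  qed
  have "(\<integral>z. \<psi> (fst z / \<delta> n) * main z \<partial>lborel) + (\<integral>z. g z * (\<psi>' (fst z / \<delta> n) / \<delta> n) \<partial>lborel) = 0" for n
    using id[of n] i1[of n] i2[of n] by simp
  hence "(\<lambda>n. 0) \<longlonglongrightarrow> (\<integral>z. main z \<partial>lborel) + 0"
    using tendsto_add[OF l1 l2] by simp
  hence "(\<integral>z. main z \<partial>lborel) = 0" by (simp add: LIMSEQ_const_iff)
  thus "(\<integral>z. w z * dt \<phi> z + F z \<bullet> grad_x \<phi> z \<partial>lborel) = 0" by (simp add: main_def)
qed

section \<open>Algebra of tame functions and of singular orders\<close>

lemma tame_const: "tame S (\<lambda>_. a)"
  unfolding tame_def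
proof (intro conjI allI impI exI ballI)
  show "((\<lambda>_. a) has_derivative (\<lambda>_. 0)) (at z)" for z :: spacetime by simp
  show "\<bar>0\<bar> \<le> 0 * norm v" for v :: spacetime by simp
qed simp

lemma tame_bound:
  assumes "tame S f" "compact T" "T \<subseteq> {z. fst z \<noteq> 0}"
  shows "\<exists>M N. (\<forall>z\<in>T. \<bar>f z\<bar> \<le> N) \<and>
    (\<forall>z\<in>T - S. \<exists>f'. (f has_derivative f') (at z) \<and> (\<forall>v. \<bar>f' v\<bar> \<le> M * norm v))"
proof -
  have "continuous_on T f" using assms by (auto simp: tame_def intro: continuous_on_subset)
  hence "bounded (f ` T)" by (intro compact_imp_bounded compact_continuous_image assms(2))
  hence "\<exists>N. \<forall>z\<in>T. \<bar>f z\<bar> \<le> N" unfolding bounded_iff by auto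
  moreover have "\<exists>M. \<forall>z\<in>T - S. \<exists>f'. (f has_derivative f') (at z) \<and> (\<forall>v. \<bar>f' v\<bar> \<le> M * norm v)"
    using assms unfolding tame_def by blast
  ultimately show ?thesis by blast
qed

lemma tame_add:
  assumes "tame S f" "tame S g"
  shows "tame S (\<lambda>z. f z + g z)"
  unfolding tame_def
proof (intro conjI allI impI)
  show "continuous_on {z. fst z \<noteq> 0} (\<lambda>z. f z + g z)"
    using assms by (auto simp: tame_def intro!: continuous_intros)
  fix T :: "spacetime set" assume T: "compact T" "T \<subseteq> {z. fst z \<noteq> 0}"
  obtain M N where N: "\<forall>z\<in>T. \<bar>f z\<bar> \<le> N" and M: "\<forall>z\<in>T - S. \<exists>f'. (f has_derivative f') (at z) \<and> (\<forall>v. \<bar>f' v\<bar> \<le> M * norm v)"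
    using tame_bound[OF assms(1) T] by blast
  obtain M' N' where N': "\<forall>z\<in>T. \<bar>g z\<bar> \<le> N'" and M': "\<forall>z\<in>T - S. \<exists>f'. (g has_derivative f') (at z) \<and> (\<forall>v. \<bar>f' v\<bar> \<le> M' * norm v)"
    using tame_bound[OF assms(2) T] by blast
  show "\<exists>M. \<forall>z\<in>T - S. \<exists>f'. ((\<lambda>z. f z + g z) has_derivative f') (at z) \<and> (\<forall>v. \<bar>f' v\<bar> \<le> M * norm v)"
  proof (intro exI[of _ "M + M'"] ballI)
    fix z assume z: "z \<in> T - S"
    obtain f' where f': "(f has_derivative f') (at z)" "\<And>v. \<bar>f' v\<bar> \<le> M * norm v" using bspec[OF M z] by blast
    obtain g' where g': "(g has_derivative g') (at z)" "\<And>v. \<bar>g' v\<bar> \<le> M' * norm v" using bspec[OF M' z] by blast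
    have "\<bar>f' v + g' v\<bar> \<le> (M + M') * norm v" for v
      using f'(2)[of v] g'(2)[of v] by (simp add: distrib_right)
    thus "\<exists>f'. ((\<lambda>z. f z + g z) has_derivative f') (at z) \<and> (\<forall>v. \<bar>f' v\<bar> \<le> (M + M') * norm v)"
      using has_derivative_add[OF f'(1) g'(1)] by blast
  qed
qed

lemma tame_mult:
  assumes "tame S f" "tame S g"
  shows "tame S (\<lambda>z. f z * g z)"
  unfolding tame_def
proof (intro conjI allI impI)
  show "continuous_on {z. fst z \<noteq> 0} (\<lambda>z. f z * g z)"
    using assms by (auto simp: tame_def intro!: continuous_intros)
  fix T :: "spacetime set" assume T: "compact T" "T \<subseteq> {z. fst z \<noteq> 0}"
  obtain M N where N: "\<forall>z\<in>T. \<bar>f z\<bar> \<le> N" and M: "\<forall>z\<in>T - S. \<exists>f'. (f has_derivative f') (at z) \<and> (\<forall>v. \<bar>f' v\<bar> \<le> M * norm v)"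
    using tame_bound[OF assms(1) T] by blast
  obtain M' N' where N': "\<forall>z\<in>T. \<bar>g z\<bar> \<le> N'" and M': "\<forall>z\<in>T - S. \<exists>f'. (g has_derivative f') (at z) \<and> (\<forall>v. \<bar>f' v\<bar> \<le> M' * norm v)"
    using tame_bound[OF assms(2) T] by blast
  have ab: "\<bar>x * y\<bar> \<le> p * q" if "\<bar>x\<bar> \<le> p" "\<bar>y\<bar> \<le> q" for x y p q :: real
    using mult_mono[OF that] that by (simp add: abs_mult)
  show "\<exists>M. \<forall>z\<in>T - S. \<exists>f'. ((\<lambda>z. f z * g z) has_derivative f') (at z) \<and> (\<forall>v. \<bar>f' v\<bar> \<le> M * norm v)"
  proof (intro exI[of _ "N * M' + M * N'"] ballI)
    fix z assume z: "z \<in> T - S"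
    hence zT: "z \<in> T" by blast
    obtain f' where f': "(f has_derivative f') (at z)" "\<And>v. \<bar>f' v\<bar> \<le> M * norm v" using bspec[OF M z] by blast
    obtain g' where g': "(g has_derivative g') (at z)" "\<And>v. \<bar>g' v\<bar> \<le> M' * norm v" using bspec[OF M' z] by blast
    have "\<bar>f z * g' v + f' v * g z\<bar> \<le> (N * M' + M * N') * norm v" for v
      using ab[OF bspec[OF N zT] g'(2)[of v]] ab[OF f'(2)[of v] bspec[OF N' zT]] by (simp add: algebra_simps)
    thus "\<exists>f'. ((\<lambda>z. f z * g z) has_derivative f') (at z) \<and> (\<forall>v. \<bar>f' v\<bar> \<le> (N * M' + M * N') * norm v)"
      using has_derivative_mult[OF f'(1) g'(1)] by blast
  qed
qed

lemma tame_powr: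
  assumes "tame S f" and pos: "\<And>z. fst z \<noteq> 0 \<Longrightarrow> f z > 0"
  shows "tame S (\<lambda>z. f z powr b)"
  unfolding tame_def
proof (intro conjI allI impI)
  show c: "continuous_on {z. fst z \<noteq> 0} (\<lambda>z. f z powr b)"
    using assms by (auto simp: tame_def intro!: continuous_intros) (metis less_irrefl)
  fix T :: "spacetime set" assume T: "compact T" "T \<subseteq> {z. fst z \<noteq> 0}"
  obtain M N0 where N0: "\<forall>z\<in>T. \<bar>f z\<bar> \<le> N0" and M: "\<forall>z\<in>T - S. \<exists>f'. (f has_derivative f') (at z) \<and> (\<forall>v. \<bar>f' v\<bar> \<le> M * norm v)"
    using tame_bound[OF assms(1) T] by blast
  have "continuous_on T (\<lambda>z. f z powr (b - 1))"
  proof (rule continuous_on_powr)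
    have "continuous_on {z. fst z \<noteq> 0} f" using assms(1) by (simp add: tame_def)
    from continuous_on_subset[OF this T(2)] show "continuous_on T f" .
    show "\<forall>z\<in>T. f z \<noteq> 0"
    proof
      fix z assume "z \<in> T"
      hence "fst z \<noteq> 0" using T(2) by blast
      from pos[OF this] show "f z \<noteq> 0" by simp
    qed
  qed simp
  hence "bounded ((\<lambda>z. f z powr (b - 1)) ` T)" by (intro compact_imp_bounded compact_continuous_image T)
  then obtain N where "\<forall>y\<in>(\<lambda>z. f z powr (b - 1)) ` T. norm y \<le> N" unfolding bounded_iff by blast
  hence N: "\<bar>f z powr (b - 1)\<bar> \<le> N" if "z \<in> T" for z using that by auto
  show "\<exists>M. \<forall>z\<in>T - S. \<exists>f'. ((\<lambda>z. f z powr b) has_derivative f') (at z) \<and> (\<forall>v. \<bar>f' v\<bar> \<le> M * norm v)"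
  proof (intro exI[of _ "\<bar>b\<bar> * N * M"] ballI)
    fix z assume z: "z \<in> T - S"
    hence zT: "z \<in> T" by blast
    hence "fst z \<noteq> 0" using T by blast
    hence fz: "f z > 0" by (rule pos)
    obtain f' where f': "(f has_derivative f') (at z)" "\<And>v. \<bar>f' v\<bar> \<le> M * norm v" using bspec[OF M z] by blast
    have "((\<lambda>y. y powr b) has_real_derivative b * f z powr (b - 1)) (at (f z))"
      using fz by (rule DERIV_powr[OF DERIV_ident _ DERIV_const, THEN DERIV_cong]) (use fz in \<open>simp add: powr_diff field_simps\<close>)
    from has_derivative_compose[OF f'(1) this[THEN has_field_derivative_imp_has_derivative]]
    have "((\<lambda>z. f z powr b) has_derivative (\<lambda>v. b * f z powr (b - 1) * f' v)) (at z)" .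
    moreover have "\<bar>b * f z powr (b - 1) * f' v\<bar> \<le> \<bar>b\<bar> * N * M * norm v" for v
    proof -
      have "\<bar>b * f z powr (b - 1) * f' v\<bar> = \<bar>b\<bar> * (\<bar>f z powr (b - 1)\<bar> * \<bar>f' v\<bar>)" by (simp add: abs_mult)
      also have "\<dots> \<le> \<bar>b\<bar> * (N * (M * norm v))"
        using N[OF zT] f'(2)[of v] by (intro mult_left_mono mult_mono order_trans[OF abs_ge_zero N[OF zT]]) auto
      finally show ?thesis by (simp add: ac_simps)
    qed
    ultimately show "\<exists>f'. ((\<lambda>z. f z powr b) has_derivative f') (at z) \<and> (\<forall>v. \<bar>f' v\<bar> \<le> \<bar>b\<bar> * N * M * norm v)"
      by blast
  qed
qed

lemma tame_sum: "finite I \<Longrightarrow> (\<And>i. i \<in> I \<Longrightarrow> tame S (f i)) \<Longrightarrow> tame S (\<lambda>z. \<Sum>i\<in>I. f i z)"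
  by (induction I rule: finite_induct) (auto intro: tame_const tame_add)

text \<open>The order is counted in the distance from the axis, not from the space-time origin: this
  is the bound that the similarity form yields at once, orders add under multiplication, and in
  three space dimensions every order below 3 is integrable.\<close>

definition sing :: "real \<Rightarrow> (spacetime \<Rightarrow> real) \<Rightarrow> bool" where
  "sing a f \<longleftrightarrow> (\<forall>\<rho>. \<exists>K. \<forall>z\<in>cball 0 \<rho>. snd z \<noteq> 0 \<longrightarrow> \<bar>f z\<bar> \<le> K * norm (snd z) powr (- a))"

lemma sing_mult:
  assumes "sing a f" "sing b g"
  shows "sing (a + b) (\<lambda>z. f z * g z)"
  unfolding sing_def
proof
  fix \<rho>
  obtain K where K: "\<And>z. z \<in> cball 0 \<rho> \<Longrightarrow> snd z \<noteq> 0 \<Longrightarrow> \<bar>f z\<bar> \<le> K * norm (snd z) powr (- a)"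
    using assms(1) unfolding sing_def by metis
  obtain L where L: "\<And>z. z \<in> cball 0 \<rho> \<Longrightarrow> snd z \<noteq> 0 \<Longrightarrow> \<bar>g z\<bar> \<le> L * norm (snd z) powr (- b)"
    using assms(2) unfolding sing_def by metis
  show "\<exists>K. \<forall>z\<in>cball 0 \<rho>. snd z \<noteq> 0 \<longrightarrow> \<bar>f z * g z\<bar> \<le> K * norm (snd z) powr (- (a + b))"
  proof (intro exI[of _ "K * L"] ballI impI)
    fix z :: spacetime assume z: "z \<in> cball 0 \<rho>" "snd z \<noteq> 0"
    have "\<bar>f z * g z\<bar> \<le> (K * norm (snd z) powr (- a)) * (L * norm (snd z) powr (- b))"
      unfolding abs_mult using K[OF z] L[OF z] by (intro mult_mono) auto
    also have "\<dots> = K * L * norm (snd z) powr (- (a + b))"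
      by (simp add: powr_add[symmetric] add.commute)
    finally show "\<bar>f z * g z\<bar> \<le> K * L * norm (snd z) powr (- (a + b))" .
  qed
qed

lemma sing_add:
  assumes "sing a f" "sing a g"
  shows "sing a (\<lambda>z. f z + g z)"
  unfolding sing_def
proof
  fix \<rho>
  obtain K where K: "\<And>z. z \<in> cball 0 \<rho> \<Longrightarrow> snd z \<noteq> 0 \<Longrightarrow> \<bar>f z\<bar> \<le> K * norm (snd z) powr (- a)"
    using assms(1) unfolding sing_def by metis
  obtain L where L: "\<And>z. z \<in> cball 0 \<rho> \<Longrightarrow> snd z \<noteq> 0 \<Longrightarrow> \<bar>g z\<bar> \<le> L * norm (snd z) powr (- a)"
    using assms(2) unfolding sing_def by metis
  show "\<exists>K. \<forall>z\<in>cball 0 \<rho>. snd z \<noteq> 0 \<longrightarrow> \<bar>f z + g z\<bar> \<le> K * norm (snd z) powr (- a)"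
  proof (intro exI[of _ "K + L"] ballI impI)
    fix z :: spacetime assume z: "z \<in> cball 0 \<rho>" "snd z \<noteq> 0"
    show "\<bar>f z + g z\<bar> \<le> (K + L) * norm (snd z) powr (- a)"
      using K[OF z] L[OF z] by (simp add: distrib_right)
  qed
qed

lemma sing_const: "sing 0 (\<lambda>_. K)"
  unfolding sing_def by (intro allI exI[of _ "\<bar>K\<bar>"]) auto

lemma sing_mono:
  assumes "sing a f" "a \<le> b"
  shows "sing b f"
  unfolding sing_def
proof
  fix \<rho>
  obtain K where K: "\<And>z. z \<in> cball 0 \<rho> \<Longrightarrow> snd z \<noteq> 0 \<Longrightarrow> \<bar>f z\<bar> \<le> K * norm (snd z) powr (- a)"
    using assms(1) unfolding sing_def by metis
  show "\<exists>K. \<forall>z\<in>cball 0 \<rho>. snd z \<noteq> 0 \<longrightarrow> \<bar>f z\<bar> \<le> K * norm (snd z) powr (- b)"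
  proof (intro exI[of _ "\<bar>K\<bar> * \<rho> powr (b - a)"] ballI impI)
    fix z :: spacetime assume z: "z \<in> cball 0 \<rho>" "snd z \<noteq> 0"
    have n: "norm (snd z) \<le> \<rho>" using z(1) norm_snd_le[of "snd z" "fst z"] by simp
    have "\<bar>f z\<bar> \<le> \<bar>K\<bar> * norm (snd z) powr (- a)"
      using K[OF z] mult_right_mono[of K "\<bar>K\<bar>" "norm (snd z) powr (- a)"] by force
    also have "norm (snd z) powr (- a) = norm (snd z) powr (b - a) * norm (snd z) powr (- b)"
      by (simp add: powr_add[symmetric])
    also have "\<dots> \<le> \<rho> powr (b - a) * norm (snd z) powr (- b)"
      using n assms(2) by (intro mult_right_mono powr_mono2) auto
    finally show "\<bar>f z\<bar> \<le> \<bar>K\<bar> * \<rho> powr (b - a) * norm (snd z) powr (- b)"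
      by (simp add: mult_left_mono mult.assoc)
  qed
qed

lemma sing_sum: "finite I \<Longrightarrow> 0 \<le> a \<Longrightarrow> (\<And>i. i \<in> I \<Longrightarrow> sing a (f i)) \<Longrightarrow> sing a (\<lambda>z. \<Sum>i\<in>I. f i z)"
  by (induction I rule: finite_induct) (auto intro: sing_mono[OF sing_const] sing_add)

lemma sing_vector:
  fixes F :: "spacetime \<Rightarrow> real^3"
  assumes "\<And>i. sing a (\<lambda>z. F z $ i)"
  shows "\<exists>K. \<forall>z\<in>cball 0 \<rho>. snd z \<noteq> 0 \<longrightarrow> norm (F z) \<le> K * norm (snd z) powr (- a)"
proof -
  have "\<forall>i. \<exists>K. \<forall>z\<in>cball 0 \<rho>. snd z \<noteq> 0 \<longrightarrow> \<bar>F z $ i\<bar> \<le> K * norm (snd z) powr (- a)"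
    using assms unfolding sing_def by blast
  then obtain K where K: "\<And>i z. z \<in> cball 0 \<rho> \<Longrightarrow> snd z \<noteq> 0 \<Longrightarrow> \<bar>F z $ i\<bar> \<le> K i * norm (snd z) powr (- a)"
    by metis
  show ?thesis
  proof (intro exI[of _ "\<Sum>i\<in>UNIV. K i"] ballI impI)
    fix z :: spacetime assume z: "z \<in> cball 0 \<rho>" "snd z \<noteq> 0"
    have "norm (F z) \<le> (\<Sum>i\<in>UNIV. \<bar>F z $ i\<bar>)" by (rule norm_le_l1_cart)
    also have "\<dots> \<le> (\<Sum>i\<in>UNIV. K i * norm (snd z) powr (- a))" by (intro sum_mono K z)
    finally show "norm (F z) \<le> (\<Sum>i\<in>UNIV. K i) * norm (snd z) powr (- a)" by (simp add: sum_distrib_right)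
  qed
qed

section \<open>Flows from similarity profiles\<close>

text \<open>The factor \<open>s = \<rho> / (k c)\<close> is \<open>d\<rho> / dc\<close> along the isentrope \<open>\<rho> = c powr (1 / k)\<close>.\<close>

lemma euler_conservation_forms:
  fixes c U1 U2 U3 k g s ct c1 c2 c3 :: real
  assumes k: "k > 0" "g = 1 + 2 * k"
    and M: "ct + (U1*c1 + U2*c2 + U3*c3) + k * c * (a11 + a22 + a33) = 0"
    and P1: "U1t + (U1*a11 + U2*a12 + U3*a13) + c / k * c1 = 0"
    and P2: "U2t + (U1*a21 + U2*a22 + U3*a23) + c / k * c2 = 0"
    and P3: "U3t + (U1*a31 + U2*a32 + U3*a33) + c / k * c3 = 0"
  defines "\<rho> \<equiv> s * k * c" and "E \<equiv> c\<^sup>2 / (g * (g - 1)) + (U1\<^sup>2 + U2\<^sup>2 + U3\<^sup>2) / 2" and "p \<equiv> s * k * c * c\<^sup>2 / g"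
  shows "s * ct + ((s*c1*U1 + \<rho>*a11) + (s*c2*U2 + \<rho>*a22) + (s*c3*U3 + \<rho>*a33)) = 0"
    and "s*ct*U1 + \<rho>*U1t + (((s*c1*U1 + \<rho>*a11)*U1 + \<rho>*U1*a11 + s*c\<^sup>2*c1)
         + ((s*c2*U1 + \<rho>*a12)*U2 + \<rho>*U1*a22) + ((s*c3*U1 + \<rho>*a13)*U3 + \<rho>*U1*a33)) = 0"
    and "(s*ct*E + \<rho>*(c*ct/(g*k) + U1*U1t + U2*U2t + U3*U3t))
       + ((s*c1*E + \<rho>*(c*c1/(g*k) + U1*a11 + U2*a21 + U3*a31) + s*c\<^sup>2*c1)*U1 + (\<rho>*E + p)*a11
        + (s*c2*E + \<rho>*(c*c2/(g*k) + U1*a12 + U2*a22 + U3*a32) + s*c\<^sup>2*c2)*U2 + (\<rho>*E + p)*a22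
        + (s*c3*E + \<rho>*(c*c3/(g*k) + U1*a13 + U2*a23 + U3*a33) + s*c\<^sup>2*c3)*U3 + (\<rho>*E + p)*a33) = 0"
proof -
  show m: "s * ct + ((s*c1*U1 + \<rho>*a11) + (s*c2*U2 + \<rho>*a22) + (s*c3*U3 + \<rho>*a33)) = 0" (is "?m = 0")
  proof -
    have "?m = s * (ct + (U1*c1 + U2*c2 + U3*c3) + k * c * (a11 + a22 + a33))"
      unfolding \<rho>_def by (simp add: algebra_simps)
    thus ?thesis using M by simp
  qed
  \<comment> \<open>Multiplied by the density, the term \<open>c / k\<close> times the gradient of
    \<open>c\<close> becomes the pressure gradient.\<close>
  have cc: "\<rho> * (c / k * x) = s * c\<^sup>2 * x" for x using k(1) by (simp add: \<rho>_def power2_eq_square)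
  show "s*ct*U1 + \<rho>*U1t + (((s*c1*U1 + \<rho>*a11)*U1 + \<rho>*U1*a11 + s*c\<^sup>2*c1)
         + ((s*c2*U1 + \<rho>*a12)*U2 + \<rho>*U1*a22) + ((s*c3*U1 + \<rho>*a13)*U3 + \<rho>*U1*a33)) = 0" (is "?p = 0")
  proof -
    have "?p = U1 * ?m + \<rho> * (U1t + (U1*a11 + U2*a12 + U3*a13) + c / k * c1)"
      unfolding distrib_left cc by (simp add: algebra_simps)
    thus ?thesis using m P1 by simp
  qed
  have gk: "g > 0" "g - 1 = 2 * k" using k by auto
  have pp: "\<rho> * (c / (g * k)) * (k * c) = p" using gk(1) k(1) by (simp add: \<rho>_def p_def divide_simps power2_eq_square)
  show "(s*ct*E + \<rho>*(c*ct/(g*k) + U1*U1t + U2*U2t + U3*U3t))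
       + ((s*c1*E + \<rho>*(c*c1/(g*k) + U1*a11 + U2*a21 + U3*a31) + s*c\<^sup>2*c1)*U1 + (\<rho>*E + p)*a11
        + (s*c2*E + \<rho>*(c*c2/(g*k) + U1*a12 + U2*a22 + U3*a32) + s*c\<^sup>2*c2)*U2 + (\<rho>*E + p)*a22
        + (s*c3*E + \<rho>*(c*c3/(g*k) + U1*a13 + U2*a23 + U3*a33) + s*c\<^sup>2*c3)*U3 + (\<rho>*E + p)*a33) = 0" (is "?e = 0")
  proof -
    \<comment> \<open>This is \<open>de / dc\<close>. The energy balance is the combination of the
      mass equation with weight \<open>E\<close>, the sound speed equation with weight
      \<open>\<rho> * h\<close>, and the momentum equations with weights \<open>U1\<close>,
      \<open>U2\<close>, \<open>U3\<close>; the work of the pressure is recovered from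
      \<open>p = \<rho> * h * (k * c)\<close>.\<close>
    define h where "h = c / (g * k)"
    have h: "c * x / (g * k) = h * x" for x by (simp add: h_def)
    have p: "p = \<rho> * h * (k * c)" using pp by (simp add: h_def)
    have "?e = E * ?m + \<rho> * h * (ct + (U1*c1 + U2*c2 + U3*c3) + k * c * (a11 + a22 + a33))
       + U1 * (\<rho> * (U1t + (U1*a11 + U2*a12 + U3*a13) + c / k * c1))
       + U2 * (\<rho> * (U2t + (U1*a21 + U2*a22 + U3*a23) + c / k * c2))
       + U3 * (\<rho> * (U3t + (U1*a31 + U2*a32 + U3*a33) + c / k * c3))"
      unfolding distrib_left[of \<rho> _ "c / k * _"] cc h p by (simp add: algebra_simps)
    thus ?thesis using m M P1 P2 P3 by simp
  qed
qed

lemma has_derivative_norm_snd: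
  fixes z :: spacetime
  assumes "snd z \<noteq> 0"
  shows "((\<lambda>z. norm (snd z)) has_derivative (\<lambda>v. (snd z \<bullet> snd v) / norm (snd z))) (at z)"
proof -
  have "((\<lambda>z. norm (snd z)) has_derivative (\<lambda>v. sgn (snd z) \<bullet> snd v)) (at z)"
    using has_derivative_compose[OF bounded_linear_imp_has_derivative[OF bounded_linear_snd] has_derivative_norm[OF assms]]
    by (simp add: has_derivative_snd inner_commute)
  thus ?thesis by (simp add: sgn_div_norm divide_inverse mult.commute)
qed

lemma continuous_off_originI:
  fixes f :: "spacetime \<Rightarrow> 'b::topological_space"
  assumes "continuous_on {z. snd z \<noteq> 0} f" "continuous_on {z. fst z > 0} f" "continuous_on {z. fst z < 0} f"
  shows "continuous_off_origin f"
proof -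
  have o: "open {z::spacetime. snd z \<noteq> 0}" "open {z::spacetime. fst z > 0}" "open {z::spacetime. fst z < 0}"
    by (intro open_Collect_neq open_Collect_less continuous_intros)+
  have "continuous_on ({z. snd z \<noteq> 0} \<union> {z. fst z > 0} \<union> {z. fst z < 0}) f"
    using assms o by (intro continuous_on_open_Un open_Un)
  moreover have "- {(0::real, 0::real^3)} \<subseteq> {z. snd z \<noteq> 0} \<union> {z. fst z > 0} \<union> {z. fst z < 0}" by auto
  ultimately show ?thesis unfolding continuous_off_origin_def by (rule continuous_on_subset)
qed

text \<open>\<open>Vd x\<close> and \<open>Cd x\<close> stand for \<open>x V'(x)\<close> and
  \<open>x C'(x)\<close>, which keeps the equations autonomous. \<open>X\<close> holds the
  similarity variables of the sonic surfaces, where the profile may have a kink. Not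
  \<open>Cd\<close> but \<open>C x - lam * Cd x\<close> is bounded, because \<open>C\<close> grows
  like \<open>\<bar>x\<bar> powr (1 / lam)\<close>; the limits \<open>Bp\<close> and
  \<open>Bm\<close> determine the sound speed on the axis after and before \<open>t = 0\<close>.
  \<open>small\<close> says that the energy flux has singular order at most 1.\<close>

locale blowup_profile =
  fixes lam k :: real and V C Vd Cd :: "real \<Rightarrow> real" and X :: "real set" and v0 c0 M Bp Bm :: real
  assumes lam: "lam > 1" and k: "k > 0" and small: "(lam - 1) * (3 + 1 / k) \<le> 1"
    and X: "finite X"
    and V_cont: "continuous_on UNIV V" and C_cont: "continuous_on UNIV C"
    and sign: "\<And>x. x \<noteq> 0 \<Longrightarrow> x * C x < 0"
    and dV: "\<And>x. x \<noteq> 0 \<Longrightarrow> x \<notin> X \<Longrightarrow> (V has_real_derivative Vd x / x) (at x)"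
    and dC: "\<And>x. x \<noteq> 0 \<Longrightarrow> x \<notin> X \<Longrightarrow> (C has_real_derivative Cd x / x) (at x)"
    and E1: "\<And>x. x \<noteq> 0 \<Longrightarrow> x \<notin> X \<Longrightarrow>
        lam * (V x - Vd x) + (V x)\<^sup>2 - lam * V x * Vd x + ((C x)\<^sup>2 - lam * C x * Cd x) / k = 0"
    and E2: "\<And>x. x \<noteq> 0 \<Longrightarrow> x \<notin> X \<Longrightarrow>
        lam * (Cd x - C x) - V x * (C x - lam * Cd x) + k * C x * (lam * Vd x - 3 * V x) = 0"
    and V_bd: "\<And>x. \<bar>V x\<bar> \<le> M"
    and Vd_bd: "\<And>x. x \<noteq> 0 \<Longrightarrow> x \<notin> X \<Longrightarrow> \<bar>Vd x\<bar> \<le> M"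
    and Cd_bd: "\<And>x. x \<noteq> 0 \<Longrightarrow> x \<notin> X \<Longrightarrow> \<bar>C x - lam * Cd x\<bar> \<le> M"
    and V_lim: "((\<lambda>x. V x / x) \<longlongrightarrow> v0) (at 0)" and C_lim: "((\<lambda>x. C x / x) \<longlongrightarrow> c0) (at 0)"
    and v0: "v0 \<noteq> 0" and c0: "c0 < 0" and Bp: "Bp > 0" and Bm: "Bm > 0"
    and C_top: "((\<lambda>x. \<bar>C x\<bar> * \<bar>x\<bar> powr (- 1 / lam)) \<longlongrightarrow> Bp) at_top"
    and C_bot: "((\<lambda>x. \<bar>C x\<bar> * \<bar>x\<bar> powr (- 1 / lam)) \<longlongrightarrow> Bm) at_bot"
begin

definition "Vq x = (if x = 0 then v0 else V x / x)"
definition "Cq x = (if x = 0 then c0 else C x / x)"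

definition "uu t r = (if r = 0 then 0 else - (r powr (1 - lam) / lam) * Vq (t / r powr lam))"
text \<open>The values on the axis are forced by the growth of \<open>C\<close>: in
  \<open>- (r / (lam * t)) * C (t / r powr lam)\<close> the powers of \<open>r\<close> cancel in the
  limit.\<close>

definition "cc t r = (if r = 0 then
    (if t > 0 then t powr (1 / lam - 1) * Bp / lam else (- t) powr (1 / lam - 1) * Bm / lam)
    else - (r powr (1 - lam) / lam) * Cq (t / r powr lam))"
definition "dd t r = cc t r powr (1 / k)"

abbreviation "cs \<equiv> radial_scalar cc"
abbreviation "Us \<equiv> radial_vector uu"

text \<open>The axis belongs to the set because the norm is not differentiable there, and
  \<open>t = 0\<close> because the profile is only assumed to have limits of quotients at
  \<open>x = 0\<close>.\<close>

definition "S = {z::spacetime. fst z = 0 \<or> snd z = 0 \<or> fst z / norm (snd z) powr lam \<in> X}"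

lemma quotient_cont: assumes "continuous_on UNIV F" "((\<lambda>x. F x / x) \<longlongrightarrow> l) (at (0::real))"
  shows "continuous_on UNIV (\<lambda>x. if x = 0 then l else F x / x :: real)"
  unfolding continuous_on_eq_continuous_at[OF open_UNIV]
proof
  fix x :: real
  show "isCont (\<lambda>x. if x = 0 then l else F x / x) x"
  proof (cases "x = 0")
    case True
    have "((\<lambda>x. if x = 0 then l else F x / x) \<longlongrightarrow> l) (at 0)"
      by (rule Lim_transform_eventually[OF assms(2)]) (auto simp: eventually_at_filter)
    thus ?thesis using True by (simp add: isCont_def)
  next
    case False
    have "isCont (\<lambda>x. F x / x) x" using assms(1) False by (auto simp: continuous_on_eq_continuous_at intro!: continuous_intros)
    have ev: "\<forall>\<^sub>F y in nhds x. (if y = 0 then l else F y / y) = F y / y"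
      using t1_space_nhds[OF False] by (rule eventually_mono) auto
    show ?thesis unfolding isCont_cong[OF ev] by fact
  qed
qed

lemma Vq_cont: "continuous_on UNIV Vq" and Cq_cont: "continuous_on UNIV Cq"
  unfolding Vq_def[abs_def] Cq_def[abs_def]
  by (rule quotient_cont[OF V_cont V_lim], rule quotient_cont[OF C_cont C_lim])

lemma Cq_neg: "Cq x < 0"
proof (cases "x = 0")
  case False
  have "x * C x / (x * x) < 0" using sign[OF False] False by (intro divide_neg_pos) (auto simp: zero_less_mult_iff)
  thus ?thesis using False by (simp add: Cq_def)
qed (simp add: Cq_def c0)

lemma Vq_bounded: "\<exists>K. \<forall>x. \<bar>Vq x\<bar> \<le> K"
proof -
  have "bounded (Vq ` {-1..1})"
    by (intro compact_imp_bounded compact_continuous_image continuous_on_subset[OF Vq_cont]) auto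
  then obtain K where K: "\<And>x. x \<in> {-1..1} \<Longrightarrow> \<bar>Vq x\<bar> \<le> K" unfolding bounded_iff by (auto simp del: atLeastAtMost_iff)
  have "\<bar>Vq x\<bar> \<le> max K M" for x
  proof (cases "x \<in> {-1..1}")
    case True thus ?thesis using K[OF True] by simp
  next
    case False
    hence "\<bar>x\<bar> \<ge> 1" "x \<noteq> 0" by auto
    hence "\<bar>Vq x\<bar> \<le> \<bar>V x\<bar>" by (simp add: Vq_def abs_divide divide_le_eq mult_left_le_one_le) (metis abs_ge_zero mult_left_mono mult.right_neutral)
    thus ?thesis using V_bd[of x] by simp
  qed
  thus ?thesis by blast
qed

lemma Cq_bounded: "\<exists>K. \<forall>x. \<bar>Cq x\<bar> \<le> K"
proof -
  define f where "f x = \<bar>C x\<bar> * \<bar>x\<bar> powr (- 1 / lam)" for x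
  have "\<forall>\<^sub>F x in at_top. f x < Bp + 1" "\<forall>\<^sub>F x in at_bot. f x < Bm + 1"
    using order_tendstoD(2)[OF C_top, of "Bp + 1"] order_tendstoD(2)[OF C_bot, of "Bm + 1"] by (auto simp: f_def)
  then obtain N1 N2 where N: "\<And>x. x \<ge> N1 \<Longrightarrow> f x < Bp + 1" "\<And>x. x \<le> N2 \<Longrightarrow> f x < Bm + 1"
    unfolding eventually_at_top_linorder eventually_at_bot_linorder by blast
  define N where "N = max 1 (max N1 (- N2))"
  have "bounded (Cq ` {-N..N})"
    by (intro compact_imp_bounded compact_continuous_image continuous_on_subset[OF Cq_cont]) auto
  then obtain K where K: "\<And>x. x \<in> {-N..N} \<Longrightarrow> \<bar>Cq x\<bar> \<le> K" unfolding bounded_iff by (auto simp del: atLeastAtMost_iff)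
  have "\<bar>Cq x\<bar> \<le> max K (Bp + Bm + 1)" for x
  proof (cases "x \<in> {-N..N}")
    case True thus ?thesis using K[OF True] by simp
  next
    case False
    hence x: "\<bar>x\<bar> > 1" "x \<ge> N1 \<or> x \<le> N2" by (auto simp: N_def)
    have "\<bar>Cq x\<bar> = f x * \<bar>x\<bar> powr (1 / lam - 1)"
      using x by (auto simp: Cq_def f_def abs_divide powr_diff powr_minus_divide)
    also have "\<dots> \<le> f x * 1"
    proof (rule mult_left_mono)
      have "1 / lam - 1 \<le> 0" using lam by simp
      from powr_mono[OF this, of "\<bar>x\<bar>"] show "\<bar>x\<bar> powr (1 / lam - 1) \<le> 1" using x by (simp split: if_splits)
    qed (simp add: f_def)
    also have "\<dots> \<le> Bp + Bm + 1" using x N Bp Bm by force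
    finally show ?thesis by simp
  qed
  thus ?thesis by blast
qed

lemma cc_pos:
  assumes "r \<ge> 0" "(t, r) \<noteq> (0, 0)"
  shows "cc t r > 0"
proof (cases "r = 0")
  case False
  hence "r powr (1 - lam) / lam * (- Cq (t / r powr lam)) > 0"
    using assms lam Cq_neg[of "t / r powr lam"] by (intro mult_pos_pos) auto
  thus ?thesis using False by (simp add: cc_def)
qed (use assms lam Bp Bm in \<open>auto simp: cc_def\<close>)

lemma cs_pos: "z \<noteq> (0, 0) \<Longrightarrow> cs z > 0"
  by (cases z) (auto simp: radial_scalar_def intro!: cc_pos)

lemma arg_cont: "continuous_on {z::spacetime. snd z \<noteq> 0} (\<lambda>z. fst z / norm (snd z) powr lam)"
  by (intro continuous_intros) auto

text \<open>For \<open>t \<noteq> 0\<close> the sound speed depends continuously on \<open>r powr lam / t\<close> down to the axis \<open>r = 0\<close>.\<close>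

lemma cc_half_cont:
  assumes s: "s = 1 \<or> s = -1" and B: "B = (if s = 1 then Bp else Bm)"
  shows "continuous_on {z. s * fst z > 0} cs"
proof -
  \<comment> \<open>Here \<open>s\<close> is the sign of the time and \<open>y\<close> is
    \<open>r powr lam / \<bar>t\<bar>\<close>, so \<open>y = 0\<close> is the axis, where the limit
    of \<open>\<bar>C x\<bar> * \<bar>x\<bar> powr (- 1 / lam)\<close> is filled in.\<close>
  define \<beta> where "\<beta> y = (if y = 0 then B else \<bar>C (s / y)\<bar> * \<bar>s / y\<bar> powr (- 1 / lam))" for y :: real
  have lim: "(\<beta> \<longlongrightarrow> B) (at_right 0)"
  proof -
    have inv: "filterlim (\<lambda>y::real. s / y) (if s = 1 then at_top else at_bot) (at_right 0)"
    proof (cases "s = 1")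
      case True
      thus ?thesis using filterlim_inverse_at_top_right by (simp add: inverse_eq_divide)
    next
      case False
      hence "s = -1" using s by simp
      thus ?thesis using filterlim_uminus_at_bot_at_top[THEN filterlim_compose, OF filterlim_inverse_at_top_right]
        by (simp add: inverse_eq_divide)
    qed
    have l: "((\<lambda>x. \<bar>C x\<bar> * \<bar>x\<bar> powr (- 1 / lam)) \<longlongrightarrow> B) (if s = 1 then at_top else at_bot)"
      using C_top C_bot B by simp
    have "((\<lambda>y. \<bar>C (s / y)\<bar> * \<bar>s / y\<bar> powr (- 1 / lam)) \<longlongrightarrow> B) (at_right 0)"
      by (rule filterlim_compose[OF l inv])
    thus ?thesis by (rule Lim_transform_eventually) (auto simp: \<beta>_def eventually_at_filter)
  qed
  have \<beta>c: "continuous_on {0..} \<beta>"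
    unfolding continuous_on_def
  proof
    fix y :: real assume y: "y \<in> {0..}"
    show "(\<beta> \<longlongrightarrow> \<beta> y) (at y within {0..})"
    proof (cases "y = 0")
      case True
      have "at (0::real) within {0..} = at_right 0"
        by (auto simp: at_within_def intro!: arg_cong[where f="\<lambda>S. inf (nhds 0) (principal S)"])
      thus ?thesis using lim True by (simp add: \<beta>_def)
    next
      case False
      hence yp: "y > 0" using y by simp
      have "isCont C (s / y)" using C_cont by (simp add: continuous_on_eq_continuous_at)
      hence "isCont (\<lambda>y. C (s / y)) y"
      proof (rule isCont_o2[rotated])
        show "isCont (\<lambda>y. s / y) y" using yp by (intro continuous_intros) auto
      qed
      hence "isCont (\<lambda>y. \<bar>C (s / y)\<bar> * \<bar>s / y\<bar> powr (- 1 / lam)) y"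
        using yp s by (intro continuous_intros) auto
      hence "((\<lambda>y. \<bar>C (s / y)\<bar> * \<bar>s / y\<bar> powr (- 1 / lam)) \<longlongrightarrow> \<beta> y) (at y)"
        using yp by (simp add: \<beta>_def isCont_def)
      hence "(\<beta> \<longlongrightarrow> \<beta> y) (at y)"
      proof (rule Lim_transform_eventually)
        have "\<forall>\<^sub>F x in at y. x \<noteq> 0" using t1_space_nhds[OF False] by (auto simp: eventually_at_filter elim: eventually_mono)
        thus "\<forall>\<^sub>F x in at y. \<bar>C (s / x)\<bar> * \<bar>s / x\<bar> powr (- 1 / lam) = \<beta> x"
          by (rule eventually_mono) (simp add: \<beta>_def)
      qed
      thus ?thesis by (rule tendsto_within_subset) simp
    qed
  qed
  have eq: "cs z = (s * fst z) powr (1 / lam - 1) / lam * \<beta> (norm (snd z) powr lam / (s * fst z))"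
    if z: "s * fst z > 0" for z
  proof -
    define t r where "t = fst z" and "r = norm (snd z)"
    have tp: "s * t > 0" using z by (simp add: t_def)
    have at: "\<bar>t\<bar> = s * t" using tp s by auto
    show ?thesis
    proof (cases "r = 0")
      case True
      hence "cs z = (s * t) powr (1 / lam - 1) * B / lam"
        using s B tp by (auto simp: radial_scalar_def cc_def r_def t_def)
      thus ?thesis using True lam by (simp add: \<beta>_def t_def[symmetric] r_def[symmetric])
    next
      case False
      hence r: "r > 0" by (simp add: r_def)
      define x where "x = t / r powr lam"
      have y: "s / (r powr lam / (s * t)) = x" using s r tp by (auto simp: x_def)
      have x: "\<bar>x\<bar> = (s * t) / r powr lam" using at by (simp add: x_def abs_divide)
      have xn: "x \<noteq> 0" using tp r by (auto simp: x_def)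
      have cq: "- Cq x = \<bar>C x\<bar> / \<bar>x\<bar>" 
      proof -
        have "\<bar>C x\<bar> / \<bar>x\<bar> = \<bar>Cq x\<bar>" using xn by (simp add: Cq_def)
        thus ?thesis using Cq_neg[of x] by simp
      qed
      have "(s * t) powr (1 / lam - 1) * (\<bar>x\<bar> powr (- 1 / lam)) = r powr (1 - lam) / \<bar>x\<bar>"
      proof -
        have st: "s * t = \<bar>x\<bar> * r powr lam" unfolding x using r by simp
        have e: "lam * (1 / lam - 1) = 1 - lam" using lam by (simp add: field_simps)
        have "(s * t) powr (1 / lam - 1) = \<bar>x\<bar> powr (1 / lam - 1) * (r powr lam) powr (1 / lam - 1)"
          by (simp only: st powr_mult abs_ge_zero powr_ge_zero)
        also have "(r powr lam) powr (1 / lam - 1) = r powr (1 - lam)"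
          by (simp only: powr_powr e)
        finally have "(s * t) powr (1 / lam - 1) * (\<bar>x\<bar> powr (- 1 / lam))
            = r powr (1 - lam) * (\<bar>x\<bar> powr (1 / lam - 1) * \<bar>x\<bar> powr (- 1 / lam))" by simp
        also have "\<bar>x\<bar> powr (1 / lam - 1) * \<bar>x\<bar> powr (- 1 / lam) = \<bar>x\<bar> powr (- 1)"
          by (simp add: powr_add[symmetric])
        also have "\<dots> = 1 / \<bar>x\<bar>" using xn by (simp add: powr_minus_divide)
        finally show ?thesis by simp
      qed
      hence pw: "(s * t) powr (1 / lam - 1) / lam * (\<bar>C x\<bar> * \<bar>x\<bar> powr (- 1 / lam)) = r powr (1 - lam) / lam * (\<bar>C x\<bar> / \<bar>x\<bar>)"
        by (simp add: mult.commute mult.left_commute)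
      have "cs z = r powr (1 - lam) / lam * (- Cq x)"
        using False by (simp add: radial_scalar_def cc_def r_def[symmetric] t_def[symmetric] x_def[symmetric])
      hence "cs z = (s * t) powr (1 / lam - 1) / lam * (\<bar>C x\<bar> * \<bar>x\<bar> powr (- 1 / lam))"
        unfolding pw cq .
      moreover have "\<beta> (r powr lam / (s * t)) = \<bar>C x\<bar> * \<bar>x\<bar> powr (- 1 / lam)"
        unfolding \<beta>_def y using r tp by auto
      ultimately show ?thesis by (simp add: t_def r_def)
    qed
  qed
  have "continuous_on {z. s * fst z > 0} (\<lambda>z::spacetime. (s * fst z) powr (1 / lam - 1) / lam * \<beta> (norm (snd z) powr lam / (s * fst z)))"
  proof (intro continuous_on_mult continuous_on_compose2[OF \<beta>c])
    show "continuous_on {z::spacetime. s * fst z > 0} (\<lambda>z. (s * fst z) powr (1 / lam - 1) / lam)"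
      using lam by (intro continuous_intros) auto
    show "continuous_on {z::spacetime. s * fst z > 0} (\<lambda>z. norm (snd z) powr lam / (s * fst z))"
      using lam by (intro continuous_intros continuous_on_powr') auto
  qed (auto intro!: divide_nonneg_pos)
  thus ?thesis by (rule continuous_on_eq) (simp add: eq)
qed

lemma cs_cont: "continuous_off_origin cs"
proof (rule continuous_off_originI)
  show "continuous_on {z. fst z > 0} cs" using cc_half_cont[of 1] by simp
  show "continuous_on {z. fst z < 0} cs" using cc_half_cont[of "-1"] by simp
  have "continuous_on {z. snd z \<noteq> 0} (\<lambda>z::spacetime. - (norm (snd z) powr (1 - lam) / lam) * Cq (fst z / norm (snd z) powr lam))"
    using lam by (intro continuous_intros continuous_on_compose2[OF Cq_cont arg_cont]) auto
  thus "continuous_on {z. snd z \<noteq> 0} cs"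
    by (rule continuous_on_eq) (auto simp: radial_scalar_def cc_def)
qed

lemma u_off_axis: "r > 0 \<Longrightarrow> t \<noteq> 0 \<Longrightarrow> uu t r = - (r / (lam * t)) * V (t / r powr lam)"
  using lam by (simp add: uu_def Vq_def powr_diff)

lemma c_off_axis: "r > 0 \<Longrightarrow> t \<noteq> 0 \<Longrightarrow> cc t r = - (r / (lam * t)) * C (t / r powr lam)"
  using lam by (simp add: cc_def Cq_def powr_diff)

lemma Us_eq: "fst z \<noteq> 0 \<Longrightarrow> Us z = (- V (fst z / norm (snd z) powr lam) / (lam * fst z)) *\<^sub>R snd z"
  by (cases "snd z = 0") (simp_all add: radial_vector_def u_off_axis)

lemma Us_cont: "continuous_off_origin Us"
proof -
  have a: "continuous_on {z. snd z \<noteq> 0} Us"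
  proof -
    have "continuous_on {z. snd z \<noteq> 0} (\<lambda>z::spacetime. (- (norm (snd z) powr (1 - lam) / lam) * Vq (fst z / norm (snd z) powr lam) / norm (snd z)) *\<^sub>R snd z)"
      using lam by (intro continuous_intros continuous_on_compose2[OF Vq_cont arg_cont]) auto
    thus ?thesis by (rule continuous_on_eq) (auto simp: radial_vector_def uu_def)
  qed
  have "isCont Us z" if z: "fst z \<noteq> 0" "snd z = 0" for z
  proof -
    \<comment> \<open>Towards the axis the similarity variable tends to infinity, where
      \<open>V\<close> is only known to be bounded; the factor \<open>snd y\<close> forces the limit
      0.\<close>
    have "((\<lambda>y. (- V (fst y / norm (snd y) powr lam) / (lam * fst y)) *\<^sub>R snd y) \<longlongrightarrow> 0) (at z)"
    proof (rule Lim_null_comparison)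
      show "\<forall>\<^sub>F y in at z. norm ((- V (fst y / norm (snd y) powr lam) / (lam * fst y)) *\<^sub>R snd y) \<le> M / (lam * \<bar>fst y\<bar>) * norm (snd y)"
        using lam V_bd by (intro always_eventually) (auto simp: abs_mult intro!: mult_right_mono divide_right_mono)
      have "((\<lambda>y. M / (lam * \<bar>fst y\<bar>) * norm (snd y)) \<longlongrightarrow> M / (lam * \<bar>fst z\<bar>) * norm (snd z)) (at z)"
        using z lam by (intro tendsto_intros) auto
      thus "((\<lambda>y. M / (lam * \<bar>fst y\<bar>) * norm (snd y)) \<longlongrightarrow> 0) (at z)" using z by simp
    qed
    moreover have "\<forall>\<^sub>F y in at z. (- V (fst y / norm (snd y) powr lam) / (lam * fst y)) *\<^sub>R snd y = Us y"
    proof -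
      have "open {y::spacetime. fst y \<noteq> 0}" by (intro open_Collect_neq continuous_intros)
      hence "\<forall>\<^sub>F y in nhds z. fst y \<noteq> 0" using z by (auto simp: eventually_nhds)
      hence "\<forall>\<^sub>F y in at z. fst y \<noteq> 0" by (auto simp: eventually_at_filter elim: eventually_mono)
      thus ?thesis by (rule eventually_mono) (simp add: Us_eq)
    qed
    ultimately have "(Us \<longlongrightarrow> 0) (at z)" by (rule Lim_transform_eventually)
    thus ?thesis using z by (simp add: isCont_def radial_vector_def)
  qed
  moreover have "isCont Us z" if "snd z \<noteq> 0" for z
  proof -
    have "open {z::spacetime. snd z \<noteq> 0}" by (intro open_Collect_neq continuous_intros)
    thus ?thesis using a that continuous_on_eq_continuous_at by blast
  qed
  ultimately show ?thesis unfolding continuous_off_origin_def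
    by (intro continuous_at_imp_continuous_on) (metis Compl_iff insertI1 prod.collapse)
qed

text \<open>Chain rule for \<open>- (r / (lam * t)) * C \<xi>\<close>. The radial derivative
  involves exactly the combination \<open>C \<xi> - lam * Cd \<xi>\<close>, the one that stays
  bounded up to the axis.\<close>

lemma radial_derivatives:
  assumes z: "z \<notin> S"
  defines "t \<equiv> fst z" and "r \<equiv> norm (snd z)" and "\<xi> \<equiv> fst z / norm (snd z) powr lam"
  shows "(cs has_derivative (\<lambda>v. r * (C \<xi> - Cd \<xi>) / (lam * t\<^sup>2) * fst v
      - (C \<xi> - lam * Cd \<xi>) / (lam * t) * ((snd z \<bullet> snd v) / r))) (at z)"
    and "((\<lambda>z. Us z $ i) has_derivative (\<lambda>v. - V \<xi> / (lam * t) * (snd v $ i)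
      + snd z $ i * ((V \<xi> - Vd \<xi>) / (lam * t\<^sup>2) * fst v + Vd \<xi> / (t * r) * ((snd z \<bullet> snd v) / r)))) (at z)"
proof -
  have t: "t \<noteq> 0" and sz: "snd z \<noteq> 0" and xX: "\<xi> \<notin> X" using z by (auto simp: S_def t_def \<xi>_def)
  have r: "r > 0" using sz by (simp add: r_def)
  have \<xi>: "\<xi> \<noteq> 0" using t r by (simp add: \<xi>_def t_def r_def)
  have \<xi>t: "t / r powr lam = \<xi>" by (simp add: \<xi>_def t_def r_def)
  define Om where "Om = {z::spacetime. fst z \<noteq> 0} \<inter> {z. snd z \<noteq> 0}"
  have Om: "open Om" "z \<in> Om" using t sz unfolding Om_def t_def
    by (auto intro!: open_Int open_Collect_neq continuous_intros)
  have dr: "((\<lambda>z. norm (snd z)) has_derivative (\<lambda>v. (snd z \<bullet> snd v) / r)) (at z)"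
    unfolding r_def by (rule has_derivative_norm_snd[OF sz])
  have dt: "(fst has_derivative fst) (at z)" by (rule bounded_linear_imp_has_derivative) (rule bounded_linear_fst)
  have dp: "((\<lambda>z. norm (snd z) powr - lam) has_derivative (\<lambda>v. - lam * r powr (- lam - 1) * ((snd z \<bullet> snd v) / r))) (at z)"
  proof -
    have "((\<lambda>y. y powr - lam) has_real_derivative - lam * r powr (- lam - 1)) (at r)"
      using r by (rule has_real_derivative_powr)
    from has_derivative_compose[OF dr this[unfolded r_def, THEN has_field_derivative_imp_has_derivative]]
    show ?thesis by (simp add: r_def)
  qed
  have d\<xi>: "((\<lambda>z. fst z / norm (snd z) powr lam) has_derivative (\<lambda>v. \<xi> * (fst v / t - lam * ((snd z \<bullet> snd v) / r) / r))) (at z)"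
  proof -
    have "((\<lambda>z. fst z * norm (snd z) powr - lam) has_derivative (\<lambda>v. \<xi> * (fst v / t - lam * ((snd z \<bullet> snd v) / r) / r))) (at z)"
      by (rule has_derivative_eq_rhs[OF has_derivative_mult[OF dt dp]])
         (use t r in \<open>auto simp: fun_eq_iff \<xi>_def t_def[symmetric] r_def[symmetric] powr_minus_divide powr_diff right_diff_distrib mult_ac\<close>)
    thus ?thesis by (simp add: powr_minus_divide)
  qed
  have dVx: "((\<lambda>z. V (fst z / norm (snd z) powr lam)) has_derivative (\<lambda>v. Vd \<xi> * (fst v / t - lam * ((snd z \<bullet> snd v) / r) / r))) (at z)"
    using has_derivative_compose[OF d\<xi> dV[OF \<xi> xX, unfolded \<xi>_def, THEN has_field_derivative_imp_has_derivative]] \<xi>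
    by (simp add: \<xi>_def[symmetric])
  have dCx: "((\<lambda>z. C (fst z / norm (snd z) powr lam)) has_derivative (\<lambda>v. Cd \<xi> * (fst v / t - lam * ((snd z \<bullet> snd v) / r) / r))) (at z)"
    using has_derivative_compose[OF d\<xi> dC[OF \<xi> xX, unfolded \<xi>_def, THEN has_field_derivative_imp_has_derivative]] \<xi>
    by (simp add: \<xi>_def[symmetric])
  have di: "((\<lambda>z. inverse (fst z)) has_derivative (\<lambda>v. - (inverse t * fst v * inverse t))) (at z)"
    using Deriv.has_derivative_inverse[OF t[unfolded t_def] dt] by (simp add: t_def)
  have "((\<lambda>z. norm (snd z) * (inverse (fst z) * (C (fst z / norm (snd z) powr lam) * (- 1 / lam)))) has_derivative
     (\<lambda>v. r * (C \<xi> - Cd \<xi>) / (lam * t\<^sup>2) * fst v - (C \<xi> - lam * Cd \<xi>) / (lam * t) * ((snd z \<bullet> snd v) / r))) (at z)"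
  proof (rule has_derivative_eq_rhs[OF has_derivative_mult[OF dr has_derivative_mult[OF di has_derivative_mult[OF dCx has_derivative_const]]]], rule ext)
    fix v :: spacetime
    define a b where "a = fst v" and "b = (snd z \<bullet> snd v) / r"
    show "norm (snd z) * (inverse (fst z) * (C (fst z / norm (snd z) powr lam) * 0 + Cd \<xi> * (fst v / t - lam * ((snd z \<bullet> snd v) / r) / r) * (- 1 / lam)) +
       - (inverse t * fst v * inverse t) * (C (fst z / norm (snd z) powr lam) * (- 1 / lam))) +
       (snd z \<bullet> snd v) / r * (inverse (fst z) * (C (fst z / norm (snd z) powr lam) * (- 1 / lam))) =
      r * (C \<xi> - Cd \<xi>) / (lam * t\<^sup>2) * fst v - (C \<xi> - lam * Cd \<xi>) / (lam * t) * ((snd z \<bullet> snd v) / r)"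
      unfolding t_def[symmetric] r_def[symmetric] a_def[symmetric] b_def[symmetric] unfolding \<xi>t
      using t r lam by (simp add: field_simps power2_eq_square)
  qed
  thus "(cs has_derivative (\<lambda>v. r * (C \<xi> - Cd \<xi>) / (lam * t\<^sup>2) * fst v
      - (C \<xi> - lam * Cd \<xi>) / (lam * t) * ((snd z \<bullet> snd v) / r))) (at z)"
    by (rule has_derivative_transform_within_open[OF _ Om]) (auto simp: Om_def radial_scalar_def c_off_axis divide_simps)
  have dx: "((\<lambda>z. snd z $ i) has_derivative (\<lambda>v. snd v $ i)) (at z)"
    by (intro bounded_linear_imp_has_derivative bounded_linear_compose[OF bounded_linear_vec_nth bounded_linear_snd])
  have "((\<lambda>z. inverse (fst z) * (V (fst z / norm (snd z) powr lam) * (- 1 / lam)) * snd z $ i) has_derivative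
     (\<lambda>v. - V \<xi> / (lam * t) * (snd v $ i)
      + snd z $ i * ((V \<xi> - Vd \<xi>) / (lam * t\<^sup>2) * fst v + Vd \<xi> / (t * r) * ((snd z \<bullet> snd v) / r)))) (at z)"
  proof (rule has_derivative_eq_rhs[OF has_derivative_mult[OF has_derivative_mult[OF di has_derivative_mult[OF dVx has_derivative_const]] dx]], rule ext)
    fix v :: spacetime
    define a b c d where "a = fst v" and "b = (snd z \<bullet> snd v) / r" and "c = snd v $ i" and "d = snd z $ i"
    show "inverse (fst z) * (V (fst z / norm (snd z) powr lam) * (- 1 / lam)) * snd v $ i +
       (inverse (fst z) * (V (fst z / norm (snd z) powr lam) * 0 + Vd \<xi> * (fst v / t - lam * ((snd z \<bullet> snd v) / r) / r) * (- 1 / lam)) +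
       - (inverse t * fst v * inverse t) * (V (fst z / norm (snd z) powr lam) * (- 1 / lam))) * snd z $ i =
      - V \<xi> / (lam * t) * (snd v $ i)
      + snd z $ i * ((V \<xi> - Vd \<xi>) / (lam * t\<^sup>2) * fst v + Vd \<xi> / (t * r) * ((snd z \<bullet> snd v) / r))"
      unfolding t_def[symmetric] r_def[symmetric] a_def[symmetric] b_def[symmetric] c_def[symmetric] d_def[symmetric] unfolding \<xi>t
      using t r lam by (simp add: field_simps power2_eq_square)
  qed
  thus "((\<lambda>z. Us z $ i) has_derivative (\<lambda>v. - V \<xi> / (lam * t) * (snd v $ i)
      + snd z $ i * ((V \<xi> - Vd \<xi>) / (lam * t\<^sup>2) * fst v + Vd \<xi> / (t * r) * ((snd z \<bullet> snd v) / r)))) (at z)"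
    by (rule has_derivative_transform_within_open[OF _ Om]) (auto simp: Om_def Us_eq divide_simps)
qed

text \<open>After substitution of the derivatives, the sound speed equation is
  \<open>- r / (lam\<^sup>2 * t\<^sup>2)\<close> times \<open>E2\<close>, and component
  \<open>j\<close> of the momentum equation is \<open>x $ j / (lam\<^sup>2 * t\<^sup>2)\<close>
  times \<open>E1\<close>.\<close>

lemma nonconservative_euler:
  assumes z: "z \<notin> S"
    and c': "(cs has_derivative c') (at z)"
    and U': "\<And>i. ((\<lambda>z. Us z $ i) has_derivative U' i) (at z)"
  shows "c' (1,0) + (\<Sum>i\<in>UNIV. Us z $ i * c' (0, axis i 1)) + k * cs z * (\<Sum>i\<in>UNIV. U' i (0, axis i 1)) = 0"
    and "U' j (1,0) + (\<Sum>i\<in>UNIV. Us z $ i * U' j (0, axis i 1)) + cs z / k * c' (0, axis j 1) = 0"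
proof -
  define t r \<xi> where "t = fst z" and "r = norm (snd z)" and "\<xi> = fst z / norm (snd z) powr lam"
  have t: "t \<noteq> 0" and sz: "snd z \<noteq> 0" and xX: "\<xi> \<notin> X" using z by (auto simp: S_def t_def \<xi>_def)
  have r: "r > 0" using sz by (simp add: r_def)
  have \<xi>: "\<xi> \<noteq> 0" using t r by (simp add: \<xi>_def t_def r_def)
  define x where "x = snd z"
  note d = radial_derivatives[OF z, folded t_def r_def \<xi>_def x_def]
  have c'e: "c' v = r * (C \<xi> - Cd \<xi>) / (lam * t\<^sup>2) * fst v - (C \<xi> - lam * Cd \<xi>) / (lam * t) * ((x \<bullet> snd v) / r)" for v
    using has_derivative_unique[OF c' d(1)] by simp
  have U'e: "U' i v = - V \<xi> / (lam * t) * (snd v $ i)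
      + x $ i * ((V \<xi> - Vd \<xi>) / (lam * t\<^sup>2) * fst v + Vd \<xi> / (t * r) * ((x \<bullet> snd v) / r))" for i v
    using has_derivative_unique[OF U' d(2)] by simp
  have Ue: "Us z $ i = - V \<xi> / (lam * t) * x $ i" for i
    using t by (simp add: Us_eq t_def x_def \<xi>_def)
  have ce: "cs z = - (r / (lam * t)) * C \<xi>"
    using c_off_axis[of r t] r t by (simp add: radial_scalar_def t_def r_def \<xi>_def)
  have rr: "(\<Sum>i\<in>UNIV. x $ i * (x $ i)) = r\<^sup>2"
    by (simp add: r_def x_def power2_norm_eq_inner inner_vec_def)
  define Vx Cx Vy Cy where "Vx = V \<xi>" and "Cx = C \<xi>" and "Vy = Vd \<xi>" and "Cy = Cd \<xi>"
  note E = E1[OF \<xi> xX, folded Vx_def Cx_def Vy_def Cy_def] E2[OF \<xi> xX, folded Vx_def Cx_def Vy_def Cy_def]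
  have s1: "(\<Sum>i\<in>UNIV. Us z $ i * c' (0, axis i 1)) = Vx / (lam * t) * ((Cx - lam * Cy) / (lam * t)) * r"
  proof -
    have "(\<Sum>i\<in>UNIV. Us z $ i * c' (0, axis i 1)) = (\<Sum>i\<in>UNIV. Vx / (lam * t) * ((Cx - lam * Cy) / (lam * t)) / r * (x $ i * (x $ i)))"
      unfolding Ue c'e Vx_def Cx_def Cy_def by (intro sum.cong refl) (simp add: inner_axis mult_ac)
    also have "\<dots> = Vx / (lam * t) * ((Cx - lam * Cy) / (lam * t)) / r * r\<^sup>2"
      by (simp only: sum_distrib_left[symmetric] rr)
    finally show ?thesis using r by (simp add: power2_eq_square)
  qed
  have s2: "(\<Sum>i\<in>UNIV. U' i (0, axis i 1)) = - 3 * Vx / (lam * t) + Vy / t"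
  proof -
    have "(\<Sum>i\<in>UNIV. U' i (0, axis i 1)) = (\<Sum>i\<in>(UNIV::3 set). - Vx / (lam * t) + Vy / (t * r) / r * (x $ i * (x $ i)))"
      unfolding U'e Vx_def Vy_def by (intro sum.cong refl) (simp add: inner_axis mult_ac)
    also have "\<dots> = - 3 * Vx / (lam * t) + Vy / (t * r) / r * r\<^sup>2"
      by (simp only: sum.distrib sum_distrib_left[symmetric] rr) simp
    finally show ?thesis using r by (simp add: power2_eq_square)
  qed
  have s3: "(\<Sum>i\<in>UNIV. Us z $ i * U' j (0, axis i 1)) = - Vx / (lam * t) * (- Vx / (lam * t) + Vy / t) * x $ j"
  proof -
    have "(\<Sum>i\<in>UNIV. Us z $ i * U' j (0, axis i 1)) =
       (\<Sum>i\<in>UNIV. (Vx / (lam * t))\<^sup>2 * (x $ i * axis i 1 $ j) - Vx / (lam * t) * (Vy / (t * r) / r * x $ j) * (x $ i * (x $ i)))"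
      unfolding Ue U'e Vx_def Vy_def
      by (intro sum.cong refl) (simp add: inner_axis algebra_simps power2_eq_square)
    also have "\<dots> = (Vx / (lam * t))\<^sup>2 * x $ j - Vx / (lam * t) * (Vy / (t * r) / r * x $ j) * r\<^sup>2"
    proof -
      have "(\<Sum>i\<in>UNIV. x $ i * axis i 1 $ j) = x $ j"
        by (simp add: axis_def if_distrib sum.delta cong: if_cong)
      thus ?thesis by (simp only: sum_subtractf sum_distrib_left[symmetric] rr)
    qed
    finally show ?thesis using r t lam by (simp add: power2_eq_square algebra_simps)
  qed
  show "c' (1,0) + (\<Sum>i\<in>UNIV. Us z $ i * c' (0, axis i 1)) + k * cs z * (\<Sum>i\<in>UNIV. U' i (0, axis i 1)) = 0" (is "?l = 0")
  proof -
    have "?l = - r / (lam\<^sup>2 * t\<^sup>2) * (lam * (Cy - Cx) - Vx * (Cx - lam * Cy) + k * Cx * (lam * Vy - 3 * Vx))"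
      unfolding s1 s2 unfolding ce c'e Cx_def[symmetric] Cy_def[symmetric]
      using r t lam by (simp add: power2_eq_square divide_simps) (simp add: algebra_simps)
    thus ?thesis using E(2) by simp
  qed
  show "U' j (1,0) + (\<Sum>i\<in>UNIV. Us z $ i * U' j (0, axis i 1)) + cs z / k * c' (0, axis j 1) = 0" (is "?l = 0")
  proof -
    have "?l = x $ j / (lam\<^sup>2 * t\<^sup>2) * (lam * (Vx - Vy) + Vx\<^sup>2 - lam * Vx * Vy + (Cx\<^sup>2 - lam * Cx * Cy) / k)"
      unfolding s3 unfolding ce c'e U'e Cx_def[symmetric] Cy_def[symmetric] Vx_def[symmetric] Vy_def[symmetric]
      using r t lam k by (simp add: inner_axis power2_eq_square divide_simps) (simp add: algebra_simps)
    thus ?thesis using E(1) by simp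
  qed
qed

end

section \<open>Tools for the exceptional set, blow-up rates and entropy\<close>

lemma AE_fst_neq_graph:
  fixes g :: "real^3 \<Rightarrow> real"
  assumes [measurable]: "g \<in> borel_measurable borel"
  shows "AE z::spacetime in lborel. fst z \<noteq> g (snd z)"
proof (rule AE_spacetimeI)
  have m: "{z \<in> space (lborel \<Otimes>\<^sub>M lborel). fst z \<noteq> g (snd z)} \<in> sets (lborel \<Otimes>\<^sub>M lborel :: spacetime measure)"
    unfolding lborel_prod by measurable
  have "AE x in lborel. AE t in lborel. t \<noteq> g x" by (simp add: AE_lborel_singleton)
  thus "AE t in lborel. AE x in lborel. fst (t, x) \<noteq> g (snd (t, x))"
    using lborel_pair.AE_commute[of "\<lambda>t x. t \<noteq> g x"] m by (simp add: case_prod_beta')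
qed measurable

text \<open>Completing the square leaves two candidates for \<open>s\<close>. At a fixed time other
  than 0 the sonic surfaces are such spheres.\<close>

lemma finite_line_sphere:
  fixes x :: "real^3"
  shows "finite {s. norm (x + s *\<^sub>R axis i 1) = \<rho>}"
proof (rule finite_subset)
  show "{s. norm (x + s *\<^sub>R axis i 1) = \<rho>}
      \<subseteq> {- (x $ i) + sqrt ((x $ i)\<^sup>2 + \<rho>\<^sup>2 - (norm x)\<^sup>2), - (x $ i) - sqrt ((x $ i)\<^sup>2 + \<rho>\<^sup>2 - (norm x)\<^sup>2)}"
  proof
    fix s assume "s \<in> {s. norm (x + s *\<^sub>R axis i 1) = \<rho>}"
    hence "(norm (x + s *\<^sub>R axis i 1))\<^sup>2 = \<rho>\<^sup>2" by simp
    moreover have "(norm (x + s *\<^sub>R axis i 1))\<^sup>2 = (norm x)\<^sup>2 + 2 * s * x $ i + s\<^sup>2"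
      unfolding power2_norm_eq_inner
      by (simp add: inner_add_left inner_add_right inner_axis inner_axis' axis_nth power2_eq_square distrib_left)
    ultimately have "(norm x)\<^sup>2 + 2 * s * x $ i + s\<^sup>2 = \<rho>\<^sup>2" by simp
    hence "(s + x $ i)\<^sup>2 = (x $ i)\<^sup>2 + \<rho>\<^sup>2 - (norm x)\<^sup>2" by (simp add: power2_eq_square algebra_simps)
    hence "\<bar>s + x $ i\<bar> = sqrt ((x $ i)\<^sup>2 + \<rho>\<^sup>2 - (norm x)\<^sup>2)" by (metis real_sqrt_abs)
    thus "s \<in> {- (x $ i) + sqrt ((x $ i)\<^sup>2 + \<rho>\<^sup>2 - (norm x)\<^sup>2), - (x $ i) - sqrt ((x $ i)\<^sup>2 + \<rho>\<^sup>2 - (norm x)\<^sup>2)}"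
      by (auto simp: abs_if split: if_splits)
  qed
qed simp

lemma filterlim_norm_powr_at_top:
  fixes f :: "spacetime \<Rightarrow> real"
  assumes "A > 0" "b < 0" "\<And>x. x \<noteq> 0 \<Longrightarrow> f (0, x) = A * norm x powr b"
  shows "blows_up_at_time_zero f"
  unfolding blows_up_at_time_zero_def
proof -
  have "filterlim (\<lambda>r. r powr b) at_top (at_right 0)"
  proof -
    have "filterlim (\<lambda>r::real. inverse r powr (- b)) at_top (at_right 0)"
      by (rule filterlim_compose[OF real_powr_at_top filterlim_inverse_at_top_right]) (use assms in simp)
    moreover have "\<forall>\<^sub>F r in at_right 0. inverse r powr (- b) = r powr b"
      by (auto simp: eventually_at_filter powr_minus inverse_powr)
    ultimately show ?thesis by (rule filterlim_mono_eventually[OF _ order.refl order.refl])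
  qed
  hence "filterlim (\<lambda>r. A * r powr b) at_top (at_right 0)"
    using assms(1) by (intro filterlim_tendsto_pos_mult_at_top[OF tendsto_const])
  moreover have "filterlim norm (at_right 0) (at (0::real^3))"
    unfolding filterlim_at by (auto intro!: tendsto_norm_zero simp: eventually_at_filter)
  ultimately have "filterlim (\<lambda>x::real^3. A * norm x powr b) at_top (at 0)" by (rule filterlim_compose)
  moreover have "\<forall>\<^sub>F x in at 0. A * norm x powr b = f (0, x)"
    by (auto simp: eventually_at_filter assms(3))
  ultimately show "filterlim (\<lambda>x. f (0, x)) at_top (at 0)"
    by (rule filterlim_mono_eventually[OF _ order.refl order.refl])
qed

lemma ex_specific_entropy:
  assumes "cv > 0" "\<gamma> > 1"
  shows "specific_entropy \<gamma> cv (\<lambda>p. cv * (ln (snd p) - (\<gamma> - 1) * ln (fst p)))"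
  unfolding specific_entropy_def
proof (intro allI impI)
  fix \<rho> \<theta> :: real assume pos: "\<rho> > 0" "\<theta> > 0"
  have df: "(fst has_derivative fst) (at (\<rho>, \<theta>))" "(snd has_derivative snd) (at (\<rho>, \<theta>))"
    by (intro bounded_linear_imp_has_derivative bounded_linear_fst bounded_linear_snd)+
  have "((\<lambda>p. cv * (ln (snd p) - (\<gamma> - 1) * ln (fst p))) has_derivative
      (\<lambda>v. cv * (snd v / \<theta> - (\<gamma> - 1) * (fst v / \<rho>)))) (at (\<rho>, \<theta>))"
    using pos df by (auto intro!: derivative_eq_intros simp: divide_inverse mult_ac)
  moreover have "cv * d\<theta> = \<theta> * (cv * (snd (d\<rho>, d\<theta>) / \<theta> - (\<gamma> - 1) * (fst (d\<rho>, d\<theta>) / \<rho>)))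
      - pressure \<gamma> \<rho> (cv * \<theta>) * (- d\<rho> / \<rho>\<^sup>2)" for d\<rho> d\<theta>
    using pos by (simp add: pressure_def field_simps power2_eq_square)
  ultimately show "\<exists>dS. ((\<lambda>p. cv * (ln (snd p) - (\<gamma> - 1) * ln (fst p))) has_derivative dS) (at (\<rho>, \<theta>)) \<and>
      (\<forall>d\<rho> d\<theta>. cv * d\<theta> = \<theta> * dS (d\<rho>, d\<theta>) - pressure \<gamma> \<rho> (cv * \<theta>) * (- d\<rho> / \<rho>\<^sup>2))"
    by blast
qed

section \<open>Regularity, conservation laws and blow-up of the flow\<close>

context blowup_profile
begin

lemma off_S: assumes "z \<notin> S" shows "fst z \<noteq> 0" "snd z \<noteq> 0" "fst z / norm (snd z) powr lam \<noteq> 0"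
    "fst z / norm (snd z) powr lam \<notin> X"
  using assms by (auto simp: S_def)

lemma compact_time_bounds:
  assumes "compact T" "T \<subseteq> {z::spacetime. fst z \<noteq> 0}"
  shows "\<exists>d>0. \<exists>\<rho>\<ge>0. \<forall>z\<in>T. \<bar>fst z\<bar> \<ge> d \<and> norm (snd z) \<le> \<rho>"
proof (cases "T = {}")
  case False
  have "\<exists>y\<in>T. \<forall>z\<in>T. \<bar>fst y\<bar> \<le> \<bar>fst z\<bar>"
    by (rule continuous_attains_inf[OF assms(1) False]) (intro continuous_intros)
  then obtain y where y: "y \<in> T" "\<And>z. z \<in> T \<Longrightarrow> \<bar>fst y\<bar> \<le> \<bar>fst z\<bar>" by blast
  obtain y' where y': "y' \<in> T" "\<And>z. z \<in> T \<Longrightarrow> norm (snd z) \<le> norm (snd y')"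
  proof -
    have "\<exists>y\<in>T. \<forall>z\<in>T. norm (snd z) \<le> norm (snd y)"
      by (rule continuous_attains_sup[OF assms(1) False]) (intro continuous_intros)
    thus ?thesis using that by blast
  qed
  have "\<bar>fst y\<bar> > 0" using y(1) assms(2) by auto
  thus ?thesis using y(2) y'(2) norm_ge_zero by blast
qed (auto intro: exI[of _ 1] exI[of _ 0])

lemma inner_div_le: "r = norm x \<Longrightarrow> \<bar>(x \<bullet> snd v) / r\<bar> \<le> norm (v :: spacetime)" for x :: "real^3"
proof (cases "x = 0")
  case False
  assume r: "r = norm x"
  have "\<bar>x \<bullet> snd v\<bar> \<le> norm x * norm (snd v)" by (rule Cauchy_Schwarz_ineq2)
  hence "\<bar>(x \<bullet> snd v) / r\<bar> \<le> norm (snd v)" using False r by (simp add: divide_le_eq mult.commute)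
  also have "\<dots> \<le> norm v" using norm_snd_le[of "snd v" "fst v"] by simp
  finally show ?thesis .
qed simp

lemma abs_mult_le: "\<bar>x\<bar> \<le> p \<Longrightarrow> \<bar>y\<bar> \<le> q \<Longrightarrow> \<bar>x * y\<bar> \<le> p * q" for x y p q :: real
  using mult_mono[of "\<bar>x\<bar>" p "\<bar>y\<bar>" q] by (simp add: abs_mult)

lemma fst_le: "\<bar>fst v\<bar> \<le> norm (v :: spacetime)"
  using norm_fst_le[of "fst v" "snd v"] by simp

lemma tame_cs: "tame S cs"
  unfolding tame_def
proof (intro conjI allI impI)
  show c: "continuous_on {z. fst z \<noteq> 0} cs"
    using cs_cont unfolding continuous_off_origin_def by (rule continuous_on_subset) auto
  fix T :: "spacetime set" assume T: "compact T" "T \<subseteq> {z. fst z \<noteq> 0}"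
  obtain d \<rho> where d: "d > 0" "\<rho> \<ge> 0" "\<And>z. z \<in> T \<Longrightarrow> \<bar>fst z\<bar> \<ge> d" "\<And>z. z \<in> T \<Longrightarrow> norm (snd z) \<le> \<rho>"
    using compact_time_bounds[OF T] by blast
  have "bounded (cs ` T)"
    by (intro compact_imp_bounded compact_continuous_image continuous_on_subset[OF c T(2)] T(1))
  then obtain N where "\<forall>y\<in>cs ` T. norm y \<le> N" unfolding bounded_iff by blast
  hence N: "\<And>z. z \<in> T \<Longrightarrow> \<bar>cs z\<bar> \<le> N" by auto
  define A where "A = N / d + \<rho> * M / d\<^sup>2"
  define B where "B = M / d"
  show "\<exists>M. \<forall>z\<in>T - S. \<exists>f'. (cs has_derivative f') (at z) \<and> (\<forall>v. \<bar>f' v\<bar> \<le> M * norm v)"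
  proof (intro exI[of _ "A + B"] ballI)
    fix z assume z: "z \<in> T - S"
    hence zT: "z \<in> T" and zS: "z \<notin> S" by auto
    define t r \<xi> where "t = fst z" and "r = norm (snd z)" and "\<xi> = fst z / norm (snd z) powr lam"
    note o = off_S[OF zS, folded t_def \<xi>_def]
    have r: "r > 0" using o by (simp add: r_def)
    have t: "\<bar>t\<bar> \<ge> d" using d(3)[OF zT] by (simp add: t_def)
    have M0: "M \<ge> 0" using V_bd[of 0] by linarith
    have e: "\<bar>C \<xi> - lam * Cd \<xi>\<bar> \<le> M" by (rule Cd_bd[OF o(3,4)])
    have ce: "\<bar>cs z\<bar> = r / (lam * \<bar>t\<bar>) * \<bar>C \<xi>\<bar>"
      using c_off_axis[of r t] r o lam by (simp add: radial_scalar_def t_def r_def \<xi>_def abs_mult)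
    have N0: "N \<ge> 0" using N[OF zT] by linarith
    \<comment> \<open>\<open>C \<xi>\<close> is unbounded near the axis. It is split off by
      \<open>lam * (C - Cd) = (lam - 1) * C + (C - lam * Cd)\<close>, and together with its factor
      \<open>r / (lam * \<bar>t\<bar>)\<close> it is just the sound speed, which is bounded on
      \<open>T\<close>.\<close>
    have b1: "\<bar>r * (C \<xi> - Cd \<xi>) / (lam * t\<^sup>2)\<bar> \<le> A"
    proof -
      have "lam * \<bar>C \<xi> - Cd \<xi>\<bar> = \<bar>lam * (C \<xi> - Cd \<xi>)\<bar>" using lam by (simp add: abs_mult)
      also have "lam * (C \<xi> - Cd \<xi>) = (lam - 1) * C \<xi> + (C \<xi> - lam * Cd \<xi>)" by (simp add: algebra_simps)
      also have "\<bar>\<dots>\<bar> \<le> \<bar>(lam - 1) * C \<xi>\<bar> + \<bar>C \<xi> - lam * Cd \<xi>\<bar>" by (rule abs_triangle_ineq)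
      also have "\<dots> \<le> (lam - 1) * \<bar>C \<xi>\<bar> + M" using e lam by (simp add: abs_mult)
      also have "\<dots> \<le> lam * \<bar>C \<xi>\<bar> + lam * M" using lam M0 by (intro add_mono mult_right_mono) (auto simp: mult_le_cancel_right1)
      finally have "\<bar>C \<xi> - Cd \<xi>\<bar> \<le> \<bar>C \<xi>\<bar> + M" using lam by (simp add: distrib_left[symmetric])
      hence "r * \<bar>C \<xi> - Cd \<xi>\<bar> / (lam * t\<^sup>2) \<le> r * (\<bar>C \<xi>\<bar> + M) / (lam * t\<^sup>2)"
        using r lam by (intro divide_right_mono mult_left_mono) auto
      also have "\<dots> = \<bar>cs z\<bar> / \<bar>t\<bar> + r * M / (lam * t\<^sup>2)"
        unfolding ce using o lam by (simp add: field_simps power2_eq_square)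
      also have "\<dots> \<le> N / d + \<rho> * M / (1 * d\<^sup>2)"
      proof (intro add_mono frac_le mult_mono)
        show "d\<^sup>2 \<le> t\<^sup>2" using t d(1) by (metis abs_of_pos abs_le_square_iff)
        show "r \<le> \<rho>" using d(4)[OF zT] by (simp add: r_def)
      qed (use N[OF zT] N0 t d lam M0 in auto)
      finally show ?thesis using r lam by (simp add: abs_mult A_def)
    qed
    have b2: "\<bar>(C \<xi> - lam * Cd \<xi>) / (lam * t)\<bar> \<le> B"
    proof -
      have "1 * d \<le> lam * \<bar>t\<bar>" using t lam d by (intro mult_mono) auto
      thus ?thesis unfolding B_def abs_divide abs_mult using e d lam by (intro frac_le) auto
    qed
    have "\<bar>r * (C \<xi> - Cd \<xi>) / (lam * t\<^sup>2) * fst v - (C \<xi> - lam * Cd \<xi>) / (lam * t) * ((snd z \<bullet> snd v) / r)\<bar> \<le> (A + B) * norm v" for v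
    proof -
      have "\<bar>r * (C \<xi> - Cd \<xi>) / (lam * t\<^sup>2) * fst v\<bar> \<le> A * norm v"
        by (rule abs_mult_le[OF b1 fst_le])
      moreover have "\<bar>(C \<xi> - lam * Cd \<xi>) / (lam * t) * ((snd z \<bullet> snd v) / r)\<bar> \<le> B * norm v"
        by (rule abs_mult_le[OF b2 inner_div_le[OF r_def]])
      ultimately show ?thesis unfolding distrib_right by linarith
    qed
    thus "\<exists>f'. (cs has_derivative f') (at z) \<and> (\<forall>v. \<bar>f' v\<bar> \<le> (A + B) * norm v)"
      using radial_derivatives(1)[OF zS, folded t_def r_def \<xi>_def] by blast
  qed
qed

lemma tame_Us: "tame S (\<lambda>z. Us z $ i)"
  unfolding tame_def
proof (intro conjI allI impI)
  have "continuous_on {z. fst z \<noteq> 0} Us"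
    using Us_cont unfolding continuous_off_origin_def by (rule continuous_on_subset) auto
  thus "continuous_on {z. fst z \<noteq> 0} (\<lambda>z. Us z $ i)" by (intro continuous_intros)
  fix T :: "spacetime set" assume T: "compact T" "T \<subseteq> {z. fst z \<noteq> 0}"
  obtain d \<rho> where d: "d > 0" "\<rho> \<ge> 0" "\<And>z. z \<in> T \<Longrightarrow> \<bar>fst z\<bar> \<ge> d" "\<And>z. z \<in> T \<Longrightarrow> norm (snd z) \<le> \<rho>"
    using compact_time_bounds[OF T] by blast
  show "\<exists>M. \<forall>z\<in>T - S. \<exists>f'. ((\<lambda>z. Us z $ i) has_derivative f') (at z) \<and> (\<forall>v. \<bar>f' v\<bar> \<le> M * norm v)"
  proof (intro exI[of _ "M / d + (\<rho> * (2 * M / d\<^sup>2) + M / d)"] ballI)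
    fix z assume z: "z \<in> T - S"
    hence zT: "z \<in> T" and zS: "z \<notin> S" by auto
    define t r \<xi> where "t = fst z" and "r = norm (snd z)" and "\<xi> = fst z / norm (snd z) powr lam"
    note o = off_S[OF zS, folded t_def \<xi>_def]
    have r: "r > 0" "r \<le> \<rho>" using o d(4)[OF zT] by (simp_all add: r_def)
    have t: "\<bar>t\<bar> \<ge> d" using d(3)[OF zT] by (simp add: t_def)
    have M0: "M \<ge> 0" using V_bd[of 0] by linarith
    have lt: "1 * d \<le> lam * \<bar>t\<bar>" using t lam d by (intro mult_mono) auto
    have "d\<^sup>2 \<le> \<bar>t\<bar>\<^sup>2" using t d by (intro power_mono) auto
    hence ltt: "d\<^sup>2 \<le> t\<^sup>2" by simp
    have lt2: "1 * d\<^sup>2 \<le> lam * t\<^sup>2" using ltt lam d by (intro mult_mono) auto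
    have b1: "\<bar>- V \<xi> / (lam * t)\<bar> \<le> M / d"
      unfolding abs_divide abs_mult abs_minus_cancel using V_bd[of \<xi>] lt d lam by (intro frac_le) auto
    have b2: "\<bar>(V \<xi> - Vd \<xi>) / (lam * t\<^sup>2)\<bar> \<le> 2 * M / d\<^sup>2"
      unfolding abs_divide abs_mult using V_bd[of \<xi>] Vd_bd[OF o(3,4)] lt2 d lam by (intro frac_le) auto
    \<comment> \<open>The coefficient is singular on the axis but always comes with a component of
      \<open>snd z\<close>, which is at most \<open>r\<close>.\<close>
    have b3: "\<bar>Vd \<xi> / (t * r)\<bar> * r \<le> M / d"
    proof -
      have "\<bar>Vd \<xi> / (t * r)\<bar> * r = \<bar>Vd \<xi>\<bar> / \<bar>t\<bar>" using r by (simp add: abs_mult)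
      also have "\<dots> \<le> M / d" using Vd_bd[OF o(3,4)] t d by (intro frac_le) auto
      finally show ?thesis .
    qed
    have xi: "\<bar>snd z $ i\<bar> \<le> r" unfolding r_def by (rule component_le_norm_cart)
    have "\<bar>- V \<xi> / (lam * t) * (snd v $ i) + snd z $ i * ((V \<xi> - Vd \<xi>) / (lam * t\<^sup>2) * fst v + Vd \<xi> / (t * r) * ((snd z \<bullet> snd v) / r))\<bar>
        \<le> (M / d + (\<rho> * (2 * M / d\<^sup>2) + M / d)) * norm v" for v
    proof -
      have "\<bar>snd v $ i\<bar> \<le> norm v"
        using order_trans[OF component_le_norm_cart norm_snd_le[of "snd v" "fst v"]] by simp
      hence a1: "\<bar>- V \<xi> / (lam * t) * (snd v $ i)\<bar> \<le> M / d * norm v"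
        by (rule abs_mult_le[OF b1])
      have "\<bar>snd z $ i * ((V \<xi> - Vd \<xi>) / (lam * t\<^sup>2) * fst v)\<bar> = \<bar>snd z $ i\<bar> * (\<bar>(V \<xi> - Vd \<xi>) / (lam * t\<^sup>2)\<bar> * \<bar>fst v\<bar>)"
        by (simp add: abs_mult)
      also have "\<dots> \<le> \<rho> * (2 * M / d\<^sup>2 * norm v)"
        by (intro mult_mono order_trans[OF xi r(2)] b2 fst_le mult_nonneg_nonneg divide_nonneg_nonneg abs_ge_zero zero_le_power2 order_trans[OF less_imp_le[OF r(1)] r(2)] norm_ge_zero M0 zero_le_numeral)
      finally have a2: "\<bar>snd z $ i * ((V \<xi> - Vd \<xi>) / (lam * t\<^sup>2) * fst v)\<bar> \<le> \<rho> * (2 * M / d\<^sup>2) * norm v" by (simp add: mult.assoc)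
      have "\<bar>snd z $ i * (Vd \<xi> / (t * r) * ((snd z \<bullet> snd v) / r))\<bar> = \<bar>Vd \<xi> / (t * r)\<bar> * \<bar>snd z $ i\<bar> * \<bar>(snd z \<bullet> snd v) / r\<bar>"
        by (simp add: abs_mult)
      also have "\<dots> \<le> \<bar>Vd \<xi> / (t * r)\<bar> * r * norm v"
        using xi r inner_div_le[OF r_def, of v] by (intro mult_mono) auto
      also have "\<dots> \<le> M / d * norm v" using b3 by (rule mult_right_mono) simp
      finally have a3: "\<bar>snd z $ i * (Vd \<xi> / (t * r) * ((snd z \<bullet> snd v) / r))\<bar> \<le> M / d * norm v" .
      have "\<bar>x + (y + w)\<bar> \<le> a + (b + c)" if "\<bar>x\<bar> \<le> a" "\<bar>y\<bar> \<le> b" "\<bar>w\<bar> \<le> c" for x y w a b c :: real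
        using that by linarith
      from this[OF a1 a2 a3] show ?thesis unfolding distrib_left distrib_right .
    qed
    thus "\<exists>f'. ((\<lambda>z. Us z $ i) has_derivative f') (at z) \<and> (\<forall>v. \<bar>f' v\<bar> \<le> (M / d + (\<rho> * (2 * M / d\<^sup>2) + M / d)) * norm v)"
      using radial_derivatives(2)[OF zS, of i, folded t_def r_def \<xi>_def] by blast
  qed
qed

lemma S_null: "AE z in lborel. z \<notin> S"
proof -
  have 1: "AE z::spacetime in lborel. \<forall>a\<in>insert 0 X. fst z \<noteq> a * norm (snd z) powr lam"
    using X by (subst AE_finite_all) (auto intro!: AE_fst_neq_graph)
  show ?thesis using 1 AE_snd_neq_0
    by eventually_elim (auto simp: S_def)
qed

text \<open>A line in time direction off the axis meets each surface
  \<open>t = a * r powr lam\<close> once. A spatial line at a time other than 0 meets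
  \<open>S\<close> only in spheres around the centre, the axis being the one of radius 0.\<close>

lemma S_lines:
  "AE z in lborel. finite {s. z + s *\<^sub>R (1, 0) \<in> S}"
  "AE z in lborel. finite {s. z + s *\<^sub>R (0, axis i 1) \<in> S}"
proof -
  show "AE z in lborel. finite {s. z + s *\<^sub>R (1, 0) \<in> S}"
    using AE_snd_neq_0
  proof eventually_elim
    case (elim z)
    have "{s. z + s *\<^sub>R (1, 0) \<in> S} \<subseteq> (\<lambda>a. a * norm (snd z) powr lam - fst z) ` insert 0 X"
    proof
      fix s assume "s \<in> {s. z + s *\<^sub>R (1, 0) \<in> S}"
      hence "fst z + s = 0 \<or> (fst z + s) / norm (snd z) powr lam \<in> X" using elim by (auto simp: S_def)
      hence "\<exists>a\<in>insert 0 X. s = a * norm (snd z) powr lam - fst z"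
      proof
        assume "(fst z + s) / norm (snd z) powr lam \<in> X"
        thus ?thesis using elim by (intro bexI[of _ "(fst z + s) / norm (snd z) powr lam"]) auto
      qed auto
      thus "s \<in> (\<lambda>a. a * norm (snd z) powr lam - fst z) ` insert 0 X" by blast
    qed
    thus ?case by (rule finite_subset) (use X in simp)
  qed
  have "AE z::spacetime in lborel. fst z \<noteq> 0" using AE_fst_neq_graph[of "\<lambda>_. 0"] by simp
  thus "AE z in lborel. finite {s. z + s *\<^sub>R (0, axis i 1) \<in> S}"
  proof eventually_elim
    case (elim z)
    have "{s. z + s *\<^sub>R (0, axis i 1) \<in> S} \<subseteq> (\<Union>\<rho>\<in>insert 0 ((\<lambda>a. (fst z / a) powr (1 / lam)) ` X). {s. norm (snd z + s *\<^sub>R axis i 1) = \<rho>})"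
    proof
      fix s assume s: "s \<in> {s. z + s *\<^sub>R (0, axis i 1) \<in> S}"
      define n where "n = norm (snd z + s *\<^sub>R axis i 1)"
      have "n = 0 \<or> n \<in> (\<lambda>a. (fst z / a) powr (1 / lam)) ` X"
      proof (cases "n = 0")
        case False
        hence "fst z / n powr lam \<in> X" using s elim by (auto simp: S_def n_def)
        moreover have "n = (fst z / (fst z / n powr lam)) powr (1 / lam)"
          using elim False lam by (simp add: powr_powr n_def)
        ultimately show ?thesis by blast
      qed simp
      thus "s \<in> (\<Union>\<rho>\<in>insert 0 ((\<lambda>a. (fst z / a) powr (1 / lam)) ` X). {s. norm (snd z + s *\<^sub>R axis i 1) = \<rho>})"
        by (auto simp: n_def)
    qed
    thus ?case by (rule finite_subset) (intro finite_UN_I finite_line_sphere, use X in simp)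
  qed
qed

lemma sing_cs: "sing (lam - 1) cs" and sing_Us: "sing (lam - 1) (\<lambda>z. Us z $ i)"
  and sing_ds: "sing ((lam - 1) / k) (\<lambda>z. cs z powr (1 / k))"
proof -
  obtain K where K: "\<And>x. \<bar>Cq x\<bar> \<le> K" using Cq_bounded by blast
  obtain L where L: "\<And>x. \<bar>Vq x\<bar> \<le> L" using Vq_bounded by blast
  have b: "\<bar>r powr (1 - lam) / lam * y\<bar> \<le> N / lam * r powr (- (lam - 1))" if "\<bar>y\<bar> \<le> N" for r y N
  proof -
    have "\<bar>r powr (1 - lam) / lam * y\<bar> \<le> r powr (1 - lam) / lam * N"
      using that lam by (intro abs_mult_le) auto
    thus ?thesis by (simp add: mult.commute)
  qed
  have cb: "\<bar>cs z\<bar> \<le> K / lam * norm (snd z) powr (- (lam - 1))" if "snd z \<noteq> 0" for z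
    using b[OF K, of "norm (snd z)" "fst z / norm (snd z) powr lam"] that by (simp add: radial_scalar_def cc_def)
  show "sing (lam - 1) cs" unfolding sing_def using cb by blast
  show "sing (lam - 1) (\<lambda>z. Us z $ i)" unfolding sing_def
  proof (intro allI exI[of _ "L / lam"] ballI impI)
    fix z :: spacetime assume z: "snd z \<noteq> 0"
    have "\<bar>Us z $ i\<bar> \<le> norm (Us z)" by (rule component_le_norm_cart)
    also have "\<dots> = \<bar>uu (fst z) (norm (snd z))\<bar>" using z by (simp add: radial_vector_def)
    also have "\<dots> \<le> L / lam * norm (snd z) powr (- (lam - 1))"
      using b[OF L, of "norm (snd z)" "fst z / norm (snd z) powr lam"] z by (simp add: uu_def)
    finally show "\<bar>Us z $ i\<bar> \<le> L / lam * norm (snd z) powr (- (lam - 1))" .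
  qed
  have K0: "K \<ge> 0" using K[of 0] by linarith
  show "sing ((lam - 1) / k) (\<lambda>z. cs z powr (1 / k))" unfolding sing_def
  proof (intro allI exI[of _ "(K / lam) powr (1 / k)"] ballI impI)
    fix z :: spacetime assume z: "snd z \<noteq> 0"
    have "cs z > 0" using z by (intro cs_pos) auto
    hence "cs z powr (1 / k) \<le> (K / lam * norm (snd z) powr (- (lam - 1))) powr (1 / k)"
      using cb[OF z] k by (intro powr_mono2) auto
    also have "\<dots> = (K / lam) powr (1 / k) * norm (snd z) powr (- ((lam - 1) / k))"
      using K0 lam by (subst powr_mult) (auto simp: powr_powr diff_divide_distrib)
    finally show "\<bar>cs z powr (1 / k)\<bar> \<le> (K / lam) powr (1 / k) * norm (snd z) powr (- ((lam - 1) / k))" by simp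
  qed
qed

text \<open>Isentropy prescribes the density as the power \<open>1 / k\<close> of the sound speed;
  this produces the exponent \<open>(1 - lam) / k\<close>, which is the required \<kappa> because
  \<open>\<gamma> - 1 = 2 * k\<close>.\<close>

definition "RR x = (- Cq x / lam) powr (1 / k)"

lemma self_similar_flow:
  assumes "\<kappa> = (1 - lam) / k"
  shows "self_similar lam \<kappa> RR V C dd uu cc"
  unfolding self_similar_def
proof (intro conjI allI impI)
  fix t r :: real assume r: "r > 0"
  have "cc t r = r powr (1 - lam) * (- Cq (t / r powr lam) / lam)" using r by (simp add: cc_def)
  hence "dd t r = (r powr (1 - lam) * (- Cq (t / r powr lam) / lam)) powr (1 / k)" by (simp only: dd_def)
  also have "\<dots> = (r powr (1 - lam)) powr (1 / k) * RR (t / r powr lam)"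
    unfolding RR_def by (rule powr_mult)
  finally show "dd t r = r powr \<kappa> * RR (t / r powr lam)" by (simp add: powr_powr assms)
next
  fix t r :: real assume r: "r > 0" "t \<noteq> 0"
  thus "let x = t / r powr lam in uu t r = - (r powr (1 - lam) / lam) * (V x / x) \<and> cc t r = - (r powr (1 - lam) / lam) * (C x / x)"
    by (simp add: uu_def cc_def Vq_def Cq_def Let_def)
next
  show "\<exists>v0 c0. ((\<lambda>x. V x / x) \<longlongrightarrow> v0) (at 0) \<and> ((\<lambda>x. C x / x) \<longlongrightarrow> c0) (at 0) \<and>
        (\<forall>r>0. uu 0 r = - (r powr (1 - lam) / lam) * v0 \<and> cc 0 r = - (r powr (1 - lam) / lam) * c0)"
    using V_lim C_lim by (intro exI[of _ v0] exI[of _ c0]) (simp add: uu_def cc_def Vq_def Cq_def)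
next
  fix t :: real assume t: "t \<noteq> 0"
  \<comment> \<open>A ray along a coordinate axis turns continuity in space-time into the one-sided
    radial limits.\<close>
  have path: "((\<lambda>r::real. (t, r *\<^sub>R (axis 1 1 :: real^3))) \<longlongrightarrow> (t, 0)) (at_right 0)"
    by (auto intro!: tendsto_eq_intros)
  have nr: "norm (r *\<^sub>R (axis 1 1 :: real^3)) = \<bar>r\<bar>" for r by (simp add: norm_axis_1)
  have op: "open (- {(0::real, 0::real^3)})" by (intro open_Compl closed_singleton)
  have "isCont cs (t, 0)"
    using cs_cont t continuous_on_eq_continuous_at[OF op] unfolding continuous_off_origin_def by blast
  from isCont_tendsto_compose[OF this path]
  have "((\<lambda>r. cc t \<bar>r\<bar>) \<longlongrightarrow> cc t 0) (at_right 0)" by (simp add: radial_scalar_def nr)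
  thus c: "(cc t \<longlongrightarrow> cc t 0) (at_right 0)"
    by (rule Lim_transform_eventually) (auto simp: eventually_at_filter)
  show "(dd t \<longlongrightarrow> dd t 0) (at_right 0)"
    unfolding dd_def[abs_def] using cc_pos[of 0 t] t by (intro tendsto_powr c tendsto_const) auto
  have "isCont Us (t, 0)"
    using Us_cont t continuous_on_eq_continuous_at[OF op] unfolding continuous_off_origin_def by blast
  from tendsto_norm[OF isCont_tendsto_compose[OF this path]]
  have "((\<lambda>r. norm (Us (t, r *\<^sub>R axis 1 1))) \<longlongrightarrow> 0) (at_right 0)" by (simp add: radial_vector_def)
  hence "((\<lambda>r. \<bar>uu t r\<bar>) \<longlongrightarrow> 0) (at_right 0)"
    by (rule Lim_transform_eventually, intro eventually_mono[OF eventually_at_right_less[of 0]])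
       (simp add: radial_vector_def nr norm_axis_1 abs_mult)
  hence "(uu t \<longlongrightarrow> 0) (at_right 0)" by (simp add: tendsto_rabs_zero_iff)
  thus "(uu t \<longlongrightarrow> uu t 0) (at_right 0)" by (simp add: uu_def)
qed

abbreviation "ds \<equiv> radial_scalar dd"

lemma ds_eq: "ds = (\<lambda>z. cs z powr (1 / k))"
  by (simp add: radial_scalar_def dd_def fun_eq_iff)

lemma conservation_laws:
  assumes g: "\<gamma> = 1 + 2 * k"
  defines "es \<equiv> radial_scalar (\<lambda>t r. internal_energy \<gamma> (cc t r))"
  shows "weak_euler_solution \<gamma> ds Us es"
proof -
  have g0: "\<gamma> > 0" "\<gamma> - 1 = 2 * k" using g k by auto
  have es: "es = (\<lambda>z. (cs z)\<^sup>2 / (\<gamma> * (\<gamma> - 1)))"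
    by (simp add: es_def radial_scalar_def internal_energy_def fun_eq_iff)
  define ps where "ps z = pressure \<gamma> (ds z) (es z)" for z
  define Es where "Es z = es z + (norm (Us z))\<^sup>2 / 2" for z
  have ps: "ps = (\<lambda>z. ds z * ((cs z)\<^sup>2 * (1 / \<gamma>)))"
    using g0 k by (auto simp: ps_def pressure_def es fun_eq_iff)
  have Es: "Es = (\<lambda>z. (cs z)\<^sup>2 * (1 / (\<gamma> * (\<gamma> - 1))) + (\<Sum>i\<in>UNIV. Us z $ i * Us z $ i) * (1 / 2))"
    by (auto simp: Es_def es fun_eq_iff power2_norm_eq_inner inner_vec_def)
  have tc: "tame S cs" and tU: "\<And>i. tame S (\<lambda>z. Us z $ i)" by (rule tame_cs tame_Us)+
  have td: "tame S ds" unfolding ds_eq by (rule tame_powr[OF tc]) (auto intro!: cs_pos)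
  have tp: "tame S ps" unfolding ps power2_eq_square by (intro tame_mult tame_const td tc)
  have tE: "tame S Es" unfolding Es power2_eq_square
    by (intro tame_add tame_mult tame_const tame_sum tc tU) auto
  let ?O = "- {(0::real, 0::real^3)}"
  have cc: "continuous_on ?O cs" and cU: "continuous_on ?O Us"
    using cs_cont Us_cont by (auto simp: continuous_off_origin_def)
  have cs0: "\<forall>z\<in>?O. cs z \<noteq> 0"
  proof
    fix z assume "z \<in> ?O"
    hence "cs z > 0" by (intro cs_pos) simp
    thus "cs z \<noteq> 0" by simp
  qed
  have cd: "continuous_on ?O ds" unfolding ds_eq
    by (rule continuous_on_powr[OF cc continuous_on_const cs0])
  have cp: "continuous_on ?O ps" unfolding ps by (intro continuous_intros cd cc)
  have cE: "continuous_on ?O Es" unfolding Es by (intro continuous_intros cU cc)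
  define b where "b = lam - 1"
  have b: "b \<ge> 0" using lam by (simp add: b_def)
  \<comment> \<open>This is the order of the energy flux, the most singular quantity:
    \<open>b / k\<close> for the density and \<open>b\<close> for each of three factors of velocity
    or sound speed. All the other densities and fluxes are raised to this order.\<close>
  define a where "a = b / k + (b + (b + b))"
  have a: "0 \<le> a" "a < 3" and bb: "b / k \<ge> 0"
    using small lam k by (auto simp: a_def b_def distrib_left)
  have sc: "sing b cs" and sU: "\<And>i. sing b (\<lambda>z. Us z $ i)" and sd: "sing (b / k) ds"
    using sing_cs sing_Us sing_ds by (auto simp: b_def ds_eq)
  have sp: "sing (b / k + (b + b)) ps"
    using sing_mult[OF sd sing_mult[OF sing_mult[OF sc sc] sing_const[of "1 / \<gamma>"]]] by (simp add: ps power2_eq_square)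
  have sE: "sing (b + b) Es"
  proof -
    have "sing (b + b) (\<lambda>z. cs z * cs z * (1 / (\<gamma> * (\<gamma> - 1))))"
      using sing_mult[OF sing_mult[OF sc sc] sing_const[of "1 / (\<gamma> * (\<gamma> - 1))"]] by (simp only: add_0_right)
    moreover have "sing (b + b) (\<lambda>z. (\<Sum>i\<in>UNIV. Us z $ i * Us z $ i) * (1 / 2))"
    proof -
      have "sing (b + b) (\<lambda>z. \<Sum>i\<in>UNIV. Us z $ i * Us z $ i)"
        by (intro sing_sum sing_mult sU) (use b in auto)
      from sing_mult[OF this sing_const[of "1 / 2"]] show ?thesis by (simp only: add_0_right)
    qed
    ultimately show ?thesis unfolding Es power2_eq_square by (rule sing_add)
  qed
  have sv: "\<exists>K. \<forall>z\<in>cball 0 \<rho>. snd z \<noteq> 0 \<longrightarrow> norm (f z) \<le> K * norm (snd z) powr (- a)" if "sing a f" for f :: "spacetime \<Rightarrow> real" and \<rho>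
    using that unfolding sing_def real_norm_def by blast
  have loc: "\<exists>c' U'. (cs has_derivative c') (at z) \<and> (\<forall>i. ((\<lambda>z. Us z $ i) has_derivative U' i) (at z))" if "z \<notin> S" for z
    by (intro exI conjI allI) (rule radial_derivatives[OF that])+
  have der: "\<exists>c' U' s. ds z = s * k * cs z \<and> (ds has_derivative (\<lambda>v. s * c' v)) (at z) \<and>
     (\<forall>i. ((\<lambda>z. Us z $ i) has_derivative U' i) (at z)) \<and>
     (ps has_derivative (\<lambda>v. s * (cs z)\<^sup>2 * c' v)) (at z) \<and>
     (Es has_derivative (\<lambda>v. cs z * c' v / (\<gamma> * k) + (\<Sum>i\<in>UNIV. Us z $ i * U' i v))) (at z) \<and>
     c' (1,0) + (\<Sum>i\<in>UNIV. Us z $ i * c' (0, axis i 1)) + k * cs z * (\<Sum>i\<in>UNIV. U' i (0, axis i 1)) = 0 \<and>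
     (\<forall>j. U' j (1,0) + (\<Sum>i\<in>UNIV. Us z $ i * U' j (0, axis i 1)) + cs z / k * c' (0, axis j 1) = 0)"
    if zS: "z \<notin> S" for z
  proof -
    obtain c' U' where d: "(cs has_derivative c') (at z)" "\<And>i. ((\<lambda>z. Us z $ i) has_derivative U' i) (at z)"
      using loc[OF zS] by blast
    have cz: "cs z > 0" using off_S[OF zS] by (intro cs_pos) auto
    define s where "s = ds z / (k * cs z)"
    have s: "ds z = s * k * cs z" using cz k by (simp add: s_def)
    have "((\<lambda>y. y powr (1 / k)) has_real_derivative 1 / k * cs z powr (1 / k - 1)) (at (cs z))"
      using cz by (rule has_real_derivative_powr)
    moreover have "1 / k * cs z powr (1 / k - 1) = s"
      using cz k by (simp add: s_def ds_eq powr_diff)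
    ultimately have "((\<lambda>y. y powr (1 / k)) has_real_derivative s) (at (cs z))" by simp
    from has_derivative_compose[OF d(1) this[THEN has_field_derivative_imp_has_derivative]]
    have dd': "(ds has_derivative (\<lambda>v. s * c' v)) (at z)" by (simp add: ds_eq)
    have dp: "(ps has_derivative (\<lambda>v. s * (cs z)\<^sup>2 * c' v)) (at z)"
      unfolding ps power2_eq_square
      by (rule has_derivative_eq_rhs[OF has_derivative_mult[OF dd' has_derivative_mult[OF has_derivative_mult[OF d(1) d(1)] has_derivative_const]]])
         (use g0 k in \<open>simp add: fun_eq_iff s g divide_simps, simp add: algebra_simps\<close>)
    have dE: "(Es has_derivative (\<lambda>v. cs z * c' v / (\<gamma> * k) + (\<Sum>i\<in>UNIV. Us z $ i * U' i v))) (at z)"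
      unfolding Es power2_eq_square
      by (rule has_derivative_eq_rhs[OF has_derivative_add[OF has_derivative_mult[OF has_derivative_mult[OF d(1) d(1)] has_derivative_const]
             has_derivative_mult[OF has_derivative_sum[OF has_derivative_mult[OF d(2) d(2)]] has_derivative_const]]])
         (use g0 k in \<open>auto simp: fun_eq_iff sum_distrib_right sum_distrib_left mult_ac\<close>)
    show ?thesis
      using s dd' d(2) dp dE nonconservative_euler[OF zS d] by blast
  qed
  have mass: "weak_conservation_law ds (\<lambda>z. ds z *\<^sub>R Us z)"
  proof (rule weak_conservation_lawI[where S=S and a=a])
    show "\<exists>K. \<forall>z\<in>cball 0 \<rho>. snd z \<noteq> 0 \<longrightarrow> norm (ds z) \<le> K * norm (snd z) powr (- a)" for \<rho>
      by (rule sv[OF sing_mono[OF sd]]) (use b in \<open>simp add: a_def\<close>)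
    show "\<exists>K. \<forall>z\<in>cball 0 \<rho>. snd z \<noteq> 0 \<longrightarrow> norm (ds z *\<^sub>R Us z) \<le> K * norm (snd z) powr (- a)" for \<rho>
      by (rule sing_vector) (use sing_mono[OF sing_mult[OF sd sU]] b in \<open>simp add: a_def\<close>)
    fix z w' F' assume zS: "z \<notin> S" and w': "(ds has_derivative w') (at z)"
      and F': "\<And>i. ((\<lambda>z. (ds z *\<^sub>R Us z) $ i) has_derivative F' i) (at z)"
    obtain c' U' s where d: "ds z = s * k * cs z" "(ds has_derivative (\<lambda>v. s * c' v)) (at z)"
      "\<And>i. ((\<lambda>z. Us z $ i) has_derivative U' i) (at z)"
      and M: "c' (1,0) + (\<Sum>i\<in>UNIV. Us z $ i * c' (0, axis i 1)) + k * cs z * (\<Sum>i\<in>UNIV. U' i (0, axis i 1)) = 0"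
      using der[OF zS] by blast
    have e1: "w' = (\<lambda>v. s * c' v)" by (rule has_derivative_unique[OF w' d(2)])
    have e2: "F' i = (\<lambda>v. ds z * U' i v + s * c' v * Us z $ i)" for i
      using has_derivative_unique[OF F'[unfolded vector_scaleR_component real_scaleR_def] has_derivative_mult[OF d(2) d(3)]] .
    have "w' (1, 0) + (\<Sum>i\<in>UNIV. F' i (0, axis i 1))
       = s * (c' (1,0) + (\<Sum>i\<in>UNIV. Us z $ i * c' (0, axis i 1)) + k * cs z * (\<Sum>i\<in>UNIV. U' i (0, axis i 1)))"
      unfolding e1 e2 d(1) by (simp add: sum_3 algebra_simps)
    thus "w' (1, 0) + (\<Sum>i\<in>UNIV. F' i (0, axis i 1)) = 0" unfolding M by simp
  qed (use td tU cd cU a S_null S_lines in \<open>auto simp: continuous_off_origin_def S_def intro!: tame_mult continuous_intros\<close>)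
  have momentum: "weak_conservation_law (\<lambda>z. ds z * Us z $ j)
      (\<lambda>z. (ds z * Us z $ j) *\<^sub>R Us z + ps z *\<^sub>R axis j 1)" for j
  proof (rule weak_conservation_lawI[where S=S and a=a])
    have Fi: "((ds z * Us z $ j) *\<^sub>R Us z + ps z *\<^sub>R axis j 1) $ i = (ds z * Us z $ j) * Us z $ i + ps z * axis j 1 $ i" for z i
      by simp
    show "\<exists>K. \<forall>z\<in>cball 0 \<rho>. snd z \<noteq> 0 \<longrightarrow> norm (ds z * Us z $ j) \<le> K * norm (snd z) powr (- a)" for \<rho>
      by (rule sv[OF sing_mono[OF sing_mult[OF sd sU]]]) (use b in \<open>simp add: a_def\<close>)
    show "\<exists>K. \<forall>z\<in>cball 0 \<rho>. snd z \<noteq> 0 \<longrightarrow> norm ((ds z * Us z $ j) *\<^sub>R Us z + ps z *\<^sub>R axis j 1) \<le> K * norm (snd z) powr (- a)" for \<rho>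
      by (rule sing_vector, unfold Fi, rule sing_add[OF sing_mono[OF sing_mult[OF sing_mult[OF sd sU] sU]] sing_mono[OF sing_mult[OF sp sing_const]]])
         (use b in \<open>simp_all add: a_def\<close>)
    show "tame S (\<lambda>z. ((ds z * Us z $ j) *\<^sub>R Us z + ps z *\<^sub>R axis j 1) $ i)" for i
      unfolding Fi by (intro tame_add tame_mult tame_const td tU tp)
    fix z w' F' assume zS: "z \<notin> S" and w': "((\<lambda>z. ds z * Us z $ j) has_derivative w') (at z)"
      and F': "\<And>i. ((\<lambda>z. ((ds z * Us z $ j) *\<^sub>R Us z + ps z *\<^sub>R axis j 1) $ i) has_derivative F' i) (at z)"
    obtain c' U' s where d: "ds z = s * k * cs z" "(ds has_derivative (\<lambda>v. s * c' v)) (at z)"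
      "\<And>i. ((\<lambda>z. Us z $ i) has_derivative U' i) (at z)" "(ps has_derivative (\<lambda>v. s * (cs z)\<^sup>2 * c' v)) (at z)"
      and M: "c' (1,0) + (\<Sum>i\<in>UNIV. Us z $ i * c' (0, axis i 1)) + k * cs z * (\<Sum>i\<in>UNIV. U' i (0, axis i 1)) = 0"
      and P: "U' j (1,0) + (\<Sum>i\<in>UNIV. Us z $ i * U' j (0, axis i 1)) + cs z / k * c' (0, axis j 1) = 0"
      using der[OF zS] by blast
    have e1: "w' = (\<lambda>v. ds z * U' j v + s * c' v * Us z $ j)"
      by (rule has_derivative_unique[OF w' has_derivative_mult[OF d(2) d(3)]])
    have e2: "F' i = (\<lambda>v. (ds z * Us z $ j) * U' i v + (ds z * U' j v + s * c' v * Us z $ j) * Us z $ i + s * (cs z)\<^sup>2 * c' v * axis j 1 $ i)" for i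
    proof -
      have "((\<lambda>z. (ds z * Us z $ j) * Us z $ i + ps z * axis j 1 $ i) has_derivative
         (\<lambda>v. (ds z * Us z $ j) * U' i v + (ds z * U' j v + s * c' v * Us z $ j) * Us z $ i + s * (cs z)\<^sup>2 * c' v * axis j 1 $ i)) (at z)"
        by (rule has_derivative_eq_rhs[OF has_derivative_add[OF has_derivative_mult[OF has_derivative_mult[OF d(2) d(3)] d(3)] has_derivative_mult[OF d(4) has_derivative_const]]])
           simp
      from has_derivative_unique[OF F'[unfolded Fi] this] show ?thesis .
    qed
    have ax: "(\<Sum>i\<in>UNIV. s * (cs z)\<^sup>2 * c' (0, axis i 1) * axis j 1 $ i) = s * (cs z)\<^sup>2 * c' (0, axis j 1)"
      by (simp add: axis_def if_distrib sum.delta' cong: if_cong)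
    have sc: "s * (cs z)\<^sup>2 = ds z * (cs z / k)" using k by (simp add: d(1) power2_eq_square)
    have "w' (1, 0) + (\<Sum>i\<in>UNIV. F' i (0, axis i 1)) = (ds z * U' j (1,0) + s * c' (1,0) * Us z $ j)
       + (\<Sum>i\<in>UNIV. (ds z * Us z $ j) * U' i (0, axis i 1) + (ds z * U' j (0, axis i 1) + s * c' (0, axis i 1) * Us z $ j) * Us z $ i)
       + ds z * (cs z / k) * c' (0, axis j 1)"
      unfolding e1 e2 sum.distrib ax unfolding sc by simp
    also have "\<dots> = Us z $ j * (s * (c' (1,0) + (\<Sum>i\<in>UNIV. Us z $ i * c' (0, axis i 1)) + k * cs z * (\<Sum>i\<in>UNIV. U' i (0, axis i 1))))
       + ds z * (U' j (1,0) + (\<Sum>i\<in>UNIV. Us z $ i * U' j (0, axis i 1)) + cs z / k * c' (0, axis j 1))"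
      unfolding distrib_left[of "ds z"] mult.assoc[of "ds z" "cs z / k"] by (simp add: d(1) sum_3 algebra_simps)
    finally show "w' (1, 0) + (\<Sum>i\<in>UNIV. F' i (0, axis i 1)) = 0" unfolding M P by simp
  qed (use td tU tp cd cU cp a S_null S_lines in \<open>auto simp: continuous_off_origin_def S_def intro!: tame_mult continuous_intros\<close>)
  have energy: "weak_conservation_law (\<lambda>z. ds z * Es z) (\<lambda>z. (ds z * Es z + ps z) *\<^sub>R Us z)"
  proof (rule weak_conservation_lawI[where S=S and a=a])
    show "\<exists>K. \<forall>z\<in>cball 0 \<rho>. snd z \<noteq> 0 \<longrightarrow> norm (ds z * Es z) \<le> K * norm (snd z) powr (- a)" for \<rho>
      by (rule sv[OF sing_mono[OF sing_mult[OF sd sE]]]) (use b in \<open>simp add: a_def\<close>)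
    show "\<exists>K. \<forall>z\<in>cball 0 \<rho>. snd z \<noteq> 0 \<longrightarrow> norm ((ds z * Es z + ps z) *\<^sub>R Us z) \<le> K * norm (snd z) powr (- a)" for \<rho>
      by (rule sing_vector, unfold vector_scaleR_component real_scaleR_def, rule sing_mono[OF sing_mult[OF sing_add[OF sing_mult[OF sd sE] sp] sU]])
         (use b in \<open>simp_all add: a_def\<close>)
    fix z w' F' assume zS: "z \<notin> S" and w': "((\<lambda>z. ds z * Es z) has_derivative w') (at z)"
      and F': "\<And>i. ((\<lambda>z. ((ds z * Es z + ps z) *\<^sub>R Us z) $ i) has_derivative F' i) (at z)"
    obtain c' U' s where d: "ds z = s * k * cs z" "(ds has_derivative (\<lambda>v. s * c' v)) (at z)"
      "\<And>i. ((\<lambda>z. Us z $ i) has_derivative U' i) (at z)" "(ps has_derivative (\<lambda>v. s * (cs z)\<^sup>2 * c' v)) (at z)"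
      "(Es has_derivative (\<lambda>v. cs z * c' v / (\<gamma> * k) + (\<Sum>i\<in>UNIV. Us z $ i * U' i v))) (at z)"
      and M: "c' (1,0) + (\<Sum>i\<in>UNIV. Us z $ i * c' (0, axis i 1)) + k * cs z * (\<Sum>i\<in>UNIV. U' i (0, axis i 1)) = 0"
      and P: "\<And>j. U' j (1,0) + (\<Sum>i\<in>UNIV. Us z $ i * U' j (0, axis i 1)) + cs z / k * c' (0, axis j 1) = 0"
      using der[OF zS] by blast
    define E' where "E' v = cs z * c' v / (\<gamma> * k) + (\<Sum>i\<in>UNIV. Us z $ i * U' i v)" for v
    have dE: "(Es has_derivative E') (at z)" using d(5) by (simp add: E'_def[abs_def])
    have e1: "w' = (\<lambda>v. ds z * E' v + s * c' v * Es z)"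
      by (rule has_derivative_unique[OF w' has_derivative_mult[OF d(2) dE]])
    have e2: "F' i = (\<lambda>v. (ds z * Es z + ps z) * U' i v + ((ds z * E' v + s * c' v * Es z) + s * (cs z)\<^sup>2 * c' v) * Us z $ i)" for i
      using has_derivative_unique[OF F'[unfolded vector_scaleR_component real_scaleR_def] has_derivative_mult[OF has_derivative_add[OF has_derivative_mult[OF d(2) dE] d(4)] d(3)]] .
    have Ez: "Es z = (cs z)\<^sup>2 / (\<gamma> * (\<gamma> - 1)) + ((Us z $ 1)\<^sup>2 + (Us z $ 2)\<^sup>2 + (Us z $ 3)\<^sup>2) / 2"
      by (simp add: Es sum_3 power2_eq_square)
    have pz: "ps z = s * k * cs z * (cs z)\<^sup>2 / \<gamma>" by (simp add: ps d(1))
    note cons = euler_conservation_forms(3)[OF k g M[unfolded sum_3] P[of 1, unfolded sum_3] P[of 2, unfolded sum_3] P[of 3, unfolded sum_3], of s, folded Ez pz d(1)]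
    show "w' (1, 0) + (\<Sum>i\<in>UNIV. F' i (0, axis i 1)) = 0"
      by (rule trans[OF _ cons]) (simp add: e1 e2 E'_def sum_3 algebra_simps)
  qed (use td tU tp tE cd cU cp cE a S_null S_lines in \<open>auto simp: continuous_off_origin_def S_def intro!: tame_mult tame_add continuous_intros\<close>)
  show ?thesis
    using mass momentum energy unfolding weak_euler_solution_def Let_def ps_def[symmetric] Es_def[symmetric] by blast
qed

text \<open>Order at most 1 makes the integrand bounded after multiplication by
  \<open>r\<^sup>2\<close>. Reading \<open>f\<close> as the restriction of a space-time function to
  a ray supplies measurability in \<open>r\<close>.\<close>

lemma locally_finite_flow:
  fixes f :: "real \<Rightarrow> real \<Rightarrow> real" and h :: "spacetime \<Rightarrow> real"
  assumes h: "h \<in> borel_measurable borel" and a: "a \<le> 1" and sing: "sing a h"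
    and eq: "\<And>t r. r \<ge> 0 \<Longrightarrow> f t r = h (t, r *\<^sub>R axis 1 1)"
  shows "locally_finite f"
  unfolding locally_finite_def set_integrable_def
proof (intro allI impI)
  fix t R :: real assume R: "R > 0"
  define g where "g r = h (t, r *\<^sub>R (axis 1 1 :: real^3)) * r\<^sup>2" for r
  have "(\<lambda>r. (t, r *\<^sub>R (axis 1 1 :: real^3))) \<in> borel_measurable borel"
    by (intro borel_measurable_continuous_onI continuous_intros)
  hence gm[measurable]: "g \<in> borel_measurable borel"
    unfolding g_def using h by (intro borel_measurable_times measurable_compose[OF _ h]) auto
  obtain K where K: "\<And>z. z \<in> cball 0 (\<bar>t\<bar> + R) \<Longrightarrow> snd z \<noteq> 0 \<Longrightarrow> \<bar>h z\<bar> \<le> K * norm (snd z) powr (- 1)"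
    using sing_mono[OF sing a] unfolding sing_def by metis
  have bd: "\<bar>g r\<bar> \<le> \<bar>K\<bar> * R" if r: "r \<in> {0..R}" for r
  proof (cases "r = 0")
    case False
    have "norm (t, r *\<^sub>R (axis 1 1 :: real^3)) \<le> \<bar>t\<bar> + R"
      using norm_Pair_le[of t "r *\<^sub>R (axis 1 1 :: real^3)"] r by (simp add: norm_axis_1)
    hence "\<bar>h (t, r *\<^sub>R axis 1 1)\<bar> \<le> K * r powr (- 1)"
      using K[of "(t, r *\<^sub>R axis 1 1)"] False r by (simp add: norm_axis_1 axis_eq_0_iff)
    also have "\<dots> \<le> \<bar>K\<bar> / r" using False r by (simp add: powr_minus_divide divide_right_mono)
    finally have "\<bar>h (t, r *\<^sub>R axis 1 1)\<bar> * r\<^sup>2 \<le> \<bar>K\<bar> / r * r\<^sup>2" by (rule mult_right_mono) simp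
    hence "\<bar>g r\<bar> \<le> \<bar>K\<bar> / r * r\<^sup>2" by (simp add: g_def abs_mult)
    also have "\<dots> = \<bar>K\<bar> * r" using False by (simp add: power2_eq_square)
    also have "\<dots> \<le> \<bar>K\<bar> * R" using r by (intro mult_left_mono) auto
    finally show ?thesis .
  qed (use R in \<open>simp add: g_def\<close>)
  have "integrable lborel (\<lambda>r. indicator {0..R} r * g r)"
  proof (rule Bochner_Integration.integrable_bound)
    show "integrable lborel (\<lambda>r. \<bar>K\<bar> * R * indicator {0..R} r :: real)"
      using emeasure_compact_finite[OF compact_Icc[of 0 R]]
      by (intro integrable_mult_right integrable_real_indicator) auto
    show "AE r in lborel. norm (indicator {0..R} r * g r) \<le> norm (\<bar>K\<bar> * R * indicator {0..R} r :: real)"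
      using bd R by (intro always_eventually) (auto simp: indicator_def)
  qed measurable
  moreover have "indicat_real {0..R} r *\<^sub>R (f t r * r\<^sup>2) = indicator {0..R} r * g r" for r
    using eq[of r t] by (auto simp: indicator_def g_def)
  ultimately show "integrable lborel (\<lambda>r. indicat_real {0..R} r *\<^sub>R (f t r * r\<^sup>2))" by (simp only:)
qed

theorem continuous_blowup_flow_profile:
  assumes g: "\<gamma> = 1 + 2 * k" and cv: "cv > 0"
  shows "continuous_blowup_flow \<gamma> cv dd uu cc"
proof -
  have g1: "\<gamma> > 1" using g k by simp
  let ?O = "- {(0::real, 0::real^3)}"
  define es where "es = radial_scalar (\<lambda>t r. internal_energy \<gamma> (cc t r))"
  have es: "es z = (cs z)\<^sup>2 / (\<gamma> * (\<gamma> - 1))" for z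
    by (simp add: es_def radial_scalar_def internal_energy_def)
  have cs0: "cs z \<noteq> 0" if "z \<in> ?O" for z using cs_pos[of z] that by simp
  have cd: "continuous_off_origin ds"
    unfolding ds_eq continuous_off_origin_def using cs_cont cs0
    by (intro continuous_on_powr continuous_on_const) (auto simp: continuous_off_origin_def)
  have small2: "(lam - 1) / k + 2 * (lam - 1) \<le> 1" "(lam - 1) / k \<le> 1" "(lam - 1) / k + (lam - 1) \<le> 1"
    "0 \<le> lam - 1" "0 \<le> (lam - 1) / k"
  proof -
    have "3 * (lam - 1) + (lam - 1) / k \<le> 1" using small by (simp add: algebra_simps)
    moreover show "0 \<le> lam - 1" "0 \<le> (lam - 1) / k" using lam k by auto
    ultimately show "(lam - 1) / k + 2 * (lam - 1) \<le> 1" "(lam - 1) / k \<le> 1" "(lam - 1) / k + (lam - 1) \<le> 1" by auto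
  qed
  have ax: "norm (r *\<^sub>R (axis 1 1 :: real^3)) = r" if "r \<ge> 0" for r using that by (simp add: norm_axis_1)
  have csm: "cs \<in> borel_measurable borel" and dsm: "ds \<in> borel_measurable borel"
    and Usm: "Us \<in> borel_measurable borel"
    using cs_cont cd Us_cont by (auto intro: borel_measurable_off_origin)
  have Un: "norm (Us z) = \<bar>uu (fst z) (norm (snd z))\<bar>" for z
  proof (cases "snd z = 0")
    case True
    thus ?thesis by (simp add: uu_def radial_vector_def)
  next
    case False
    thus ?thesis by (simp add: radial_vector_def)
  qed
  have nm: "(\<lambda>z. norm (Us z)) \<in> borel_measurable borel"
    by (rule measurable_compose[OF Usm borel_measurable_norm])
  have sUn: "sing (lam - 1) (\<lambda>z. norm (Us z))"
    using sing_vector[of "lam - 1" Us, OF sing_Us] unfolding sing_def by simp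
  have sds: "sing ((lam - 1) / k) ds" using sing_ds by (simp add: ds_eq)
  have lf1: "locally_finite dd"
    by (rule locally_finite_flow[OF dsm small2(2) sds]) (simp add: radial_scalar_def ax)
  have lf2: "locally_finite (\<lambda>t r. dd t r * \<bar>uu t r\<bar>)"
    by (rule locally_finite_flow[OF borel_measurable_times[OF dsm nm] small2(3) sing_mult[OF sds sUn]])
       (simp add: Un ax radial_scalar_def)
  have lf3: "locally_finite (\<lambda>t r. dd t r * (internal_energy \<gamma> (cc t r) + (uu t r)\<^sup>2 / 2))"
  proof (rule locally_finite_flow[OF _ small2(1)])
    let ?h = "\<lambda>z. ds z * (cs z * cs z * (1 / (\<gamma> * (\<gamma> - 1))) + norm (Us z) * norm (Us z) * (1 / 2))"
    show "?h \<in> borel_measurable borel"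
      by (intro borel_measurable_times borel_measurable_add dsm csm nm borel_measurable_const)
    have "sing (2 * (lam - 1)) (\<lambda>z. cs z * cs z * (1 / (\<gamma> * (\<gamma> - 1))) + norm (Us z) * norm (Us z) * (1 / 2))"
      using sing_add[OF sing_mult[OF sing_mult[OF sing_cs sing_cs] sing_const[of "1 / (\<gamma> * (\<gamma> - 1))"]]
         sing_mult[OF sing_mult[OF sUn sUn] sing_const[of "1 / 2"]]] by simp
    from sing_mult[OF sds this] show "sing ((lam - 1) / k + 2 * (lam - 1)) ?h" .
    show "dd t r * (internal_energy \<gamma> (cc t r) + (uu t r)\<^sup>2 / 2) = ?h (t, r *\<^sub>R axis 1 1)" if "r \<ge> 0" for t r
      using that by (simp add: Un ax radial_scalar_def internal_energy_def power2_eq_square)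
  qed
  \<comment> \<open>At time 0 the sound speed is exactly \<open>A * r powr (1 - lam)\<close>, so all
    blow-up claims become claims about negative powers of \<open>r\<close>.\<close>
  define A where "A = - c0 / lam"
  have A: "A > 0" using c0 lam by (simp add: A_def divide_neg_pos)
  have c00: "cc 0 r = A * r powr (1 - lam)" if "r \<noteq> 0" for r using that by (simp add: cc_def Cq_def A_def)
  have bu_c: "blows_up_at_time_zero cs"
    by (rule filterlim_norm_powr_at_top[OF A, of "1 - lam"]) (use lam in \<open>auto simp: radial_scalar_def c00\<close>)
  have bu_d: "blows_up_at_time_zero ds"
    by (rule filterlim_norm_powr_at_top[of "A powr (1 / k)" "(1 - lam) * (1 / k)"])
       (use A lam k in \<open>auto simp: radial_scalar_def dd_def c00 powr_mult powr_powr divide_neg_pos\<close>)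
  have bu_u: "blows_up_at_time_zero (\<lambda>z. norm (Us z))"
    by (rule filterlim_norm_powr_at_top[of "\<bar>v0\<bar> / lam" "1 - lam"])
       (use v0 lam in \<open>auto simp: Un uu_def Vq_def abs_mult\<close>)
  have sq: "(r powr (1 - lam))\<^sup>2 = r powr (2 * (1 - lam))" for r :: real
    by (simp add: power2_eq_square powr_add[symmetric])
  have bu_t: "blows_up_at_time_zero (radial_scalar (\<lambda>t r. temperature cv (internal_energy \<gamma> (cc t r))))"
    by (rule filterlim_norm_powr_at_top[of "A\<^sup>2 / (\<gamma> * (\<gamma> - 1)) / cv" "2 * (1 - lam)"])
       (use A cv g1 lam in \<open>auto simp: radial_scalar_def temperature_def internal_energy_def c00 power_mult_distrib sq\<close>)
  have bu_p: "blows_up_at_time_zero (radial_scalar (\<lambda>t r. pressure \<gamma> (dd t r) (internal_energy \<gamma> (cc t r))))"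
  proof (rule filterlim_norm_powr_at_top[of "(\<gamma> - 1) * (A powr (1 / k)) * (A\<^sup>2 / (\<gamma> * (\<gamma> - 1)))" "(1 - lam) * (1 / k) + 2 * (1 - lam)"])
    have "(1 - lam) * (1 / k) < 0" using lam k by (intro mult_neg_pos) auto
    thus "(1 - lam) * (1 / k) + 2 * (1 - lam) < 0" using lam by (intro add_neg_neg) auto
    show "radial_scalar (\<lambda>t r. pressure \<gamma> (dd t r) (internal_energy \<gamma> (cc t r))) (0, x)
        = (\<gamma> - 1) * (A powr (1 / k)) * (A\<^sup>2 / (\<gamma> * (\<gamma> - 1))) * norm x powr ((1 - lam) * (1 / k) + 2 * (1 - lam))"
      if "x \<noteq> 0" for x
      unfolding powr_add using that
      by (simp add: radial_scalar_def pressure_def internal_energy_def dd_def c00 power_mult_distrib sq powr_mult powr_powr)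
  qed (use A g1 in auto)
  have entropy: "\<exists>S s0. specific_entropy \<gamma> cv S \<and>
      (\<forall>t r. r \<ge> 0 \<longrightarrow> (t, r) \<noteq> (0, 0) \<longrightarrow> S (dd t r, temperature cv (internal_energy \<gamma> (cc t r))) = s0)"
  proof (intro exI conjI allI impI)
    show "specific_entropy \<gamma> cv (\<lambda>p. cv * (ln (snd p) - (\<gamma> - 1) * ln (fst p)))"
      by (rule ex_specific_entropy[OF cv g1])
    fix t r :: real assume r: "r \<ge> 0" "(t, r) \<noteq> (0, 0)"
    have c: "cc t r > 0" by (rule cc_pos[OF r])
    have "ln (temperature cv (internal_energy \<gamma> (cc t r))) = 2 * ln (cc t r) - ln (\<gamma> * (\<gamma> - 1)) - ln cv"
      using c cv g1 by (simp add: temperature_def internal_energy_def ln_div ln_mult ln_realpow)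
    moreover have "(\<gamma> - 1) * ln (dd t r) = 2 * ln (cc t r)"
      using c k by (simp add: dd_def ln_powr g)
    ultimately show "(\<lambda>p. cv * (ln (snd p) - (\<gamma> - 1) * ln (fst p))) (dd t r, temperature cv (internal_energy \<gamma> (cc t r)))
        = cv * (- ln (\<gamma> * (\<gamma> - 1)) - ln cv)" by simp
  qed
  have pos: "dd t r > 0 \<and> cc t r > 0" if "r \<ge> 0" "(t, r) \<noteq> (0, 0)" for t r
    using cc_pos[OF that] by (simp add: dd_def)
  show ?thesis
    unfolding continuous_blowup_flow_def Let_def
    using conservation_laws[OF g] cs_cont Us_cont cd lf1 lf2 lf3 bu_c bu_d bu_u bu_t bu_p entropy pos
    by (intro conjI) blast+
qed

end

section \<open>Barriers for the similarity equations\<close>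

text \<open>With \<open>\<alpha> = \<delta>\<^sup>2\<close>, the similarity equations have the critical points \<open>w = 1 - \<alpha>\<close> and \<open>w = qa k \<alpha>\<close>
  on the sonic line precisely for the similarity exponent \<open>lama k \<alpha>\<close>.\<close>

definition qa :: "real \<Rightarrow> real \<Rightarrow> real" where "qa k \<alpha> = k * \<alpha> / (1 - \<alpha> + k * \<alpha>)"

definition lama :: "real \<Rightarrow> real \<Rightarrow> real" where "lama k \<alpha> = 1 + 2 * (1 - \<alpha>) * qa k \<alpha>"

definition inner_w where "inner_w d s \<Gamma> = 1 - d\<^sup>2 - (1 - s\<^sup>2) * (d * \<Gamma>)" for d s \<Gamma> :: real

text \<open>\<open>d\<close> times this is the difference between \<open>w\<close> and its critical
  value at the centre \<open>z = \<infinity>\<close>; at \<open>s = 0\<close> it is the only factor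
  of \<open>inner_N\<close> that can change sign.\<close>

definition inner_dw where "inner_dw k d s \<Gamma> = - d * (1 + 2 * qa k (d\<^sup>2)) / 3 - (1 - s\<^sup>2) * \<Gamma>" for d s \<Gamma> :: real

definition inner_B where "inner_B k d s \<Gamma> = (let w = inner_w d s \<Gamma> in
   w\<^sup>2 + 2 * (k + 1) * (s\<^sup>2 * (d * \<Gamma>)) * (w - qa k (d\<^sup>2)) - 3 * w * (d * inner_dw k d s \<Gamma>))" for d s \<Gamma> :: real

text \<open>In the variables near the centre the trajectory equation reads
  \<open>s * (1 - s\<^sup>2) * \<Gamma>' = inner_N / inner_B\<close>; a common factor
  \<open>d\<close> has been divided out.\<close>

definition inner_N where "inner_N k d s \<Gamma> = (let w = inner_w d s \<Gamma>; q = qa k (d\<^sup>2) in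
   3 * w * (w - 2 * s\<^sup>2 * (d * \<Gamma>)) * inner_dw k d s \<Gamma> + 2 * s\<^sup>2 * \<Gamma> * w * q
     + 4 * (k + 1) * s ^ 4 * (d * \<Gamma>\<^sup>2) * (w - q))" for d s \<Gamma> :: real

lemma qa_den:
  fixes k \<alpha> :: real
  assumes "k > 0" "0 \<le> \<alpha>" "\<alpha> \<le> 1"
  shows "1 - \<alpha> + k * \<alpha> > 0"
proof (cases "\<alpha> = 1")
  case False
  thus ?thesis using assms by (intro add_pos_nonneg) auto
qed (use assms in simp)

lemma continuous_on_qa [continuous_intros]:
  assumes "k > 0" "continuous_on A f" "\<And>x. x \<in> A \<Longrightarrow> 0 \<le> f x \<and> f x \<le> 1"
  shows "continuous_on A (\<lambda>x. qa k (f x))"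
  unfolding qa_def using qa_den[OF assms(1)] assms(3)
  by (intro continuous_intros assms(2)) (metis less_irrefl)

text \<open>Near the centre put \<open>s = 1 / z\<close> and \<open>w = 1 - \<delta>\<^sup>2 - (1 - s\<^sup>2) \<delta> \<Gamma>\<close>: the
  constants \<open>-2\<close> and \<open>0\<close> are barriers for \<open>\<Gamma>\<close>.\<close>

lemma inner_eventually:
  assumes k: "k > 0"
  shows "\<forall>\<^sub>F d in at_right 0. (\<forall>s\<in>{0..1}. \<forall>\<Gamma>\<in>{-2..0}. inner_B k d s \<Gamma> > 1/2 \<and> inner_w d s \<Gamma> > 1/2 \<and> inner_w d s \<Gamma> < 2)
     \<and> (\<forall>s\<in>{0..1}. inner_N k d s (-2) \<ge> 0) \<and> (\<forall>s\<in>{0..1}. inner_N k d s 0 \<le> 0)"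
proof -
  define K where "K = {0..1::real} \<times> {-2..0::real}"
  have K: "compact K" unfolding K_def by (intro compact_Times) auto
  have qc: "continuous_on ({0..1} \<times> T) (\<lambda>p. qa k ((fst p)\<^sup>2))" for T :: "'a::topological_space set"
    by (rule continuous_on_qa[OF k]) (auto intro!: continuous_intros simp: power_le_one)
  have q0: "qa k 0 = 0" by (simp add: qa_def)
  have den: "1 - a\<^sup>2 + k * a\<^sup>2 \<noteq> 0" if "0 \<le> a" "a \<le> 1" for a
    using qa_den[OF k, of "a\<^sup>2"] that by (simp add: power_le_one)
  have e1: "\<forall>\<^sub>F d in at_right 0. \<forall>p\<in>K. inner_B k d (fst p) (snd p) - 1/2 > 0"
    by (rule eventually_pos_on_compact[OF K])
       (auto simp: inner_B_def inner_w_def inner_dw_def Let_def K_def q0 intro!: continuous_intros qc)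
  have e2: "\<forall>\<^sub>F d in at_right 0. \<forall>p\<in>K. inner_w d (fst p) (snd p) - 1/2 > 0"
    by (rule eventually_pos_on_compact[OF K]) (auto simp: inner_w_def intro!: continuous_intros)
  have e3: "\<forall>\<^sub>F d in at_right 0. \<forall>p\<in>K. 2 - inner_w d (fst p) (snd p) > 0"
    by (rule eventually_pos_on_compact[OF K]) (auto simp: inner_w_def intro!: continuous_intros)
  \<comment> \<open>\<open>inner_N k d s (-2)\<close> vanishes at \<open>d = 0\<close>,
    \<open>s = 1\<close>, so compactness does not apply to it directly. In the splitting
    \<open>(1 - s\<^sup>2) * A + d * B\<close> each term has a sign near \<open>s = 1\<close>, since
    \<open>A 0 s = 6\<close> and \<open>B 0 s = 16 * (k + 1) * s ^ 4 - 1\<close>.\<close>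
  define A where "A d s = 6 * inner_w d s (-2) * (inner_w d s (-2) + 4 * s\<^sup>2 * d)" for d s :: real
  define B where "B d s = (let w = inner_w d s (-2) in - (1 + 2 * qa k (d\<^sup>2)) * w * (w + 4 * s\<^sup>2 * d)
      - 4 * s\<^sup>2 * w * (k * d / (1 - d\<^sup>2 + k * d\<^sup>2)) + 16 * (k + 1) * s ^ 4 * (w - qa k (d\<^sup>2)))" for d s :: real
  have AB: "inner_N k d s (-2) = (1 - s\<^sup>2) * A d s + d * B d s" for d s
  proof -
    define w where "w = inner_w d s (-2)"
    have q: "qa k (d\<^sup>2) = d * (k * d / (1 - d\<^sup>2 + k * d\<^sup>2))" by (simp add: qa_def power2_eq_square)
    define q' where "q' = k * d / (1 - d\<^sup>2 + k * d\<^sup>2)"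
    show ?thesis unfolding inner_N_def A_def B_def Let_def inner_dw_def w_def[symmetric] q q'_def[symmetric]
      by (simp add: power2_eq_square field_simps)
  qed
  have dc: "continuous_on ({0..1} \<times> T) (\<lambda>p. k * fst p / (1 - (fst p)\<^sup>2 + k * (fst p)\<^sup>2))" for T :: "'a::topological_space set"
    by (intro continuous_intros) (auto simp: den)
  have e4: "\<forall>\<^sub>F d in at_right 0. \<forall>s\<in>{0..1::real}. A d s > 0"
    by (rule eventually_pos_on_compact) (auto simp: A_def inner_w_def intro!: continuous_intros)
  have e5: "\<forall>\<^sub>F d in at_right 0. \<forall>s\<in>{s\<in>{0..1::real}. s\<^sup>2 \<ge> 1/2}. B d s > 0"
  proof (rule eventually_pos_on_compact)
    show "compact {s\<in>{0..1::real}. s\<^sup>2 \<ge> 1/2}"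
    proof -
      have "{s\<in>{0..1::real}. s\<^sup>2 \<ge> 1/2} = {0..1} \<inter> {s. 1/2 \<le> s\<^sup>2}" by auto
      thus ?thesis by (auto intro!: compact_Int_closed closed_Collect_le continuous_intros)
    qed
    fix s :: real assume s: "s \<in> {s\<in>{0..1::real}. s\<^sup>2 \<ge> 1/2}"
    have "s ^ 4 = s\<^sup>2 * s\<^sup>2" by simp
    also have "\<dots> \<ge> 1/2 * (1/2)" using s by (intro mult_mono) auto
    finally have "s ^ 4 \<ge> 1/4" by simp
    hence "16 * (k + 1) * s ^ 4 \<ge> 16 * (k + 1) * (1/4)" using k by (intro mult_left_mono) auto
    moreover have "16 * (k + 1) * (1/4) > 1" using k by simp
    ultimately have "16 * (k + 1) * s ^ 4 > 1" by (rule less_le_trans[rotated])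
    thus "B 0 s > 0" using k by (simp add: B_def inner_w_def q0 Let_def)
  qed (auto simp: B_def inner_w_def Let_def den intro!: continuous_intros qc dc)
  have e6: "\<forall>\<^sub>F d in at_right 0. \<forall>s\<in>{s\<in>{0..1::real}. s\<^sup>2 \<le> 1/2}. inner_N k d s (-2) > 0"
  proof (rule eventually_pos_on_compact)
    show "compact {s\<in>{0..1::real}. s\<^sup>2 \<le> 1/2}"
    proof -
      have "{s\<in>{0..1::real}. s\<^sup>2 \<le> 1/2} = {0..1} \<inter> {s. s\<^sup>2 \<le> 1/2}" by auto
      thus ?thesis by (auto intro!: compact_Int_closed closed_Collect_le continuous_intros)
    qed
    fix s :: real assume s: "s \<in> {s\<in>{0..1::real}. s\<^sup>2 \<le> 1/2}"
    thus "inner_N k 0 s (-2) > 0" by (simp add: inner_N_def inner_w_def inner_dw_def q0 Let_def)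
  qed (auto simp: inner_N_def inner_w_def inner_dw_def Let_def intro!: continuous_intros qc)
  have pos: "\<forall>\<^sub>F d::real in at_right 0. d \<in> {0<..<1}" by (rule eventually_at_right_real) simp
  show ?thesis
  proof (rule eventually_mono[OF eventually_conj[OF e1 eventually_conj[OF e2 eventually_conj[OF e3
        eventually_conj[OF e4 eventually_conj[OF e5 eventually_conj[OF e6 pos]]]]]]])
    fix d :: real
    assume "(\<forall>p\<in>K. inner_B k d (fst p) (snd p) - 1/2 > 0) \<and> (\<forall>p\<in>K. inner_w d (fst p) (snd p) - 1/2 > 0) \<and>
      (\<forall>p\<in>K. 2 - inner_w d (fst p) (snd p) > 0) \<and> (\<forall>s\<in>{0..1}. A d s > 0) \<and>
      (\<forall>s\<in>{s\<in>{0..1}. s\<^sup>2 \<ge> 1/2}. B d s > 0) \<and> (\<forall>s\<in>{s\<in>{0..1}. s\<^sup>2 \<le> 1/2}. inner_N k d s (-2) > 0) \<and> d \<in> {0<..<1}"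
    then have elim: "\<forall>p\<in>K. inner_B k d (fst p) (snd p) - 1/2 > 0" "\<forall>p\<in>K. inner_w d (fst p) (snd p) - 1/2 > 0"
      "\<forall>p\<in>K. 2 - inner_w d (fst p) (snd p) > 0" "\<forall>s\<in>{0..1}. A d s > 0" "\<forall>s\<in>{s\<in>{0..1}. s\<^sup>2 \<ge> 1/2}. B d s > 0"
      "\<forall>s\<in>{s\<in>{0..1}. s\<^sup>2 \<le> 1/2}. inner_N k d s (-2) > 0" "d \<in> {0<..<1}" by blast+
    have "inner_N k d s (-2) \<ge> 0" if s: "s \<in> {0..1}" for s
    proof (cases "s\<^sup>2 \<le> 1/2")
      case True thus ?thesis using elim(6) s by (auto intro: less_imp_le)
    next
      case False
      hence "B d s > 0" "A d s > 0" using elim(4,5) s by auto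
      moreover have "1 - s\<^sup>2 \<ge> 0" using s by (simp add: power_le_one)
      ultimately show ?thesis unfolding AB using elim(7) by (intro add_nonneg_nonneg mult_nonneg_nonneg) auto
    qed
    moreover have "inner_N k d s 0 \<le> 0" if s: "s \<in> {0..1}" for s
    proof -
      have "d\<^sup>2 \<le> 1" using elim(7) by (simp add: power_le_one)
      hence "qa k (d\<^sup>2) \<ge> 0" using k qa_den[OF k, of "d\<^sup>2"] by (simp add: qa_def)
      hence "inner_dw k d s 0 \<le> 0" using elim(7) by (simp add: inner_dw_def)
      thus ?thesis by (simp add: inner_N_def Let_def mult_nonneg_nonpos)
    qed
    ultimately show "(\<forall>s\<in>{0..1}. \<forall>\<Gamma>\<in>{-2..0}. inner_B k d s \<Gamma> > 1/2 \<and> inner_w d s \<Gamma> > 1/2 \<and> inner_w d s \<Gamma> < 2)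
     \<and> (\<forall>s\<in>{0..1}. inner_N k d s (-2) \<ge> 0) \<and> (\<forall>s\<in>{0..1}. inner_N k d s 0 \<le> 0)" using elim(1,2,3) by (auto simp: K_def)
  qed
qed

text \<open>Outside put \<open>w = 1 + z m\<close> with \<open>y = \<alpha> + z \<delta> H\<close>; all quantities below are divided by the
  appropriate power of \<open>\<delta>\<close>.\<close>

definition outer_m where "outer_m d z H = - z * d + (1 - z\<^sup>2) * H" for d z H :: real

text \<open>The quotient of \<open>Bz - lam\<close> by \<open>z * d\<close>, written out as a
  polynomial in \<open>z\<close> and \<open>H\<close> so that nothing has to be divided by
  \<open>z\<close> or \<open>d\<close>.\<close>

definition outer_be where "outer_be k d z H = (let m = outer_m d z H; q = qa k (d\<^sup>2) in
   m * (-1 + 2 * k * d\<^sup>2 + 2 * d\<^sup>2 * q) - 2 * z * d * m\<^sup>2 + 2 * (k + 1) * H * (1 - q + z * d * m))" for d z H :: real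

definition outer_B where "outer_B k d z H = lama k (d\<^sup>2) + z * d * outer_be k d z H" for d z H :: real

text \<open>The trajectory equation becomes
  \<open>(1 - z\<^sup>2) * H' = d * outer_N / outer_B\<close>. The factor
  \<open>z\<^sup>2 * d\<close> has been cancelled by hand, which makes the equation regular at
  \<open>z = 0\<close>.\<close>

definition outer_N where "outer_N k d z H = (let m = outer_m d z H; q = qa k (d\<^sup>2) in
   (2 * lama k (d\<^sup>2) - 3 + 2 * d\<^sup>2 * q) + d * (k / (1 - d\<^sup>2 + k * d\<^sup>2)) * z * H * (6 - 4 * d\<^sup>2)
   + (- H + 2 * z * d + 3 * z\<^sup>2 * H) * outer_be k d z H + 3 * m\<^sup>2 - 2 * H * m
   + m * (m * (3 + 3 * z * d * m - 2 * d\<^sup>2 * q) - 2 * H * (1 - q + z * d * m)))" for d z H :: real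

text \<open>At \<open>d = 0\<close> the coefficient of \<open>H\<^sup>2\<close> in
  \<open>outer_N\<close> is at most \<open>4 * (k + 1)\<close> in absolute value, so at this height
  the quadratic term is at most 1/2, against the constant -1.\<close>

definition H0 :: "real \<Rightarrow> real" where "H0 k = sqrt (1 / (8 * (k + 1)))"

lemma outer_N_0: "outer_N k 0 z H = - 1 + H\<^sup>2 * ((3 * z\<^sup>2 - 1) * (2 * k - 1 + 3 * z\<^sup>2))"
  by (simp add: outer_N_def outer_be_def outer_m_def lama_def qa_def Let_def power2_eq_square algebra_simps)

lemma H0_bounds: "k > 0 \<Longrightarrow> H0 k > 0" "k > 0 \<Longrightarrow> (H0 k)\<^sup>2 = 1 / (8 * (k + 1))" "k > 0 \<Longrightarrow> H0 k \<le> 1"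
  by (simp_all add: H0_def real_sqrt_le_1_iff)

text \<open>The constant \<open>H0 k\<close> is an upper barrier. A constant lower barrier would
  fail for small \<open>z\<close>, where \<open>outer_N\<close> can be negative. The line
  \<open>- H0 k - 4 * z\<close> falls at the fixed rate 4 while the equation moves \<open>H\<close>
  only at a rate of order \<open>d\<close>, which settles \<open>z\<^sup>2 \<le> 1/2\<close>; nearer
  to the sonic point the gain from falling fades with \<open>1 - z\<^sup>2\<close>, but there the
  line is so low that the quadratic term makes \<open>outer_N\<close> positive.\<close>

lemma outer_eventually:
  assumes k: "k > 0"
  shows "\<forall>\<^sub>F d in at_right 0. (\<forall>z\<in>{0..1}. \<forall>H\<in>{-6..1}. outer_B k d z H > 1/2 \<and> 1 + z * d * outer_m d z H > 1/2 \<and> 1 + z * d * outer_m d z H < 2)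
     \<and> (\<forall>z\<in>{0..1}. outer_N k d z (H0 k) \<le> 0)
     \<and> (\<forall>z\<in>{0..1}. d * outer_N k d z (- H0 k - 4 * z) \<ge> - 4 * (1 - z\<^sup>2) * outer_B k d z (- H0 k - 4 * z))"
proof -
  define K where "K = {0..1::real} \<times> {-6..1::real}"
  have K: "compact K" unfolding K_def by (intro compact_Times) auto
  have qc: "continuous_on ({0..1} \<times> T) (\<lambda>p. qa k ((fst p)\<^sup>2))" for T :: "'a::topological_space set"
    by (rule continuous_on_qa[OF k]) (auto intro!: continuous_intros simp: power_le_one)
  have q0: "qa k 0 = 0" by (simp add: qa_def)
  have den: "1 - a\<^sup>2 + k * a\<^sup>2 \<noteq> 0" if "0 \<le> a" "a \<le> 1" for a
    using qa_den[OF k, of "a\<^sup>2"] that by (simp add: power_le_one)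
  have h: "0 < H0 k" "(H0 k)\<^sup>2 = 1 / (8 * (k + 1))" "H0 k \<le> 1" using H0_bounds[OF k] by auto
  note defs = outer_N_def outer_B_def outer_be_def outer_m_def lama_def Let_def
  have e1: "\<forall>\<^sub>F d in at_right 0. \<forall>p\<in>K. outer_B k d (fst p) (snd p) - 1/2 > 0"
    by (rule eventually_pos_on_compact[OF K]) (auto simp: defs q0 intro!: continuous_intros qc)
  have e2: "\<forall>\<^sub>F d in at_right 0. \<forall>p\<in>K. (1 + fst p * d * outer_m d (fst p) (snd p)) - 1/2 > 0"
    by (rule eventually_pos_on_compact[OF K]) (auto simp: defs intro!: continuous_intros)
  have e3: "\<forall>\<^sub>F d in at_right 0. \<forall>p\<in>K. 2 - (1 + fst p * d * outer_m d (fst p) (snd p)) > 0"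
    by (rule eventually_pos_on_compact[OF K]) (auto simp: defs intro!: continuous_intros)
  have e4: "\<forall>\<^sub>F d in at_right 0. \<forall>z\<in>{0..1::real}. - outer_N k d z (H0 k) > 0"
  proof (rule eventually_pos_on_compact)
    fix z :: real assume z: "z \<in> {0..1}"
    have z2: "0 \<le> z\<^sup>2" "z\<^sup>2 \<le> 1" using z by (auto simp: power_le_one)
    have "\<bar>(3 * z\<^sup>2 - 1) * (2 * k - 1 + 3 * z\<^sup>2)\<bar> \<le> 2 * (2 * k + 2)"
    proof -
      have "\<bar>3 * z\<^sup>2 - 1\<bar> \<le> 2" "\<bar>2 * k - 1 + 3 * z\<^sup>2\<bar> \<le> 2 * k + 2" using z2 k by linarith+
      from mult_mono[OF this] show ?thesis by (simp add: abs_mult)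
    qed
    hence "(H0 k)\<^sup>2 * ((3 * z\<^sup>2 - 1) * (2 * k - 1 + 3 * z\<^sup>2)) \<le> 1 / (8 * (k + 1)) * (2 * (2 * k + 2))"
      unfolding h(2) using k by (intro mult_left_mono) auto
    also have "\<dots> = 1 / 2" using k by (simp add: field_simps)
    finally show "- outer_N k 0 z (H0 k) > 0" unfolding outer_N_0 by simp
  qed (auto simp: defs den intro!: continuous_intros qc)
  have e5: "\<forall>\<^sub>F d in at_right 0. \<forall>z\<in>{z\<in>{0..1::real}. z\<^sup>2 \<ge> 1/2}. outer_N k d z (- H0 k - 4 * z) > 0"
  proof (rule eventually_pos_on_compact)
    show "compact {s\<in>{0..1::real}. s\<^sup>2 \<ge> 1/2}"
    proof -
      have "{s\<in>{0..1::real}. s\<^sup>2 \<ge> 1/2} = {0..1} \<inter> {s. 1/2 \<le> s\<^sup>2}" by auto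
      thus ?thesis by (auto intro!: compact_Int_closed closed_Collect_le continuous_intros)
    qed
    fix z :: real assume z: "z \<in> {z\<in>{0..1::real}. z\<^sup>2 \<ge> 1/2}"
    \<comment> \<open>The slope 4 suffices here: \<open>H\<^sup>2 \<ge> 8\<close> and a coefficient
      of at least 1/4 give a quadratic term of at least 2, which beats the constant -1 in
      \<open>outer_N_0\<close>.\<close>
    have "(- H0 k - 4 * z)\<^sup>2 = (H0 k)\<^sup>2 + 8 * (H0 k * z) + 16 * z\<^sup>2" by (simp add: power2_eq_square algebra_simps)
    moreover have "H0 k * z \<ge> 0" using h z by simp
    moreover have zz: "z\<^sup>2 \<ge> 1/2" using z by simp
    ultimately have A: "8 \<le> (- H0 k - 4 * z)\<^sup>2" using zero_le_power2[of "H0 k"] by linarith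
    have "1/2 \<le> 3 * z\<^sup>2 - 1" "1/2 \<le> 2 * k - 1 + 3 * z\<^sup>2" using zz k by linarith+
    from mult_mono[OF this] zz have B: "1/4 \<le> (3 * z\<^sup>2 - 1) * (2 * k - 1 + 3 * z\<^sup>2)" by simp
    have "8 * (1/4) \<le> (- H0 k - 4 * z)\<^sup>2 * ((3 * z\<^sup>2 - 1) * (2 * k - 1 + 3 * z\<^sup>2))"
      by (rule mult_mono[OF A B]) auto
    thus "outer_N k 0 z (- H0 k - 4 * z) > 0" unfolding outer_N_0 by simp
  qed (auto simp: defs den intro!: continuous_intros qc)
  have e6: "\<forall>\<^sub>F d in at_right 0. \<forall>z\<in>{z\<in>{0..1::real}. z\<^sup>2 \<le> 1/2}. d * outer_N k d z (- H0 k - 4 * z) + 4 * (1 - z\<^sup>2) * outer_B k d z (- H0 k - 4 * z) > 0"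
  proof (rule eventually_pos_on_compact)
    show "compact {s\<in>{0..1::real}. s\<^sup>2 \<le> 1/2}"
    proof -
      have "{s\<in>{0..1::real}. s\<^sup>2 \<le> 1/2} = {0..1} \<inter> {s. s\<^sup>2 \<le> 1/2}" by auto
      thus ?thesis by (auto intro!: compact_Int_closed closed_Collect_le continuous_intros)
    qed
    fix z :: real assume z: "z \<in> {z\<in>{0..1::real}. z\<^sup>2 \<le> 1/2}"
    thus "0 * outer_N k 0 z (- H0 k - 4 * z) + 4 * (1 - z\<^sup>2) * outer_B k 0 z (- H0 k - 4 * z) > 0"
      by (simp add: outer_B_def lama_def q0)
  qed (auto simp: defs den intro!: continuous_intros qc)
  have pos: "\<forall>\<^sub>F d::real in at_right 0. d \<in> {0<..<1}" by (rule eventually_at_right_real) simp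
  show ?thesis
  proof (rule eventually_mono[OF eventually_conj[OF e1 eventually_conj[OF e2 eventually_conj[OF e3
        eventually_conj[OF e4 eventually_conj[OF e5 eventually_conj[OF e6 pos]]]]]]])
    fix d :: real
    assume "(\<forall>p\<in>K. outer_B k d (fst p) (snd p) - 1/2 > 0) \<and> (\<forall>p\<in>K. (1 + fst p * d * outer_m d (fst p) (snd p)) - 1/2 > 0) \<and>
      (\<forall>p\<in>K. 2 - (1 + fst p * d * outer_m d (fst p) (snd p)) > 0) \<and> (\<forall>z\<in>{0..1}. - outer_N k d z (H0 k) > 0) \<and>
      (\<forall>z\<in>{z\<in>{0..1}. z\<^sup>2 \<ge> 1/2}. outer_N k d z (- H0 k - 4 * z) > 0) \<and>
      (\<forall>z\<in>{z\<in>{0..1}. z\<^sup>2 \<le> 1/2}. d * outer_N k d z (- H0 k - 4 * z) + 4 * (1 - z\<^sup>2) * outer_B k d z (- H0 k - 4 * z) > 0) \<and>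
      d \<in> {0<..<1}"
    then have elim: "\<forall>p\<in>K. outer_B k d (fst p) (snd p) - 1/2 > 0" "\<forall>p\<in>K. (1 + fst p * d * outer_m d (fst p) (snd p)) - 1/2 > 0"
      "\<forall>p\<in>K. 2 - (1 + fst p * d * outer_m d (fst p) (snd p)) > 0" "\<forall>z\<in>{0..1}. - outer_N k d z (H0 k) > 0"
      "\<forall>z\<in>{z\<in>{0..1}. z\<^sup>2 \<ge> 1/2}. outer_N k d z (- H0 k - 4 * z) > 0"
      "\<forall>z\<in>{z\<in>{0..1}. z\<^sup>2 \<le> 1/2}. d * outer_N k d z (- H0 k - 4 * z) + 4 * (1 - z\<^sup>2) * outer_B k d z (- H0 k - 4 * z) > 0"
      "d \<in> {0<..<1}" by blast+
    have B: "\<forall>z\<in>{0..1}. \<forall>H\<in>{-6..1}. outer_B k d z H > 1/2 \<and> 1 + z * d * outer_m d z H > 1/2 \<and> 1 + z * d * outer_m d z H < 2"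
    proof (intro ballI)
      fix z H :: real assume "z \<in> {0..1}" "H \<in> {-6..1}"
      hence p: "(z, H) \<in> K" by (simp add: K_def)
      from bspec[OF elim(1) p] bspec[OF elim(2) p] bspec[OF elim(3) p]
      show "outer_B k d z H > 1/2 \<and> 1 + z * d * outer_m d z H > 1/2 \<and> 1 + z * d * outer_m d z H < 2"
        unfolding fst_conv snd_conv by linarith
    qed
    have "d * outer_N k d z (- H0 k - 4 * z) \<ge> - 4 * (1 - z\<^sup>2) * outer_B k d z (- H0 k - 4 * z)" if z: "z \<in> {0..1}" for z
    proof (cases "z\<^sup>2 \<le> 1/2")
      case True
      hence "d * outer_N k d z (- H0 k - 4 * z) + 4 * (1 - z\<^sup>2) * outer_B k d z (- H0 k - 4 * z) > 0" using elim(6) z by blast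
      thus ?thesis by (simp add: algebra_simps)
    next
      case False
      hence "outer_N k d z (- H0 k - 4 * z) > 0" using elim(5) z by auto
      hence "d * outer_N k d z (- H0 k - 4 * z) \<ge> 0" using elim(7) by simp
      moreover have "- H0 k - 4 * z \<in> {-6..1}" using z h by auto
      hence "outer_B k d z (- H0 k - 4 * z) > 1/2" using B z by blast
      hence "4 * (1 - z\<^sup>2) * outer_B k d z (- H0 k - 4 * z) \<ge> 0" using z by (intro mult_nonneg_nonneg) (auto simp: power_le_one)
      ultimately show ?thesis by (simp add: algebra_simps)
    qed
    moreover have "\<forall>z\<in>{0..1}. outer_N k d z (H0 k) \<le> 0" using elim(4) by (auto intro: less_imp_le)
    ultimately show "(\<forall>z\<in>{0..1}. \<forall>H\<in>{-6..1}. outer_B k d z H > 1/2 \<and> 1 + z * d * outer_m d z H > 1/2 \<and> 1 + z * d * outer_m d z H < 2)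
     \<and> (\<forall>z\<in>{0..1}. outer_N k d z (H0 k) \<le> 0)
     \<and> (\<forall>z\<in>{0..1}. d * outer_N k d z (- H0 k - 4 * z) \<ge> - 4 * (1 - z\<^sup>2) * outer_B k d z (- H0 k - 4 * z))"
      using B by blast
  qed
qed

section \<open>Trapped trajectories on both sides of the sonic point\<close>

lemma lip_family_num: "lip_family S J (\<lambda>s y. c)"
  by (rule lip_familyI[where M="\<bar>c\<bar>" and M'=0]) auto

lemma lip_family_s: "bounded S \<Longrightarrow> lip_family S J (\<lambda>s y. s)"
  by (rule lip_family_const) simp

lemmas lip_family_intros = lip_family_num lip_family_s lip_family_var lip_family_add lip_family_diff
  lip_family_mult lip_family_minus lip_family_power

lemma lip_family_bounded: "lip_family S J f \<Longrightarrow> \<exists>M. \<forall>s\<in>S. \<forall>y\<in>J. \<bar>f s y\<bar> \<le> M"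
  unfolding lip_family_def by blast

lemma lip_family_inner:
  "lip_family {0..1} {-2..0} (inner_N k d)" "lip_family {0..1} {-2..0} (inner_B k d)"
proof -
  have b: "bounded {0..1::real}" "bounded {-2..0::real}" by auto
  have "lip_family {0..1} {-2..0} (\<lambda>s y. inner_N k d s y)"
    unfolding inner_N_def inner_w_def inner_dw_def Let_def divide_inverse by (intro lip_family_intros b)
  thus "lip_family {0..1} {-2..0} (inner_N k d)" .
  have "lip_family {0..1} {-2..0} (\<lambda>s y. inner_B k d s y)"
    unfolding inner_B_def inner_w_def inner_dw_def Let_def divide_inverse by (intro lip_family_intros b)
  thus "lip_family {0..1} {-2..0} (inner_B k d)" .
qed

lemma lip_family_outer:
  "lip_family {0..1} {-6..1} (outer_N k d)" "lip_family {0..1} {-6..1} (outer_B k d)"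
    "lip_family {0..1} {-6..1} (outer_be k d)" "lip_family {0..1} {-6..1} (outer_m d)"
proof -
  have b: "bounded {0..1::real}" "bounded {-6..1::real}" by auto
  have "lip_family {0..1} {-6..1} (\<lambda>s y. outer_m d s y)"
    unfolding outer_m_def by (intro lip_family_intros b)
  thus m: "lip_family {0..1} {-6..1} (outer_m d)" .
  have "lip_family {0..1} {-6..1} (\<lambda>s y. outer_be k d s y)"
    unfolding outer_be_def Let_def by (intro lip_family_intros m b)
  thus be: "lip_family {0..1} {-6..1} (outer_be k d)" .
  have "lip_family {0..1} {-6..1} (\<lambda>s y. outer_N k d s y)"
    unfolding outer_N_def Let_def by (intro lip_family_intros m be b)
  thus "lip_family {0..1} {-6..1} (outer_N k d)" .
  have "lip_family {0..1} {-6..1} (\<lambda>s y. outer_B k d s y)"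
    unfolding outer_B_def by (intro lip_family_intros be b)
  thus "lip_family {0..1} {-6..1} (outer_B k d)" .
qed

lemma continuous_on_inner [continuous_intros]:
  fixes f g :: "'a::topological_space \<Rightarrow> real"
  assumes "continuous_on A f" "continuous_on A g"
  shows "continuous_on A (\<lambda>x. inner_N k d (f x) (g x))" "continuous_on A (\<lambda>x. inner_B k d (f x) (g x))"
  unfolding inner_N_def inner_B_def inner_w_def inner_dw_def Let_def
  by (intro continuous_intros assms; simp)+

lemma continuous_on_outer [continuous_intros]:
  fixes f g :: "'a::topological_space \<Rightarrow> real"
  assumes "continuous_on A f" "continuous_on A g"
  shows "continuous_on A (\<lambda>x. outer_N k d (f x) (g x))" "continuous_on A (\<lambda>x. outer_B k d (f x) (g x))"
  unfolding outer_N_def outer_B_def outer_be_def outer_m_def Let_def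
  by (intro continuous_intros assms; simp)+

definition inner_good :: "real \<Rightarrow> real \<Rightarrow> bool" where
  "inner_good k d \<longleftrightarrow> (\<forall>s\<in>{0..1}. \<forall>\<Gamma>\<in>{-2..0}. inner_B k d s \<Gamma> > 1/2 \<and> inner_w d s \<Gamma> > 1/2 \<and> inner_w d s \<Gamma> < 2)
     \<and> (\<forall>s\<in>{0..1}. inner_N k d s (-2) \<ge> 0) \<and> (\<forall>s\<in>{0..1}. inner_N k d s 0 \<le> 0)"

definition outer_good :: "real \<Rightarrow> real \<Rightarrow> bool" where
  "outer_good k d \<longleftrightarrow> (\<forall>z\<in>{0..1}. \<forall>H\<in>{-6..1}. outer_B k d z H > 1/2 \<and> 1 + z * d * outer_m d z H > 1/2 \<and> 1 + z * d * outer_m d z H < 2)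
     \<and> (\<forall>z\<in>{0..1}. outer_N k d z (H0 k) \<le> 0)
     \<and> (\<forall>z\<in>{0..1}. d * outer_N k d z (- H0 k - 4 * z) \<ge> - 4 * (1 - z\<^sup>2) * outer_B k d z (- H0 k - 4 * z))"

lemma clamp_lipschitz: "\<bar>max l (min u x) - max l (min u y)\<bar> \<le> \<bar>x - y\<bar>" for l u x y :: real
  by (auto simp: max_def min_def)

lemma tanh_artanh: "tanh (artanh z) = z" if "\<bar>z\<bar> < 1" for z :: real
proof -
  have p: "1 + z > 0" "1 - z > 0" using that by auto
  have "- 2 * artanh z = - ln ((1 + z) / (1 - z))" by (simp add: artanh_def)
  hence e: "exp (- 2 * artanh z) = (1 - z) / (1 + z)" using p by (simp only: exp_minus exp_ln divide_pos_pos inverse_divide)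
  have "tanh (artanh z) = (1 - exp (- 2 * artanh z)) / (1 + exp (- 2 * artanh z))" by (rule tanh_real_altdef)
  also have "\<dots> = z" unfolding e using p by (simp add: field_simps)
  finally show ?thesis .
qed

text \<open>The time \<open>\<sigma> = ln s - ln (1 - s\<^sup>2) / 2\<close>, whose inverse is
  \<open>sg\<close>, removes the factor \<open>s * (1 - s\<^sup>2)\<close> and sends the centre and
  the sonic point to the two infinite ends, so an entire solution is required. Truncation of the
  unknown to the range between the barriers makes the field globally Lipschitz, and the trapped
  solution never notices it.\<close>

lemma inner_solution:
  assumes g: "inner_good k d"
  shows "\<exists>G. \<forall>s\<in>{0<..<1}. -2 \<le> G s \<and> G s \<le> 0 \<and>
     (G has_real_derivative inner_N k d s (G s) / (inner_B k d s (G s) * (s * (1 - s\<^sup>2)))) (at s)"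
proof -
  define sg where "sg \<sigma> = 1 / sqrt (1 + exp (- 2 * \<sigma>))" for \<sigma> :: real
  define cl where "cl y = max (-2) (min 0 y)" for y :: real
  define F where "F s y = inner_N k d s y / inner_B k d s y" for s y
  define f where "f \<sigma> y = F (sg \<sigma>) (cl y)" for \<sigma> y
  have sg: "sg \<sigma> \<in> {0..1}" for \<sigma> by (auto simp: sg_def divide_le_eq add_pos_pos)
  have cl: "cl y \<in> {-2..0}" for y by (auto simp: cl_def)
  have B: "inner_B k d s y \<ge> 1/2" if "s \<in> {0..1}" "y \<in> {-2..0}" for s y
    using g that unfolding inner_good_def by (blast intro: less_imp_le)
  have lf: "lip_family {0..1} {-2..0} F"
    using lip_family_divide[OF lip_family_inner(1) lip_family_inner(2), of "1/2"] B by (simp add: F_def[abs_def])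
  obtain M where M: "M \<ge> 0" "\<And>s y. s \<in> {0..1} \<Longrightarrow> y \<in> {-2..0} \<Longrightarrow> \<bar>F s y\<bar> \<le> M"
    "\<And>s y y'. s \<in> {0..1} \<Longrightarrow> y \<in> {-2..0} \<Longrightarrow> y' \<in> {-2..0} \<Longrightarrow> \<bar>F s y - F s y'\<bar> \<le> M * \<bar>y - y'\<bar>"
    using lip_familyE[OF lf] by metis
  have "\<exists>y. \<forall>t. -2 \<le> y t \<and> y t \<le> 0 \<and> (y has_real_derivative f t (y t)) (at t)"
  proof (rule entire_trapped_solution[where M=M and B=M])
    have Bn: "inner_B k d (sg \<sigma>) (cl y) \<noteq> 0" for \<sigma> y using B[OF sg cl, of \<sigma> y] by linarith
    have "1 + exp x \<noteq> 0" for x :: real using exp_gt_zero[of x] by linarith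
    hence "continuous_on UNIV (\<lambda>p::real\<times>real. sg (fst p))"
      unfolding sg_def by (intro continuous_intros) (auto simp: add_nonneg_eq_0_iff)
    moreover have "continuous_on UNIV (\<lambda>p::real\<times>real. cl (snd p))" unfolding cl_def by (intro continuous_intros)
    ultimately show "continuous_on UNIV (\<lambda>p. f (fst p) (snd p))"
      unfolding f_def F_def by (intro continuous_intros) (auto simp: Bn)
    show "\<bar>f t y - f t y'\<bar> \<le> M * \<bar>y - y'\<bar>" for t y y'
      unfolding f_def using M(3)[OF sg cl cl, of t y y'] clamp_lipschitz[of "-2" 0 y y'] M(1)
      by (fold cl_def) (meson mult_left_mono order_trans)
    show "\<bar>f t y\<bar> \<le> M" for t y unfolding f_def by (rule M(2)[OF sg cl])
    show "f t y \<ge> 0" if "y \<le> -2" for t y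
    proof -
      have "cl y = -2" using that by (simp add: cl_def)
      thus ?thesis using g sg[of t] B[OF sg, of "-2" t] unfolding f_def F_def inner_good_def
        by (intro divide_nonneg_pos) auto
    qed
    show "f t y \<le> 0" if "y \<ge> 0" for t y
    proof -
      have "cl y = 0" using that by (simp add: cl_def)
      thus ?thesis using g sg[of t] B[OF sg, of 0 t] unfolding f_def F_def inner_good_def
        by (intro divide_nonpos_pos) auto
    qed
  qed simp
  then obtain y where y: "\<And>t. -2 \<le> y t" "\<And>t. y t \<le> 0" "\<And>t. (y has_real_derivative f t (y t)) (at t)" by blast
  define \<sigma> where "\<sigma> s = ln s - ln (1 - s\<^sup>2) / 2" for s :: real
  define G where "G s = y (\<sigma> s)" for s
  have "-2 \<le> G s \<and> G s \<le> 0 \<and> (G has_real_derivative inner_N k d s (G s) / (inner_B k d s (G s) * (s * (1 - s\<^sup>2)))) (at s)"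
    if s: "s \<in> {0<..<1}" for s
  proof -
    have s2: "1 - s\<^sup>2 > 0" using s by (simp add: power_less_one_iff abs_square_less_1)
    have e: "exp (- 2 * \<sigma> s) = (1 - s\<^sup>2) / s\<^sup>2"
    proof -
      have "- 2 * \<sigma> s = ln (1 - s\<^sup>2) - ln (s\<^sup>2)" using s by (simp add: \<sigma>_def ln_realpow)
      also have "\<dots> = ln ((1 - s\<^sup>2) / s\<^sup>2)" using s s2 by (simp add: ln_div)
      finally show ?thesis using s s2 by simp
    qed
    have sgs: "sg (\<sigma> s) = s"
    proof -
      have "1 + (1 - s\<^sup>2) / s\<^sup>2 = (1 / s)\<^sup>2" using s by (simp add: field_simps)
      thus ?thesis unfolding sg_def e using s by (simp add: real_sqrt_abs)
    qed
    have "(\<sigma> has_real_derivative 1 / (s * (1 - s\<^sup>2))) (at s)"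
      unfolding \<sigma>_def using s s2
      by (auto intro!: derivative_eq_intros simp: field_simps power2_eq_square)
    from DERIV_chain2[OF y(3) this]
    have "(G has_real_derivative f (\<sigma> s) (G s) * (1 / (s * (1 - s\<^sup>2)))) (at s)" unfolding G_def .
    moreover have "f (\<sigma> s) (G s) = inner_N k d s (G s) / inner_B k d s (G s)"
      using y(1,2)[of "\<sigma> s"] by (simp add: f_def F_def sgs cl_def G_def max_def min_def)
    ultimately show ?thesis using y(1,2) by (simp add: G_def)
  qed
  thus ?thesis by blast
qed

text \<open>With \<open>z = tanh \<sigma>\<close> only the sonic point moves to infinity, while
  \<open>z = 0\<close> is an ordinary initial time. This is an initial value problem, and
  \<open>h\<close> is free between the barriers.\<close>

lemma outer_solution:
  assumes g: "outer_good k d" and k: "k > 0" and d: "d > 0" and h: "h \<in> {- H0 k..H0 k}"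
  shows "\<exists>G. continuous_on {0..<1} G \<and> G 0 = h \<and> (\<forall>z\<in>{0..<1}. G z \<in> {-6..1}) \<and> (\<forall>z\<in>{0<..<1}.
     (G has_real_derivative d * outer_N k d z (G z) / (outer_B k d z (G z) * (1 - z\<^sup>2))) (at z))"
proof -
  \<comment> \<open>The field is extended constantly in time to \<open>\<sigma> < 0\<close>, because
    the existence result takes a field on the whole plane.\<close>
  define zt where "zt \<sigma> = tanh (max 0 \<sigma>)" for \<sigma> :: real
  define cl where "cl z y = max (- H0 k - 4 * z) (min (H0 k) y)" for z y :: real
  define F where "F z y = d * outer_N k d z y / outer_B k d z y" for z y
  define f where "f \<sigma> y = F (zt \<sigma>) (cl (zt \<sigma>) y)" for \<sigma> y
  have H: "0 < H0 k" "H0 k \<le> 1" using H0_bounds[OF k] by auto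
  have zt: "zt \<sigma> \<in> {0..1}" for \<sigma> using tanh_real_lt_1[of "max 0 \<sigma>"] by (auto simp: zt_def)
  have cl: "cl z y \<in> {-6..1}" if "z \<in> {0..1}" for z y using H that by (auto simp: cl_def)
  have B: "outer_B k d z y \<ge> 1/2" if "z \<in> {0..1}" "y \<in> {-6..1}" for z y
    using g that unfolding outer_good_def by (blast intro: less_imp_le)
  have "lip_family {0..1} {-6..1} (\<lambda>z y. d * outer_N k d z y)"
    by (intro lip_family_intros lip_family_outer)
  from lip_family_divide[OF this lip_family_outer(2), of "1/2"] B
  have lf: "lip_family {0..1} {-6..1} F" by (simp add: F_def[abs_def])
  obtain M where M: "M \<ge> 0" "\<And>s y. s \<in> {0..1} \<Longrightarrow> y \<in> {-6..1} \<Longrightarrow> \<bar>F s y\<bar> \<le> M"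
    "\<And>s y y'. s \<in> {0..1} \<Longrightarrow> y \<in> {-6..1} \<Longrightarrow> y' \<in> {-6..1} \<Longrightarrow> \<bar>F s y - F s y'\<bar> \<le> M * \<bar>y - y'\<bar>"
    using lip_familyE[OF lf] by metis
  have "\<exists>y. y 0 = h \<and> (\<forall>t\<ge>0. (y has_real_derivative f t (y t)) (at t within {0..}))"
  proof (rule picard_global[where L=M and B=M])
    have Bn: "outer_B k d (zt \<sigma>) (cl (zt \<sigma>) y) \<noteq> 0" for \<sigma> y using B[OF zt[of \<sigma>] cl[OF zt[of \<sigma>], of y]] by linarith
    have c1: "continuous_on UNIV (\<lambda>p::real\<times>real. zt (fst p))"
      unfolding zt_def by (intro continuous_intros) (auto simp: cosh_real_nonzero)
    hence "continuous_on UNIV (\<lambda>p::real\<times>real. cl (zt (fst p)) (snd p))" unfolding cl_def by (intro continuous_intros)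
    with c1 show "continuous_on UNIV (\<lambda>p. f (fst p) (snd p))"
      unfolding f_def F_def by (intro continuous_intros) (auto simp: Bn)
    show "\<bar>f t y - f t y'\<bar> \<le> M * \<bar>y - y'\<bar>" for t y y'
    proof -
      have "\<bar>f t y - f t y'\<bar> \<le> M * \<bar>cl (zt t) y - cl (zt t) y'\<bar>" unfolding f_def by (intro M(3) zt cl)
      also have "\<dots> \<le> M * \<bar>y - y'\<bar>" unfolding cl_def by (intro mult_left_mono clamp_lipschitz M(1))
      finally show ?thesis .
    qed
    show "\<bar>f t y\<bar> \<le> M" for t y unfolding f_def by (intro M(2) zt cl)
  qed
  then obtain y where y0: "y 0 = h" and yd: "\<And>t. t \<ge> 0 \<Longrightarrow> (y has_real_derivative f t (y t)) (at t within {0..})" by blast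
  have dz: "(zt has_real_derivative 1 - (zt t)\<^sup>2) (at t within {0..})" if "t \<ge> 0" for t
  proof -
    have "(tanh has_real_derivative 1 - (tanh t)\<^sup>2) (at t within {0..})"
      by (auto intro!: derivative_eq_intros simp: cosh_real_nonzero)
    hence "(zt has_real_derivative 1 - (tanh t)\<^sup>2) (at t within {0..})"
      by (rule has_field_derivative_transform_within[OF _ zero_less_one]) (use that in \<open>auto simp: zt_def\<close>)
    thus ?thesis using that by (simp add: zt_def)
  qed
  have lo: "- H0 k - 4 * zt t \<le> y t" if "t \<ge> 0" for t
  proof -
    have "y t - (- H0 k - 4 * zt t) \<ge> 0"
    proof (rule nonneg_of_deriv_nonneg_where_neg[where d="\<lambda>t. y t - (- H0 k - 4 * zt t)" and d'="\<lambda>t. f t (y t) - (0 - 4 * (1 - (zt t)\<^sup>2))" and a=0])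
      fix t :: real assume t: "t \<ge> 0"
      show "((\<lambda>t. y t - (- H0 k - 4 * zt t)) has_real_derivative f t (y t) - (0 - 4 * (1 - (zt t)\<^sup>2))) (at t within {0..})"
        by (intro DERIV_diff DERIV_const DERIV_cmult yd dz t)
      assume "y t - (- H0 k - 4 * zt t) < 0"
      \<comment> \<open>Below the barrier the truncated field takes its value on the barrier itself,
        so the inequality there controls all lower points.\<close>
      hence c: "cl (zt t) (y t) = - H0 k - 4 * zt t" using H zt[of t] by (auto simp: cl_def)
      have "outer_B k d (zt t) (- H0 k - 4 * zt t) \<ge> 1/2" using B[OF zt[of t] cl[OF zt[of t], of "y t"]] c by simp
      moreover have "d * outer_N k d (zt t) (- H0 k - 4 * zt t) \<ge> - 4 * (1 - (zt t)\<^sup>2) * outer_B k d (zt t) (- H0 k - 4 * zt t)"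
        using g zt[of t] unfolding outer_good_def by blast
      ultimately have "f t (y t) \<ge> - 4 * (1 - (zt t)\<^sup>2)" unfolding f_def F_def c by (subst pos_le_divide_eq) auto
      thus "0 \<le> f t (y t) - (0 - 4 * (1 - (zt t)\<^sup>2))" by simp
    qed (use y0 h that in \<open>auto simp: zt_def\<close>)
    thus ?thesis by simp
  qed
  have up: "y t \<le> H0 k" if "t \<ge> 0" for t
  proof -
    have "H0 k - y t \<ge> 0"
    proof (rule nonneg_of_deriv_nonneg_where_neg[where d="\<lambda>t. H0 k - y t" and d'="\<lambda>t. 0 - f t (y t)" and a=0])
      fix t :: real assume t: "t \<ge> 0"
      show "((\<lambda>t. H0 k - y t) has_real_derivative 0 - f t (y t)) (at t within {0..})"
        by (intro DERIV_diff DERIV_const yd t)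
      assume "H0 k - y t < 0"
      hence c: "cl (zt t) (y t) = H0 k" using H zt[of t] by (auto simp: cl_def)
      have "outer_B k d (zt t) (H0 k) \<ge> 1/2" using B[OF zt[of t] cl[OF zt[of t], of "y t"]] c by simp
      moreover have "outer_N k d (zt t) (H0 k) \<le> 0" using g zt[of t] unfolding outer_good_def by blast
      ultimately have "F (zt t) (H0 k) \<le> 0" unfolding F_def using d
        by (intro divide_nonpos_pos mult_nonneg_nonpos) auto
      thus "0 \<le> 0 - f t (y t)" unfolding f_def c by simp
    qed (use y0 h that in auto)
    thus ?thesis by simp
  qed
  define G where "G z = y (artanh z)" for z
  have at: "artanh z \<ge> 0" "zt (artanh z) = z" if "z \<in> {0..<1}" for z
  proof -
    show a: "artanh z \<ge> 0" using that by (auto simp: artanh_def)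
    show "zt (artanh z) = z" using that a by (simp add: zt_def tanh_artanh)
  qed
  have ac: "continuous_on {0..<1::real} artanh" by (intro continuous_intros) auto
  have yc: "continuous_on {0..} y" by (rule DERIV_continuous_on[OF yd]) simp
  have "continuous_on {0..<1} G"
    unfolding G_def by (rule continuous_on_compose2[OF yc ac]) (use at in auto)
  moreover have "G 0 = h" by (simp add: G_def y0)
  moreover have "G z \<in> {-6..1}" if "z \<in> {0..<1}" for z
    using lo[OF at(1)[OF that]] up[OF at(1)[OF that]] at(2)[OF that] H that by (auto simp: G_def)
  moreover have "(G has_real_derivative d * outer_N k d z (G z) / (outer_B k d z (G z) * (1 - z\<^sup>2))) (at z)" if z: "z \<in> {0<..<1}" for z
  proof -
    have z': "z \<in> {0..<1}" using z by simp
    have "artanh z > 0" using z by (simp add: artanh_def)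
    hence "(y has_real_derivative f (artanh z) (y (artanh z))) (at (artanh z))"
    proof -
      assume p: "artanh z > 0"
      have "(y has_real_derivative f (artanh z) (y (artanh z))) (at (artanh z) within {0<..})"
        by (rule DERIV_subset[OF yd]) (use p in auto)
      moreover have "at (artanh z) within {0<..} = at (artanh z)"
        by (rule at_within_open) (use p in auto)
      ultimately show ?thesis by simp
    qed
    moreover have "(artanh has_real_derivative 1 / (1 - z\<^sup>2)) (at z)"
      by (rule artanh_real_has_field_derivative) (use z in simp)
    ultimately have "(G has_real_derivative f (artanh z) (G z) * (1 / (1 - z\<^sup>2))) (at z)"
      unfolding G_def by (rule DERIV_chain2)
    moreover have "f (artanh z) (G z) = d * outer_N k d z (G z) / outer_B k d z (G z)"
      using lo[OF at(1)[OF z']] up[OF at(1)[OF z']] at(2)[OF z'] by (simp add: f_def F_def cl_def G_def max_def min_def)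
    ultimately show ?thesis by simp
  qed
  ultimately show ?thesis by blast
qed

text \<open>The trajectory of the similarity equations from the origin (\<open>z = 0\<close>) through the sonic point
  (\<open>z = 1\<close>) to the centre (\<open>z = \<infinity>\<close>), with \<open>1 + V = w\<close> and \<open>C = z w\<close>.\<close>

definition excess :: "real \<Rightarrow> real \<Rightarrow> real \<Rightarrow> real" where
  "excess \<alpha> q w = 3 * (w - 1) + 2 * \<alpha> * (1 - q)"

text \<open>\<open>Bz / (lam * w\<^sup>2)\<close> is the derivative of \<open>ln z\<close> with
  respect to \<open>ln x\<close>, so positivity makes \<open>z\<close> strictly increasing along the
  trajectory.\<close>

definition Bz :: "real \<Rightarrow> real \<Rightarrow> real \<Rightarrow> real \<Rightarrow> real \<Rightarrow> real" where
  "Bz k \<alpha> q w y = w\<^sup>2 + 2 * (k + 1) * y * (w - q) - w * excess \<alpha> q w"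

lemma inner_excess: "excess (d\<^sup>2) (qa k (d\<^sup>2)) (inner_w d s G) = 3 * (d * inner_dw k d s G)"
proof -
  have "3 * inner_dw k d s G = - d * (1 + 2 * qa k (d\<^sup>2)) - 3 * ((1 - s\<^sup>2) * G)" by (simp add: inner_dw_def)
  hence "d * (3 * inner_dw k d s G) = d * (- d * (1 + 2 * qa k (d\<^sup>2)) - 3 * ((1 - s\<^sup>2) * G))" by simp
  also have "\<dots> = excess (d\<^sup>2) (qa k (d\<^sup>2)) (inner_w d s G)"
    by (simp add: excess_def inner_w_def power2_eq_square algebra_simps)
  finally show ?thesis by simp
qed

lemma inner_B_eq: "inner_B k d s G = Bz k (d\<^sup>2) (qa k (d\<^sup>2)) (inner_w d s G) (s\<^sup>2 * (d * G))"
  unfolding Bz_def inner_excess by (simp add: inner_B_def Let_def algebra_simps)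

text \<open>The right-hand side is \<open>- z * Bz * w'\<close> for the trajectory equation of
  \<open>w\<close>; the identity says that the equation for \<Gamma> is that equation in the
  coordinates near the centre.\<close>

lemma inner_slope:
  fixes k d s G
  defines "\<alpha> \<equiv> d\<^sup>2" and "q \<equiv> qa k (d\<^sup>2)" and "w \<equiv> inner_w d s G" and "y \<equiv> s\<^sup>2 * (d * G)"
  shows "2 * y * Bz k \<alpha> q w y - d * inner_N k d s G = w * (2 * y * (w - q) - w * excess \<alpha> q w)"
proof -
  have e: "d * inner_dw k d s G = excess \<alpha> q w / 3"
    unfolding \<alpha>_def q_def w_def inner_excess by simp
  have "d * inner_N k d s G = 3 * w * (w - 2 * y) * (d * inner_dw k d s G) + 2 * y * w * q + 4 * (k + 1) * y\<^sup>2 * (w - q)"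
    by (simp add: inner_N_def Let_def w_def q_def y_def power2_eq_square power4_eq_xxxx algebra_simps)
  thus ?thesis unfolding e Bz_def by (simp add: power2_eq_square algebra_simps)
qed

text \<open>This is Vieta's rule. On the sonic line the critical points are the roots of
  \<open>w * (3 * (w - 1) + (lam - 1) / k) - (w - 1) * (lam + w - 1)\<close>. That the roots are
  \<open>1 - \<alpha>\<close> and \<open>q\<close> means, for their product,
  \<open>lam - 1 = 2 * (1 - \<alpha>) * q\<close>, and for their sum the present relation, which
  also gives \<open>2 * \<alpha> * (1 - q) = (lam - 1) / k\<close>.\<close>

lemma qa_relation:
  assumes "k > 0" "0 \<le> \<alpha>" "\<alpha> \<le> 1"
  shows "k * \<alpha> * (1 - qa k \<alpha>) = (1 - \<alpha>) * qa k \<alpha>"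
proof -
  have "1 - \<alpha> + k * \<alpha> \<noteq> 0" using qa_den[OF assms] by simp
  thus ?thesis by (simp add: qa_def field_simps)
qed

lemma outer_B_eq:
  assumes "k > 0" "0 \<le> d" "d \<le> 1"
  shows "outer_B k d z H = Bz k (d\<^sup>2) (qa k (d\<^sup>2)) (1 + z * d * outer_m d z H) (d\<^sup>2 + z * (d * H))"
proof -
  define q where "q = qa k (d\<^sup>2)"
  define m where "m = outer_m d z H"
  have "d\<^sup>2 \<le> 1" using assms by (simp add: power_le_one)
  hence rel: "k * d\<^sup>2 * (1 - q) = (1 - d\<^sup>2) * q" unfolding q_def using assms by (intro qa_relation) auto
  have "Bz k (d\<^sup>2) q (1 + z * d * m) (d\<^sup>2 + z * (d * H)) - outer_B k d z H = 2 * (k * d\<^sup>2 * (1 - q) - (1 - d\<^sup>2) * q)"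
    unfolding outer_B_def outer_be_def Bz_def excess_def lama_def Let_def q_def[symmetric] m_def[symmetric]
    by (simp add: power2_eq_square algebra_simps)
  thus ?thesis unfolding rel by (simp add: q_def m_def)
qed

text \<open>On the left stand the two parts of \<open>w'\<close> for
  \<open>w = 1 + z * d * m\<close>: the derivative at fixed \<open>H\<close>, and the contribution
  of \<open>H'\<close>, from which \<open>1 - z\<^sup>2\<close> has cancelled. The right-hand side
  is the slope required by the trajectory equation.\<close>

lemma outer_slope:
  fixes k d z H
  assumes k: "k > 0" and d: "0 \<le> d" "d \<le> 1"
  defines "\<alpha> \<equiv> d\<^sup>2" and "q \<equiv> qa k (d\<^sup>2)" and "w \<equiv> 1 + z * d * outer_m d z H" and "y \<equiv> d\<^sup>2 + z * (d * H)"
  shows "z * (d * outer_m d z H + z * d * (- d - 2 * z * H)) * outer_B k d z H + z\<^sup>2 * d * (d * outer_N k d z H)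
     = - w * (2 * y * (w - q) - w * excess \<alpha> q w)"
proof -
  define m where "m = outer_m d z H"
  define \<sigma> where "\<sigma> = m * (3 + 3 * z * d * m - 2 * d\<^sup>2 * q) - 2 * H * (1 - q + z * d * m)"
  define \<rho> where "\<rho> = - H + 2 * z * d + 3 * z\<^sup>2 * H"
  define b where "b = outer_be k d z H"
  define p where "p = k / (1 - d\<^sup>2 + k * d\<^sup>2)"
  have q: "q = d\<^sup>2 * p" by (simp add: q_def p_def qa_def mult.commute)
  have lam: "lama k (d\<^sup>2) = 1 + 2 * (1 - d\<^sup>2) * q" by (simp add: lama_def q_def)
  have mdef: "m = - z * d + (1 - z\<^sup>2) * H" by (simp add: m_def outer_m_def)
  have s: "w * excess \<alpha> q w - 2 * y * (w - q) = z * d * \<sigma>"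
    unfolding w_def y_def excess_def \<alpha>_def \<sigma>_def m_def[symmetric] unfolding mdef
    by (simp add: power2_eq_square algebra_simps)
  have r: "m + z * (- d - 2 * z * H) = - \<rho>" unfolding mdef \<rho>_def by (simp add: power2_eq_square algebra_simps)
  have N: "outer_N k d z H = (2 * lama k (d\<^sup>2) - 3 + 2 * d\<^sup>2 * q) + d * p * z * H * (6 - 4 * d\<^sup>2) + \<rho> * b + 3 * m\<^sup>2 - 2 * H * m + m * \<sigma>"
    by (simp add: outer_N_def Let_def p_def \<rho>_def b_def \<sigma>_def m_def q_def)
  have B: "outer_B k d z H = lama k (d\<^sup>2) + z * d * b" by (simp add: outer_B_def b_def)
  \<comment> \<open>At \<open>z = 0\<close> this reads
    \<open>lama k (d\<^sup>2) * H = \<sigma>\<close>, which is true for every \<open>H\<close>: the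
    origin is a star node of the similarity equations, and for this reason the initial slope is
    free.\<close>
  have key: "- \<rho> * lama k (d\<^sup>2) + z * d * ((2 * lama k (d\<^sup>2) - 3 + 2 * d\<^sup>2 * q) + d * p * z * H * (6 - 4 * d\<^sup>2) + 3 * m\<^sup>2 - 2 * H * m) = \<sigma>"
    unfolding lam \<sigma>_def \<rho>_def mdef q by (simp add: power2_eq_square algebra_simps)
  have "- \<rho> * outer_B k d z H + z * d * outer_N k d z H = (1 + z * d * m) * \<sigma>"
    unfolding B N key[symmetric] by (simp add: algebra_simps)
  hence "z * d * (- \<rho> * outer_B k d z H + z * d * outer_N k d z H) = w * (z * d * \<sigma>)"
    by (simp add: w_def m_def[symmetric] mult_ac)
  thus ?thesis unfolding s[symmetric] r[symmetric] m_def[symmetric]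
    by (simp add: power2_eq_square algebra_simps)
qed

text \<open>The two trapped solutions are joined at \<open>z = 1\<close>, where boundedness of
  \<open>y\<close> alone forces both sides to \<open>w = 1 - \<alpha>\<close>. The bound on
  \<open>\<bar>y z\<bar> * z\<^sup>2\<close> is for the asymptotics at the centre, the one on
  \<open>lam * (w z)\<^sup>2 - Bz\<close> for the integration of the similarity variable from the
  origin.\<close>

lemma similarity_curve:
  assumes k: "k > 0" and d: "d > 0" "d < 1" and ig: "inner_good k d" and og: "outer_good k d"
    and h: "h \<in> {- H0 k..H0 k}"
  defines "\<alpha> \<equiv> d\<^sup>2" and "q \<equiv> qa k (d\<^sup>2)" and "lam \<equiv> lama k (d\<^sup>2)"
  shows "\<exists>w y M. M > 0 \<and>
     (\<forall>z>0. 1/2 < w z \<and> w z < 2 \<and> (1 - z\<^sup>2) * y z = w z - (1 - \<alpha>) \<and> \<bar>y z\<bar> \<le> M \<and> \<bar>y z\<bar> * z\<^sup>2 \<le> M) \<and>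
     (\<forall>z>0. z \<noteq> 1 \<longrightarrow> Bz k \<alpha> q (w z) (y z) > 1/2 \<and>
        \<bar>lam * (w z)\<^sup>2 - Bz k \<alpha> q (w z) (y z)\<bar> \<le> M * z \<and>
        isCont y z \<and> (w has_real_derivative - w z / (z * Bz k \<alpha> q (w z) (y z)) * (2 * y z * (w z - q) - w z * excess \<alpha> q (w z))) (at z)) \<and>
     ((\<lambda>z. (w z - 1) / z) \<longlongrightarrow> d * h) (at_right 0)"
proof -
  obtain G where G: "\<And>s. s \<in> {0<..<1} \<Longrightarrow> -2 \<le> G s" "\<And>s. s \<in> {0<..<1} \<Longrightarrow> G s \<le> 0"
    "\<And>s. s \<in> {0<..<1} \<Longrightarrow> (G has_real_derivative inner_N k d s (G s) / (inner_B k d s (G s) * (s * (1 - s\<^sup>2)))) (at s)"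
    using inner_solution[OF ig] by blast
  obtain H where Hc: "continuous_on {0..<1} H" and H0: "H 0 = h" and Hb: "\<And>z. z \<in> {0..<1} \<Longrightarrow> H z \<in> {-6..1}"
    and Hd: "\<And>z. z \<in> {0<..<1} \<Longrightarrow> (H has_real_derivative d * outer_N k d z (H z) / (outer_B k d z (H z) * (1 - z\<^sup>2))) (at z)"
    using outer_solution[OF og k d(1) h] by blast
  define yo where "yo z = d\<^sup>2 + z * (d * H z)" for z
  define wo where "wo z = 1 + z * d * outer_m d z (H z)" for z
  define yi where "yi z = (1/z)\<^sup>2 * (d * G (1/z))" for z
  define wi where "wi z = inner_w d (1/z) (G (1/z))" for z
  \<comment> \<open>The value 0 at \<open>z = 1\<close> is a default: \<open>1 - z\<^sup>2\<close>
    vanishes there, and no continuity of \<open>y\<close> across the sonic point is claimed.\<close>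
  define y where "y z = (if z < 1 then yo z else if z = 1 then 0 else yi z)" for z
  define w where "w z = (if z < 1 then wo z else if z = 1 then 1 - \<alpha> else wi z)" for z
  have d2: "d\<^sup>2 < 1" using d by (simp add: power_less_one_iff abs_square_less_1)
  have si: "1 / z \<in> {0<..<1}" "1 / z \<in> {0..1}" if "z > 1" for z :: real using that by auto
  have Gi: "G (1/z) \<in> {-2..0}" if "z > 1" for z using G(1,2)[OF si(1)[OF that]] by auto
  have dG: "\<bar>d * G (1/z)\<bar> \<le> 2" if "z > 1" for z
  proof -
    have "\<bar>d\<bar> * \<bar>G (1/z)\<bar> \<le> 1 * 2" using d Gi[OF that] by (intro mult_mono) auto
    thus ?thesis by (simp add: abs_mult)
  qed
  have Bi: "inner_B k d (1/z) (G (1/z)) > 1/2" "wi z > 1/2" "wi z < 2" if "z > 1" for z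
    using ig si(2)[OF that] Gi[OF that] unfolding inner_good_def wi_def by blast+
  have Bo: "outer_B k d z (H z) > 1/2" "wo z > 1/2" "wo z < 2" if "z \<in> {0..<1}" for z
    using og Hb[OF that] that unfolding outer_good_def wo_def by force+
  have Bie: "inner_B k d (1/z) (G (1/z)) = Bz k \<alpha> q (wi z) (yi z)" for z
    unfolding inner_B_eq \<alpha>_def q_def wi_def yi_def ..
  have Boe: "outer_B k d z (H z) = Bz k \<alpha> q (wo z) (yo z)" for z
    unfolding \<alpha>_def q_def wo_def yo_def using k d by (intro outer_B_eq) auto
  obtain Mb where Mbb: "\<forall>s\<in>{0..1}. \<forall>y\<in>{-6..1}. \<bar>outer_be k d s y\<bar> \<le> Mb"
    using lip_family_bounded[OF lip_family_outer(3)] by blast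
  have Mb: "\<bar>outer_be k d s y\<bar> \<le> Mb" if "s \<in> {0..1}" "y \<in> {-6..1}" for s y using Mbb that by blast
  obtain Mm where Mmb: "\<forall>s\<in>{0..1}. \<forall>y\<in>{-6..1}. \<bar>outer_m d s y\<bar> \<le> Mm"
    using lip_family_bounded[OF lip_family_outer(4)] by blast
  have Mm: "\<bar>outer_m d s y\<bar> \<le> Mm" if "s \<in> {0..1}" "y \<in> {-6..1}" for s y using Mmb that by blast
  obtain Mi where Mib: "\<forall>s\<in>{0..1}. \<forall>y\<in>{-2..0}. \<bar>inner_B k d s y\<bar> \<le> Mi"
    using lip_family_bounded[OF lip_family_inner(2)] by blast
  have Mi: "\<bar>inner_B k d s y\<bar> \<le> Mi" if "s \<in> {0..1}" "y \<in> {-2..0}" for s y using Mib that by blast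
  have Mn: "0 \<le> Mb" "0 \<le> Mm" "0 \<le> Mi"
    using order_trans[OF abs_ge_zero Mb[of 0 0]] order_trans[OF abs_ge_zero Mm[of 0 0]] order_trans[OF abs_ge_zero Mi[of 0 0]] by auto
  define M where "M = 8 + \<bar>lam\<bar> * (Mm * 3) + Mb + (4 * \<bar>lam\<bar> + Mi)"
  have Mp: "M \<ge> 8" "M > 0" using Mn by (auto simp: M_def intro!: add_nonneg_nonneg add_pos_nonneg)
  have range: "1/2 < w z \<and> w z < 2 \<and> (1 - z\<^sup>2) * y z = w z - (1 - \<alpha>) \<and> \<bar>y z\<bar> \<le> M \<and> \<bar>y z\<bar> * z\<^sup>2 \<le> M" if z: "z > 0" for z
  proof -
    consider "z < 1" | "z = 1" | "z > 1" by linarith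
    thus ?thesis
    proof cases
      case 1
      hence zz: "z \<in> {0..<1}" using z by simp
      have "\<bar>z\<bar> * (\<bar>d\<bar> * \<bar>H z\<bar>) \<le> 1 * (1 * 6)" using 1 z d Hb[OF zz] by (intro mult_mono) auto
      hence "\<bar>z * (d * H z)\<bar> \<le> 6" by (simp add: abs_mult)
      hence a: "\<bar>yo z\<bar> \<le> 8" using d2 zero_le_power2[of d] unfolding yo_def by linarith
      moreover have "\<bar>yo z\<bar> * z\<^sup>2 \<le> 8 * 1" using a 1 z by (intro mult_mono) (auto simp: power_le_one)
      moreover have "(1 - z\<^sup>2) * yo z = wo z - (1 - \<alpha>)"
        by (simp add: yo_def wo_def outer_m_def \<alpha>_def power2_eq_square algebra_simps)
      ultimately show ?thesis using Bo(2,3)[OF zz] 1 Mp by (auto simp: y_def w_def)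
    next
      case 2
      have "wi 2 > 1/2" using Bi by simp
      have "wo 0 = 1" by (simp add: wo_def)
      \<comment> \<open>The bound \<open>w 1 > 1/2\<close> is read off from
        \<open>outer_good\<close> at \<open>z = 1\<close>, where \<open>outer_m\<close> equals
        \<open>- d\<close> whatever \<open>H\<close> is.\<close>
      have "d\<^sup>2 < 1/2"
      proof -
        have "outer_good k d" "(1::real) \<in> {0..1}" "(0::real) \<in> {-6..1}" using og by auto
        hence "1 + 1 * d * outer_m d 1 0 > 1/2" unfolding outer_good_def by blast
        thus ?thesis by (simp add: outer_m_def power2_eq_square)
      qed
      moreover have "- 1 < d\<^sup>2" using zero_le_power2[of d] by linarith
      ultimately show ?thesis using 2 Mp by (simp add: y_def w_def \<alpha>_def)
    next
      case 3
      have "\<bar>yi z\<bar> * z\<^sup>2 = \<bar>d * G (1/z)\<bar>" using 3 by (simp add: yi_def abs_mult power_divide)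
      hence a: "\<bar>yi z\<bar> * z\<^sup>2 \<le> 2" using dG[OF 3] by simp
      have "\<bar>yi z\<bar> * 1 \<le> \<bar>yi z\<bar> * z\<^sup>2" using 3 by (intro mult_left_mono) auto
      hence "\<bar>yi z\<bar> \<le> 2" using a by simp
      moreover have "(1 - z\<^sup>2) * yi z = wi z - (1 - \<alpha>)"
        using 3 by (simp add: yi_def wi_def inner_w_def \<alpha>_def power_divide field_simps)
      ultimately show ?thesis using Bi(2,3)[OF 3] a 3 Mp by (auto simp: y_def w_def)
    qed
  qed
  have deriv: "Bz k \<alpha> q (w z) (y z) > 1/2 \<and> \<bar>lam * (w z)\<^sup>2 - Bz k \<alpha> q (w z) (y z)\<bar> \<le> M * z \<and> isCont y z \<and>
        (w has_real_derivative - w z / (z * Bz k \<alpha> q (w z) (y z)) * (2 * y z * (w z - q) - w z * excess \<alpha> q (w z))) (at z)"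
    if z: "z > 0" "z \<noteq> 1" for z
  proof (cases "z < 1")
    case True
    hence zo: "z \<in> {0<..<1}" "z \<in> {0..<1}" "z \<in> {0..1}" using z by auto
    have wz: "w z = wo z" "y z = yo z" using True by (auto simp: w_def y_def)
    define m where "m = outer_m d z (H z)"
    define b where "b = outer_be k d z (H z)"
    have mb: "\<bar>m\<bar> \<le> Mm" "\<bar>b\<bar> \<le> Mb" unfolding m_def b_def using Mm Mb zo(3) Hb[OF zo(2)] by blast+
    have "lam * (wo z)\<^sup>2 - outer_B k d z (H z) = z * (lam * (d * m * (2 + z * d * m)) - d * b)"
      by (simp add: wo_def outer_B_def m_def b_def lam_def power2_eq_square algebra_simps)
    moreover have "\<bar>lam * (d * m * (2 + z * d * m)) - d * b\<bar> \<le> M"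
    proof -
      have "\<bar>2 + z * d * m\<bar> \<le> 3" using Bo(2,3)[OF zo(2)] by (auto simp: wo_def m_def)
      moreover have dm: "\<bar>d * m\<bar> \<le> 1 * Mm" unfolding abs_mult using d mb by (intro mult_mono) auto
      ultimately have "\<bar>d * m * (2 + z * d * m)\<bar> \<le> (1 * Mm) * 3" unfolding abs_mult[of "d * m"] by (intro mult_mono) (use Mn in auto)
      hence "\<bar>lam * (d * m * (2 + z * d * m))\<bar> \<le> \<bar>lam\<bar> * (Mm * 3)" unfolding abs_mult[of lam] by (intro mult_left_mono) auto
      moreover have "\<bar>d * b\<bar> \<le> 1 * Mb" unfolding abs_mult using d mb by (intro mult_mono) auto
      ultimately show ?thesis using Mn abs_ge_zero[of lam] unfolding M_def by linarith
    qed
    ultimately have bd: "\<bar>lam * (wo z)\<^sup>2 - Bz k \<alpha> q (wo z) (yo z)\<bar> \<le> M * z"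
      using z(1) by (simp add: Boe abs_mult mult.commute mult_left_mono)
    have "\<forall>\<^sub>F x in nhds z. x \<in> {..<1}" by (intro eventually_nhds_in_open) (use True in auto)
    hence nb: "\<forall>\<^sub>F x in nhds z. x < 1" by simp
    have "isCont H z" using Hd[OF zo(1)] DERIV_isCont by blast
    hence "isCont yo z" unfolding yo_def by (intro continuous_intros)
    moreover have "isCont y z = isCont yo z" by (rule isCont_cong, rule eventually_mono[OF nb]) (simp add: y_def)
    ultimately have cy: "isCont y z" by simp
    define B where "B = outer_B k d z (H z)"
    have B: "B > 1/2" using Bo(1)[OF zo(2)] by (simp add: B_def)
    have z2: "1 - z\<^sup>2 \<noteq> 0" using zo(1) by (simp add: power2_eq_1_iff)
    have "(wo has_real_derivative (d * m + z * d * (- d - 2 * z * H z) + z * d * (d * outer_N k d z (H z) / B))) (at z)"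
    proof -
      define Hp where "Hp = d * outer_N k d z (H z) / (B * (1 - z\<^sup>2))"
      have dH: "(H has_real_derivative Hp) (at z)" using Hd[OF zo(1)] by (simp add: Hp_def B_def)
      have "(wo has_real_derivative d * m + z * d * (- d - 2 * z * H z) + z * d * ((1 - z\<^sup>2) * Hp)) (at z)"
        unfolding wo_def outer_m_def
        using dH by (auto intro!: derivative_eq_intros simp: m_def outer_m_def algebra_simps)
      moreover have "(1 - z\<^sup>2) * Hp = d * outer_N k d z (H z) / B"
        unfolding Hp_def using z2 by simp
      ultimately show ?thesis by (simp only:)
    qed
    moreover have "d * m + z * d * (- d - 2 * z * H z) + z * d * (d * outer_N k d z (H z) / B)
        = - wo z / (z * B) * (2 * yo z * (wo z - q) - wo z * excess \<alpha> q (wo z))"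
    proof -
      have "z * (d * m + z * d * (- d - 2 * z * H z)) * B + z\<^sup>2 * d * (d * outer_N k d z (H z))
         = - wo z * (2 * yo z * (wo z - q) - wo z * excess \<alpha> q (wo z))"
        unfolding m_def B_def \<alpha>_def q_def wo_def yo_def using k d by (intro outer_slope) auto
      thus ?thesis using z(1) B by (simp add: divide_simps power2_eq_square) (simp add: algebra_simps)
    qed
    ultimately have "(wo has_real_derivative - wo z / (z * Bz k \<alpha> q (wo z) (yo z)) * (2 * yo z * (wo z - q) - wo z * excess \<alpha> q (wo z))) (at z)"
      by (simp add: Boe B_def)
    hence dw: "(w has_real_derivative - wo z / (z * Bz k \<alpha> q (wo z) (yo z)) * (2 * yo z * (wo z - q) - wo z * excess \<alpha> q (wo z))) (at z)"
      by (rule has_field_derivative_transform_within_open[of _ _ _ "{..<1}"]) (use True in \<open>auto simp: w_def\<close>)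
    show ?thesis using B bd cy dw by (simp add: wz Boe B_def)
  next
    case False
    hence z1: "z > 1" using z by simp
    have wz: "w z = wi z" "y z = yi z" using z1 by (auto simp: w_def y_def)
    have bd: "\<bar>lam * (wi z)\<^sup>2 - Bz k \<alpha> q (wi z) (yi z)\<bar> \<le> M * z"
    proof -
      have "(wi z)\<^sup>2 \<le> 2\<^sup>2" using Bi(2,3)[OF z1] by (intro power_mono) auto
      hence "\<bar>lam * (wi z)\<^sup>2\<bar> \<le> \<bar>lam\<bar> * 4" unfolding abs_mult by (intro mult_left_mono) auto
      moreover have "\<bar>Bz k \<alpha> q (wi z) (yi z)\<bar> \<le> Mi" unfolding Bie[symmetric] by (rule Mi[OF si(2)[OF z1] Gi[OF z1]])
      moreover have "4 * \<bar>lam\<bar> + Mi \<le> M" unfolding M_def using Mn by simp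
      moreover have "M * 1 \<le> M * z" using Mp z1 by (intro mult_left_mono) auto
      ultimately show ?thesis by linarith
    qed
    have "\<forall>\<^sub>F x in nhds z. x \<in> {1<..}" by (intro eventually_nhds_in_open) (use z1 in auto)
    hence nb: "\<forall>\<^sub>F x in nhds z. x > 1" by simp
    define s where "s = 1 / z"
    have s: "s \<in> {0<..<1}" "s > 0" using si(1)[OF z1] by (auto simp: s_def)
    have ds: "((\<lambda>z. 1 / z) has_real_derivative - (s\<^sup>2)) (at z)"
      using z1 by (auto intro!: derivative_eq_intros simp: s_def power2_eq_square)
    define B where "B = inner_B k d s (G s)"
    have B: "B > 1/2" using Bi(1)[OF z1] by (simp add: B_def s_def)
    define Gp where "Gp = inner_N k d s (G s) / (B * (s * (1 - s\<^sup>2)))"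
    have dGs: "(G has_real_derivative Gp) (at s)" using G(3)[OF s(1)] by (simp add: Gp_def B_def)
    have dGz: "((\<lambda>z. G (1 / z)) has_real_derivative Gp * - (s\<^sup>2)) (at z)"
      by (rule DERIV_chain2[OF _ ds]) (use dGs in \<open>simp add: s_def\<close>)
    have "isCont yi z" unfolding yi_def using z1 DERIV_isCont[OF dGz] by (intro continuous_intros) auto
    moreover have "isCont y z = isCont yi z" by (rule isCont_cong, rule eventually_mono[OF nb]) (simp add: y_def)
    ultimately have cy: "isCont y z" by simp
    have s2: "1 - s\<^sup>2 \<noteq> 0" using s(1) by (simp add: power2_eq_1_iff)
    have "(wi has_real_derivative - s * (2 * s\<^sup>2 * (d * G s) - d * inner_N k d s (G s) / B)) (at z)"
    proof -
      have "((\<lambda>s. inner_w d s (G s)) has_real_derivative 2 * s * (d * G s) - (1 - s\<^sup>2) * (d * Gp)) (at s)"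
        unfolding inner_w_def using dGs by (auto intro!: derivative_eq_intros simp: algebra_simps)
      from DERIV_chain2[OF this[unfolded s_def] ds]
      have "(wi has_real_derivative (2 * s * (d * G s) - (1 - s\<^sup>2) * (d * Gp)) * - (s\<^sup>2)) (at z)"
        unfolding wi_def by (simp add: s_def)
      moreover have "(1 - s\<^sup>2) * (d * Gp) * s = d * inner_N k d s (G s) / B"
        unfolding Gp_def using s2 s(2) B by (simp add: field_simps)
      from this[symmetric] have "(2 * s * (d * G s) - (1 - s\<^sup>2) * (d * Gp)) * - (s\<^sup>2) = - s * (2 * s\<^sup>2 * (d * G s) - d * inner_N k d s (G s) / B)"
        by (simp only:) (simp add: power2_eq_square algebra_simps)
      ultimately show ?thesis by (simp only:)
    qed
    moreover have "- s * (2 * s\<^sup>2 * (d * G s) - d * inner_N k d s (G s) / B)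
       = - wi z / (z * B) * (2 * yi z * (wi z - q) - wi z * excess \<alpha> q (wi z))"
    proof -
      have "2 * (s\<^sup>2 * (d * G s)) * B - d * inner_N k d s (G s) = wi z * (2 * yi z * (wi z - q) - wi z * excess \<alpha> q (wi z))"
        unfolding B_def inner_B_eq using inner_slope[of s d "G s" k] by (simp add: wi_def yi_def \<alpha>_def q_def s_def)
      hence "2 * (s\<^sup>2 * (d * G s)) - d * inner_N k d s (G s) / B = wi z * (2 * yi z * (wi z - q) - wi z * excess \<alpha> q (wi z)) / B"
        using B by (simp add: field_simps)
      thus ?thesis using z1 by (simp add: s_def mult.assoc)
    qed
    ultimately have "(wi has_real_derivative - wi z / (z * Bz k \<alpha> q (wi z) (yi z)) * (2 * yi z * (wi z - q) - wi z * excess \<alpha> q (wi z))) (at z)"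
      by (simp add: Bie[symmetric] B_def s_def)
    hence dw: "(w has_real_derivative - wi z / (z * Bz k \<alpha> q (wi z) (yi z)) * (2 * yi z * (wi z - q) - wi z * excess \<alpha> q (wi z))) (at z)"
      by (rule has_field_derivative_transform_within_open[of _ _ _ "{1<..}"]) (use z1 in \<open>auto simp: w_def\<close>)
    show ?thesis using Bi(1)[OF z1] bd cy dw by (simp add: wz Bie)
  qed
  have "((\<lambda>z. (w z - 1) / z) \<longlongrightarrow> d * h) (at_right 0)"
  proof -
    have "(H \<longlongrightarrow> h) (at 0 within {0..<1})"
      using Hc H0 unfolding continuous_on_def by force
    hence "(H \<longlongrightarrow> h) (at 0 within {0<..<1})" by (rule tendsto_within_subset) auto
    moreover have "at (0::real) within {0<..<1} = at_right 0"
      by (rule at_within_nhd[of _ "{-1<..<1}"]) auto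
    ultimately have Hl: "(H \<longlongrightarrow> h) (at_right 0)" by simp
    have "((\<lambda>z. d * (- z * d + (1 - z\<^sup>2) * H z)) \<longlongrightarrow> d * (- 0 * d + (1 - 0\<^sup>2) * h)) (at_right 0)"
      by (intro tendsto_intros Hl)
    hence "((\<lambda>z. d * (- z * d + (1 - z\<^sup>2) * H z)) \<longlongrightarrow> d * h) (at_right 0)" by simp
    moreover have "\<forall>\<^sub>F z::real in at_right 0. z \<in> {0<..<1}" by (rule eventually_at_right_real) simp
    hence "\<forall>\<^sub>F z in at_right 0. d * (- z * d + (1 - z\<^sup>2) * H z) = (w z - 1) / z"
      by (rule eventually_mono) (auto simp: w_def wo_def outer_m_def field_simps)
    ultimately show ?thesis by (rule Lim_transform_eventually)
  qed
  moreover have "\<forall>z>0. z \<noteq> 1 \<longrightarrow> Bz k \<alpha> q (w z) (y z) > 1/2 \<and>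
        \<bar>lam * (w z)\<^sup>2 - Bz k \<alpha> q (w z) (y z)\<bar> \<le> M * z \<and>
        isCont y z \<and> (w has_real_derivative - w z / (z * Bz k \<alpha> q (w z) (y z)) * (2 * y z * (w z - q) - w z * excess \<alpha> q (w z))) (at z)"
    using deriv by simp
  moreover have "\<forall>z>0. 1/2 < w z \<and> w z < 2 \<and> (1 - z\<^sup>2) * y z = w z - (1 - \<alpha>) \<and> \<bar>y z\<bar> \<le> M \<and> \<bar>y z\<bar> * z\<^sup>2 \<le> M"
    using range by simp
  ultimately show ?thesis using Mp(2) by (intro exI[of _ w] exI[of _ y] exI[of _ M] conjI) simp_all
qed

section \<open>Similarity profiles\<close>

text \<open>A bounded integrand may behave arbitrarily at the sonic point: the extension by 0 is
  bounded and Borel, so its indefinite integral is continuous across \<open>z = 1\<close> and starts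
  at 0.\<close>

lemma antiderivative_off_one:
  fixes g :: "real \<Rightarrow> real"
  assumes cont: "\<And>z. z > 0 \<Longrightarrow> z \<noteq> 1 \<Longrightarrow> isCont g z" and bd: "\<And>z. z > 0 \<Longrightarrow> z \<noteq> 1 \<Longrightarrow> \<bar>g z\<bar> \<le> N"
  shows "\<exists>K. continuous_on {0..} K \<and> K 0 = 0 \<and> (\<forall>z>0. z \<noteq> 1 \<longrightarrow> (K has_real_derivative g z) (at z))"
proof -
  define A where "A = {0<..} - {1::real}"
  have A: "open A" unfolding A_def by (intro open_Diff) auto
  define f where "f z = indicator A z * g z" for z
  have N: "N \<ge> 0" using bd[of 2] by linarith
  have fb: "\<bar>f z\<bar> \<le> N" for z using bd N by (auto simp: f_def A_def indicator_def)
  have fc: "isCont f z" if "z \<in> A" for z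
  proof -
    have "\<forall>\<^sub>F x in nhds z. x \<in> A" using A that by (rule eventually_nhds_in_open)
    hence "isCont f z = isCont g z" by (intro isCont_cong) (auto elim!: eventually_mono simp: f_def)
    thus ?thesis using cont that by (auto simp: A_def)
  qed
  have "continuous_on A g" using cont by (auto intro!: continuous_at_imp_continuous_on simp: A_def)
  hence fm: "f \<in> borel_measurable borel"
    unfolding f_def using borel_measurable_continuous_on_indicator[of A g] A by simp
  have int: "f integrable_on {0..b}" for b
  proof -
    have "set_integrable lborel {0..b} f"
      unfolding set_integrable_def
    proof (rule Bochner_Integration.integrable_bound)
      show "integrable lborel (\<lambda>x. N * indicator {0..b} x :: real)"
        using emeasure_compact_finite[OF compact_Icc[of 0 b]]
        by (intro integrable_mult_right integrable_real_indicator) auto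
      show "AE x in lborel. norm (indicat_real {0..b} x *\<^sub>R f x) \<le> norm (N * indicator {0..b} x :: real)"
        using fb N by (intro always_eventually) (auto simp: indicator_def)
    qed (use fm in measurable)
    thus ?thesis by (rule set_borel_integral_eq_integral(1))
  qed
  define K where "K z = integral {0..z} f" for z
  have "continuous_on {0..b} K" for b
    unfolding K_def by (rule indefinite_integral_continuous_1[OF int])
  hence "continuous_on {0..} K" by (rule continuous_on_atLeast_exhaust)
  moreover have "K 0 = 0" by (simp add: K_def)
  moreover have "(K has_real_derivative g z) (at z)" if z: "z > 0" "z \<noteq> 1" for z
  proof -
    have zA: "z \<in> A" using z by (simp add: A_def)
    have "((\<lambda>u. integral {0..u} f) has_vector_derivative f z) (at z within ({0..z+1} - {}))"
      by (rule integral_has_vector_derivative_continuous_at[OF int])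
         (use z fc[OF zA] in \<open>auto intro: continuous_at_imp_continuous_at_within\<close>)
    hence "(K has_vector_derivative f z) (at z within {0..z+1})" by (simp add: K_def[abs_def])
    moreover have "at z within {0..z+1} = at z" using z by (intro at_within_interior) auto
    ultimately show ?thesis using zA by (simp add: has_real_derivative_iff_has_vector_derivative f_def)
  qed
  ultimately show ?thesis by blast
qed

text \<open>\<open>f z - N / z\<close> is nondecreasing and \<open>f z + N / z\<close>
  nonincreasing, so the first is bounded above by the start of the second and converges.\<close>

lemma convergent_at_top_of_deriv_bound:
  fixes f f' :: "real \<Rightarrow> real"
  assumes der: "\<And>z. z \<ge> 2 \<Longrightarrow> (f has_real_derivative f' z) (at z)" and bd: "\<And>z. z \<ge> 2 \<Longrightarrow> \<bar>f' z\<bar> \<le> N / z\<^sup>2"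
  shows "\<exists>l. (f \<longlongrightarrow> l) at_top"
proof -
  have N: "N \<ge> 0" using bd[of 2] by (simp add: abs_le_iff)
  define g where "g z = f z - N / z" for z
  have mono: "g x \<le> g y" if "2 \<le> x" "x \<le> y" for x y
  proof (rule DERIV_nonneg_imp_nondecreasing[OF that(2)])
    fix z assume z: "x \<le> z" "z \<le> y"
    have "(g has_real_derivative f' z + N / z\<^sup>2) (at z)"
      unfolding g_def using der[of z] z that
      by (auto intro!: derivative_eq_intros simp: power2_eq_square)
    moreover have "f' z + N / z\<^sup>2 \<ge> 0" using bd[of z] z that by (simp add: abs_le_iff)
    ultimately show "\<exists>y. (g has_real_derivative y) (at z) \<and> y \<ge> 0" by blast
  qed
  have ub: "g z \<le> f 2 + N / 2" if "z \<ge> 2" for z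
  proof -
    have "f z + N / z \<le> f 2 + N / 2"
    proof (rule DERIV_nonpos_imp_nonincreasing[OF that])
      fix x assume x: "2 \<le> x" "x \<le> z"
      have "((\<lambda>z. f z + N / z) has_real_derivative f' x - N / x\<^sup>2) (at x)"
        using der[of x] x by (auto intro!: derivative_eq_intros simp: power2_eq_square)
      moreover have "f' x - N / x\<^sup>2 \<le> 0" using bd[of x] x by (simp add: abs_le_iff)
      ultimately show "\<exists>y. ((\<lambda>z. f z + N / z) has_real_derivative y) (at x) \<and> y \<le> 0" by blast
    qed
    moreover have "N / z \<ge> 0" using N that by simp
    ultimately show ?thesis by (simp add: g_def)
  qed
  define l where "l = Sup (g ` {2..})"
  have bdd: "bdd_above (g ` {2..})" using ub by (auto intro!: bdd_aboveI)
  have "(g \<longlongrightarrow> l) at_top"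
  proof (rule order_tendstoI)
    fix a assume "a < l"
    then obtain x where x: "x \<ge> 2" "a < g x" unfolding l_def using less_cSup_iff[OF _ bdd] by auto
    show "\<forall>\<^sub>F z in at_top. a < g z"
      using eventually_ge_at_top[of x] by (rule eventually_mono) (use x mono[of x] in force)
  next
    fix a assume a: "a > l"
    show "\<forall>\<^sub>F z in at_top. g z < a"
      using eventually_ge_at_top[of 2]
    proof (rule eventually_mono)
      fix z :: real assume "2 \<le> z"
      hence "g z \<le> l" unfolding l_def by (intro cSup_upper bdd) auto
      thus "g z < a" using a by simp
    qed
  qed
  moreover have "((\<lambda>z. N / z) \<longlongrightarrow> 0) at_top" by (rule tendsto_divide_0[OF tendsto_const filterlim_at_top_imp_at_infinity[OF filterlim_ident]])
  ultimately have "((\<lambda>z. g z + N / z) \<longlongrightarrow> l + 0) at_top" by (rule tendsto_add)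
  thus ?thesis by (auto simp: g_def)
qed

lemma strict_increasing_off_one:
  fixes f :: "real \<Rightarrow> real"
  assumes "continuous_on {0<..} f" and "\<And>z. z > 0 \<Longrightarrow> z \<noteq> 1 \<Longrightarrow> \<exists>D>0. (f has_real_derivative D) (at z)"
    and "0 < x" "x < y"
  shows "f x < f y"
proof -
  have one: "f a < f b" if "0 < a" "a < b" "1 \<notin> {a<..<b}" for a b
  proof (rule DERIV_pos_imp_increasing_open[OF that(2)])
    fix x assume x: "a < x" "x < b"
    hence "x > 0" "x \<noteq> 1" using that by auto
    from assms(2)[OF this] show "\<exists>y. (f has_real_derivative y) (at x) \<and> y > 0" by blast
  next
    show "continuous_on {a..b} f" by (rule continuous_on_subset[OF assms(1)]) (use that in auto)
  qed
  show ?thesis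
  proof (cases "1 \<in> {x<..<y}")
    case True
    thus ?thesis using one[of x 1] one[of 1 y] assms(3) by auto
  qed (use one assms(3,4) in blast)
qed

text \<open>The formulas for \<open>Vd\<close> and \<open>Cd\<close> have the factor
  \<open>1 - z\<^sup>2\<close> already divided out. The first equation then amounts to the
  factorisation of the sonic quadratic, the second to \<open>rel\<close>. The third identity shows
  that \<open>C - lam * Cd\<close> is controlled by \<open>y * z\<close> although \<open>C\<close>
  itself is unbounded.\<close>

lemma similarity_equations:
  fixes k \<alpha> q lam w y z :: real
  assumes k: "k > 0" and w: "w > 0" and lam: "lam = 1 + 2 * (1 - \<alpha>) * q" "lam \<noteq> 0" and rel: "k * \<alpha> * (1 - q) = (1 - \<alpha>) * q"
    and y: "(1 - z\<^sup>2) * y = w - (1 - \<alpha>)"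
  defines "V \<equiv> w - 1" and "C \<equiv> z * w" and "Vd \<equiv> - (2 * y * (w - q) - w * excess \<alpha> q w) / (lam * w)"
    and "Cd \<equiv> z * w * (w\<^sup>2 + 2 * k * y * (w - q)) / (lam * w\<^sup>2)"
  shows "lam * (V - Vd) + V\<^sup>2 - lam * V * Vd + (C\<^sup>2 - lam * C * Cd) / k = 0"
    and "lam * (Cd - C) - V * (C - lam * Cd) + k * C * (lam * Vd - 3 * V) = 0"
    and "C - lam * Cd = - 2 * k * (y * z) * (w - q) / w"
proof -
  define a where "a = y * (w - q)"
  have lV: "lam * Vd = excess \<alpha> q w - 2 * a / w"
    using w lam(2) by (simp add: Vd_def a_def field_simps)
  have lC: "lam * Cd = C + 2 * k * z * a / w"
    using w lam(2) by (simp add: Cd_def C_def a_def power2_eq_square field_simps)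
  show "C - lam * Cd = - 2 * k * (y * z) * (w - q) / w" unfolding lC by (simp add: a_def)
  have "lam * (V - Vd) + V\<^sup>2 - lam * V * Vd + (C\<^sup>2 - lam * C * Cd) / k = lam * V + V\<^sup>2 - w * (lam * Vd) + (C * (C - lam * Cd)) / k"
    by (simp add: V_def power2_eq_square algebra_simps)
  also have "\<dots> = (w - 1) * (lam + w - 1) - w * excess \<alpha> q w + 2 * (w - q) * ((1 - z\<^sup>2) * y)"
    unfolding lV lC using w k by (simp add: V_def C_def a_def field_simps power2_eq_square)
  \<comment> \<open>Once \<open>(1 - z\<^sup>2) * y\<close> is replaced by
    \<open>w - (1 - \<alpha>)\<close>, the terms left over are the sonic quadratic minus its
    factored form.\<close>
  also have "\<dots> = 0" unfolding y lam(1) excess_def by (simp add: algebra_simps power2_eq_square)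
  finally show "lam * (V - Vd) + V\<^sup>2 - lam * V * Vd + (C\<^sup>2 - lam * C * Cd) / k = 0" .
  have "lam * (Cd - C) - V * (C - lam * Cd) + k * C * (lam * Vd - 3 * V)
     = w * (lam * Cd - C) - (lam - 1) * C + k * C * (lam * Vd - 3 * V)"
    by (simp add: V_def algebra_simps)
  also have "\<dots> = C * (2 * k * \<alpha> * (1 - q) - (lam - 1))"
    unfolding lV lC using w by (simp add: V_def C_def excess_def field_simps power2_eq_square)
  also have "2 * k * \<alpha> * (1 - q) = 2 * (k * \<alpha> * (1 - q))" by simp
  also have "\<dots> = lam - 1" unfolding rel lam(1) by simp
  finally show "lam * (Cd - C) - V * (C - lam * Cd) + k * C * (lam * Vd - 3 * V) = 0" by simp
qed

text \<open>Both time directions are described on \<open>x > 0\<close> with \<open>C > 0\<close> and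
  brought to the true signs later by reflections. The slope of \<open>C\<close> at 0 is normalised
  to 1, so that two halves fit together without rescaling \<open>x\<close>; \<open>xP\<close> is the
  similarity variable of the sonic point.\<close>

definition half_similarity where
  "half_similarity lam k v V C Vd Cd xP M B \<longleftrightarrow> B > 0 \<and> continuous_on {0<..} V \<and> continuous_on {0<..} C \<and>
    (\<forall>x>0. \<bar>V x\<bar> \<le> M \<and> C x > 0) \<and>
    (\<forall>x>0. x \<noteq> xP \<longrightarrow> (V has_real_derivative Vd x / x) (at x) \<and> (C has_real_derivative Cd x / x) (at x) \<and>
       \<bar>Vd x\<bar> \<le> M \<and> \<bar>C x - lam * Cd x\<bar> \<le> M \<and>
       lam * (V x - Vd x) + (V x)\<^sup>2 - lam * V x * Vd x + ((C x)\<^sup>2 - lam * C x * Cd x) / k = 0 \<and>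
       lam * (Cd x - C x) - V x * (C x - lam * Cd x) + k * C x * (lam * Vd x - 3 * V x) = 0) \<and>
    ((\<lambda>x. V x / x) \<longlongrightarrow> v) (at_right 0) \<and> ((\<lambda>x. C x / x) \<longlongrightarrow> 1) (at_right 0) \<and>
    ((\<lambda>x. C x * x powr (- 1 / lam)) \<longlongrightarrow> B) at_top"
  for V C Vd Cd :: "real \<Rightarrow> real"

text \<open>The similarity variable is recovered by a quadrature: \<open>ln x\<close> has derivative
  \<open>lam * w\<^sup>2 / b\<close> with respect to \<open>ln z\<close>. This makes
  \<open>x = \<xi> z\<close> an increasing bijection of the positive half line, and its inverse
  \<open>Z\<close> carries the trajectory back to functions of \<open>x\<close>.\<close>

lemma half_profile:
  assumes k: "k > 0" and d: "d > 0" "d < 1" and ig: "inner_good k d" and og: "outer_good k d"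
    and h: "h \<in> {- H0 k..H0 k}"
  defines "lam \<equiv> lama k (d\<^sup>2)"
  shows "\<exists>V C Vd Cd xP M B. half_similarity lam k (d * h) V C Vd Cd xP M B"
proof -
  define \<alpha> where "\<alpha> = d\<^sup>2"
  define q where "q = qa k \<alpha>"
  have \<alpha>: "0 < \<alpha>" "\<alpha> < 1" using d by (auto simp: \<alpha>_def power_less_one_iff abs_square_less_1)
  have rel: "k * \<alpha> * (1 - q) = (1 - \<alpha>) * q" unfolding q_def using k \<alpha> by (intro qa_relation) auto
  have qb: "0 \<le> q" "q \<le> 1"
    using qa_den[OF k, of \<alpha>] k \<alpha> by (auto simp: q_def qa_def divide_le_eq)
  have lam: "lam = 1 + 2 * (1 - \<alpha>) * q" by (simp add: lam_def lama_def q_def \<alpha>_def)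
  have lam1: "lam \<ge> 1" unfolding lam using \<alpha> qb by simp
  have "\<exists>w y M. M > 0 \<and>
     (\<forall>z>0. 1/2 < w z \<and> w z < 2 \<and> (1 - z\<^sup>2) * y z = w z - (1 - \<alpha>) \<and> \<bar>y z\<bar> \<le> M \<and> \<bar>y z\<bar> * z\<^sup>2 \<le> M) \<and>
     (\<forall>z>0. z \<noteq> 1 \<longrightarrow> Bz k \<alpha> q (w z) (y z) > 1/2 \<and>
        \<bar>lam * (w z)\<^sup>2 - Bz k \<alpha> q (w z) (y z)\<bar> \<le> M * z \<and>
        isCont y z \<and> (w has_real_derivative - w z / (z * Bz k \<alpha> q (w z) (y z)) * (2 * y z * (w z - q) - w z * excess \<alpha> q (w z))) (at z)) \<and>
     ((\<lambda>z. (w z - 1) / z) \<longlongrightarrow> d * h) (at_right 0)" (is "\<exists>w y M. ?P w y M")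
    unfolding lam_def q_def \<alpha>_def by (rule similarity_curve[OF k d ig og h])
  then obtain w y :: "real \<Rightarrow> real" and M :: real where curve: "?P w y M" by blast
  have M: "M > 0" using curve by (rule conjunct1)
  note rng = curve[THEN conjunct2, THEN conjunct1, rule_format]
  note dd = curve[THEN conjunct2, THEN conjunct2, THEN conjunct1, rule_format]
  have wl: "((\<lambda>z. (w z - 1) / z) \<longlongrightarrow> d * h) (at_right 0)"
    using curve[THEN conjunct2, THEN conjunct2] by (rule conjunct2)
  define b where "b z = Bz k \<alpha> q (w z) (y z)" for z
  \<comment> \<open>The derivative of \<open>ln (x / z)\<close>. Subtracting \<open>ln z\<close>
    removes the pole at \<open>z = 0\<close>, because \<open>lam * (w z)\<^sup>2 - b z\<close> is of
    order \<open>z\<close>.\<close>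
  define g where "g z = (lam * (w z)\<^sup>2 - b z) / (z * b z)" for z
  have w: "1/2 < w z" "w z < 2" "(1 - z\<^sup>2) * y z = w z - (1 - \<alpha>)" "\<bar>y z\<bar> \<le> M" "\<bar>y z\<bar> * z\<^sup>2 \<le> M" if "z > 0" for z
    using rng[OF that] by auto
  have bz: "b z > 1/2" "\<bar>lam * (w z)\<^sup>2 - b z\<bar> \<le> M * z" "isCont y z"
    and dw: "(w has_real_derivative - w z / (z * b z) * (2 * y z * (w z - q) - w z * excess \<alpha> q (w z))) (at z)"
    if "z > 0" "z \<noteq> 1" for z
    using dd[OF that] by (auto simp: b_def)
  have cw: "isCont w z" if "z > 0" for z
  proof (cases "z = 1")
    case True
    have ev: "\<forall>\<^sub>F x in nhds (1::real). x \<in> {0<..}" by (rule eventually_nhds_in_open) auto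
    have "((\<lambda>z. w z - (1 - \<alpha>)) \<longlongrightarrow> 0) (at 1)"
    proof (rule Lim_null_comparison)
      show "\<forall>\<^sub>F z in at 1. norm (w z - (1 - \<alpha>)) \<le> \<bar>1 - z\<^sup>2\<bar> * M"
        unfolding eventually_at_filter using ev
      proof (rule eventually_mono)
        fix z :: real assume "z \<in> {0<..}"
        hence z: "z > 0" by simp
        show "z \<noteq> 1 \<longrightarrow> z \<in> UNIV \<longrightarrow> norm (w z - (1 - \<alpha>)) \<le> \<bar>1 - z\<^sup>2\<bar> * M"
          unfolding w(3)[OF z, symmetric] using w(4)[OF z] by (simp add: abs_mult mult_left_mono)
      qed
      have "((\<lambda>z::real. \<bar>1 - z\<^sup>2\<bar> * M) \<longlongrightarrow> \<bar>1 - 1\<^sup>2\<bar> * M) (at 1)" by (intro tendsto_intros)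
      thus "((\<lambda>z::real. \<bar>1 - z\<^sup>2\<bar> * M) \<longlongrightarrow> 0) (at 1)" by simp
    qed
    hence "(w \<longlongrightarrow> 1 - \<alpha>) (at 1)" by (simp add: LIM_zero_iff)
    moreover have "w 1 = 1 - \<alpha>" using w(3)[of 1] by simp
    ultimately show ?thesis using True by (simp add: isCont_def)
  next
    case False
    thus ?thesis using dw[OF that] DERIV_isCont by blast
  qed
  have cb: "isCont b z" if "z > 0" "z \<noteq> 1" for z
    unfolding b_def Bz_def excess_def using cw[OF that(1)] bz(3)[OF that] by (intro continuous_intros)
  have "\<exists>K. continuous_on {0..} K \<and> K 0 = 0 \<and> (\<forall>z>0. z \<noteq> 1 \<longrightarrow> (K has_real_derivative g z) (at z))"
  proof (rule antiderivative_off_one)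
    fix z :: real assume z: "z > 0" "z \<noteq> 1"
    show "isCont g z" unfolding g_def using cw[OF z(1)] cb[OF z] bz(1)[OF z] z by (intro continuous_intros) auto
    have "\<bar>g z\<bar> = \<bar>lam * (w z)\<^sup>2 - b z\<bar> / (z * b z)" using z bz(1)[OF z] by (simp add: g_def abs_mult)
    also have "\<dots> \<le> M * z / (z * (1/2))" using z bz(1,2)[OF z] M by (intro frac_le mult_left_mono) auto
    also have "\<dots> = 2 * M" using z by simp
    finally show "\<bar>g z\<bar> \<le> 2 * M" .
  qed
  then obtain K where K: "continuous_on {0..} K" "K 0 = 0" "\<And>z. z > 0 \<Longrightarrow> z \<noteq> 1 \<Longrightarrow> (K has_real_derivative g z) (at z)" by blast
  \<comment> \<open>The equations are autonomous in \<open>ln x\<close>, so the constant of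
    integration is free; \<open>K 0 = 0\<close> makes \<open>x\<close> and \<open>z\<close>
    asymptotically equal at the origin and thereby normalises the slope of \<open>C\<close>.\<close>
  define \<xi> where "\<xi> z = z * exp (K z)" for z
  have \<xi>pos: "\<xi> z > 0" if "z > 0" for z using that by (simp add: \<xi>_def)
  have d\<xi>: "(\<xi> has_real_derivative \<xi> z * (lam * (w z)\<^sup>2 / (z * b z))) (at z)" if z: "z > 0" "z \<noteq> 1" for z
  proof -
    have "(\<xi> has_real_derivative exp (K z) + z * (exp (K z) * g z)) (at z)"
      unfolding \<xi>_def using K(3)[OF z] by (auto intro!: derivative_eq_intros)
    moreover have "exp (K z) + z * (exp (K z) * g z) = \<xi> z * (lam * (w z)\<^sup>2 / (z * b z))"
      using z bz(1)[OF z] by (simp add: \<xi>_def g_def field_simps)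
    ultimately show ?thesis by simp
  qed
  have \<xi>c: "continuous_on {0..} \<xi>" unfolding \<xi>_def by (intro continuous_intros K(1))
  have inc: "\<xi> x < \<xi> z" if "0 < x" "x < z" for x z
  proof (rule strict_increasing_off_one[OF _ _ that])
    show "continuous_on {0<..} \<xi>" by (rule continuous_on_subset[OF \<xi>c]) auto
    fix z :: real assume z: "z > 0" "z \<noteq> 1"
    have "\<xi> z * (lam * (w z)\<^sup>2 / (z * b z)) > 0"
      using \<xi>pos[OF z(1)] lam1 w(1)[OF z(1)] z bz(1)[OF z] by (intro mult_pos_pos divide_pos_pos) auto
    thus "\<exists>D>0. (\<xi> has_real_derivative D) (at z)" using d\<xi>[OF z] by blast
  qed
  have c\<xi>: "isCont \<xi> z" if "z > 0" for z
    by (rule continuous_on_interior[OF \<xi>c]) (use that in simp)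
  text \<open>\<open>exp (L z)\<close> is \<open>C x powr (-1/lam)\<close>.\<close>
  define L where "L z = ln (z * w z) - ln (\<xi> z) / lam" for z
  have dL: "(L has_real_derivative 2 * k * y z * (w z - q) / (z * b z)) (at z)" if z: "z > 0" "z \<noteq> 1" for z
  proof -
    define e where "e = 2 * y z * (w z - q) - w z * excess \<alpha> q (w z)"
    have wp: "w z > 0" using w(1)[OF z(1)] by simp
    have "((\<lambda>z. ln (z * w z)) has_real_derivative (w z + z * (- w z / (z * b z) * e)) / (z * w z)) (at z)"
      using dw[OF z] z wp by (auto intro!: derivative_eq_intros simp: e_def field_simps)
    moreover have "((\<lambda>z. ln (\<xi> z) / lam) has_real_derivative (\<xi> z * (lam * (w z)\<^sup>2 / (z * b z))) / \<xi> z / lam) (at z)"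
      using d\<xi>[OF z] \<xi>pos[OF z(1)] lam1 by (auto intro!: derivative_eq_intros)
    ultimately have "(L has_real_derivative (w z + z * (- w z / (z * b z) * e)) / (z * w z) - (\<xi> z * (lam * (w z)\<^sup>2 / (z * b z))) / \<xi> z / lam) (at z)"
      unfolding L_def by (rule DERIV_diff)
    moreover have "(w z + z * (- w z / (z * b z) * e)) / (z * w z) - (\<xi> z * (lam * (w z)\<^sup>2 / (z * b z))) / \<xi> z / lam
        = (b z - e - (w z)\<^sup>2) / (z * b z)"
      using z wp bz(1)[OF z] \<xi>pos[OF z(1)] lam1 by (simp add: divide_simps) (simp add: algebra_simps power2_eq_square)
    moreover have "b z - e - (w z)\<^sup>2 = 2 * k * y z * (w z - q)"
      unfolding b_def Bz_def e_def by (simp add: algebra_simps)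
    ultimately show ?thesis by simp
  qed
  have wq: "\<bar>w z - q\<bar> \<le> 3" if "z > 0" for z using w(1,2)[OF that] qb by linarith
  \<comment> \<open>Near the centre \<open>\<bar>y z\<bar>\<close> is at most
    \<open>M / z\<^sup>2\<close>, so the derivative of \<open>L\<close> is integrable at infinity.
    The limit gives the positive constant \<open>B = exp l\<close>.\<close>
  have "\<exists>l. (L \<longlongrightarrow> l) at_top"
  proof (rule convergent_at_top_of_deriv_bound[OF dL])
    fix z :: real assume z: "z \<ge> 2"
    hence z': "z > 0" "z \<noteq> 1" by auto
    have "\<bar>y z\<bar> \<le> M / z\<^sup>2" using w(5)[OF z'(1)] z by (simp add: pos_le_divide_eq)
    hence "\<bar>y z * (w z - q)\<bar> \<le> M / z\<^sup>2 * 3" unfolding abs_mult using wq[OF z'(1)] M by (intro mult_mono) auto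
    hence yb: "2 * k * \<bar>y z * (w z - q)\<bar> / 1 \<le> 2 * k * (M / z\<^sup>2 * 3) / 1" using k by (intro divide_right_mono mult_left_mono) auto
    have "\<bar>2 * k * y z * (w z - q) / (z * b z)\<bar> = 2 * k * \<bar>y z * (w z - q)\<bar> / (z * b z)"
      using k z' bz(1)[OF z'] by (simp add: abs_mult)
    also have "\<dots> \<le> 2 * k * \<bar>y z * (w z - q)\<bar> / 1"
    proof (intro divide_left_mono)
      have "2 * (1/2) \<le> z * b z" using z bz(1)[OF z'] by (intro mult_mono) auto
      thus "1 \<le> z * b z" by simp
    qed (use k z' bz(1)[OF z'] in auto)
    also note yb
    finally show "\<bar>2 * k * y z * (w z - q) / (z * b z)\<bar> \<le> (2 * k * (M * 3)) / z\<^sup>2" by simp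
  qed auto
  then obtain l where l: "(L \<longlongrightarrow> l) at_top" by blast
  \<comment> \<open>Since \<open>L\<close> converges, \<open>\<xi> z\<close> is
    \<open>(z * w z) powr lam\<close> up to a factor with a positive limit. Hence the trajectory
    does not stop at a finite similarity variable.\<close>
  have \<xi>top: "filterlim \<xi> at_top at_top"
  proof -
    have t1: "((\<lambda>z. exp (- L z)) \<longlongrightarrow> exp (- l)) at_top" by (intro tendsto_intros l)
    have t2: "filterlim (\<lambda>z. z * w z) at_top at_top"
    proof (rule filterlim_at_top_mono[where f="\<lambda>z. 1/2 * z"])
      show "filterlim (\<lambda>z::real. 1/2 * z) at_top at_top"
        by (rule filterlim_tendsto_pos_mult_at_top[OF tendsto_const _ filterlim_ident]) simp
      show "\<forall>\<^sub>F z in at_top. 1/2 * z \<le> z * w z"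
        using eventually_gt_at_top[of 0] by (rule eventually_mono) (use w(1) in \<open>force simp: mult.commute\<close>)
    qed
    have t3: "filterlim (\<lambda>z. exp (- L z) * (z * w z)) at_top at_top"
      by (rule filterlim_tendsto_pos_mult_at_top[OF t1 _ t2]) simp
    have "filterlim (\<lambda>z. (exp (- L z) * (z * w z)) powr lam) at_top at_top"
      by (rule filterlim_compose[OF real_powr_at_top t3]) (use lam1 in simp)
    moreover have "\<forall>\<^sub>F z in at_top. (exp (- L z) * (z * w z)) powr lam = \<xi> z"
      using eventually_gt_at_top[of 0]
    proof (rule eventually_mono)
      fix z :: real assume z: "0 < z"
      have zw: "z * w z > 0" using z w(1)[OF z] by simp
      have "exp (- L z) = exp (ln (\<xi> z) / lam) / (z * w z)"
        unfolding L_def using zw by (simp add: exp_diff)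
      hence "exp (- L z) * (z * w z) = exp (ln (\<xi> z) / lam)" using zw z by auto
      thus "(exp (- L z) * (z * w z)) powr lam = \<xi> z" using lam1 \<xi>pos[OF z] by (simp add: powr_def)
    qed
    ultimately show ?thesis by (rule filterlim_mono_eventually[OF _ order.refl order.refl])
  qed
  have surj: "\<exists>z>0. \<xi> z = x" if x: "x > 0" for x
  proof -
    obtain z2 where z2: "z2 > 0" "\<xi> z2 \<ge> x"
    proof -
      have "\<forall>\<^sub>F z in at_top. \<xi> z \<ge> x \<and> z > 0"
        using \<xi>top eventually_gt_at_top[of 0] by (auto simp: filterlim_at_top intro: eventually_conj)
      then obtain z where "\<xi> z \<ge> x \<and> z > 0" using eventually_happens by force
      thus ?thesis using that by blast
    qed
    have "\<exists>z\<ge>0. z \<le> z2 \<and> \<xi> z = x"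
      by (rule IVT') (use z2 x in \<open>auto simp: \<xi>_def[of 0] intro: continuous_on_subset[OF \<xi>c]\<close>)
    then obtain z where z: "z \<ge> 0" "\<xi> z = x" by blast
    hence "z \<noteq> 0" using x by (auto simp: \<xi>_def)
    thus ?thesis using z by (intro exI[of _ z]) auto
  qed
  define Z where "Z x = (SOME z. z > 0 \<and> \<xi> z = x)" for x
  have Z: "Z x > 0" "\<xi> (Z x) = x" if "x > 0" for x
    using someI_ex[OF surj[OF that]] unfolding Z_def by auto
  have inj: "x = z" if "\<xi> x = \<xi> z" "x > 0" "z > 0" for x z
    using inc[of x z] inc[of z x] that by (metis less_irrefl linorder_neqE_linordered_idom)
  have Z\<xi>: "Z (\<xi> z) = z" if "z > 0" for z
    using Z[OF \<xi>pos[OF that]] inj that by blast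
  have Zc: "isCont Z x" if x: "x > 0" for x
  proof -
    have "isCont Z (\<xi> (Z x))"
    proof (rule isCont_inverse_function[where f=\<xi> and g=Z and x="Z x" and d="Z x / 2"])
      fix z assume "\<bar>z - Z x\<bar> \<le> Z x / 2"
      hence "z > 0" using Z(1)[OF x] by (auto simp: abs_if split: if_splits)
      thus "Z (\<xi> z) = z" "isCont \<xi> z" by (rule Z\<xi>, rule c\<xi>)
    qed (use Z(1)[OF x] in simp)
    thus ?thesis using Z(2)[OF x] by simp
  qed
  define xP where "xP = \<xi> 1"
  have Zn1: "Z x \<noteq> 1" if "x > 0" "x \<noteq> xP" for x using Z(2)[OF that(1)] that(2) by (auto simp: xP_def)
  have dZ: "(Z has_real_derivative Z x * b (Z x) / (x * (lam * (w (Z x))\<^sup>2))) (at x)" if x: "x > 0" "x \<noteq> xP" for x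
  proof -
    note z = Z(1)[OF x(1)] Zn1[OF x]
    let ?D = "\<xi> (Z x) * (lam * (w (Z x))\<^sup>2 / (Z x * b (Z x)))"
    have Dp: "?D > 0" using \<xi>pos[OF z(1)] lam1 w(1)[OF z(1)] z bz(1)[OF z] by (intro mult_pos_pos divide_pos_pos) auto
    have "(Z has_real_derivative inverse ?D) (at x)"
      by (rule DERIV_inverse_function[of \<xi> _ Z x "x / 2" "x + 1"]) (use d\<xi>[OF z] Dp x Z(2) Zc[OF x(1)] in auto)
    thus ?thesis using Z(2)[OF x(1)] by simp
  qed
  define V where "V x = w (Z x) - 1" for x
  define C where "C x = Z x * w (Z x)" for x
  define Vd where "Vd x = - (2 * y (Z x) * (w (Z x) - q) - w (Z x) * excess \<alpha> q (w (Z x))) / (lam * w (Z x))" for x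
  define Cd where "Cd x = Z x * w (Z x) * ((w (Z x))\<^sup>2 + 2 * k * y (Z x) * (w (Z x) - q)) / (lam * (w (Z x))\<^sup>2)" for x
  have ccw: "isCont (\<lambda>x. w (Z x)) x" if "x > 0" for x
    by (rule isCont_o2[OF Zc[OF that] cw[OF Z(1)[OF that]]])
  have Vc: "continuous_on {0<..} V" unfolding V_def
    using ccw by (intro continuous_at_imp_continuous_on ballI continuous_intros) auto
  have Cc: "continuous_on {0<..} C" unfolding C_def
    using ccw Zc by (intro continuous_at_imp_continuous_on ballI continuous_intros) auto
  define N where "N = 1 + (2 * M * 3 + 2 * 9) * 2 + 2 * k * M * 3 * 2 + 2 * (2 * M * 3 + 2 * 9)"
  have N0: "N \<ge> 1" using M k by (simp add: N_def)
  have main: "(V has_real_derivative Vd x / x) (at x) \<and> (C has_real_derivative Cd x / x) (at x) \<and>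
       \<bar>Vd x\<bar> \<le> N \<and> \<bar>C x - lam * Cd x\<bar> \<le> N \<and>
       lam * (V x - Vd x) + (V x)\<^sup>2 - lam * V x * Vd x + ((C x)\<^sup>2 - lam * C x * Cd x) / k = 0 \<and>
       lam * (Cd x - C x) - V x * (C x - lam * Cd x) + k * C x * (lam * Vd x - 3 * V x) = 0"
    if x: "x > 0" "x \<noteq> xP" for x
  proof -
    define z where "z = Z x"
    have z: "z > 0" "z \<noteq> 1" using Z(1)[OF x(1)] Zn1[OF x] by (auto simp: z_def)
    have wp: "w z > 0" using w(1)[OF z(1)] by simp
    define e where "e = 2 * y z * (w z - q) - w z * excess \<alpha> q (w z)"
    have dZ': "(Z has_real_derivative z * b z / (x * (lam * (w z)\<^sup>2))) (at x)" using dZ[OF x] by (simp add: z_def)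
    have dwz: "((\<lambda>x. w (Z x)) has_real_derivative - w z / (z * b z) * e * (z * b z / (x * (lam * (w z)\<^sup>2)))) (at x)"
      by (rule DERIV_chain2[OF _ dZ']) (use dw[OF z] in \<open>simp add: z_def e_def\<close>)
    have Vd_e: "Vd x = - e / (lam * w z)" by (simp add: Vd_def z_def e_def)
    have s1: "- w z / (z * b z) * e * (z * b z / (x * (lam * (w z)\<^sup>2))) = Vd x / x"
      using z x wp lam1 bz(1)[OF z] by (simp add: Vd_e field_simps power2_eq_square)
    have dV: "(V has_real_derivative Vd x / x) (at x)"
      unfolding V_def using DERIV_diff[OF dwz[unfolded s1] DERIV_const[of 1]] by simp
    have dC: "(C has_real_derivative Cd x / x) (at x)"
    proof -
      have "(C has_real_derivative z * b z / (x * (lam * (w z)\<^sup>2)) * w z + - w z / (z * b z) * e * (z * b z / (x * (lam * (w z)\<^sup>2))) * z) (at x)"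
        unfolding C_def using DERIV_mult[OF dZ' dwz] by (simp add: z_def[symmetric] add.commute)
      moreover have "z * b z / (x * (lam * (w z)\<^sup>2)) * w z + - w z / (z * b z) * e * (z * b z / (x * (lam * (w z)\<^sup>2))) * z
          = z * w z * (b z - e) / (lam * (w z)\<^sup>2) / x"
        using z x wp lam1 bz(1)[OF z] by (simp add: divide_simps) (simp add: algebra_simps power2_eq_square)
      moreover have "b z - e = (w z)\<^sup>2 + 2 * k * y z * (w z - q)"
        unfolding b_def Bz_def e_def by (simp add: algebra_simps)
      ultimately show ?thesis by (simp add: Cd_def z_def[symmetric])
    qed
    note eqs = similarity_equations[OF k wp lam _ rel w(3)[OF z(1)]]
    have ab: "\<bar>a * c\<bar> \<le> p * r" if "\<bar>a\<bar> \<le> p" "\<bar>c\<bar> \<le> r" for a c p r :: real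
      using mult_mono[OF that] that by (simp add: abs_mult)
    have eb: "\<bar>e\<bar> \<le> 2 * M * 3 + 2 * 9"
    proof -
      have e9: "\<bar>excess \<alpha> q (w z)\<bar> \<le> 9"
      proof -
        define t where "t = \<alpha> * (1 - q)"
        have "0 \<le> t" unfolding t_def using \<alpha> qb by simp
        moreover have "t \<le> 1" unfolding t_def using \<alpha> qb by (intro mult_le_one) auto
        moreover have "excess \<alpha> q (w z) = 3 * (w z - 1) + 2 * t" by (simp add: excess_def t_def)
        ultimately show ?thesis using w(1,2)[OF z(1)] by (simp add: abs_le_iff)
      qed
      have "\<bar>2 * y z\<bar> \<le> 2 * M" using w(4)[OF z(1)] by simp
      from ab[OF this wq[OF z(1)]] have "\<bar>2 * y z * (w z - q)\<bar> \<le> 2 * M * 3" .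
      moreover have "\<bar>w z * excess \<alpha> q (w z)\<bar> \<le> 2 * 9" using w(1,2)[OF z(1)] by (intro ab e9) auto
      ultimately show ?thesis unfolding e_def by linarith
    qed
    have "1 * (1/2) \<le> lam * w z" using lam1 w(1)[OF z(1)] by (intro mult_mono) auto
    hence "\<bar>e\<bar> / (lam * w z) \<le> (2 * M * 3 + 2 * 9) / (1/2)" using eb M by (intro frac_le) auto
    moreover have "\<bar>Vd x\<bar> = \<bar>e\<bar> / (lam * w z)" using lam1 wp by (simp add: Vd_e abs_mult)
    moreover have "0 \<le> k * M" using k M by simp
    ultimately have b1: "\<bar>Vd x\<bar> \<le> N" using M by (simp add: N_def)
    \<comment> \<open>The first bound on \<open>y\<close> serves up to the sonic point, the decay at
      the centre beyond it.\<close>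
    have yz: "\<bar>y z * z\<bar> \<le> M"
    proof (cases "z \<le> 1")
      case True
      have "\<bar>y z\<bar> * z \<le> M * 1" using w(4)[OF z(1)] True z(1) M by (intro mult_mono) auto
      thus ?thesis using z(1) by (simp add: abs_mult)
    next
      case False
      have "\<bar>y z\<bar> * z \<le> \<bar>y z\<bar> * z\<^sup>2" using False by (intro mult_left_mono) (auto simp: power2_eq_square)
      thus ?thesis using w(5)[OF z(1)] z(1) by (simp add: abs_mult)
    qed
    have Ceq: "C x - lam * Cd x = - 2 * k * (y z * z) * (w z - q) / w z"
      using eqs(3) lam1 by (simp add: C_def Cd_def z_def[symmetric])
    have "\<bar>- 2 * k * (y z * z) * (w z - q)\<bar> \<le> 2 * k * M * 3"
      unfolding mult.assoc[of _ "y z * z"] abs_mult[of "- 2 * k"] using ab[OF yz wq[OF z(1)]] k by simp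
    hence "\<bar>- 2 * k * (y z * z) * (w z - q)\<bar> / w z \<le> (2 * k * M * 3) / (1/2)"
      using w(1)[OF z(1)] k M by (intro frac_le) auto
    hence b2: "\<bar>C x - lam * Cd x\<bar> \<le> N" unfolding Ceq using wp M k by (simp add: abs_divide N_def)
    show ?thesis using dV dC b1 b2 eqs(1,2) lam1
      by (simp add: C_def Cd_def V_def Vd_def z_def[symmetric])
  qed
  have Z0: "filterlim Z (at_right 0) (at_right 0)"
  proof -
    have "(Z \<longlongrightarrow> 0) (at_right 0)"
    proof (rule order_tendstoI)
      fix a :: real assume "a < 0"
      show "\<forall>\<^sub>F x in at_right 0. a < Z x"
        by (rule eventually_mono[OF eventually_at_right_less[of 0]]) (use Z(1) \<open>a < 0\<close> in force)
    next
      fix a :: real assume a: "a > 0"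
      have "\<forall>\<^sub>F x in at_right 0. x \<in> {0<..<\<xi> a}" by (rule eventually_at_right_real[OF \<xi>pos[OF a]])
      thus "\<forall>\<^sub>F x in at_right 0. Z x < a"
      proof (rule eventually_mono)
        fix x assume x: "x \<in> {0<..<\<xi> a}"
        show "Z x < a"
        proof (rule ccontr)
          assume "\<not> Z x < a"
          hence "a = Z x \<or> a < Z x" by auto
          hence "\<xi> a \<le> \<xi> (Z x)" using inc[OF a] by (auto intro: less_imp_le)
          thus False using x Z(2)[of x] by simp
        qed
      qed
    qed
    moreover have "\<forall>\<^sub>F x in at_right 0. Z x \<in> {0<..} \<and> Z x \<noteq> 0"
      by (rule eventually_mono[OF eventually_at_right_less[of 0]]) (use Z(1) in force)
    ultimately show ?thesis unfolding filterlim_at by blast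
  qed
  have Kl: "(K \<longlongrightarrow> 0) (at_right 0)"
  proof -
    have "(K \<longlongrightarrow> K 0) (at 0 within {0..})" using K(1) unfolding continuous_on_def by blast
    hence "(K \<longlongrightarrow> K 0) (at 0 within {0<..})" by (rule tendsto_within_subset) auto
    thus ?thesis using K(2) by simp
  qed
  have ez: "((\<lambda>z. exp (- K z)) \<longlongrightarrow> 1) (at_right 0)" using tendsto_exp[OF tendsto_minus[OF Kl]] by simp
  have "((\<lambda>z. (w z - 1) / z * exp (- K z)) \<longlongrightarrow> d * h * 1) (at_right 0)" by (rule tendsto_mult[OF wl ez])
  from filterlim_compose[OF this Z0]
  have "((\<lambda>x. (w (Z x) - 1) / Z x * exp (- K (Z x))) \<longlongrightarrow> d * h) (at_right 0)" by simp
  moreover have xe: "x = Z x * exp (K (Z x))" if "x > 0" for x using Z(2)[OF that] by (simp add: \<xi>_def)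
  have "\<forall>\<^sub>F x in at_right 0. (w (Z x) - 1) / Z x * exp (- K (Z x)) = V x / x"
  proof (rule eventually_mono[OF eventually_at_right_less[of 0]])
    fix x :: real assume x: "0 < x"
    have "(w (Z x) - 1) / Z x * exp (- K (Z x)) = V x / (Z x * exp (K (Z x)))"
      by (simp add: V_def exp_minus divide_inverse)
    thus "(w (Z x) - 1) / Z x * exp (- K (Z x)) = V x / x" by (simp only: xe[OF x, symmetric])
  qed
  ultimately have Vl: "((\<lambda>x. V x / x) \<longlongrightarrow> d * h) (at_right 0)" by (rule Lim_transform_eventually)
  have w1: "(w \<longlongrightarrow> 1) (at_right 0)"
  proof -
    have "((\<lambda>z. (w z - 1) / z * z + 1) \<longlongrightarrow> d * h * 0 + 1) (at_right 0)"
      by (intro tendsto_intros wl)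
    moreover have "\<forall>\<^sub>F z in at_right 0. (w z - 1) / z * z + 1 = w z"
      by (rule eventually_mono[OF eventually_at_right_less[of 0]]) simp
    ultimately show ?thesis using Lim_transform_eventually by force
  qed
  have "((\<lambda>z. w z * exp (- K z)) \<longlongrightarrow> 1 * 1) (at_right 0)" by (rule tendsto_mult[OF w1 ez])
  from filterlim_compose[OF this Z0]
  have "((\<lambda>x. w (Z x) * exp (- K (Z x))) \<longlongrightarrow> 1) (at_right 0)" by simp
  moreover have "\<forall>\<^sub>F x in at_right 0. w (Z x) * exp (- K (Z x)) = C x / x"
  proof (rule eventually_mono[OF eventually_at_right_less[of 0]])
    fix x :: real assume x: "0 < x"
    have "w (Z x) * exp (- K (Z x)) = C x / (Z x * exp (K (Z x)))"
      using Z(1)[OF x] by (simp add: C_def exp_minus field_simps)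
    thus "w (Z x) * exp (- K (Z x)) = C x / x" by (simp only: xe[OF x, symmetric])
  qed
  ultimately have Cl: "((\<lambda>x. C x / x) \<longlongrightarrow> 1) (at_right 0)" by (rule Lim_transform_eventually)
  have Ztop: "filterlim Z at_top at_top"
    unfolding filterlim_at_top
  proof
    fix a :: real
    define a' where "a' = max a 1"
    show "\<forall>\<^sub>F x in at_top. a \<le> Z x"
      using eventually_ge_at_top[of "\<xi> a'"]
    proof (rule eventually_mono)
      fix x assume x: "\<xi> a' \<le> x"
      have a': "a' > 0" by (simp add: a'_def)
      have xp: "x > 0" using x \<xi>pos[OF a'] by simp
      have "\<not> Z x < a'" using inc[of "Z x" a'] Z[OF xp] x by auto
      thus "a \<le> Z x" by (simp add: a'_def)
    qed
  qed
  have "((\<lambda>x. exp (L (Z x))) \<longlongrightarrow> exp l) at_top"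
    by (intro tendsto_exp filterlim_compose[OF l Ztop])
  moreover have "\<forall>\<^sub>F x in at_top. exp (L (Z x)) = C x * x powr (- 1 / lam)"
    using eventually_gt_at_top[of 0]
  proof (rule eventually_mono)
    fix x :: real assume x: "0 < x"
    have zw: "Z x * w (Z x) > 0" using Z(1)[OF x] w(1)[OF Z(1)[OF x]] by simp
    show "exp (L (Z x)) = C x * x powr (- 1 / lam)"
      using zw x by (simp add: L_def Z(2)[OF x] exp_diff powr_def C_def exp_minus divide_inverse mult.commute)
  qed
  ultimately have Ct: "((\<lambda>x. C x * x powr (- 1 / lam)) \<longlongrightarrow> exp l) at_top" by (rule Lim_transform_eventually)
  have VC: "\<bar>V x\<bar> \<le> N \<and> C x > 0" if x: "x > 0" for x
    using w(1,2)[OF Z(1)[OF x]] Z(1)[OF x] N0 by (auto simp: V_def C_def)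
  hence VC': "\<forall>x>0. \<bar>V x\<bar> \<le> N \<and> C x > 0" by blast
  show ?thesis
    unfolding half_similarity_def
    by (rule exI[of _ V], rule exI[of _ C], rule exI[of _ Vd], rule exI[of _ Cd], rule exI[of _ xP], rule exI[of _ N],
        rule exI[of _ "exp l"], rule conjI[OF exp_gt_zero conjI[OF Vc conjI[OF Cc conjI[OF VC' conjI[OF _ conjI[OF Vl conjI[OF Cl Ct]]]]]]],
        intro allI impI, rule main)
qed

section \<open>Joining the two halves and choosing the exponent\<close>

text \<open>In terms of \<open>Vd\<close> and \<open>Cd\<close> the equations are invariant under
  reflection of \<open>x\<close> and under a change of sign of \<open>C\<close>. The first half is
  reflected to \<open>x < 0\<close>, in the second \<open>C\<close> is negated. Reflection reverses
  the slope of \<open>V\<close>, so the quotient \<open>V x / x\<close> has a limit at 0 only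
  because the second half starts with the opposite slope.\<close>

lemma blowup_profile_of_halves:
  assumes lam: "lam > 1" and k: "k > 0" and small: "(lam - 1) * (3 + 1 / k) \<le> 1"
    and 1: "half_similarity lam k v V1 C1 Vd1 Cd1 x1 M1 B1"
    and 2: "half_similarity lam k (- v) V2 C2 Vd2 Cd2 x2 M2 B2" and v: "v \<noteq> 0"
  shows "\<exists>V C Vd Cd X M. blowup_profile lam k V C Vd Cd X (- v) (- 1) M B2 B1"
proof -
  define V where "V x = (if x < 0 then V1 (- x) else if x = 0 then 0 else V2 x)" for x
  define C where "C x = (if x < 0 then C1 (- x) else if x = 0 then 0 else - C2 x)" for x
  define Vd where "Vd x = (if x < 0 then Vd1 (- x) else Vd2 x)" for x
  define Cd where "Cd x = (if x < 0 then Cd1 (- x) else - Cd2 x)" for x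
  define X where "X = {- x1, x2}"
  define M where "M = max 0 (max M1 M2)"
  note D = half_similarity_def
  have b1: "\<bar>V1 x\<bar> \<le> M1" "C1 x > 0" if "x > 0" for x using 1 that unfolding D by blast+
  have b2: "\<bar>V2 x\<bar> \<le> M2" "C2 x > 0" if "x > 0" for x using 2 that unfolding D by blast+
  have e1: "(V1 has_real_derivative Vd1 x / x) (at x)" "(C1 has_real_derivative Cd1 x / x) (at x)"
       "\<bar>Vd1 x\<bar> \<le> M1" "\<bar>C1 x - lam * Cd1 x\<bar> \<le> M1"
       "lam * (V1 x - Vd1 x) + (V1 x)\<^sup>2 - lam * V1 x * Vd1 x + ((C1 x)\<^sup>2 - lam * C1 x * Cd1 x) / k = 0"
       "lam * (Cd1 x - C1 x) - V1 x * (C1 x - lam * Cd1 x) + k * C1 x * (lam * Vd1 x - 3 * V1 x) = 0"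
    if "x > 0" "x \<noteq> x1" for x using 1 that unfolding D by blast+
  have e2: "(V2 has_real_derivative Vd2 x / x) (at x)" "(C2 has_real_derivative Cd2 x / x) (at x)"
       "\<bar>Vd2 x\<bar> \<le> M2" "\<bar>C2 x - lam * Cd2 x\<bar> \<le> M2"
       "lam * (V2 x - Vd2 x) + (V2 x)\<^sup>2 - lam * V2 x * Vd2 x + ((C2 x)\<^sup>2 - lam * C2 x * Cd2 x) / k = 0"
       "lam * (Cd2 x - C2 x) - V2 x * (C2 x - lam * Cd2 x) + k * C2 x * (lam * Vd2 x - 3 * V2 x) = 0"
    if "x > 0" "x \<noteq> x2" for x using 2 that unfolding D by blast+
  have c1: "continuous_on {0<..} V1" "continuous_on {0<..} C1" using 1 unfolding D by blast+
  have c2: "continuous_on {0<..} V2" "continuous_on {0<..} C2" using 2 unfolding D by blast+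
  have B: "B1 > 0" "B2 > 0" using 1 2 unfolding D by blast+
  have l1: "((\<lambda>x. V1 x / x) \<longlongrightarrow> v) (at_right 0)" "((\<lambda>x. C1 x / x) \<longlongrightarrow> 1) (at_right 0)"
    "((\<lambda>x. C1 x * x powr (- 1 / lam)) \<longlongrightarrow> B1) at_top" using 1 unfolding D by blast+
  have l2: "((\<lambda>x. V2 x / x) \<longlongrightarrow> - v) (at_right 0)" "((\<lambda>x. C2 x / x) \<longlongrightarrow> 1) (at_right 0)"
    "((\<lambda>x. C2 x * x powr (- 1 / lam)) \<longlongrightarrow> B2) at_top" using 2 unfolding D by blast+
  have pos: "\<forall>\<^sub>F x in at_right 0. x > (0::real)" by (rule eventually_at_right_less)
  have limV: "((\<lambda>x. V x / x) \<longlongrightarrow> - v) (at 0)"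
  proof (rule filterlim_split_at_real)
    have ev: "\<forall>\<^sub>F x in at_right 0. - (V1 x / x) = V (- x) / - x"
      using pos by (rule eventually_mono) (simp add: V_def)
    show "((\<lambda>x. V x / x) \<longlongrightarrow> - v) (at_left 0)"
      using Lim_transform_eventually[OF tendsto_minus[OF l1(1)] ev] by (simp add: filterlim_at_left_to_right)
    have ev: "\<forall>\<^sub>F x in at_right 0. V2 x / x = V x / x"
      using pos by (rule eventually_mono) (simp add: V_def)
    show "((\<lambda>x. V x / x) \<longlongrightarrow> - v) (at_right 0)"
      by (rule Lim_transform_eventually[OF l2(1) ev])
  qed
  have limC: "((\<lambda>x. C x / x) \<longlongrightarrow> - 1) (at 0)"
  proof (rule filterlim_split_at_real)
    have ev: "\<forall>\<^sub>F x in at_right 0. - (C1 x / x) = C (- x) / - x"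
      using pos by (rule eventually_mono) (simp add: C_def)
    show "((\<lambda>x. C x / x) \<longlongrightarrow> - 1) (at_left 0)"
      using Lim_transform_eventually[OF tendsto_minus[OF l1(2)] ev] by (simp add: filterlim_at_left_to_right)
    have ev: "\<forall>\<^sub>F x in at_right 0. - (C2 x / x) = C x / x"
      using pos by (rule eventually_mono) (simp add: C_def)
    show "((\<lambda>x. C x / x) \<longlongrightarrow> - 1) (at_right 0)"
      by (rule Lim_transform_eventually[OF tendsto_minus[OF l2(2)] ev])
  qed
  have cont: "continuous_on UNIV F"
    if F: "continuous_on {0<..} F" "continuous_on {..<0} F" "((\<lambda>x. F x / x) \<longlongrightarrow> l) (at 0)" "F 0 = 0"
    for F :: "real \<Rightarrow> real" and l
  proof (rule continuous_at_imp_continuous_on, rule ballI)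
    fix x :: real
    consider "x > 0" | "x < 0" | "x = 0" by linarith
    thus "isCont F x"
    proof cases
      case 3
      have "((\<lambda>x. F x / x * x) \<longlongrightarrow> l * 0) (at 0)" by (intro tendsto_intros F(3))
      moreover have "\<forall>\<^sub>F x in at 0. F x / x * x = F x" by (simp add: eventually_at_filter)
      ultimately have "(F \<longlongrightarrow> l * 0) (at 0)" by (rule Lim_transform_eventually)
      thus ?thesis using 3 F(4) by (simp add: isCont_def)
    qed (use F(1,2) in \<open>auto simp: continuous_on_eq_continuous_at\<close>)
  qed
  have neg: "continuous_on {..<0} (\<lambda>x. f (- x))" if "continuous_on {0<..} f" for f :: "real \<Rightarrow> real"
    by (rule continuous_on_compose2[OF that]) (auto intro!: continuous_intros)
  have Vc: "continuous_on UNIV V"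
  proof (rule cont[OF _ _ limV])
    show "continuous_on {0<..} V" using c2(1) by (rule continuous_on_eq) (simp add: V_def)
    show "continuous_on {..<0} V" using neg[OF c1(1)] by (rule continuous_on_eq) (simp add: V_def)
  qed (simp add: V_def)
  have Cc: "continuous_on UNIV C"
  proof (rule cont[OF _ _ limC])
    show "continuous_on {0<..} C" using continuous_on_minus[OF c2(2)] by (rule continuous_on_eq) (simp add: C_def)
    show "continuous_on {..<0} C" using neg[OF c1(2)] by (rule continuous_on_eq) (simp add: C_def)
  qed (simp add: C_def)
  have main: "(V has_real_derivative Vd x / x) (at x) \<and> (C has_real_derivative Cd x / x) (at x) \<and>
       lam * (V x - Vd x) + (V x)\<^sup>2 - lam * V x * Vd x + ((C x)\<^sup>2 - lam * C x * Cd x) / k = 0 \<and>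
       lam * (Cd x - C x) - V x * (C x - lam * Cd x) + k * C x * (lam * Vd x - 3 * V x) = 0 \<and>
       \<bar>Vd x\<bar> \<le> M \<and> \<bar>C x - lam * Cd x\<bar> \<le> M" if x: "x \<noteq> 0" "x \<notin> X" for x
  proof (cases "x < 0")
    case True
    hence y: "- x > 0" "- x \<noteq> x1" using x by (auto simp: X_def)
    have neg: "((\<lambda>x. f (- x)) has_real_derivative f' / x) (at x)" if "(f has_real_derivative f' / - x) (at (- x))" for f f'
      using that DERIV_mirror[of f "- (f' / x)" x] by simp
    have eq: "V x = V1 (- x)" "C x = C1 (- x)" "Vd x = Vd1 (- x)" "Cd x = Cd1 (- x)"
      using True by (auto simp: V_def C_def Vd_def Cd_def)
    have "(V has_real_derivative Vd x / x) (at x)" unfolding eq(3)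
      by (rule has_field_derivative_transform_within_open[OF neg[OF e1(1)[OF y]], of "{..<0}"]) (use True in \<open>auto simp: V_def\<close>)
    moreover have "(C has_real_derivative Cd x / x) (at x)" unfolding eq(4)
      by (rule has_field_derivative_transform_within_open[OF neg[OF e1(2)[OF y]], of "{..<0}"]) (use True in \<open>auto simp: C_def\<close>)
    moreover have "M1 \<le> M" by (simp add: M_def)
    ultimately show ?thesis using e1(3-6)[OF y] unfolding eq by (intro conjI) (assumption | linarith)+
  next
    case False
    hence y: "x > 0" "x \<noteq> x2" using x by (auto simp: X_def)
    have eq: "V x = V2 x" "C x = - C2 x" "Vd x = Vd2 x" "Cd x = - Cd2 x"
      using y by (auto simp: V_def C_def Vd_def Cd_def)
    have "(V has_real_derivative Vd x / x) (at x)" unfolding eq(3)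
      by (rule has_field_derivative_transform_within_open[OF e2(1)[OF y], of "{0<..}"]) (use y in \<open>auto simp: V_def\<close>)
    moreover have "(C has_real_derivative - (Cd2 x / x)) (at x)"
      by (rule has_field_derivative_transform_within_open[OF DERIV_minus[OF e2(2)[OF y]], of "{0<..}"]) (use y in \<open>auto simp: C_def\<close>)
    hence "(C has_real_derivative Cd x / x) (at x)" unfolding eq by simp
    moreover have "M2 \<le> M" by (simp add: M_def)
    moreover have "lam * (Cd x - C x) - V x * (C x - lam * Cd x) + k * C x * (lam * Vd x - 3 * V x) =
      - (lam * (Cd2 x - C2 x) - V2 x * (C2 x - lam * Cd2 x) + k * C2 x * (lam * Vd2 x - 3 * V2 x))"
      unfolding eq by (simp add: algebra_simps)
    moreover have "C x - lam * Cd x = - (C2 x - lam * Cd2 x)" unfolding eq by simp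
    hence "\<bar>C x - lam * Cd x\<bar> = \<bar>C2 x - lam * Cd2 x\<bar>" by linarith
    ultimately show ?thesis using e2(3-6)[OF y] by (simp add: eq(1-3)) (simp add: eq(2,4))
  qed
  have bd: "\<bar>V x\<bar> \<le> M" for x
    using b1(1)[of "- x"] b2(1)[of x] by (auto simp: V_def M_def)
  have sign: "x * C x < 0" if "x \<noteq> 0" for x
    using that b1(2)[of "- x"] b2(2)[of x] by (auto simp: C_def mult_less_0_iff)
  have top: "((\<lambda>x. \<bar>C x\<bar> * \<bar>x\<bar> powr (- 1 / lam)) \<longlongrightarrow> B2) at_top"
  proof (rule Lim_transform_eventually[OF l2(3)])
    show "\<forall>\<^sub>F x in at_top. C2 x * x powr (- 1 / lam) = \<bar>C x\<bar> * \<bar>x\<bar> powr (- 1 / lam)"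
      using eventually_gt_at_top[of 0] by (rule eventually_mono) (use b2(2) in \<open>force simp: C_def\<close>)
  qed
  have bot: "((\<lambda>x. \<bar>C x\<bar> * \<bar>x\<bar> powr (- 1 / lam)) \<longlongrightarrow> B1) at_bot"
    unfolding filterlim_at_bot_mirror
  proof (rule Lim_transform_eventually[OF l1(3)])
    show "\<forall>\<^sub>F x in at_top. C1 x * x powr (- 1 / lam) = \<bar>C (- x)\<bar> * \<bar>- x\<bar> powr (- 1 / lam)"
      using eventually_gt_at_top[of 0] by (rule eventually_mono) (use b1(2) in \<open>force simp: C_def\<close>)
  qed
  have "blowup_profile lam k V C Vd Cd X (- v) (- 1) M B2 B1"
    by (unfold_locales; (rule lam k small Vc Cc sign bd limV limC B top bot | (drule (1) main, blast) | use v in \<open>simp add: X_def\<close>))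
  thus ?thesis by blast
qed

text \<open>At \<open>d = 0\<close> the exponent is 1, and it depends continuously on
  \<open>d\<close>.\<close>

lemma lama_surj:
  assumes k: "k > 0" and d1: "0 < d1" "d1 < 1" and lam: "1 < lam" "lam < lama k (d1\<^sup>2)"
  shows "\<exists>d>0. d \<le> d1 \<and> lama k (d\<^sup>2) = lam"
proof -
  have c: "continuous_on {0..d1} (\<lambda>d. lama k (d\<^sup>2))"
    unfolding lama_def using d1 by (intro continuous_intros k) (auto simp: power_le_one)
  have "\<exists>d\<ge>0. d \<le> d1 \<and> lama k (d\<^sup>2) = lam"
    by (rule IVT'[OF _ _ _ c]) (use lam d1 in \<open>auto simp: lama_def qa_def\<close>)
  then obtain d where d: "d \<ge> 0" "d \<le> d1" "lama k (d\<^sup>2) = lam" by blast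
  moreover have "d \<noteq> 0" using d lam by (auto simp: lama_def qa_def)
  ultimately show ?thesis by (intro exI[of _ d]) auto
qed

text \<open>The slope \<open>h\<close> passes directly into the velocity at \<open>t = 0\<close>,
  with a positive factor, so its sign decides between inflow and outflow.\<close>

lemma blowup_flow_exists:
  assumes k: "k > 0" and d: "d > 0" "d < 1" and good: "inner_good k d" "outer_good k d"
    and lam: "lam = lama k (d\<^sup>2)" "lam > 1" and small: "(lam - 1) * (3 + 1 / k) \<le> 1"
    and h: "h \<in> {- H0 k..H0 k}" "h \<noteq> 0" and g: "\<gamma> = 1 + 2 * k" and cv: "cv > 0"
  shows "\<exists>R V C \<rho> u c. self_similar lam (- (2 * (lam - 1) / (\<gamma> - 1))) R V C \<rho> u c \<and>
    continuous_blowup_flow \<gamma> cv \<rho> u c \<and> (\<forall>r>0. u 0 r = r powr (1 - lam) / lam * (d * h))"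
proof -
  have h': "- h \<in> {- H0 k..H0 k}" using h by auto
  obtain V1 C1 Vd1 Cd1 x1 M1 B1 where 1: "half_similarity lam k (d * h) V1 C1 Vd1 Cd1 x1 M1 B1"
    using half_profile[OF k d good h(1)] unfolding lam(1) by blast
  obtain V2 C2 Vd2 Cd2 x2 M2 B2 where 2: "half_similarity lam k (- (d * h)) V2 C2 Vd2 Cd2 x2 M2 B2"
    using half_profile[OF k d good h'] unfolding lam(1) by auto
  obtain V C Vd Cd X M where "blowup_profile lam k V C Vd Cd X (- (d * h)) (- 1) M B2 B1"
    using blowup_profile_of_halves[OF lam(2) k small 1 2] d h by auto
  then interpret blowup_profile lam k V C Vd Cd X "- (d * h)" "- 1" M B2 B1 .
  have \<kappa>: "- (2 * (lam - 1) / (\<gamma> - 1)) = (1 - lam) / k" using k by (simp add: g field_simps)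
  have "\<forall>r>0. uu 0 r = r powr (1 - lam) / lam * (d * h)" by (simp add: uu_def Vq_def)
  thus ?thesis using self_similar_flow[OF \<kappa>] continuous_blowup_flow_profile[OF g cv] by blast
qed

theorem theorem1p1:
  fixes \<gamma> :: real
  assumes "\<gamma> > 1"
  shows "\<exists>lam0>1. \<forall>lam. 1 < lam \<and> lam < lam0 \<longrightarrow> (\<forall>cv>0.
     (\<exists>R V C \<rho> u c.
        self_similar lam (- (2 * (lam - 1) / (\<gamma> - 1))) R V C \<rho> u c \<and>
        continuous_blowup_flow \<gamma> cv \<rho> u c \<and> (\<forall>r>0. u 0 r < 0)) \<and>
     (\<exists>R V C \<rho> u c.
        self_similar lam (- (2 * (lam - 1) / (\<gamma> - 1))) R V C \<rho> u c \<and>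
        continuous_blowup_flow \<gamma> cv \<rho> u c \<and> (\<forall>r>0. u 0 r > 0)))"
proof -
  define k where "k = (\<gamma> - 1) / 2"
  have k: "k > 0" and g: "\<gamma> = 1 + 2 * k" using assms by (auto simp: k_def field_simps)
  have "\<forall>\<^sub>F d in at_right 0. inner_good k d \<and> outer_good k d"
    unfolding inner_good_def outer_good_def by (rule eventually_conj[OF inner_eventually[OF k] outer_eventually[OF k]])
  then obtain b where b: "b > 0" "\<And>d. d > 0 \<Longrightarrow> d < b \<Longrightarrow> inner_good k d \<and> outer_good k d"
    unfolding eventually_at_right_field by blast
  \<comment> \<open>Every parameter in \<open>{0<..d1}\<close> is good, so any preimage delivered by
    the intermediate value theorem is admissible.\<close>
  define d1 where "d1 = min b 1 / 2"
  have d1: "0 < d1" "d1 < 1" "d1 < b" using b(1) by (auto simp: d1_def min_def)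
  have q: "0 < qa k (d1\<^sup>2)" "d1\<^sup>2 < 1"
  proof -
    show *: "d1\<^sup>2 < 1" using d1 by (simp add: power_less_one_iff abs_square_less_1)
    have "1 - d1\<^sup>2 + k * d1\<^sup>2 > 0" using * k by (intro add_pos_nonneg) auto
    thus "0 < qa k (d1\<^sup>2)" using k d1 by (simp add: qa_def)
  qed
  \<comment> \<open>The second term of the minimum is the condition \<open>small\<close>, which
    keeps the order of the energy flux at most 1.\<close>
  define lam0 where "lam0 = min (lama k (d1\<^sup>2)) (1 + 1 / (3 + 1 / k))"
  have k3: "3 + 1 / k > 0" using k by (intro add_pos_pos) auto
  have "lam0 > 1" using q k3 by (simp add: lam0_def lama_def)
  moreover have "(\<exists>R V C \<rho> u c.
        self_similar lam (- (2 * (lam - 1) / (\<gamma> - 1))) R V C \<rho> u c \<and>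
        continuous_blowup_flow \<gamma> cv \<rho> u c \<and> (\<forall>r>0. u 0 r < 0)) \<and>
     (\<exists>R V C \<rho> u c.
        self_similar lam (- (2 * (lam - 1) / (\<gamma> - 1))) R V C \<rho> u c \<and>
        continuous_blowup_flow \<gamma> cv \<rho> u c \<and> (\<forall>r>0. u 0 r > 0))"
    if lam: "1 < lam" "lam < lam0" and cv: "cv > 0" for lam cv
  proof -
    obtain d where d: "d > 0" "d \<le> d1" "lam = lama k (d\<^sup>2)"
      using lama_surj[OF k d1(1,2) lam(1)] lam(2) by (auto simp: lam0_def)
    have d': "d < 1" "inner_good k d" "outer_good k d" using d d1 b(2)[of d] by auto
    have "lam - 1 \<le> 1 / (3 + 1 / k)" using lam(2) by (simp add: lam0_def)
    hence small: "(lam - 1) * (3 + 1 / k) \<le> 1" using k3 by (simp only: pos_le_divide_eq)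
    note ex = blowup_flow_exists[OF k d(1) d' d(3) lam(1) small _ _ g cv]
    have H: "H0 k > 0" by (rule H0_bounds(1)[OF k])
    have s: "r powr (1 - lam) / lam * (d * - H0 k) < 0" "r powr (1 - lam) / lam * (d * H0 k) > 0" if "r > 0" for r
      using that lam(1) d(1) H by (auto intro!: divide_pos_pos mult_pos_pos)
    \<comment> \<open>The extreme slopes \<open>- H0 k\<close> and \<open>H0 k\<close> are allowed
      by the barriers and are nonzero with opposite signs.\<close>
    have hm: "- H0 k \<in> {- H0 k..H0 k}" "- H0 k \<noteq> 0" and hp: "H0 k \<in> {- H0 k..H0 k}" "H0 k \<noteq> 0" using H by auto
    show ?thesis
    proof
      show "\<exists>R V C \<rho> u c. self_similar lam (- (2 * (lam - 1) / (\<gamma> - 1))) R V C \<rho> u c \<and>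
          continuous_blowup_flow \<gamma> cv \<rho> u c \<and> (\<forall>r>0. u 0 r < 0)"
        using ex[OF hm] s(1) by (elim exE conjE) (intro exI conjI, assumption+, simp)
      show "\<exists>R V C \<rho> u c. self_similar lam (- (2 * (lam - 1) / (\<gamma> - 1))) R V C \<rho> u c \<and>
          continuous_blowup_flow \<gamma> cv \<rho> u c \<and> (\<forall>r>0. u 0 r > 0)"
        using ex[OF hp] s(2) by (elim exE conjE) (intro exI conjI, assumption+, simp)
    qed
  qed
  ultimately show ?thesis by blast
qed

end
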